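(* Let $X,\Sigma$ be a supOU stochastic volatility model whose mean reversion distribution $\pi$ is the law of $BR$ with $B<0$, $R\sim\Gamma(\alpha_\pi,1)$, $\alpha_\pi>1$, and whose underlying Lévy process has finite second moments. Let $W\subset\mathbb{R}^4$ be a compact parameter space of vectors $\beta=(\mu,\sigma^2,\alpha_\pi,B)$ which includes the true parameter vector $\beta_0$ of the model. Let $Y=(Y_n)_{n\in\mathbb{N}}$, $Y_n=X_{n\Delta}-X_{(n-1)\Delta}$, be the equidistant log-returns observed on a grid with size $\Delta>0$. For $\beta=(\mu,\sigma^2,\alpha_\pi,B)\in W$ and integers $h\ge0$ put $\varphi_h:=(1-B\Delta h)^{3-\alpha_\pi}$ and define the infinite moment vector $$f_{SV}(Y,\beta)=\big(f_{\mathrm{var}}(Y,\beta),\,f_{\mathrm{var2}}(Y,\beta),\,f_1(Y,\beta),\,f_2(Y,\beta),\dots\big)',$$ where $$f_{\mathrm{var}}(Y,\beta)=Y_1^2+\frac{\Delta\mu}{B(\alpha_\pi-1)},$$ $$f_{\mathrm{var2}}(Y,\beta)=Y_1^4+3\sigma^2\,\frac{(1-B\Delta)^{3-\alpha_\pi}-1-\Delta B(\alpha_\pi-3)}{B^3(\alpha_\pi-1)(\alpha_\pi-2)(\alpha_\pi-3)}-3\Big(\frac{\Delta\mu}{B(\alpha_\pi-1)}\Big)^2,$$ $$f_h(Y,\beta)=Y_1^2Y_{1+h}^2-\Big(\frac{\Delta\mu}{B(\alpha_\pi-1)}\Big)^2+\frac{\sigma^2(\varphi_{h+1}-2\varphi_h+\varphi_{h-1})}{2B^3(\alpha_\pi-1)(\alpha_\pi-2)(\alpha_\pi-3)},\quad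 h\ge1.$$ Then the parameter vector $\beta_0$ is asymptotically identifiable, i.e. the map $W\to\mathbb{R}^{\mathbb{N}}$, $\beta\mapsto\mathbb{E}[f_{SV}(Y,\beta)]$ (componentwise expectation) has a unique zero at the true parameter $\beta_0$.
   Context: Lévy basis: a real-valued Lévy basis on $\mathbb{R}_-\times\mathbb{R}$ ($\mathbb{R}_-$ = negative reals) is a family $\Lambda=\{\Lambda(C)\}$ of real random variables indexed by the bounded Borel sets $C\subset\mathbb{R}_-\times\mathbb{R}$, such that each $\Lambda(C)$ is infinitely divisible, the values on pairwise disjoint sets are independent, and for pairwise disjoint sets $C_n$ whose union is bounded the series $\sum_n\Lambda(C_n)$ converges a.s. and equals $\Lambda(\cup_nC_n)$. It has generating quadruple $(\gamma,\Sigma_G,\nu,\pi)$ if $\mathbb{E}(e^{iu\Lambda(C)})=\exp(\phi(u)\Pi(C))$ with $\Pi=\pi\times\lambda$ ($\pi$ a probability measure on $\mathbb{R}_-$, $\lambda$ Lebesgue measure on $\mathbb{R}$) and $\phi(u)=iu\gamma-\tfrac12\Sigma_Gu^2+\int_{\mathbb{R}}(e^{iux}-1-iux1_{\{|x|\le1\}})\nu(dx)$, where $(\gamma,\Sigma_G,\nu)$ is a Lévy-Khintchine triplet. The underlying Lévy process is $L_t=\Lambda(\mathbb{R}_-\times(0,t])$, $t\ge0$; the parameters are $\mu=\mathbb{E}[L_1]$ and $\sigma^2=\operatorname{var}(L_1)$. supOU SV model: $\Sigma_t=\int_{\mathbb{R}_-}\int_{-\infty}^te^{A(t-s)}\Lambda(dA,ds)$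 is a (stationary) supOU process (with $\int_{|x|>1}\log|x|\,\nu(dx)<\infty$ and $-\int_{\mathbb{R}_-}\frac1A\pi(dA)<\infty$) with generating quadruple $(\gamma,0,\nu,\pi)$ such that $\gamma-\int_{|x|\le1}x\,\nu(dx)\ge0$, $\int_{|x|\le1}|x|\,\nu(dx)<\infty$ and $\nu(\mathbb{R}_-)=0$ (so that $\Sigma_t\ge0$); $W^{BM}$ is a standard Brownian motion independent of $\Lambda$; and the log price process $X$ is given by $dX_t=\sqrt{\Sigma_t}\,dW^{BM}_t$, $X_0=0$. Thus $Y_n=\int_{(n-1)\Delta}^{n\Delta}\sqrt{\Sigma_t}\,dW^{BM}_t$. Finite second moments of the underlying Lévy process means $\int_{x>1}x^2\nu(dx)<\infty$. "True parameter vector $\beta_0$" means that the model is generated with $(\mu,\sigma^2,\alpha_\pi,B)=\beta_0$.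
   Formalization: Assumes the true variance σ² is positive (for σ²=0 the volatility is deterministic and the zero need not be unique), that every β in W has α_π>1 and B<0, and reads the σ²-coefficients at α_π=2 and 3, where they are 0/0, as continuous extensions. *)

theory Defs
  imports "HOL-Probability.Probability"
begin

section \<open>Probabilistic preliminaries\<close>

definition conv_in_prob :: "'w measure \<Rightarrow> (nat \<Rightarrow> 'w \<Rightarrow> real) \<Rightarrow> ('w \<Rightarrow> real) \<Rightarrow> bool" where
  "conv_in_prob M Z Z' \<longleftrightarrow>
     (\<forall>n. Z n \<in> borel_measurable M) \<and> Z' \<in> borel_measurable M \<and>
     (\<forall>\<epsilon>>0. (\<lambda>n. measure M {\<omega> \<in> space M. \<epsilon> \<le> \<bar>Z n \<omega> - Z' \<omega>\<bar>}) \<longlonglongrightarrow> 0)"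

definition generated_events :: "'w measure \<Rightarrow> ('i \<Rightarrow> 'w \<Rightarrow> real) \<Rightarrow> 'i set \<Rightarrow> 'w set set" where
  "generated_events M Z I =
     sigma_sets (space M) (\<Union>i\<in>I. {Z i -` A \<inter> space M | A. A \<in> sets borel})"

definition infinitely_divisible :: "real measure \<Rightarrow> bool" where
  "infinitely_divisible P \<longleftrightarrow> real_distribution P \<and>
     (\<forall>n\<ge>1. \<exists>Q. real_distribution Q \<and> ((\<lambda>R. Q \<star> R) ^^ n) (return borel 0) = P)"

definition gamma_distribution :: "real \<Rightarrow> real measure" where
  "gamma_distribution a =
     density lborel (\<lambda>x. ennreal (if 0 < x then x powr (a - 1) * exp (- x) / Gamma a else 0))"

section \<open>L\'evy bases\<close>

definition bounded_borel :: "(real \<times> real) set set" where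
  "bounded_borel = {C \<in> sets borel. bounded C \<and> C \<subseteq> {..<0} \<times> UNIV}"

definition levy_basis :: "'w measure \<Rightarrow> ((real \<times> real) set \<Rightarrow> 'w \<Rightarrow> real) \<Rightarrow> bool" where
  "levy_basis M \<Lambda> \<longleftrightarrow> prob_space M \<and>
     (\<forall>C\<in>bounded_borel. \<Lambda> C \<in> borel_measurable M \<and> infinitely_divisible (distr M borel (\<Lambda> C))) \<and>
     (\<forall>C :: nat \<Rightarrow> _. range C \<subseteq> bounded_borel \<longrightarrow> disjoint_family C \<longrightarrow>
        prob_space.indep_vars M (\<lambda>_. borel) (\<lambda>n. \<Lambda> (C n)) UNIV) \<and>
     (\<forall>C :: nat \<Rightarrow> _. range C \<subseteq> bounded_borel \<longrightarrow> disjoint_family C \<longrightarrow>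
        bounded (\<Union>n. C n) \<longrightarrow> (AE \<omega> in M. (\<lambda>n. \<Lambda> (C n) \<omega>) sums \<Lambda> (\<Union>n. C n) \<omega>))"

definition levy_triplet :: "real \<Rightarrow> real \<Rightarrow> real measure \<Rightarrow> bool" where
  "levy_triplet \<gamma> \<Sigma>\<^sub>G \<nu> \<longleftrightarrow> 0 \<le> \<Sigma>\<^sub>G \<and> sets \<nu> = sets borel \<and> emeasure \<nu> {0} = 0 \<and>
     (\<integral>\<^sup>+x. ennreal (min 1 (x^2)) \<partial>\<nu>) < \<infinity>"

definition levy_exponent :: "real \<Rightarrow> real \<Rightarrow> real measure \<Rightarrow> real \<Rightarrow> complex" where
  "levy_exponent \<gamma> \<Sigma>\<^sub>G \<nu> u =
     \<i> * u * \<gamma> - \<Sigma>\<^sub>G * u^2 / 2 +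
     (CLINT x|\<nu>. iexp (u * x) - 1 - \<i> * u * x * indicator {-1..1} x)"

definition generating_quadruple ::
  "'w measure \<Rightarrow> ((real \<times> real) set \<Rightarrow> 'w \<Rightarrow> real) \<Rightarrow> real \<Rightarrow> real \<Rightarrow> real measure \<Rightarrow> real measure \<Rightarrow> bool"
where
  "generating_quadruple M \<Lambda> \<gamma> \<Sigma>\<^sub>G \<nu> \<pi> \<longleftrightarrow>
     levy_triplet \<gamma> \<Sigma>\<^sub>G \<nu> \<and>
     prob_space \<pi> \<and> sets \<pi> = sets borel \<and> (AE A in \<pi>. A < 0) \<and>
     (\<forall>C\<in>bounded_borel. \<forall>u.
        char (distr M borel (\<Lambda> C)) u =
          exp (levy_exponent \<gamma> \<Sigma>\<^sub>G \<nu> u * measure (\<pi> \<Otimes>\<^sub>M lborel) C))"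

section \<open>Integration with respect to a L\'evy basis\<close>

text \<open>
  The integral of deterministic functions in the sense of Rajput and Rosinski (1989). A simple
  function is given by a list of pairs \<open>(c, C)\<close>, standing for the sum of the \<open>c * indicator C\<close>.
\<close>

definition levy_simple :: "(real \<times> (real \<times> real) set) list \<Rightarrow> bool" where
  "levy_simple g \<longleftrightarrow> (\<forall>(c, C)\<in>set g. C \<in> bounded_borel)"

definition levy_simple_fun :: "(real \<times> (real \<times> real) set) list \<Rightarrow> real \<times> real \<Rightarrow> real" where
  "levy_simple_fun g z = (\<Sum>(c, C)\<leftarrow>g. c * indicator C z)"

definition levy_simple_integral ::
  "((real \<times> real) set \<Rightarrow> 'w \<Rightarrow> real) \<Rightarrow> (real \<times> real) set \<Rightarrow> (real \<times> (real \<times> real) set) list \<Rightarrow> 'w \<Rightarrow> real"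
where
  "levy_simple_integral \<Lambda> D g \<omega> = (\<Sum>(c, C)\<leftarrow>g. c * \<Lambda> (D \<inter> C) \<omega>)"

text \<open>
  The random variable \<open>Z\<close> is (a version of) the integral of \<open>f\<close> over \<open>{..<0} \<times> UNIV\<close>. Values of \<open>f\<close>
  outside this set do not matter, since \<open>\<pi>\<close> is carried by the negative reals. For a basis with
  generating quadruple, the null sets of \<open>\<pi> \<Otimes>\<^sub>M lborel\<close> are those of the control measure (unless
  the basis is 0).
\<close>

definition has_levy_integral ::
  "'w measure \<Rightarrow> ((real \<times> real) set \<Rightarrow> 'w \<Rightarrow> real) \<Rightarrow> real measure \<Rightarrow> (real \<times> real \<Rightarrow> real) \<Rightarrow> ('w \<Rightarrow> real) \<Rightarrow> bool"
where
  "has_levy_integral M \<Lambda> \<pi> f Z \<longleftrightarrow>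
     (\<exists>g. (\<forall>n. levy_simple (g n)) \<and>
        (AE z in \<pi> \<Otimes>\<^sub>M lborel. (\<lambda>n. levy_simple_fun (g n) z) \<longlonglongrightarrow> f z) \<and>
        (\<forall>D\<in>sets borel. D \<subseteq> {..<0} \<times> UNIV \<longrightarrow>
           (\<exists>Z'. conv_in_prob M (\<lambda>n. levy_simple_integral \<Lambda> D (g n)) Z')) \<and>
        conv_in_prob M (\<lambda>n. levy_simple_integral \<Lambda> ({..<0} \<times> UNIV) (g n)) Z)"

text \<open>
  \<open>{..<0} \<times> {0<..t}\<close> is not bounded, hence \<open>\<Lambda>({..<0} \<times> {0<..t})\<close> is to be read as the integral of
  its indicator function.
\<close>

definition underlying_levy_process ::
  "'w measure \<Rightarrow> ((real \<times> real) set \<Rightarrow> 'w \<Rightarrow> real) \<Rightarrow> real measure \<Rightarrow> (real \<Rightarrow> 'w \<Rightarrow> real) \<Rightarrow> bool"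
where
  "underlying_levy_process M \<Lambda> \<pi> L \<longleftrightarrow>
     (\<forall>t\<ge>0. has_levy_integral M \<Lambda> \<pi> (indicator ({..<0} \<times> {0<..t})) (L t))"

definition supOU_process ::
  "'w measure \<Rightarrow> ((real \<times> real) set \<Rightarrow> 'w \<Rightarrow> real) \<Rightarrow> real measure \<Rightarrow> real measure \<Rightarrow> (real \<Rightarrow> 'w \<Rightarrow> real) \<Rightarrow> bool"
where
  "supOU_process M \<Lambda> \<nu> \<pi> \<Sigma> \<longleftrightarrow>
     set_integrable \<nu> {x. 1 < \<bar>x\<bar>} (\<lambda>x. ln \<bar>x\<bar>) \<and>
     integrable \<pi> (\<lambda>A. 1 / A) \<and>
     (\<forall>t. has_levy_integral M \<Lambda> \<pi>
            (\<lambda>(A, s). exp (A * (t - s)) * indicator {..t} s) (\<Sigma> t))"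

section \<open>Brownian motion and It\^o integral\<close>

definition subfiltration :: "'w measure \<Rightarrow> (real \<Rightarrow> 'w measure) \<Rightarrow> bool" where
  "subfiltration M F \<longleftrightarrow> filtration (space M) F \<and> (\<forall>t. subalgebra M (F t))"

definition brownian_motion :: "'w measure \<Rightarrow> (real \<Rightarrow> 'w measure) \<Rightarrow> (real \<Rightarrow> 'w \<Rightarrow> real) \<Rightarrow> bool" where
  "brownian_motion M F W \<longleftrightarrow> prob_space M \<and> subfiltration M F \<and>
     (\<forall>t\<ge>0. W t \<in> borel_measurable (F t)) \<and>
     (AE \<omega> in M. W 0 \<omega> = 0) \<and>
     (AE \<omega> in M. continuous_on {0..} (\<lambda>t. W t \<omega>)) \<and>
     (\<forall>s\<ge>0. \<forall>t>s.
        distributed M lborel (\<lambda>\<omega>. W t \<omega> - W s \<omega>) (normal_density 0 (sqrt (t - s))) \<and>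
        prob_space.indep_set M (sets (F s))
          {(\<lambda>\<omega>. W t \<omega> - W s \<omega>) -` A \<inter> space M | A. A \<in> sets borel})"

definition progressively_measurable :: "(real \<Rightarrow> 'w measure) \<Rightarrow> (real \<Rightarrow> 'w \<Rightarrow> real) \<Rightarrow> bool" where
  "progressively_measurable F H \<longleftrightarrow>
     (\<forall>t\<ge>0. (\<lambda>(s, \<omega>). H s \<omega>) \<in> borel_measurable (restrict_space borel {0..t} \<Otimes>\<^sub>M F t))"

text \<open>
  A simple process is given by a list of triples \<open>(r, s, \<xi>)\<close>, standing for the sum of the
  \<open>\<xi> * indicator {r<..s}\<close>.
\<close>

definition simple_process :: "(real \<Rightarrow> 'w measure) \<Rightarrow> (real \<times> real \<times> ('w \<Rightarrow> real)) list \<Rightarrow> bool" where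
  "simple_process F h \<longleftrightarrow>
     (\<forall>(r, s, \<xi>)\<in>set h. 0 \<le> r \<and> r \<le> s \<and> \<xi> \<in> borel_measurable (F r) \<and> bounded (\<xi> ` space (F r)))"

definition simple_process_fun :: "(real \<times> real \<times> ('w \<Rightarrow> real)) list \<Rightarrow> real \<Rightarrow> 'w \<Rightarrow> real" where
  "simple_process_fun h u \<omega> = (\<Sum>(r, s, \<xi>)\<leftarrow>h. \<xi> \<omega> * indicator {r<..s} u)"

definition simple_ito_integral ::
  "(real \<Rightarrow> 'w \<Rightarrow> real) \<Rightarrow> real \<Rightarrow> (real \<times> real \<times> ('w \<Rightarrow> real)) list \<Rightarrow> 'w \<Rightarrow> real"
where
  "simple_ito_integral W t h \<omega> = (\<Sum>(r, s, \<xi>)\<leftarrow>h. \<xi> \<omega> * (W (min s t) \<omega> - W (min r t) \<omega>))"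

text \<open>The random variable \<open>Z\<close> is (a version of) the It\^o integral of \<open>H\<close> over \<open>{0..t}\<close>.\<close>

definition has_ito_integral ::
  "'w measure \<Rightarrow> (real \<Rightarrow> 'w measure) \<Rightarrow> (real \<Rightarrow> 'w \<Rightarrow> real) \<Rightarrow> real \<Rightarrow> (real \<Rightarrow> 'w \<Rightarrow> real) \<Rightarrow> ('w \<Rightarrow> real) \<Rightarrow> bool"
where
  "has_ito_integral M F W t H Z \<longleftrightarrow>
     progressively_measurable F H \<and>
     (AE \<omega> in M. (\<integral>\<^sup>+u\<in>{0..t}. ennreal ((H u \<omega>)^2) \<partial>lborel) < \<infinity>) \<and>
     (\<exists>h. (\<forall>n. simple_process F (h n)) \<and>
        (\<forall>\<epsilon>>0. (\<lambda>n. measure M {\<omega> \<in> space M.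
            ennreal \<epsilon> \<le> (\<integral>\<^sup>+u\<in>{0..t}. ennreal ((simple_process_fun (h n) u \<omega> - H u \<omega>)^2) \<partial>lborel)})
              \<longlonglongrightarrow> 0) \<and>
        conv_in_prob M (\<lambda>n. simple_ito_integral W t (h n)) Z)"

section \<open>The supOU stochastic volatility model\<close>

text \<open>
  The filtration \<open>F\<close> is an arbitrary one for which \<open>W\<close> is a Brownian motion and the volatility is
  (by way of the It\^o integral) progressively measurable. That \<open>\<Sigma>\<close> is nonnegative almost surely
  is a consequence of the conditions on \<open>\<gamma>\<close> and \<open>\<nu>\<close>, which is why \<open>sqrt\<close> can be applied.
\<close>

definition supOU_SV_model ::
  "'w measure \<Rightarrow> (real \<Rightarrow> 'w measure) \<Rightarrow> ((real \<times> real) set \<Rightarrow> 'w \<Rightarrow> real) \<Rightarrow>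
   real \<Rightarrow> real measure \<Rightarrow> real measure \<Rightarrow>
   (real \<Rightarrow> 'w \<Rightarrow> real) \<Rightarrow> (real \<Rightarrow> 'w \<Rightarrow> real) \<Rightarrow> (real \<Rightarrow> 'w \<Rightarrow> real) \<Rightarrow> bool"
where
  "supOU_SV_model M F \<Lambda> \<gamma> \<nu> \<pi> \<Sigma> W X \<longleftrightarrow>
     levy_basis M \<Lambda> \<and> generating_quadruple M \<Lambda> \<gamma> 0 \<nu> \<pi> \<and>
     supOU_process M \<Lambda> \<nu> \<pi> \<Sigma> \<and>
     set_integrable \<nu> {-1..1} (\<lambda>x. \<bar>x\<bar>) \<and>
     0 \<le> \<gamma> - (LINT x:{-1..1}|\<nu>. x) \<and>
     emeasure \<nu> {..<0} = 0 \<and>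
     brownian_motion M F W \<and>
     prob_space.indep_set M (generated_events M \<Lambda> bounded_borel) (generated_events M W {0..}) \<and>
     (AE \<omega> in M. X 0 \<omega> = 0) \<and>
     (\<forall>t\<ge>0. has_ito_integral M F W t (\<lambda>u \<omega>. sqrt (\<Sigma> u \<omega>)) (X t))"

definition log_returns :: "(real \<Rightarrow> 'w \<Rightarrow> real) \<Rightarrow> real \<Rightarrow> nat \<Rightarrow> 'w \<Rightarrow> real" where
  "log_returns X \<Delta> n \<omega> = X (real n * \<Delta>) \<omega> - X ((real n - 1) * \<Delta>) \<omega>"

section \<open>The moment function\<close>

text \<open>
  The coefficients of \<open>\<sigma>\<^sup>2\<close> below contain the factor \<open>(a - 2) * (a - 3)\<close> in the denominator. The
  singularities at \<open>a = 2\<close> and \<open>a = 3\<close> are removable, and the coefficients are understood to be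
  continuously extended there (whereas division by zero in HOL would yield 0).
\<close>

definition cont_ext :: "(real \<Rightarrow> real) \<Rightarrow> real \<Rightarrow> real" where
  "cont_ext g a = (if a = 2 \<or> a = 3 then Lim (at a) g else g a)"

definition phi :: "real \<Rightarrow> real \<Rightarrow> real \<Rightarrow> nat \<Rightarrow> real" where
  "phi \<Delta> a B h = (1 - B * \<Delta> * real h) powr (3 - a)"

definition f_var :: "real \<Rightarrow> (nat \<Rightarrow> real) \<Rightarrow> real \<times> real \<times> real \<times> real \<Rightarrow> real" where
  "f_var \<Delta> y = (\<lambda>(\<mu>, \<sigma>2, a, B). (y 1)^2 + \<Delta> * \<mu> / (B * (a - 1)))"

definition f_var2 :: "real \<Rightarrow> (nat \<Rightarrow> real) \<Rightarrow> real \<times> real \<times> real \<times> real \<Rightarrow> real" where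
  "f_var2 \<Delta> y = (\<lambda>(\<mu>, \<sigma>2, a, B).
     (y 1)^4
     + 3 * \<sigma>2 * cont_ext (\<lambda>a. ((1 - B * \<Delta>) powr (3 - a) - 1 - \<Delta> * B * (a - 3))
                               / (B^3 * (a - 1) * (a - 2) * (a - 3))) a
     - 3 * (\<Delta> * \<mu> / (B * (a - 1)))^2)"

definition f_lag :: "real \<Rightarrow> nat \<Rightarrow> (nat \<Rightarrow> real) \<Rightarrow> real \<times> real \<times> real \<times> real \<Rightarrow> real" where
  "f_lag \<Delta> h y = (\<lambda>(\<mu>, \<sigma>2, a, B).
     (y 1)^2 * (y (1 + h))^2
     - (\<Delta> * \<mu> / (B * (a - 1)))^2
     + \<sigma>2 * cont_ext (\<lambda>a. (phi \<Delta> a B (h + 1) - 2 * phi \<Delta> a B h + phi \<Delta> a B (h - 1))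
                           / (2 * B^3 * (a - 1) * (a - 2) * (a - 3))) a)"

text \<open>The infinite vector \<open>(f_var, f_var2, f_lag 1, f_lag 2, \<dots>)\<close>.\<close>

definition f_SV :: "real \<Rightarrow> (nat \<Rightarrow> real) \<Rightarrow> real \<times> real \<times> real \<times> real \<Rightarrow> nat \<Rightarrow> real" where
  "f_SV \<Delta> y \<beta> k =
     (if k = 0 then f_var \<Delta> y \<beta> else if k = 1 then f_var2 \<Delta> y \<beta> else f_lag \<Delta> (k - 1) y \<beta>)"

text \<open>
  The Bochner integral of a non-integrable function is 0 in HOL, hence the existence of the
  expectations is made part of the notion.
\<close>

definition asymptotically_identifiable ::
  "'w measure \<Rightarrow> (nat \<Rightarrow> 'w \<Rightarrow> real) \<Rightarrow> ((nat \<Rightarrow> real) \<Rightarrow> 'b \<Rightarrow> nat \<Rightarrow> real) \<Rightarrow> 'b set \<Rightarrow> 'b \<Rightarrow> bool"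
where
  "asymptotically_identifiable M Y f W \<beta>\<^sub>0 \<longleftrightarrow>
     (\<forall>\<beta>\<in>W. \<forall>k. integrable M (\<lambda>\<omega>. f (\<lambda>n. Y n \<omega>) \<beta> k)) \<and>
     {\<beta>\<in>W. \<forall>k. (LINT \<omega>|M. f (\<lambda>n. Y n \<omega>) \<beta> k) = 0} = {\<beta>\<^sub>0}"

end

theory Submission
  imports Defs "HOL-Real_Asymp.Real_Asymp"
begin

text \<open>
  As an integral with respect to a square integrable L\'evy basis, the volatility has mean
  \<open>- \<mu> / (B * (\<alpha> - 1))\<close> and autocovariance
  \<open>- \<sigma>\<^sup>2 / (2 * B * (\<alpha> - 1)) * (1 - B * \<tau>) powr (1 - \<alpha>)\<close> at lag \<open>\<tau>\<close>. It is measurable with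
  respect to the basis, hence independent of the Brownian motion, and conditionally on it the
  returns are independent centred Gaussian variables whose variances are the integrated
  volatilities. The second and fourth moments of the returns are therefore means and second
  moments of integrated volatilities, that is, double integrals of the autocovariance, which makes
  the moment function vanish at the true parameter.

  Conversely, at a zero of the moment function the first component makes the squared means agree,
  so that the remaining ones equate second differences, with step \<open>\<Delta>\<close>, of a second
  antiderivative of the autocovariance. By the mean value theorem these are autocovariances at
  intermediate lags. Their logarithmic asymptotics for large lags gives \<open>\<alpha>\<close> and the
  constant \<open>\<sigma>\<^sup>2 * (- B) powr - \<alpha>\<close>. The mean value theorem for the difference of the two
  antiderivatives at a single lag then gives \<open>B\<close>, because \<open>(1 / (- B) + \<theta>) powr (1 - \<alpha>)\<close>
  is strictly monotone in \<open>1 / (- B)\<close>; \<open>\<sigma>\<^sup>2\<close> and \<open>\<mu>\<close> follow.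
\<close>

section \<open>Second differences of the integrated autocovariance\<close>

text \<open>Both stochastic integrals are given only through some approximating sequence, so no
  moment can be computed before it is known that every suitable sequence leads to the same limit.
  For the Levy integral this rests on convergence over all Borel sets \<open>D\<close> at once, for
  the Ito integral on an inequality of Lenglart type. The second obstacle is the filtration: the
  increments of the Brownian motion are independent of \<open>F\<close>, and the basis is
  independent of the Brownian motion, but nothing joins the two. Hence the volatility is discretised
  twice on the same grid, from the version adapted to \<open>F\<close>, which identifies the
  integral, and from a version measurable in the basis, which yields the moments; the two simple
  integrals agree almost surely. Mean value theorems take the place of explicit expansions because
  they treat \<open>a = 2\<close> and \<open>a = 3\<close> like all other exponents. Positivity of
  the true variance makes both sides of the lag equations positive, so that logarithms can be
  compared.\<close>

text \<open>
  The second antiderivative of \<open>\<lambda>\<tau>. (1 - B * \<tau>) powr (1 - a)\<close> that vanishes together with its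
  first derivative at 0. The cases \<open>a = 2\<close> and \<open>a = 3\<close> are the limits of the generic one.
\<close>

definition acv_prim :: "real \<Rightarrow> real \<Rightarrow> real \<Rightarrow> real" where
  "acv_prim a B \<tau> =
     (if a = 2 then ((1 - B * \<tau>) * ln (1 - B * \<tau>) + B * \<tau>) / B^2
      else if a = 3 then (- ln (1 - B * \<tau>) - B * \<tau>) / B^2
      else ((1 - B * \<tau>) powr (3 - a) - 1 - \<tau> * B * (a - 3)) / (B^2 * (a - 2) * (a - 3)))"

text \<open>The power rule for \<open>(1 - B * \<tau>) powr (1 - a)\<close> breaks down only at
  \<open>a = 2\<close>, so \<open>a = 3\<close> needs no case of its own here.\<close>

definition acv_prim' :: "real \<Rightarrow> real \<Rightarrow> real \<Rightarrow> real" where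
  "acv_prim' a B \<tau> =
     (if a = 2 then - ln (1 - B * \<tau>) / B else ((1 - B * \<tau>) powr (2 - a) - 1) / (B * (a - 2)))"

lemma acv_prim_deriv:
  assumes "B \<noteq> 0" "B * \<tau> < 1"
  shows "(acv_prim a B has_real_derivative acv_prim' a B \<tau>) (at \<tau>)"
proof -
  have p: "1 - B * \<tau> > 0" using assms by simp
  consider "a = 2" | "a = 3" | "a \<noteq> 2" "a \<noteq> 3" by blast
  then show ?thesis
  proof cases
    case 1
    have "((\<lambda>\<tau>. ((1 - B * \<tau>) * ln (1 - B * \<tau>) + B * \<tau>) / B^2) has_real_derivative
        ((0 - B * 1) * ln (1 - B * \<tau>) + 1 / (1 - B * \<tau>) * (0 - B * 1) * (1 - B * \<tau>) + B * 1) / B^2) (at \<tau>)"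
      by (rule derivative_eq_intros refl p)+ (use p assms(1) in \<open>auto simp: divide_simps power2_eq_square\<close>)
    also have "((0 - B * 1) * ln (1 - B * \<tau>) + 1 / (1 - B * \<tau>) * (0 - B * 1) * (1 - B * \<tau>) + B * 1) / B^2
       = - ln (1 - B * \<tau>) / B"
      using p assms(1) by (simp add: power2_eq_square)
    finally show ?thesis unfolding acv_prim_def acv_prim'_def 1 by simp
  next
    case 2
    have "((\<lambda>\<tau>. (- ln (1 - B * \<tau>) - B * \<tau>) / B^2) has_real_derivative ((1 - B * \<tau>) powr (2 - 3) - 1) / (B * (3 - 2))) (at \<tau>)"
      using p assms(1) by (auto intro!: derivative_eq_intros simp: powr_minus field_simps power2_eq_square)
    then show ?thesis unfolding acv_prim_def acv_prim'_def 2 by simp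
  next
    case 3
    have "((\<lambda>\<tau>. ((1 - B * \<tau>) powr (3 - a) - 1 - \<tau> * B * (a - 3)) / (B^2 * (a - 2) * (a - 3))) has_real_derivative
       ((3 - a) * (1 - B * \<tau>) powr (3 - a - 1) * (- B) - B * (a - 3)) / (B^2 * (a - 2) * (a - 3))) (at \<tau>)"
    proof -
      have "((\<lambda>\<tau>. (1 - B * \<tau>) powr (3 - a)) has_real_derivative (3 - a) * (1 - B * \<tau>) powr (3 - a - of_nat 1) * (- B)) (at \<tau>)"
        by (rule DERIV_fun_powr) (use p in \<open>auto intro!: derivative_eq_intros\<close>)
      moreover have "((\<lambda>\<tau>. \<tau> * B * (a - 3)) has_real_derivative B * (a - 3)) (at \<tau>)"
        by (auto intro!: derivative_eq_intros)
      ultimately have "((\<lambda>\<tau>. (1 - B * \<tau>) powr (3 - a) - 1 - \<tau> * B * (a - 3)) has_real_derivative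
         (3 - a) * (1 - B * \<tau>) powr (3 - a - of_nat 1) * (- B) - 0 - B * (a - 3)) (at \<tau>)"
        by (intro DERIV_diff DERIV_const)
      from DERIV_cdivide[OF this, of "B^2 * (a - 2) * (a - 3)"] show ?thesis
        by (simp only: of_nat_1 diff_zero)
    qed
    also have "((3 - a) * (1 - B * \<tau>) powr (3 - a - 1) * (- B) - B * (a - 3)) / (B^2 * (a - 2) * (a - 3))
      = (B * (a - 3)) * ((1 - B * \<tau>) powr (2 - a) - 1) / ((B * (a - 3)) * (B * (a - 2)))"
      by (simp add: algebra_simps power2_eq_square)
    also have "\<dots> = ((1 - B * \<tau>) powr (2 - a) - 1) / (B * (a - 2))"
      using assms(1) 3 by (subst mult_divide_mult_cancel_left) auto
    finally show ?thesis unfolding acv_prim_def acv_prim'_def using 3 by simp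
  qed
qed

lemma acv_prim'_deriv:
  assumes "B \<noteq> 0" "B * \<tau> < 1"
  shows "(acv_prim' a B has_real_derivative (1 - B * \<tau>) powr (1 - a)) (at \<tau>)"
proof -
  have p: "1 - B * \<tau> > 0" using assms by simp
  show ?thesis
  proof (cases "a = 2")
    case True
    have "((\<lambda>\<tau>. - ln (1 - B * \<tau>) / B) has_real_derivative (1 - B * \<tau>) powr (1 - 2)) (at \<tau>)"
      using p assms(1) by (auto intro!: derivative_eq_intros simp: powr_minus field_simps power2_eq_square)
    then show ?thesis unfolding acv_prim'_def True by simp
  next
    case False
    have "((\<lambda>\<tau>. ((1 - B * \<tau>) powr (2 - a) - 1) / (B * (a - 2))) has_real_derivative
       ((2 - a) * (1 - B * \<tau>) powr (2 - a - 1) * (- B)) / (B * (a - 2))) (at \<tau>)"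
    proof -
      have "((\<lambda>\<tau>. (1 - B * \<tau>) powr (2 - a)) has_real_derivative (2 - a) * (1 - B * \<tau>) powr (2 - a - of_nat 1) * (- B)) (at \<tau>)"
        by (rule DERIV_fun_powr) (use p in \<open>auto intro!: derivative_eq_intros\<close>)
      from DERIV_cdivide[OF DERIV_diff[OF this DERIV_const[of 1]], of "B * (a - 2)"] show ?thesis
        by (simp only: of_nat_1 diff_zero)
    qed
    also have "((2 - a) * (1 - B * \<tau>) powr (2 - a - 1) * (- B)) / (B * (a - 2)) = (1 - B * \<tau>) powr (1 - a)"
      using assms(1) False by (simp add: field_simps)
    finally show ?thesis unfolding acv_prim'_def using False by simp
  qed
qed

text \<open>Cauchy's mean value theorem compares the symmetrised function
  \<open>g (c + x) + g (c - x)\<close> with \<open>x\<^sup>2\<close> on \<open>{0..d}\<close>. The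
  quotient that it leaves, \<open>(g' (c + \<xi>) - g' (c - \<xi>)) / (2 * \<xi>)\<close>, is a
  value of \<open>g''\<close> by the ordinary mean value theorem.\<close>

lemma second_difference_mvt:
  fixes g g' g'' :: "real \<Rightarrow> real"
  assumes d: "0 < d"
    and g: "\<And>x. x \<in> {c - d..c + d} \<Longrightarrow> (g has_real_derivative g' x) (at x)"
    and g': "\<And>x. x \<in> {c - d..c + d} \<Longrightarrow> (g' has_real_derivative g'' x) (at x)"
  shows "\<exists>\<theta>\<in>{c - d<..<c + d}. g (c + d) - 2 * g c + g (c - d) = d\<^sup>2 * g'' \<theta>"
proof -
  have D: "((\<lambda>x. g (c + x) + g (c - x)) has_real_derivative g' (c + x) - g' (c - x)) (at x)"
    if "x \<in> {0..d}" for x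
  proof -
    have 1: "((\<lambda>x. g (c + x)) has_real_derivative g' (c + x) * (0 + 1)) (at x)"
      by (rule DERIV_chain2[where f=g and g="\<lambda>x. c + x"]) (use that in \<open>auto intro!: g derivative_eq_intros\<close>)
    have 2: "((\<lambda>x. g (c - x)) has_real_derivative g' (c - x) * (0 - 1)) (at x)"
      by (rule DERIV_chain2[where f=g and g="\<lambda>x. c - x"]) (use that in \<open>auto intro!: g derivative_eq_intros\<close>)
    show ?thesis using DERIV_add[OF 1 2] by simp
  qed
  define \<phi> where "\<phi> x = g (c + x) + g (c - x) - 2 * g c" for x
  have D\<phi>: "(\<phi> has_real_derivative g' (c + x) - g' (c - x)) (at x)" if "x \<in> {0..d}" for x
    unfolding \<phi>_def using DERIV_diff[OF D[OF that] DERIV_const[of "2 * g c"]] by simp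
  have Dsq: "((\<lambda>x. x\<^sup>2) has_real_derivative 2 * x) (at x)" for x :: real
    by (auto intro!: derivative_eq_intros)
  have "\<exists>\<xi>>0. \<xi> < d \<and> (\<phi> d - \<phi> 0) * (2 * \<xi>) = (d\<^sup>2 - 0\<^sup>2) * (g' (c + \<xi>) - g' (c - \<xi>))"
    by (rule GMVT'[of 0 d \<phi> "\<lambda>x. x\<^sup>2"])
      (use d D\<phi> Dsq in \<open>auto intro: DERIV_isCont\<close>)
  then obtain \<xi> where \<xi>: "0 < \<xi>" "\<xi> < d" "\<phi> d * (2 * \<xi>) = d\<^sup>2 * (g' (c + \<xi>) - g' (c - \<xi>))"
    by (auto simp: \<phi>_def)
  have "\<exists>z. z > c - \<xi> \<and> z < c + \<xi> \<and> g' (c + \<xi>) - g' (c - \<xi>) = ((c + \<xi>) - (c - \<xi>)) * g'' z"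
    by (rule MVT2) (use \<xi> in \<open>auto intro!: g'\<close>)
  then obtain z where z: "z > c - \<xi>" "z < c + \<xi>" "g' (c + \<xi>) - g' (c - \<xi>) = (2 * \<xi>) * g'' z"
    by auto
  have "\<phi> d * (2 * \<xi>) = d\<^sup>2 * g'' z * (2 * \<xi>)" using \<xi> z by simp
  then have "\<phi> d = d\<^sup>2 * g'' z" using \<xi> by simp
  then show ?thesis using z \<xi> by (intro bexI[of _ z]) (auto simp: \<phi>_def)
qed

text \<open>Up to a variance factor, the covariance of the integrated volatilities over two
  intervals of length \<open>\<Delta>\<close> whose starting points lie \<open>h\<close> steps
  apart. The subtraction \<open>h - 1\<close> is that of the naturals, so the formula has this
  meaning only for \<open>h \<ge> 1\<close>.\<close>

definition acv_diff :: "real \<Rightarrow> real \<Rightarrow> real \<Rightarrow> nat \<Rightarrow> real" where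
  "acv_diff \<Delta> a B h =
     acv_prim a B (real (h + 1) * \<Delta>) - 2 * acv_prim a B (real h * \<Delta>) + acv_prim a B (real (h - 1) * \<Delta>)"

lemma acv_diff_mvt:
  assumes "B < 0" "0 < \<Delta>" "1 \<le> h"
  shows "\<exists>\<theta>\<in>{(real h - 1) * \<Delta><..<(real h + 1) * \<Delta>}. acv_diff \<Delta> a B h = \<Delta>\<^sup>2 * (1 - B * \<theta>) powr (1 - a)"
proof -
  have lt: "B * x < 1" if "x \<in> {real h * \<Delta> - \<Delta>..real h * \<Delta> + \<Delta>}" for x
  proof -
    have "0 \<le> (real h - 1) * \<Delta>" using assms by (intro mult_nonneg_nonneg) auto
    with that have "0 \<le> x" by (simp add: algebra_simps)
    then have "B * x \<le> 0" using assms by (simp add: mult_nonpos_nonneg)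
    then show ?thesis by simp
  qed
  have "\<exists>\<theta>\<in>{real h * \<Delta> - \<Delta><..<real h * \<Delta> + \<Delta>}.
     acv_prim a B (real h * \<Delta> + \<Delta>) - 2 * acv_prim a B (real h * \<Delta>) + acv_prim a B (real h * \<Delta> - \<Delta>)
       = \<Delta>\<^sup>2 * (1 - B * \<theta>) powr (1 - a)"
    by (rule second_difference_mvt[where g' = "acv_prim' a B"])
      (use assms lt in \<open>auto intro!: acv_prim_deriv acv_prim'_deriv\<close>)
  moreover have "real (h - 1) = real h - 1" using assms by simp
  ultimately show ?thesis
    by (simp add: acv_diff_def algebra_simps)
qed

section \<open>Removable singularities of the coefficients at \<open>a = 2\<close> and
  \<open>a = 3\<close>\<close>

lemma tendsto_removable:
  fixes N q :: "real \<Rightarrow> real"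
  assumes "(N has_real_derivative D) (at c)" "N c = 0" "isCont q c" "q c \<noteq> 0"
  shows "((\<lambda>a. N a / ((a - c) * q a)) \<longlongrightarrow> D / q c) (at c)"
proof -
  have "((\<lambda>a. (N a - N c) / (a - c)) \<longlongrightarrow> D) (at c)"
    using assms(1) by (simp add: has_field_derivative_iff)
  then have "((\<lambda>a. (N a - N c) / (a - c) / q a) \<longlongrightarrow> D / q c) (at c)"
    using assms(3,4) by (intro tendsto_divide) (auto simp: isCont_def)
  then show ?thesis using assms(2) by (simp add: divide_divide_eq_left)
qed

text \<open>As a function of \<open>a\<close>, the numerator vanishes at 2 and at 3. Each
  singularity is therefore removed by the derivative of the numerator in \<open>a\<close>, divided
  by the remaining factors of the denominator; the logarithms in \<open>acv_prim\<close> are those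
  of this derivative.\<close>

lemma acv_quotient_tendsto:
  assumes "B < 0" "0 \<le> \<tau>" "a = 2 \<or> a = 3"
  shows "((\<lambda>a. ((1 - B * \<tau>) powr (3 - a) - 1 - \<tau> * B * (a - 3)) / (B^3 * (a - 1) * (a - 2) * (a - 3)))
            \<longlongrightarrow> acv_prim a B \<tau> / (B * (a - 1))) (at a)"
proof -
  have p: "1 - B * \<tau> > 0" using assms mult_nonpos_nonneg[of B \<tau>] by simp
  have D: "((\<lambda>a. (1 - B * \<tau>) powr (3 - a) - 1 - \<tau> * B * (a - 3)) has_real_derivative
       - ln (1 - B * \<tau>) * (1 - B * \<tau>) powr (3 - a) - \<tau> * B) (at a)" for a
    using p by (auto intro!: derivative_eq_intros)
  from assms(3) show ?thesis
  proof
    assume a: "a = 2"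
    have "((\<lambda>a. ((1 - B * \<tau>) powr (3 - a) - 1 - \<tau> * B * (a - 3)) / ((a - 2) * (B^3 * (a - 1) * (a - 3))))
       \<longlongrightarrow> (- ln (1 - B * \<tau>) * (1 - B * \<tau>) powr (3 - 2) - \<tau> * B) / (B^3 * (2 - 1) * (2 - 3))) (at 2)"
      by (rule tendsto_removable[OF D]) (use p assms in \<open>auto intro!: continuous_intros\<close>)
    moreover have "(- ln (1 - B * \<tau>) * (1 - B * \<tau>) powr (3 - 2) - \<tau> * B) / (B^3 * (2 - 1) * (2 - 3))
       = acv_prim 2 B \<tau> / (B * (2 - 1))"
      using p assms by (simp add: acv_prim_def field_simps power2_eq_square power3_eq_cube)
    ultimately show ?thesis by (simp add: a mult_ac)
  next
    assume a: "a = 3"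
    have "((\<lambda>a. ((1 - B * \<tau>) powr (3 - a) - 1 - \<tau> * B * (a - 3)) / ((a - 3) * (B^3 * (a - 1) * (a - 2))))
       \<longlongrightarrow> (- ln (1 - B * \<tau>) * (1 - B * \<tau>) powr (3 - 3) - \<tau> * B) / (B^3 * (3 - 1) * (3 - 2))) (at 3)"
      by (rule tendsto_removable[OF D]) (use p assms in \<open>auto intro!: continuous_intros\<close>)
    moreover have "(- ln (1 - B * \<tau>) * (1 - B * \<tau>) powr (3 - 3) - \<tau> * B) / (B^3 * (3 - 1) * (3 - 2))
       = acv_prim 3 B \<tau> / (B * (3 - 1))"
      using p assms by (simp add: acv_prim_def field_simps power2_eq_square power3_eq_cube)
    ultimately show ?thesis by (simp add: a mult_ac)
  qed
qed

lemma acv_quotient_eq: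
  assumes "B < 0" "a \<noteq> 2" "a \<noteq> 3"
  shows "((1 - B * \<tau>) powr (3 - a) - 1 - \<tau> * B * (a - 3)) / (B^3 * (a - 1) * (a - 2) * (a - 3))
            = acv_prim a B \<tau> / (B * (a - 1))"
  using assms by (simp add: acv_prim_def power2_eq_square power3_eq_cube mult_ac)

lemma cont_ext_var2:
  assumes "B < 0" "0 < \<Delta>"
  shows "cont_ext (\<lambda>a. ((1 - B * \<Delta>) powr (3 - a) - 1 - \<Delta> * B * (a - 3))
            / (B^3 * (a - 1) * (a - 2) * (a - 3))) a = acv_prim a B \<Delta> / (B * (a - 1))"
proof (cases "a = 2 \<or> a = 3")
  case True
  then show ?thesis unfolding cont_ext_def
    using tendsto_Lim[OF _ acv_quotient_tendsto[of B \<Delta> a]] assms by simp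
next
  case False
  then show ?thesis unfolding cont_ext_def using acv_quotient_eq[of B a \<Delta>] assms by simp
qed

text \<open>A single \<open>phi\<close> over this denominator has poles at 2 and 3. Subtracting a
  function affine in the lag turns it into the quotient with removable singularities, and second
  differences annihilate affine functions. The limit can thus be taken in three quotients
  separately.\<close>

lemma cont_ext_lag:
  assumes B: "B < 0" and \<Delta>: "0 < \<Delta>" and h: "1 \<le> h"
  shows "cont_ext (\<lambda>a. (phi \<Delta> a B (h + 1) - 2 * phi \<Delta> a B h + phi \<Delta> a B (h - 1))
            / (2 * B^3 * (a - 1) * (a - 2) * (a - 3))) a = acv_diff \<Delta> a B h / (2 * B * (a - 1))"
proof -
  define q where "q \<tau> a = ((1 - B * \<tau>) powr (3 - a) - 1 - \<tau> * B * (a - 3)) / (B^3 * (a - 1) * (a - 2) * (a - 3))" for \<tau> a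
  have eq: "(phi \<Delta> a B (h + 1) - 2 * phi \<Delta> a B h + phi \<Delta> a B (h - 1)) / (2 * B^3 * (a - 1) * (a - 2) * (a - 3))
     = (q (real (h + 1) * \<Delta>) a - 2 * q (real h * \<Delta>) a + q (real (h - 1) * \<Delta>) a) / 2" for a
  proof -
    define c where "c = B^3 * (a - 1) * (a - 2) * (a - 3)"
    have h1: "real (h - 1) = real h - 1" using h by simp
    have p: "phi \<Delta> a B k = q (real k * \<Delta>) a * c + 1 + (real k * \<Delta>) * B * (a - 3)" if "c \<noteq> 0" for k
      using that by (simp add: q_def phi_def c_def mult_ac)
    show ?thesis
    proof (cases "c = 0")
      \<comment> \<open>Here \<open>a\<close> is 1, 2 or 3, and both sides are 0 by the convention
        for division by zero. Having \<open>eq\<close> for every \<open>a\<close> permits rewriting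
        the function under \<open>Lim\<close>.\<close>
      case True
      then have "B^3 * (a - 1) * (a - 2) * (a - 3) = 0" "2 * B^3 * (a - 1) * (a - 2) * (a - 3) = 0"
        by (auto simp: c_def)
      then show ?thesis by (simp only: q_def div_by_0) simp
    next
      case False
      have "2 * B^3 * (a - 1) * (a - 2) * (a - 3) = 2 * c" by (simp add: c_def)
      moreover have "phi \<Delta> a B (h + 1) - 2 * phi \<Delta> a B h + phi \<Delta> a B (h - 1)
         = (q (real (h + 1) * \<Delta>) a - 2 * q (real h * \<Delta>) a + q (real (h - 1) * \<Delta>) a) * c"
        unfolding p[OF False] h1 by (simp add: algebra_simps)
      ultimately show ?thesis using False by simp
    qed
  qed
  have dist: "(x / d - 2 * (y / d) + z / d) / 2 = (x - 2 * y + z) / (2 * d)" for x y z d :: real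
    by (simp add: add_divide_distrib diff_divide_distrib)
  show ?thesis
  proof (cases "a = 2 \<or> a = 3")
    case True
    have "((\<lambda>a. (q (real (h + 1) * \<Delta>) a - 2 * q (real h * \<Delta>) a + q (real (h - 1) * \<Delta>) a) / 2) \<longlongrightarrow>
       (acv_prim a B (real (h + 1) * \<Delta>) / (B * (a - 1)) - 2 * (acv_prim a B (real h * \<Delta>) / (B * (a - 1)))
          + acv_prim a B (real (h - 1) * \<Delta>) / (B * (a - 1))) / 2) (at a)"
      unfolding q_def using True B \<Delta>
      by (intro tendsto_intros acv_quotient_tendsto) auto
    then have "Lim (at a) (\<lambda>a. (q (real (h + 1) * \<Delta>) a - 2 * q (real h * \<Delta>) a + q (real (h - 1) * \<Delta>) a) / 2) =
       (acv_prim a B (real (h + 1) * \<Delta>) / (B * (a - 1)) - 2 * (acv_prim a B (real h * \<Delta>) / (B * (a - 1)))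
          + acv_prim a B (real (h - 1) * \<Delta>) / (B * (a - 1))) / 2"
      by (rule tendsto_Lim[rotated]) simp
    then show ?thesis unfolding cont_ext_def eq using True
      by (simp only: acv_diff_def dist mult.assoc if_True if_False)
  next
    case False
    then have "q \<tau> a = acv_prim a B \<tau> / (B * (a - 1))" for \<tau>
      unfolding q_def using acv_quotient_eq[of B a \<tau>] B by simp
    then show ?thesis unfolding cont_ext_def eq using False
      by (simp only: acv_diff_def dist mult.assoc if_True if_False)
  qed
qed

section \<open>Growth of the second differences and identification of the parameters\<close>

lemma ln_acv_diff_bounds:
  assumes "B < 0" "0 < \<Delta>" "1 < a" "1 \<le> h"
  shows "acv_diff \<Delta> a B h > 0"
    "ln (acv_diff \<Delta> a B h) \<le> ln (\<Delta>\<^sup>2) + (1 - a) * ln (1 - B * ((real h - 1) * \<Delta>))"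
    "ln (acv_diff \<Delta> a B h) \<ge> ln (\<Delta>\<^sup>2) + (1 - a) * ln (1 - B * ((real h + 1) * \<Delta>))"
proof -
  obtain \<theta> where \<theta>: "\<theta> \<in> {(real h - 1) * \<Delta><..<(real h + 1) * \<Delta>}"
    "acv_diff \<Delta> a B h = \<Delta>\<^sup>2 * (1 - B * \<theta>) powr (1 - a)"
    using acv_diff_mvt[of B \<Delta> h a] assms by auto
  have 0: "0 \<le> (real h - 1) * \<Delta>" using assms by (intro mult_nonneg_nonneg) auto
  have 1: "- B * ((real h - 1) * \<Delta>) \<ge> 0" using 0 assms by (intro mult_nonneg_nonneg) auto
  have 2: "- B * ((real h - 1) * \<Delta>) \<le> - B * \<theta>" "- B * \<theta> \<le> - B * ((real h + 1) * \<Delta>)"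
    using \<theta> assms by (auto intro!: mult_left_mono)
  then have 3: "1 - B * \<theta> > 0" using 1 by simp
  show "acv_diff \<Delta> a B h > 0" using \<theta> 3 assms by simp
  have l: "ln (acv_diff \<Delta> a B h) = ln (\<Delta>\<^sup>2) + (1 - a) * ln (1 - B * \<theta>)"
    using \<theta> 3 assms by (simp add: ln_mult ln_powr)
  have "ln (1 - B * ((real h - 1) * \<Delta>)) \<le> ln (1 - B * \<theta>)"
    "ln (1 - B * \<theta>) \<le> ln (1 - B * ((real h + 1) * \<Delta>))"
    using 1 2 3 by (auto intro!: ln_mono)
  then show "ln (acv_diff \<Delta> a B h) \<le> ln (\<Delta>\<^sup>2) + (1 - a) * ln (1 - B * ((real h - 1) * \<Delta>))"
    "ln (acv_diff \<Delta> a B h) \<ge> ln (\<Delta>\<^sup>2) + (1 - a) * ln (1 - B * ((real h + 1) * \<Delta>))"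
    unfolding l using assms by (auto intro!: mult_left_mono_neg)
qed

text \<open>The intermediate lag supplied by the mean value theorem is unknown, but it lies between
  \<open>(h - 1) * \<Delta>\<close> and \<open>(h + 1) * \<Delta>\<close>. At both ends
  \<open>ln (1 - B * \<theta>)\<close> equals \<open>ln h + ln (- B * \<Delta>)\<close> up to a term
  that tends to 0, so the position in between does not matter in the limit.\<close>

lemma ln_acv_diff_asymp:
  assumes "B < 0" "0 < \<Delta>" "1 < a"
  shows "(\<lambda>h. ln (acv_diff \<Delta> a B h) - (1 - a) * ln (real h)) \<longlonglongrightarrow> ln (\<Delta>\<^sup>2) + (1 - a) * ln (- B * \<Delta>)"
proof (rule tendsto_sandwich)
  show "\<forall>\<^sub>F h in sequentially. ln (\<Delta>\<^sup>2) + (1 - a) * (ln (1 - B * ((real h + 1) * \<Delta>)) - ln (real h))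
      \<le> ln (acv_diff \<Delta> a B h) - (1 - a) * ln (real h)"
    using eventually_ge_at_top[of 1]
    by eventually_elim (use ln_acv_diff_bounds(3)[OF assms] in \<open>force simp: algebra_simps\<close>)
  show "\<forall>\<^sub>F h in sequentially. ln (acv_diff \<Delta> a B h) - (1 - a) * ln (real h) \<le>
     ln (\<Delta>\<^sup>2) + (1 - a) * (ln (1 - B * ((real h - 1) * \<Delta>)) - ln (real h))"
    using eventually_ge_at_top[of 1]
    by eventually_elim (use ln_acv_diff_bounds(2)[OF assms] in \<open>force simp: algebra_simps\<close>)
  define b where "b = - B * \<Delta>"
  have b: "b > 0" using assms by (simp add: b_def mult_neg_pos)
  have L: "(\<lambda>h. ln (1 + b * (real h + e)) - ln (real h)) \<longlonglongrightarrow> ln b" for e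
  proof -
    have L0: "(\<lambda>h. b + (1 + b * e) / real h) \<longlonglongrightarrow> b + 0"
      by (intro tendsto_intros lim_const_over_n)
    then have "(\<lambda>h. ln (b + (1 + b * e) / real h)) \<longlonglongrightarrow> ln (b + 0)"
      using b by (intro tendsto_intros) auto
    moreover have "\<forall>\<^sub>F h in sequentially. b + (1 + b * e) / real h > 0"
      by (rule order_tendstoD(1)[OF L0]) (use b in auto)
    then have "\<forall>\<^sub>F h in sequentially. ln (b + (1 + b * e) / real h) = ln (1 + b * (real h + e)) - ln (real h)"
      using eventually_gt_at_top[of 0]
    proof eventually_elim
      case (elim h)
      have "b + (1 + b * e) / real h = (1 + b * (real h + e)) / real h" using elim by (simp add: field_simps)
      moreover have "1 + b * (real h + e) > 0"
        using elim unfolding calculation by (simp add: zero_less_divide_iff)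
      ultimately show ?case using elim by (simp add: ln_div)
    qed
    ultimately show ?thesis by (simp add: tendsto_cong)
  qed
  have "(\<lambda>h. ln (\<Delta>\<^sup>2) + (1 - a) * (ln (1 + b * (real h + 1)) - ln (real h))) \<longlonglongrightarrow> ln (\<Delta>\<^sup>2) + (1 - a) * ln b"
    by (intro tendsto_intros L)
  then show "(\<lambda>h. ln (\<Delta>\<^sup>2) + (1 - a) * (ln (1 - B * ((real h + 1) * \<Delta>)) - ln (real h)))
      \<longlonglongrightarrow> ln (\<Delta>\<^sup>2) + (1 - a) * ln (- B * \<Delta>)"
    by (simp add: b_def mult_ac)
  have "(\<lambda>h. ln (\<Delta>\<^sup>2) + (1 - a) * (ln (1 + b * (real h + (-1))) - ln (real h))) \<longlonglongrightarrow> ln (\<Delta>\<^sup>2) + (1 - a) * ln b"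
    by (intro tendsto_intros L)
  then show "(\<lambda>h. ln (\<Delta>\<^sup>2) + (1 - a) * (ln (1 - B * ((real h - 1) * \<Delta>)) - ln (real h)))
      \<longlonglongrightarrow> ln (\<Delta>\<^sup>2) + (1 - a) * ln (- B * \<Delta>)"
    by (simp add: b_def mult_ac)
qed

text \<open>The candidate \<open>s\<close> may be any real number. Its sign, without which no
  logarithm could be taken, is forced by the equation at lag 1, because second differences are
  positive for all admissible parameters. The quantities \<open>q\<close> and \<open>q0\<close> are
  the variances of the volatility that belong to the two parameter vectors.\<close>

lemma acv_identification:
  fixes s s\<^sub>0 :: real
  assumes B: "B < 0" "B\<^sub>0 < 0" and a: "1 < a" "1 < a\<^sub>0" and \<Delta>: "0 < \<Delta>" and s0: "0 < s\<^sub>0"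
    and eq: "\<And>h. 1 \<le> h \<Longrightarrow> s * acv_diff \<Delta> a B h / (2 * B * (a - 1)) = s\<^sub>0 * acv_diff \<Delta> a\<^sub>0 B\<^sub>0 h / (2 * B\<^sub>0 * (a\<^sub>0 - 1))"
  shows "a = a\<^sub>0 \<and> B = B\<^sub>0 \<and> s = s\<^sub>0"
proof -
  define q where "q = s / (2 * - B * (a - 1))"
  define q0 where "q0 = s\<^sub>0 / (2 * - B\<^sub>0 * (a\<^sub>0 - 1))"
  have "2 * - B\<^sub>0 * (a\<^sub>0 - 1) > 0" using B a by (intro mult_pos_pos) auto
  then have q0: "q0 > 0" unfolding q0_def using s0 by (rule divide_pos_pos[rotated])
  have E: "q * acv_diff \<Delta> a B h = q0 * acv_diff \<Delta> a\<^sub>0 B\<^sub>0 h" if "1 \<le> h" for h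
    using eq[OF that] by (simp add: q_def q0_def)
  note pos = ln_acv_diff_bounds(1)[OF B(1) \<Delta> a(1)] ln_acv_diff_bounds(1)[OF B(2) \<Delta> a(2)]
  have "q * acv_diff \<Delta> a B 1 > 0" using E[of 1] pos(2)[of 1] q0 by simp
  then have q: "q > 0" using pos(1)[of 1] by (simp add: zero_less_mult_iff)
  have lnE: "ln (acv_diff \<Delta> a B h) - ln (acv_diff \<Delta> a\<^sub>0 B\<^sub>0 h) = ln q0 - ln q" if "1 \<le> h" for h
  proof -
    have "ln (q * acv_diff \<Delta> a B h) = ln (q0 * acv_diff \<Delta> a\<^sub>0 B\<^sub>0 h)" using E[OF that] by simp
    then show ?thesis using q q0 pos[OF that] by (simp add: ln_mult)
  qed
  let ?l = "(ln (\<Delta>\<^sup>2) + (1 - a) * ln (- B * \<Delta>)) - (ln (\<Delta>\<^sup>2) + (1 - a\<^sub>0) * ln (- B\<^sub>0 * \<Delta>))"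
  have lim: "(\<lambda>h. (ln (acv_diff \<Delta> a B h) - (1 - a) * ln (real h)) - (ln (acv_diff \<Delta> a\<^sub>0 B\<^sub>0 h) - (1 - a\<^sub>0) * ln (real h))) \<longlonglongrightarrow> ?l"
    by (intro tendsto_diff ln_acv_diff_asymp) (use B a \<Delta> in auto)
  have ev: "\<forall>\<^sub>F h in sequentially. (ln (acv_diff \<Delta> a B h) - (1 - a) * ln (real h)) - (ln (acv_diff \<Delta> a\<^sub>0 B\<^sub>0 h) - (1 - a\<^sub>0) * ln (real h))
     = (ln q0 - ln q) + (a - a\<^sub>0) * ln (real h)"
    using eventually_ge_at_top[of 1] by eventually_elim (use lnE in \<open>force simp: algebra_simps\<close>)
  have lim2: "(\<lambda>h. (ln q0 - ln q) + (a - a\<^sub>0) * ln (real h)) \<longlonglongrightarrow> ?l"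
    using lim ev by (simp add: tendsto_cong)
  have lninf: "filterlim (\<lambda>h. ln (real h)) at_top sequentially"
    by (rule filterlim_compose[OF ln_at_top filterlim_real_sequentially])
  \<comment> \<open>The two logarithms differ by a constant, while their asymptotics differ by
    \<open>(a - a\<^sub>0) * ln h\<close> up to a bounded term. Unequal exponents would make
    \<open>ln h\<close> converge.\<close>
  have aa: "a = a\<^sub>0"
  proof (rule ccontr)
    assume "a \<noteq> a\<^sub>0"
    have "(\<lambda>h. ((ln q0 - ln q) + (a - a\<^sub>0) * ln (real h) - (ln q0 - ln q)) / (a - a\<^sub>0)) \<longlonglongrightarrow> (?l - (ln q0 - ln q)) / (a - a\<^sub>0)"
      by (intro tendsto_intros lim2) (use \<open>a \<noteq> a\<^sub>0\<close> in auto)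
    then have "(\<lambda>h. ln (real h)) \<longlonglongrightarrow> (?l - (ln q0 - ln q)) / (a - a\<^sub>0)"
      using \<open>a \<noteq> a\<^sub>0\<close> by simp
    then show False using lninf by (meson not_tendsto_and_filterlim_at_infinity sequentially_bot filterlim_at_top_imp_at_infinity)
  qed
  have l: "ln q0 - ln q = (1 - a) * (ln (- B) - ln (- B\<^sub>0))"
  proof -
    have "(\<lambda>h::nat. ln q0 - ln q) \<longlonglongrightarrow> ?l" using lim2 aa by simp
    then have "ln q0 - ln q = ?l" by (simp add: LIMSEQ_const_iff)
    also have "ln (- B * \<Delta>) = ln (- B) + ln \<Delta>" using B \<Delta> by (subst ln_mult) auto
    also have "ln (- B\<^sub>0 * \<Delta>) = ln (- B\<^sub>0) + ln \<Delta>" using B \<Delta> by (subst ln_mult) auto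
    finally show ?thesis by (simp add: aa algebra_simps)
  qed
  have qq: "q * (- B) powr (1 - a) = q0 * (- B\<^sub>0) powr (1 - a)"
  proof -
    have "ln (q * (- B) powr (1 - a)) = ln (q0 * (- B\<^sub>0) powr (1 - a))"
      using q q0 B l by (simp add: ln_mult ln_powr algebra_simps)
    then show ?thesis using q q0 B by (simp add: ln_inj_iff)
  qed
  define Q where "Q = q * (- B) powr (1 - a)"
  have Q: "Q > 0" using q B by (simp add: Q_def)
  \<comment> \<open>With \<open>- B\<close> factored out, the prefactors of both powers agree by
    \<open>qq\<close>, and the two parameters differ only in the shifts \<open>c\<close> and
    \<open>c0\<close>.\<close>
  define c where "c = 1 / (- B)"
  define c0 where "c0 = 1 / (- B\<^sub>0)"
  have c: "c > 0" "c0 > 0" using B by (auto simp: c_def c0_def)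
  have P: "(1 - B * \<theta>) powr (1 - a) = (- B) powr (1 - a) * (c + \<theta>) powr (1 - a)"
    "(1 - B\<^sub>0 * \<theta>) powr (1 - a) = (- B\<^sub>0) powr (1 - a) * (c0 + \<theta>) powr (1 - a)"
    if "0 \<le> \<theta>" for \<theta>
  proof -
    have "1 - B * \<theta> = (- B) * (c + \<theta>)" "1 - B\<^sub>0 * \<theta> = (- B\<^sub>0) * (c0 + \<theta>)"
      using B by (auto simp: c_def c0_def field_simps)
    then show "(1 - B * \<theta>) powr (1 - a) = (- B) powr (1 - a) * (c + \<theta>) powr (1 - a)"
      "(1 - B\<^sub>0 * \<theta>) powr (1 - a) = (- B\<^sub>0) powr (1 - a) * (c0 + \<theta>) powr (1 - a)"
      using B c that powr_mult[of "- B" "c + \<theta>" "1 - a"] powr_mult[of "- B\<^sub>0" "c0 + \<theta>" "1 - a"]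
      by simp_all
  qed
  \<comment> \<open>The mean value theorem is applied to the difference of the two antiderivatives
    rather than to each of them, because the powers can be compared only at a common \<theta>. At
    lag 1 this \<theta> lies between 0 and \<open>2 * \<Delta>\<close>.\<close>
  have "\<exists>\<theta>\<in>{\<Delta> - \<Delta><..<\<Delta> + \<Delta>}.
     (q * acv_prim a B (\<Delta> + \<Delta>) - q0 * acv_prim a B\<^sub>0 (\<Delta> + \<Delta>))
     - 2 * (q * acv_prim a B \<Delta> - q0 * acv_prim a B\<^sub>0 \<Delta>)
     + (q * acv_prim a B (\<Delta> - \<Delta>) - q0 * acv_prim a B\<^sub>0 (\<Delta> - \<Delta>))
     = \<Delta>\<^sup>2 * (q * (1 - B * \<theta>) powr (1 - a) - q0 * (1 - B\<^sub>0 * \<theta>) powr (1 - a))"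
  proof (rule second_difference_mvt[where g = "\<lambda>x. q * acv_prim a B x - q0 * acv_prim a B\<^sub>0 x" and g' = "\<lambda>x. q * acv_prim' a B x - q0 * acv_prim' a B\<^sub>0 x", OF \<Delta>])
    fix x assume x: "x \<in> {\<Delta> - \<Delta>..\<Delta> + \<Delta>}"
    have lt: "B * x < 1" "B\<^sub>0 * x < 1"
      using x B mult_nonpos_nonneg[of B x] mult_nonpos_nonneg[of B\<^sub>0 x] by auto
    show "((\<lambda>x. q * acv_prim a B x - q0 * acv_prim a B\<^sub>0 x) has_real_derivative q * acv_prim' a B x - q0 * acv_prim' a B\<^sub>0 x) (at x)"
      by (intro DERIV_diff DERIV_cmult acv_prim_deriv) (use B lt in auto)
    show "((\<lambda>x. q * acv_prim' a B x - q0 * acv_prim' a B\<^sub>0 x) has_real_derivative q * (1 - B * x) powr (1 - a) - q0 * (1 - B\<^sub>0 * x) powr (1 - a)) (at x)"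
      by (intro DERIV_diff DERIV_cmult acv_prim'_deriv) (use B lt in auto)
  qed
  then obtain \<theta> where \<theta>: "0 < \<theta>" "\<theta> < \<Delta> + \<Delta>"
    "q * acv_diff \<Delta> a B 1 - q0 * acv_diff \<Delta> a B\<^sub>0 1
     = \<Delta>\<^sup>2 * (q * (1 - B * \<theta>) powr (1 - a) - q0 * (1 - B\<^sub>0 * \<theta>) powr (1 - a))"
    by (auto simp: acv_diff_def algebra_simps)
  have "q * (1 - B * \<theta>) powr (1 - a) = q0 * (1 - B\<^sub>0 * \<theta>) powr (1 - a)"
    using \<theta>(3) E[of 1] aa \<Delta> by simp
  moreover have "q * (1 - B * \<theta>) powr (1 - a) = Q * (c + \<theta>) powr (1 - a)"
    using P(1)[of \<theta>] \<theta> by (simp add: Q_def)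
  moreover have "q0 * (1 - B\<^sub>0 * \<theta>) powr (1 - a) = Q * (c0 + \<theta>) powr (1 - a)"
    unfolding Q_def qq using P(2)[of \<theta>] \<theta> by simp
  ultimately have "Q * (c + \<theta>) powr (1 - a) = Q * (c0 + \<theta>) powr (1 - a)" by simp
  then have "(c + \<theta>) powr (1 - a) = (c0 + \<theta>) powr (1 - a)" using Q by simp
  then have "((c + \<theta>) powr (1 - a)) powr (1 / (1 - a)) = ((c0 + \<theta>) powr (1 - a)) powr (1 / (1 - a))" by simp
  then have "c = c0" using a c \<theta> by (simp add: powr_powr)
  then have BB: "B = B\<^sub>0" using B by (simp add: c_def c0_def)
  then have "q = q0" using qq B by simp
  then have "s = s\<^sub>0" using aa BB B a by (simp add: q_def q0_def)
  then show ?thesis using aa BB by simp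
qed

section \<open>Moments and sign of a random variable from its characteristic function\<close>

lemma cos_diff_quotient_tendsto:
  "((\<lambda>u. 2 * (1 - cos (u * x)) / u\<^sup>2) \<longlongrightarrow> x\<^sup>2) (at (0::real))"
proof (cases "x = 0")
  case False
  have "((\<lambda>u::real. 2 * (1 - cos u) / u\<^sup>2) \<longlongrightarrow> 1) (at 0)"
    by real_asymp
  moreover have "filterlim (\<lambda>u. u * x) (at 0) (at (0::real))"
  proof (rule filterlim_atI)
    show "((\<lambda>u. u * x) \<longlongrightarrow> 0) (at (0::real))" by (auto intro!: tendsto_eq_intros)
    show "\<forall>\<^sub>F u in at (0::real). u * x \<noteq> 0" using False by (auto simp: eventually_at_filter)
  qed
  ultimately have "((\<lambda>u. 2 * (1 - cos (u * x)) / (u * x)\<^sup>2) \<longlongrightarrow> 1) (at (0::real))"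
    by (rule filterlim_compose)
  then have "((\<lambda>u. 2 * (1 - cos (u * x)) / (u * x)\<^sup>2 * x\<^sup>2) \<longlongrightarrow> 1 * x\<^sup>2) (at (0::real))"
    by (intro tendsto_intros)
  moreover have "2 * (1 - cos (u * x)) / (u * x)\<^sup>2 * x\<^sup>2 = 2 * (1 - cos (u * x)) / u\<^sup>2" for u
    using False by (simp add: power_mult_distrib)
  ultimately show ?thesis by simp
qed simp

lemma sin_diff_quotient_tendsto: "((\<lambda>u. sin (u * x) / u) \<longlongrightarrow> x) (at (0::real))"
proof -
  have "((\<lambda>u. sin (u * x)) has_real_derivative x) (at 0)"
    by (auto intro!: derivative_eq_intros)
  then show ?thesis by (simp add: has_field_derivative_iff)
qed

lemma cos_diff_quotient_bounds:
  fixes x u :: real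
  shows "0 \<le> 2 * (1 - cos (u * x)) / u\<^sup>2" "2 * (1 - cos (u * x)) / u\<^sup>2 \<le> x\<^sup>2"
proof -
  show "0 \<le> 2 * (1 - cos (u * x)) / u\<^sup>2" by simp
  have "cos (u * x) = 1 - 2 * (sin (u * x / 2))\<^sup>2"
    using cos_double_sin[of "u * x / 2"] by simp
  moreover have "\<bar>sin (u * x / 2)\<bar> \<le> \<bar>u * x / 2\<bar>" by (rule abs_sin_x_le_abs_x)
  then have "(sin (u * x / 2))\<^sup>2 \<le> (u * x / 2)\<^sup>2" by (simp only: abs_le_square_iff)
  ultimately have "2 * (1 - cos (u * x)) \<le> u\<^sup>2 * x\<^sup>2" by (simp add: power_mult_distrib power_divide)
  then show "2 * (1 - cos (u * x)) / u\<^sup>2 \<le> x\<^sup>2"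
    by (cases "u = 0") (auto simp: divide_le_eq mult_ac)
qed

lemma sin_diff_quotient_bound:
  fixes x u :: real
  shows "\<bar>sin (u * x) / u\<bar> \<le> \<bar>x\<bar>"
  using abs_sin_x_le_abs_x[of "u * x"] by (cases "u = 0") (auto simp: abs_mult divide_le_eq mult_ac)

lemma at_0_sequentially:
  assumes "(f \<longlongrightarrow> l) (at (0::real))"
  shows "(\<lambda>n. f (1 / real (Suc n))) \<longlonglongrightarrow> l"
proof (rule filterlim_compose[OF assms])
  show "filterlim (\<lambda>n. 1 / real (Suc n)) (at 0) sequentially"
    by (rule filterlim_atI) (use LIMSEQ_inverse_real_of_nat in \<open>auto simp: inverse_eq_divide\<close>)
qed

lemma (in real_distribution) Re_Im_char:
  "Re (char M u) = (\<integral>x. cos (u * x) \<partial>M)" "Im (char M u) = (\<integral>x. sin (u * x) \<partial>M)"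
  unfolding char_def
  by (simp_all add: integral_Re[symmetric] integral_Im[symmetric] integrable_iexp Re_exp Im_exp)

text \<open>No moment is assumed to exist. Fatou's lemma along \<open>u = 1 / (n + 1)\<close> turns
  the first limit into finiteness of the second moment; after that, dominated convergence with
  \<open>x\<^sup>2\<close> and \<open>\<bar>x\<bar>\<close> identifies both limits.\<close>

lemma (in real_distribution) moments_from_char:
  assumes b: "((\<lambda>u. 2 * (1 - Re (char M u)) / u\<^sup>2) \<longlongrightarrow> b) (at 0)"
    and a: "((\<lambda>u. Im (char M u) / u) \<longlongrightarrow> a) (at 0)"
  shows "integrable M (\<lambda>x. x\<^sup>2)" "(\<integral>x. x\<^sup>2 \<partial>M) = b" "(\<integral>x. x \<partial>M) = a"
proof -
  have ic: "integrable M (\<lambda>x. cos (u * x))" "integrable M (\<lambda>x. sin (u * x))" for u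
    by (rule integrable_const_bound[where B = 1]; simp)+
  have re: "2 * (1 - Re (char M u)) / u\<^sup>2 = (\<integral>x. 2 * (1 - cos (u * x)) / u\<^sup>2 \<partial>M)" for u
    using ic prob_space by (simp add: Re_Im_char)
  have im: "Im (char M u) / u = (\<integral>x. sin (u * x) / u \<partial>M)" for u
    by (simp add: Re_Im_char)
  let ?u = "\<lambda>n. 1 / real (Suc n)"
  have I: "integrable M (\<lambda>x. 2 * (1 - cos (u * x)) / u\<^sup>2)" for u
    using ic by auto
  have bn: "(\<lambda>n. \<integral>x. 2 * (1 - cos (?u n * x)) / (?u n)\<^sup>2 \<partial>M) \<longlonglongrightarrow> b"
    using at_0_sequentially[OF b] unfolding re .
  have "(\<integral>\<^sup>+x. ennreal (x\<^sup>2) \<partial>M) \<le> liminf (\<lambda>n. \<integral>\<^sup>+x. ennreal (2 * (1 - cos (?u n * x)) / (?u n)\<^sup>2) \<partial>M)"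
  proof -
    have "(\<integral>\<^sup>+x. ennreal (x\<^sup>2) \<partial>M) = (\<integral>\<^sup>+x. liminf (\<lambda>n. ennreal (2 * (1 - cos (?u n * x)) / (?u n)\<^sup>2)) \<partial>M)"
    proof (rule nn_integral_cong)
      fix x
      have "(\<lambda>n. ennreal (2 * (1 - cos (?u n * x)) / (?u n)\<^sup>2)) \<longlonglongrightarrow> ennreal (x\<^sup>2)"
        by (intro tendsto_ennrealI at_0_sequentially[OF cos_diff_quotient_tendsto])
      then show "ennreal (x\<^sup>2) = liminf (\<lambda>n. ennreal (2 * (1 - cos (?u n * x)) / (?u n)\<^sup>2))"
        by (rule lim_imp_Liminf[symmetric, rotated]) simp
    qed
    also have "\<dots> \<le> liminf (\<lambda>n. \<integral>\<^sup>+x. ennreal (2 * (1 - cos (?u n * x)) / (?u n)\<^sup>2) \<partial>M)"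
      by (rule nn_integral_liminf) simp
    finally show ?thesis .
  qed
  also have "(\<lambda>n. \<integral>\<^sup>+x. ennreal (2 * (1 - cos (?u n * x)) / (?u n)\<^sup>2) \<partial>M)
      = (\<lambda>n. ennreal (\<integral>x. 2 * (1 - cos (?u n * x)) / (?u n)\<^sup>2 \<partial>M))"
    by (intro ext nn_integral_eq_integral I AE_I2 cos_diff_quotient_bounds)
  also have "liminf \<dots> = ennreal b"
    using bn by (intro lim_imp_Liminf tendsto_ennrealI) auto
  finally have "(\<integral>\<^sup>+x. ennreal (x\<^sup>2) \<partial>M) < \<infinity>" by (simp add: order_le_less_trans)
  then show int2: "integrable M (\<lambda>x. x\<^sup>2)"
    by (intro integrableI_nonneg) auto
  have "(\<lambda>n. \<integral>x. 2 * (1 - cos (?u n * x)) / (?u n)\<^sup>2 \<partial>M) \<longlonglongrightarrow> (\<integral>x. x\<^sup>2 \<partial>M)"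
  proof (rule integral_dominated_convergence[where w = "\<lambda>x. x\<^sup>2"])
    show "AE x in M. (\<lambda>n. 2 * (1 - cos (?u n * x)) / (?u n)\<^sup>2) \<longlonglongrightarrow> x\<^sup>2"
      by (intro AE_I2 at_0_sequentially[OF cos_diff_quotient_tendsto])
    show "AE x in M. norm (2 * (1 - cos (?u n * x)) / (?u n)\<^sup>2) \<le> x\<^sup>2" for n
      using cos_diff_quotient_bounds[of "?u n"] by (intro AE_I2) (metis abs_of_nonneg real_norm_def)
  qed (use int2 in auto)
  then show "(\<integral>x. x\<^sup>2 \<partial>M) = b" using bn LIMSEQ_unique by blast
  have int1: "integrable M (\<lambda>x. \<bar>x\<bar>)"
  proof (rule Bochner_Integration.integrable_bound)
    show "integrable M (\<lambda>x. 1 + x\<^sup>2)" using int2 by simp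
    show "AE x in M. norm \<bar>x\<bar> \<le> norm (1 + x\<^sup>2)"
    proof (rule AE_I2)
      fix x :: real
      have "0 \<le> (\<bar>x\<bar> - 1)\<^sup>2 + 1 + x\<^sup>2" by simp
      then show "norm \<bar>x\<bar> \<le> norm (1 + x\<^sup>2)" by (simp add: power2_diff)
    qed
  qed simp
  have "(\<lambda>n. \<integral>x. sin (?u n * x) / ?u n \<partial>M) \<longlonglongrightarrow> (\<integral>x. x \<partial>M)"
  proof (rule integral_dominated_convergence[where w = "\<lambda>x. \<bar>x\<bar>"])
    show "AE x in M. (\<lambda>n. sin (?u n * x) / ?u n) \<longlonglongrightarrow> x"
      by (intro AE_I2 at_0_sequentially[OF sin_diff_quotient_tendsto])
    show "AE x in M. norm (sin (?u n * x) / ?u n) \<le> \<bar>x\<bar>" for n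
      by (intro AE_I2) (simp only: real_norm_def sin_diff_quotient_bound)
  qed (use int1 in auto)
  then show "(\<integral>x. x \<partial>M) = a" using at_0_sequentially[OF a] LIMSEQ_unique unfolding im by blast
qed

text \<open>Passes from cumulants to moments: \<open>m\<close> and \<open>v\<close> are read off
  from the exponent, and the additional \<open>m\<^sup>2\<close> comes from
  \<open>1 - cos (Im (\<psi> u))\<close>.\<close>

lemma exp_char_expansion:
  fixes \<psi> :: "real \<Rightarrow> complex"
  assumes R: "((\<lambda>u. Re (\<psi> u) / u\<^sup>2) \<longlongrightarrow> - v / 2) (at 0)"
    and I: "((\<lambda>u. Im (\<psi> u) / u) \<longlongrightarrow> m) (at 0)"
  shows "((\<lambda>u. 2 * (1 - Re (exp (\<psi> u))) / u\<^sup>2) \<longlongrightarrow> v + m\<^sup>2) (at 0)"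
    "((\<lambda>u. Im (exp (\<psi> u)) / u) \<longlongrightarrow> m) (at 0)"
proof -
  have R0: "((\<lambda>u. Re (\<psi> u)) \<longlongrightarrow> 0) (at 0)"
  proof -
    have "((\<lambda>u. Re (\<psi> u) / u\<^sup>2 * u\<^sup>2) \<longlongrightarrow> (- v / 2) * 0\<^sup>2) (at 0)"
      by (intro tendsto_intros R)
    then show ?thesis
      by (rule Lim_transform_eventually[THEN tendsto_eq_rhs]) (auto simp: eventually_at_filter)
  qed
  have I0: "((\<lambda>u. Im (\<psi> u)) \<longlongrightarrow> 0) (at 0)"
  proof -
    have "((\<lambda>u. Im (\<psi> u) / u * u) \<longlongrightarrow> m * 0) (at 0)"
      by (intro tendsto_intros I)
    then show ?thesis
      by (rule Lim_transform_eventually[THEN tendsto_eq_rhs]) (auto simp: eventually_at_filter)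
  qed
  \<comment> \<open>Continuous extensions to 0 of the elementary quotients. They are needed because
    \<open>Re (\<psi> u)\<close> or \<open>Im (\<psi> u)\<close> may vanish for some
    \<open>u \<noteq> 0\<close>, where a limit at the punctured origin could not be
    composed.\<close>
  define E where "E r = (if r = 0 then 1 else (exp r - 1) / r)" for r :: real
  define S where "S r = (if r = 0 then 1 else sin r / r)" for r :: real
  define C where "C r = (if r = 0 then 1 / 2 else (1 - cos r) / r\<^sup>2)" for r :: real
  have "(E \<longlongrightarrow> 1) (at 0)" "(S \<longlongrightarrow> 1) (at 0)" "(C \<longlongrightarrow> 1 / 2) (at 0)"
  proof -
    have "((\<lambda>r::real. (exp r - 1) / r) \<longlongrightarrow> 1) (at 0)" "((\<lambda>r::real. sin r / r) \<longlongrightarrow> 1) (at 0)"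
      "((\<lambda>r::real. (1 - cos r) / r\<^sup>2) \<longlongrightarrow> 1 / 2) (at 0)" by real_asymp+
    moreover have "\<forall>\<^sub>F r in at 0. (exp r - 1) / r = E r" "\<forall>\<^sub>F r in at 0. sin r / r = S r"
      "\<forall>\<^sub>F r in at 0. (1 - cos r) / r\<^sup>2 = C r"
      by (auto simp: eventually_at_filter E_def S_def C_def)
    ultimately show "(E \<longlongrightarrow> 1) (at 0)" "(S \<longlongrightarrow> 1) (at 0)" "(C \<longlongrightarrow> 1 / 2) (at 0)"
      by (blast intro: Lim_transform_eventually)+
  qed
  then have cont: "isCont E 0" "isCont S 0" "isCont C 0" by (auto simp: isCont_def E_def S_def C_def)
  have E: "((\<lambda>u. E (Re (\<psi> u))) \<longlongrightarrow> 1) (at 0)"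
    and S: "((\<lambda>u. S (Im (\<psi> u))) \<longlongrightarrow> 1) (at 0)"
    and C: "((\<lambda>u. C (Im (\<psi> u))) \<longlongrightarrow> 1 / 2) (at 0)"
    using isCont_tendsto_compose[OF cont(1) R0] isCont_tendsto_compose[OF cont(2) I0]
      isCont_tendsto_compose[OF cont(3) I0] by (auto simp: E_def S_def C_def)
  have "((\<lambda>u. 2 * (- E (Re (\<psi> u)) * (Re (\<psi> u) / u\<^sup>2) + exp (Re (\<psi> u)) * (C (Im (\<psi> u)) * (Im (\<psi> u) / u)\<^sup>2))) \<longlongrightarrow>
     2 * (- 1 * (- v / 2) + exp 0 * (1 / 2 * m\<^sup>2))) (at 0)"
    by (intro tendsto_intros E R R0 C I)
  moreover have "2 * (- E (Re (\<psi> u)) * (Re (\<psi> u) / u\<^sup>2) + exp (Re (\<psi> u)) * (C (Im (\<psi> u)) * (Im (\<psi> u) / u)\<^sup>2))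
     = 2 * (1 - Re (exp (\<psi> u))) / u\<^sup>2" for u
  proof -
    have 1: "E r * r = exp r - 1" for r by (simp add: E_def)
    have 2: "C r * r\<^sup>2 = 1 - cos r" for r by (simp add: C_def)
    have "2 * (- E (Re (\<psi> u)) * (Re (\<psi> u) / u\<^sup>2) + exp (Re (\<psi> u)) * (C (Im (\<psi> u)) * (Im (\<psi> u) / u)\<^sup>2))
      = 2 * (- (E (Re (\<psi> u)) * Re (\<psi> u)) + exp (Re (\<psi> u)) * (C (Im (\<psi> u)) * (Im (\<psi> u))\<^sup>2)) / u\<^sup>2"
      by (simp add: power_divide add_divide_distrib diff_divide_distrib algebra_simps)
    also have "\<dots> = 2 * (- (exp (Re (\<psi> u)) - 1) + exp (Re (\<psi> u)) * (1 - cos (Im (\<psi> u)))) / u\<^sup>2"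
      by (simp only: 1 2)
    finally show ?thesis by (simp add: Re_exp algebra_simps)
  qed
  ultimately show "((\<lambda>u. 2 * (1 - Re (exp (\<psi> u))) / u\<^sup>2) \<longlongrightarrow> v + m\<^sup>2) (at 0)" by simp
  have "((\<lambda>u. exp (Re (\<psi> u)) * (S (Im (\<psi> u)) * (Im (\<psi> u) / u))) \<longlongrightarrow> exp 0 * (1 * m)) (at 0)"
    by (intro tendsto_intros R0 S I)
  moreover have "exp (Re (\<psi> u)) * (S (Im (\<psi> u)) * (Im (\<psi> u) / u)) = Im (exp (\<psi> u)) / u" for u
  proof -
    have 1: "S r * r = sin r" for r by (simp add: S_def)
    have "exp (Re (\<psi> u)) * (S (Im (\<psi> u)) * (Im (\<psi> u) / u)) = exp (Re (\<psi> u)) * (S (Im (\<psi> u)) * Im (\<psi> u)) / u"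
      by simp
    then show ?thesis by (simp only: 1 Im_exp)
  qed
  ultimately show "((\<lambda>u. Im (exp (\<psi> u)) / u) \<longlongrightarrow> m) (at 0)" by (simp only: exp_zero mult_1_left)
qed

section \<open>Subordinators with square integrable jumps\<close>

locale subordinator_triplet =
  fixes \<gamma> :: real and \<nu> :: "real measure"
  assumes triplet: "levy_triplet \<gamma> 0 \<nu>"
    and small_jumps: "set_integrable \<nu> {-1..1} (\<lambda>x. \<bar>x\<bar>)"
    and no_negative_jumps: "emeasure \<nu> {..<0} = 0"
    and large_jumps: "set_integrable \<nu> {1<..} (\<lambda>x. x^2)"
begin

text \<open>The drift that remains once the small jumps are no longer compensated. The sign
  condition of the model says that it is nonnegative.\<close>

definition drift :: real where "drift = \<gamma> - (LINT x:{-1..1}|\<nu>. x)"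

definition mean :: real where "mean = drift + (\<integral>x. x \<partial>\<nu>)"

definition var :: real where "var = (\<integral>x. x\<^sup>2 \<partial>\<nu>)"

lemma sets_nu [measurable_cong]: "sets \<nu> = sets borel"
  using triplet by (simp add: levy_triplet_def)

lemma AE_pos: "AE x in \<nu>. 0 < x"
proof -
  have "AE x in \<nu>. x \<notin> {..<0}" "AE x in \<nu>. x \<notin> {0}"
    using no_negative_jumps triplet by (intro AE_not_in null_setsI; simp add: levy_triplet_def sets_nu)+
  then show ?thesis by eventually_elim auto
qed

lemma integrable_min: "integrable \<nu> (\<lambda>x. min 1 (x\<^sup>2))"
  using triplet by (intro integrableI_nonneg) (auto simp: levy_triplet_def)

lemma integrable_square: "integrable \<nu> (\<lambda>x. x\<^sup>2)"
proof (rule Bochner_Integration.integrable_bound)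
  show "integrable \<nu> (\<lambda>x. min 1 (x\<^sup>2) + indicator {1<..} x *\<^sub>R x\<^sup>2)"
    using integrable_min large_jumps by (auto simp: set_integrable_def)
  show "AE x in \<nu>. norm (x\<^sup>2) \<le> norm (min 1 (x\<^sup>2) + indicator {1<..} x *\<^sub>R x\<^sup>2)"
    using AE_pos
  proof eventually_elim
    case (elim x)
    then show ?case by (cases "x \<le> 1") (auto simp: power_le_one)
  qed
qed simp

lemma integrable_id: "integrable \<nu> (\<lambda>x. x)"
proof (rule Bochner_Integration.integrable_bound)
  show "integrable \<nu> (\<lambda>x. indicator {-1..1} x *\<^sub>R \<bar>x\<bar> + indicator {1<..} x *\<^sub>R x\<^sup>2)"
    using small_jumps large_jumps by (auto simp: set_integrable_def)
  show "AE x in \<nu>. norm x \<le> norm (indicator {-1..1} x *\<^sub>R \<bar>x\<bar> + indicator {1<..} x *\<^sub>R x\<^sup>2)"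
    using AE_pos
  proof eventually_elim
    case (elim x)
    then show ?case by (cases "x \<le> 1") (auto simp: power2_eq_square)
  qed
qed simp

lemma var_nonneg: "0 \<le> var"
  unfolding var_def by (intro integral_nonneg_AE) auto

lemma norm_iexp_diff_le: "cmod (iexp x - 1) \<le> \<bar>x\<bar>"
  using iexp_approx1[of x 0] by simp

lemma integrable_iexp_diff: "integrable \<nu> (\<lambda>x. iexp (u * x) - 1)"
proof (rule Bochner_Integration.integrable_bound)
  show "integrable \<nu> (\<lambda>x. u * x)" using integrable_id by simp
  show "AE x in \<nu>. norm (iexp (u * x) - 1) \<le> norm (u * x)"
    by (intro AE_I2) (simp only: real_norm_def norm_iexp_diff_le)
qed simp

text \<open>Small jumps are absolutely summable, so the compensator can be moved into the drift,
  which leaves an integrand bounded by \<open>\<bar>u * x\<bar>\<close>.\<close>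

lemma levy_exponent_eq:
  "levy_exponent \<gamma> 0 \<nu> u = \<i> * u * drift + (CLINT x|\<nu>. iexp (u * x) - 1)"
proof -
  have i: "integrable \<nu> (\<lambda>x. indicator {-1..1} x *\<^sub>R x)"
    by (rule Bochner_Integration.integrable_bound[OF integrable_id]) (auto split: split_indicator)
  then have ic: "integrable \<nu> (\<lambda>x. complex_of_real (indicator {-1..1} x *\<^sub>R x))"
    by (rule integrable_of_real)
  have "(CLINT x|\<nu>. iexp (u * x) - 1 - \<i> * u * x * indicator {-1..1} x)
    = (CLINT x|\<nu>. (iexp (u * x) - 1) - (\<i> * u) * complex_of_real (indicator {-1..1} x *\<^sub>R x))"
    by (intro Bochner_Integration.integral_cong) (auto split: split_indicator)
  also have "\<dots> = (CLINT x|\<nu>. iexp (u * x) - 1) - (CLINT x|\<nu>. (\<i> * u) * complex_of_real (indicator {-1..1} x *\<^sub>R x))"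
    by (intro Bochner_Integration.integral_diff integrable_iexp_diff integrable_mult_right ic)
  also have "(CLINT x|\<nu>. (\<i> * u) * complex_of_real (indicator {-1..1} x *\<^sub>R x)) = \<i> * u * complex_of_real (LINT x:{-1..1}|\<nu>. x)"
    unfolding set_lebesgue_integral_def by (subst integral_mult_right_zero) (simp only: integral_of_real[OF i])
  finally show ?thesis
    by (simp add: levy_exponent_def drift_def algebra_simps)
qed

lemma Re_Im_levy_exponent:
  "Re (levy_exponent \<gamma> 0 \<nu> u) = (\<integral>x. cos (u * x) - 1 \<partial>\<nu>)"
  "Im (levy_exponent \<gamma> 0 \<nu> u) = u * drift + (\<integral>x. sin (u * x) \<partial>\<nu>)"
proof -
  have "Re (CLINT x|\<nu>. iexp (u * x) - 1) = (\<integral>x. Re (iexp (u * x) - 1) \<partial>\<nu>)"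
    by (simp only: integral_Re[OF integrable_iexp_diff])
  then show "Re (levy_exponent \<gamma> 0 \<nu> u) = (\<integral>x. cos (u * x) - 1 \<partial>\<nu>)"
    by (simp add: levy_exponent_eq Re_exp)
  have "Im (CLINT x|\<nu>. iexp (u * x) - 1) = (\<integral>x. Im (iexp (u * x) - 1) \<partial>\<nu>)"
    by (simp only: integral_Im[OF integrable_iexp_diff])
  then show "Im (levy_exponent \<gamma> 0 \<nu> u) = u * drift + (\<integral>x. sin (u * x) \<partial>\<nu>)"
    by (simp add: levy_exponent_eq Im_exp)
qed

text \<open>The first two cumulants, obtained by passing to the limit under the integral;
  \<open>x\<^sup>2\<close> and \<open>\<bar>x\<bar>\<close> dominate and are integrable for
  \<nu>.\<close>

lemma levy_exponent_tendsto:
  "((\<lambda>u. Re (levy_exponent \<gamma> 0 \<nu> u) / u\<^sup>2) \<longlongrightarrow> - var / 2) (at 0)"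
  "((\<lambda>u. Im (levy_exponent \<gamma> 0 \<nu> u) / u) \<longlongrightarrow> mean) (at 0)"
proof -
  have "((\<lambda>u. \<integral>x. 2 * (1 - cos (u * x)) / u\<^sup>2 \<partial>\<nu>) \<longlongrightarrow> (\<integral>x. x\<^sup>2 \<partial>\<nu>)) (at 0)"
  proof (subst tendsto_at_iff_sequentially, intro allI impI)
    fix X :: "nat \<Rightarrow> real" assume X: "\<forall>i. X i \<in> UNIV - {0}" "X \<longlonglongrightarrow> 0"
    then have F: "filterlim X (at 0) sequentially" by (auto intro!: filterlim_atI)
    have "(\<lambda>n. \<integral>x. 2 * (1 - cos (X n * x)) / (X n)\<^sup>2 \<partial>\<nu>) \<longlonglongrightarrow> (\<integral>x. x\<^sup>2 \<partial>\<nu>)"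
    proof (rule integral_dominated_convergence[where w = "\<lambda>x. x\<^sup>2"])
      show "AE x in \<nu>. (\<lambda>n. 2 * (1 - cos (X n * x)) / (X n)\<^sup>2) \<longlonglongrightarrow> x\<^sup>2"
        by (intro AE_I2 filterlim_compose[OF cos_diff_quotient_tendsto F])
      show "AE x in \<nu>. norm (2 * (1 - cos (X n * x)) / (X n)\<^sup>2) \<le> x\<^sup>2" for n
        using cos_diff_quotient_bounds[of "X n"] by (intro AE_I2) (metis abs_of_nonneg real_norm_def)
    qed (simp_all add: integrable_square)
    then show "((\<lambda>u. \<integral>x. 2 * (1 - cos (u * x)) / u\<^sup>2 \<partial>\<nu>) \<circ> X) \<longlonglongrightarrow> (\<integral>x. x\<^sup>2 \<partial>\<nu>)"
      by (simp only: o_def)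
  qed
  then have "((\<lambda>u. - (\<integral>x. 2 * (1 - cos (u * x)) / u\<^sup>2 \<partial>\<nu>) / 2) \<longlongrightarrow> - var / 2) (at 0)"
    unfolding var_def by (intro tendsto_intros) auto
  moreover have "- (\<integral>x. 2 * (1 - cos (u * x)) / u\<^sup>2 \<partial>\<nu>) / 2 = Re (levy_exponent \<gamma> 0 \<nu> u) / u\<^sup>2" for u
  proof -
    have "(\<integral>x. 2 * (1 - cos (u * x)) / u\<^sup>2 \<partial>\<nu>) = (\<integral>x. - 2 / u\<^sup>2 * (cos (u * x) - 1) \<partial>\<nu>)"
      by (intro Bochner_Integration.integral_cong) (auto simp: diff_divide_distrib right_diff_distrib)
    also have "\<dots> = - 2 / u\<^sup>2 * (\<integral>x. cos (u * x) - 1 \<partial>\<nu>)" by (rule integral_mult_right_zero)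
    finally show ?thesis by (simp add: Re_Im_levy_exponent)
  qed
  ultimately show "((\<lambda>u. Re (levy_exponent \<gamma> 0 \<nu> u) / u\<^sup>2) \<longlongrightarrow> - var / 2) (at 0)" by simp
  have "((\<lambda>u. \<integral>x. sin (u * x) / u \<partial>\<nu>) \<longlongrightarrow> (\<integral>x. x \<partial>\<nu>)) (at 0)"
  proof (subst tendsto_at_iff_sequentially, intro allI impI)
    fix X :: "nat \<Rightarrow> real" assume X: "\<forall>i. X i \<in> UNIV - {0}" "X \<longlonglongrightarrow> 0"
    then have F: "filterlim X (at 0) sequentially" by (auto intro!: filterlim_atI)
    have "(\<lambda>n. \<integral>x. sin (X n * x) / X n \<partial>\<nu>) \<longlonglongrightarrow> (\<integral>x. x \<partial>\<nu>)"
    proof (rule integral_dominated_convergence[where w = "\<lambda>x. \<bar>x\<bar>"])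
      show "AE x in \<nu>. (\<lambda>n. sin (X n * x) / X n) \<longlonglongrightarrow> x"
        by (intro AE_I2 filterlim_compose[OF sin_diff_quotient_tendsto F])
      show "AE x in \<nu>. norm (sin (X n * x) / X n) \<le> \<bar>x\<bar>" for n
        by (intro AE_I2) (simp only: real_norm_def sin_diff_quotient_bound)
    qed (simp_all add: integrable_abs[OF integrable_id])
    then show "((\<lambda>u. \<integral>x. sin (u * x) / u \<partial>\<nu>) \<circ> X) \<longlonglongrightarrow> (\<integral>x. x \<partial>\<nu>)"
      by (simp only: o_def)
  qed
  then have "((\<lambda>u. drift + (\<integral>x. sin (u * x) / u \<partial>\<nu>)) \<longlongrightarrow> mean) (at 0)"
    unfolding mean_def by (intro tendsto_intros) auto
  moreover have "\<forall>\<^sub>F u in at 0. drift + (\<integral>x. sin (u * x) / u \<partial>\<nu>) = Im (levy_exponent \<gamma> 0 \<nu> u) / u"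
    by (auto simp: eventually_at_filter Re_Im_levy_exponent add_divide_distrib)
  ultimately show "((\<lambda>u. Im (levy_exponent \<gamma> 0 \<nu> u) / u) \<longlongrightarrow> mean) (at 0)"
    by (rule Lim_transform_eventually)
qed

text \<open>Cumulants scale linearly with \<open>p\<close>, which will be the control measure of a
  set of the basis. Square integrability is a conclusion, drawn from the characteristic function
  alone.\<close>

lemma moments_infdiv:
  fixes p :: real
  assumes P: "real_distribution P" and ch: "\<And>u. char P u = exp (levy_exponent \<gamma> 0 \<nu> u * p)"
  shows "integrable P (\<lambda>x. x\<^sup>2)" "(\<integral>x. x\<^sup>2 \<partial>P) = var * p + (mean * p)\<^sup>2" "(\<integral>x. x \<partial>P) = mean * p"
proof -
  interpret real_distribution P by fact
  have "((\<lambda>u. Re (levy_exponent \<gamma> 0 \<nu> u * p) / u\<^sup>2) \<longlongrightarrow> - (var * p) / 2) (at 0)"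
    using tendsto_mult[OF levy_exponent_tendsto(1) tendsto_const[of p]] by simp
  moreover have "((\<lambda>u. Im (levy_exponent \<gamma> 0 \<nu> u * p) / u) \<longlongrightarrow> mean * p) (at 0)"
    using tendsto_mult[OF levy_exponent_tendsto(2) tendsto_const[of p]] by simp
  ultimately have "((\<lambda>u. 2 * (1 - Re (char P u)) / u\<^sup>2) \<longlongrightarrow> var * p + (mean * p)\<^sup>2) (at 0)"
    "((\<lambda>u. Im (char P u) / u) \<longlongrightarrow> mean * p) (at 0)"
    unfolding ch by (rule exp_char_expansion)+
  from moments_from_char[OF this] show "integrable P (\<lambda>x. x\<^sup>2)"
    "(\<integral>x. x\<^sup>2 \<partial>P) = var * p + (mean * p)\<^sup>2" "(\<integral>x. x \<partial>P) = mean * p" .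
qed

text \<open>Markov's inequality. It makes the intensity of the jumps above \<epsilon> finite and
  keeps the mixing probability in \<open>nonneg_char_compound\<close> below 1.\<close>

lemma nu_tail:
  assumes "0 < \<epsilon>"
  shows "emeasure \<nu> {\<epsilon><..} \<le> ennreal ((\<integral>x. x \<partial>\<nu>) / \<epsilon>)"
proof -
  have "emeasure \<nu> {\<epsilon><..} = (\<integral>\<^sup>+x. indicator {\<epsilon><..} x \<partial>\<nu>)"
    by (simp add: nn_integral_indicator sets_nu)
  also have "\<dots> \<le> (\<integral>\<^sup>+x. ennreal (x / \<epsilon>) \<partial>\<nu>)"
    using AE_pos by (intro nn_integral_mono_AE, eventually_elim)
      (use assms in \<open>auto split: split_indicator simp: ennreal_1[symmetric] simp del: ennreal_1 intro!: ennreal_leI\<close>)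
  also have "\<dots> = ennreal (\<integral>x. x / \<epsilon> \<partial>\<nu>)"
    using AE_pos by (intro nn_integral_eq_integral integrable_divide integrable_id, eventually_elim) (use assms in auto)
  finally show ?thesis by simp
qed

end

text \<open>
  The law of a variable of the basis is a limit of laws of \<open>n\<close>-fold sums of a nonnegative variable
  that is 0 except with a probability of order \<open>1 / n\<close>. Nonnegativity is traced through this
  construction on the level of characteristic functions.
\<close>

definition nonneg_char :: "(real \<Rightarrow> complex) \<Rightarrow> bool" where
  "nonneg_char \<phi> \<longleftrightarrow> (\<exists>P. real_distribution P \<and> (AE x in P. 0 \<le> x) \<and> char P = \<phi>)"

text \<open>Realised by the sum of the two coordinates on the product space.\<close>

lemma nonneg_char_mult:
  assumes "nonneg_char \<phi>" "nonneg_char \<psi>"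
  shows "nonneg_char (\<lambda>u. \<phi> u * \<psi> u)"
proof -
  obtain P Q where P: "real_distribution P" "AE x in P. 0 \<le> x" "char P = \<phi>"
    and Q: "real_distribution Q" "AE x in Q. 0 \<le> x" "char Q = \<psi>"
    using assms by (auto simp: nonneg_char_def)
  interpret P: real_distribution P by fact
  interpret Q: real_distribution Q by fact
  interpret PQ: pair_prob_space P Q ..
  let ?R = "distr (P \<Otimes>\<^sub>M Q) borel (\<lambda>z. fst z + snd z)"
  have [measurable_cong]: "sets P = sets borel" "sets Q = sets borel" by simp_all
  have m: "(\<lambda>z. fst z + snd z) \<in> borel_measurable (P \<Otimes>\<^sub>M Q)" by simp
  have R: "real_distribution ?R" by (rule PQ.real_distribution_distr) simp
  have "AE z in P \<Otimes>\<^sub>M Q. 0 \<le> fst z + snd z"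
  proof (rule PQ.AE_pair_measure)
    show "{x \<in> space (P \<Otimes>\<^sub>M Q). 0 \<le> fst x + snd x} \<in> sets (P \<Otimes>\<^sub>M Q)" by measurable
    show "AE x in P. AE y in Q. 0 \<le> fst (x, y) + snd (x, y)"
      using P(2) by eventually_elim (use Q(2) in \<open>eventually_elim, simp\<close>)
  qed
  then have "AE x in ?R. 0 \<le> x" by (subst AE_distr_iff[OF m]) auto
  moreover have "char ?R = (\<lambda>u. \<phi> u * \<psi> u)"
  proof
    fix u
    have "char ?R u = (CLINT z|P \<Otimes>\<^sub>M Q. iexp (u * fst z) * iexp (u * snd z))"
      unfolding char_def by (subst integral_distr[OF m]) (auto simp: distrib_left exp_add)
    also have "\<dots> = (CLINT x|P. CLINT y|Q. iexp (u * x) * iexp (u * y))"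
      by (subst PQ.integral_fst'[symmetric]) (auto intro!: PQ.integrable_const_bound[where B = 1] simp: norm_mult split_beta)
    also have "\<dots> = char P u * char Q u" by (simp add: char_def)
    finally show "char ?R u = \<phi> u * \<psi> u" using P Q by simp
  qed
  ultimately show ?thesis using R unfolding nonneg_char_def by blast
qed

text \<open>A coin with success probability \<open>q\<close> decides whether an independent variable
  with characteristic function \<phi> is kept or replaced by 0.\<close>

lemma nonneg_char_mix:
  fixes q :: real
  assumes "nonneg_char \<phi>" "0 \<le> q" "q \<le> 1"
  shows "nonneg_char (\<lambda>u. (1 - complex_of_real q) + complex_of_real q * \<phi> u)"
proof -
  obtain P where P: "real_distribution P" "AE x in P. 0 \<le> x" "char P = \<phi>"
    using assms by (auto simp: nonneg_char_def)
  interpret P: real_distribution P by fact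
  define Q where "Q = measure_pmf (bernoulli_pmf q)"
  interpret Q: prob_space Q unfolding Q_def by (rule measure_pmf.prob_space_axioms)
  interpret PQ: pair_prob_space Q P ..
  have [measurable_cong]: "sets P = sets borel" "sets Q = sets (count_space UNIV)" by (simp_all add: Q_def)
  define f where "f z = (if fst z then snd z else 0)" for z :: "bool \<times> real"
  have m[measurable]: "f \<in> borel_measurable (Q \<Otimes>\<^sub>M P)" unfolding f_def by measurable
  let ?R = "distr (Q \<Otimes>\<^sub>M P) borel f"
  have R: "real_distribution ?R" by (rule PQ.real_distribution_distr) simp
  have "AE z in Q \<Otimes>\<^sub>M P. 0 \<le> f z"
  proof (rule PQ.AE_pair_measure)
    show "{x \<in> space (Q \<Otimes>\<^sub>M P). 0 \<le> f x} \<in> sets (Q \<Otimes>\<^sub>M P)" by measurable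
    show "AE x in Q. AE y in P. 0 \<le> f (x, y)"
    proof (rule AE_I2)
      fix x
      show "AE y in P. 0 \<le> f (x, y)" using P(2) by (rule eventually_mono) (simp add: f_def)
    qed
  qed
  then have "AE x in ?R. 0 \<le> x" by (subst AE_distr_iff[OF m]) auto
  moreover have "char ?R = (\<lambda>u. (1 - complex_of_real q) + complex_of_real q * \<phi> u)"
  proof
    fix u
    have "char ?R u = (CLINT z|Q \<Otimes>\<^sub>M P. iexp (u * f z))"
      unfolding char_def by (subst integral_distr[OF m]) auto
    also have "\<dots> = (CLINT b|Q. CLINT x|P. iexp (u * f (b, x)))"
      by (subst PQ.integral_fst'[symmetric]) (auto intro!: PQ.integrable_const_bound[where B = 1] simp: split_beta)
    also have "\<dots> = q *\<^sub>R (CLINT x|P. iexp (u * f (True, x))) + (1 - q) *\<^sub>R (CLINT x|P. iexp (u * f (False, x)))"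
      unfolding Q_def using assms by (subst integral_measure_pmf[where A = UNIV]) (auto simp: UNIV_bool)
    also have "\<dots> = q * char P u + (1 - q)"
      using P.prob_space by (simp add: f_def char_def scaleR_conv_of_real)
    finally show "char ?R u = (1 - complex_of_real q) + complex_of_real q * \<phi> u" using P by simp
  qed
  ultimately show ?thesis using R unfolding nonneg_char_def by blast
qed

lemma nonneg_char_shift:
  assumes "0 \<le> c"
  shows "nonneg_char (\<lambda>u. iexp (u * c))"
proof -
  have "real_distribution (return borel c)"
    by (intro real_distribution.intro prob_space_return real_distribution_axioms.intro) auto
  moreover have "AE x in return borel c. 0 \<le> x" using assms by (subst AE_return) auto
  moreover have "char (return borel c) = (\<lambda>u. iexp (u * c))"
    by (auto simp: char_def integral_return)
  ultimately show ?thesis unfolding nonneg_char_def by blast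
qed

lemma nonneg_char_power:
  assumes "nonneg_char \<phi>"
  shows "nonneg_char (\<lambda>u. \<phi> u ^ n)"
proof (induction n)
  case 0
  show ?case using nonneg_char_shift[of 0] by simp
next
  case (Suc n)
  show ?case using nonneg_char_mult[OF assms Suc] by simp
qed

text \<open>By Levy's continuity theorem the laws converge weakly. Their distribution functions
  vanish on the negative axis, which carries over to the limit at its continuity points; as atoms
  are countable, there is one between any \<open>x < 0\<close> and 0.\<close>

lemma nonneg_limit:
  assumes "\<And>n::nat. nonneg_char (\<phi> n)" "real_distribution P" "\<And>u. (\<lambda>n. \<phi> n u) \<longlonglongrightarrow> char P u"
  shows "AE x in P. 0 \<le> x"
proof -
  obtain Q where Q: "\<And>n. real_distribution (Q n)" "\<And>n. AE x in Q n. 0 \<le> x" "\<And>n. char (Q n) = \<phi> n"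
    using assms(1) unfolding nonneg_char_def by metis
  interpret P: real_distribution P by fact
  have w: "weak_conv_m Q P"
    by (rule levy_continuity) (use Q assms in auto)
  have zero: "cdf (Q n) x = 0" if "x < 0" for n x
  proof -
    interpret Qn: real_distribution "Q n" by (rule Q)
    have "AE y in Q n. y \<notin> {..x}" using Q(2)[of n] by eventually_elim (use that in auto)
    then have "measure (Q n) {..x} = 0" by (subst Qn.prob_eq_0) auto
    then show ?thesis by (simp add: cdf_def)
  qed
  have cdf0: "cdf P x = 0" if x: "x < 0" for x
  proof -
    have "\<not> {x<..<0} \<subseteq> {y. measure P {y} > 0}"
    proof
      assume "{x<..<0} \<subseteq> {y. measure P {y} > 0}"
      then have "countable {x<..<0}"
        using countable_subset[OF _ P.countable_atoms] by blast
      then show False using uncountable_open_interval x by blast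
    qed
    then obtain y where "x < y" "y < 0" "\<not> measure P {y} > 0" by (auto simp: subset_eq)
    then have y: "x < y" "y < 0" "measure P {y} = 0" using measure_nonneg[of P "{y}"] by auto
    then have "isCont (cdf P) y" by (simp add: P.isCont_cdf)
    then have "(\<lambda>n. cdf (Q n) y) \<longlonglongrightarrow> cdf P y"
      using w by (simp add: weak_conv_m_def weak_conv_def)
    then have "cdf P y = 0" using zero[OF y(2)] by (simp add: LIMSEQ_const_iff)
    moreover have "cdf P x \<le> cdf P y" using y by (intro P.cdf_nondecreasing) auto
    ultimately show ?thesis using P.cdf_nonneg[of x] by simp
  qed
  have "AE x in P. \<forall>n::nat. x \<notin> {..- 1 / real (Suc n)}"
  proof (subst AE_all_countable, intro allI)
    fix n
    have "measure P {..- 1 / real (Suc n)} = 0" using cdf0[of "- 1 / real (Suc n)"] by (simp add: cdf_def)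
    then show "AE x in P. x \<notin> {..- 1 / real (Suc n)}" by (subst (asm) P.prob_eq_0) auto
  qed
  then show ?thesis
  proof eventually_elim
    case (elim x)
    show ?case
    proof (rule ccontr)
      assume "\<not> 0 \<le> x"
      then obtain n where "inverse (real (Suc n)) < - x" using reals_Archimedean[of "- x"] by auto
      then show False using elim by (auto simp: inverse_eq_divide dest!: spec[of _ n])
    qed
  qed
qed

text \<open>With \<open>E\<close> the continuous extension of \<open>Ln (1 + z) / z\<close>, the
  power equals \<open>exp (w n * E (w n / n))\<close> as soon as \<open>w n / n\<close> lies in the
  unit disc, where the principal logarithm causes no trouble.\<close>

lemma complex_exp_limit:
  fixes w :: "nat \<Rightarrow> complex"
  assumes "w \<longlonglongrightarrow> z"
  shows "(\<lambda>n. (1 + w n / of_nat n) ^ n) \<longlonglongrightarrow> exp z"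
proof -
  define E where "E z = (if z = 0 then 1 else Ln (1 + z) / z)" for z :: complex
  have "((\<lambda>z. Ln (1 + z)) has_field_derivative 1) (at 0)"
    by (auto intro!: derivative_eq_intros simp: complex_nonpos_Reals_iff)
  then have "((\<lambda>z. Ln (1 + z) / z) \<longlongrightarrow> 1) (at 0)"
    by (simp add: has_field_derivative_iff)
  then have "(E \<longlongrightarrow> 1) (at 0)"
    by (rule Lim_transform_eventually) (auto simp: eventually_at_filter E_def)
  then have E: "isCont E 0" by (simp add: isCont_def E_def)
  have w0: "(\<lambda>n. w n / of_nat n) \<longlonglongrightarrow> 0"
    using tendsto_mult[OF assms lim_inverse_n] by (simp add: field_simps)
  have "(\<lambda>n. exp (w n * E (w n / of_nat n))) \<longlonglongrightarrow> exp (z * E 0)"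
    by (intro tendsto_intros assms isCont_tendsto_compose[OF E w0])
  moreover have "\<forall>\<^sub>F n in sequentially. exp (w n * E (w n / of_nat n)) = (1 + w n / of_nat n) ^ n"
  proof -
    have "\<forall>\<^sub>F n in sequentially. norm (w n / of_nat n) < 1"
      using order_tendstoD(2)[OF tendsto_norm[OF w0], of 1] by simp
    then show ?thesis using eventually_gt_at_top[of 0]
    proof eventually_elim
      case (elim n)
      have ne: "1 + w n / of_nat n \<noteq> 0"
      proof
        assume "1 + w n / of_nat n = 0"
        then have "w n / of_nat n = - 1" by (simp add: eq_neg_iff_add_eq_0 add.commute)
        then show False using elim by simp
      qed
      have "w n * E (w n / of_nat n) = of_nat n * Ln (1 + w n / of_nat n)"
        using elim by (auto simp: E_def)
      then show ?case using ne by (simp add: exp_of_nat_mult)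
    qed
  qed
  ultimately show ?thesis by (simp add: E_def tendsto_cong)
qed

context subordinator_triplet
begin

text \<open>The variable behind this function is, with probability \<open>q * lam\<close>, a jump
  drawn from the normalised restriction of \<nu> to \<open>{\<epsilon><..}\<close>, and 0 otherwise.
  The second condition on \<open>q\<close> ensures \<open>q * lam \<le> 1\<close> by way of
  \<open>nu_tail\<close>.\<close>

lemma nonneg_char_compound:
  assumes \<epsilon>: "0 < \<epsilon>" and q: "0 \<le> q" "q * (\<integral>x. x \<partial>\<nu>) \<le> \<epsilon>"
  shows "nonneg_char (\<lambda>u. 1 + q * (CLINT x|\<nu>. indicator {\<epsilon><..} x *\<^sub>R (iexp (u * x) - 1)))"
proof -
  define lam where "lam = measure \<nu> {\<epsilon><..}"
  have fin: "emeasure \<nu> {\<epsilon><..} < \<infinity>"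
    using nu_tail[OF \<epsilon>] by (simp add: order_le_less_trans)
  have em: "emeasure \<nu> {\<epsilon><..} = ennreal lam"
    using fin unfolding lam_def by (intro emeasure_eq_ennreal_measure) auto
  have "0 \<le> (\<integral>x. x \<partial>\<nu>)" using AE_pos by (intro integral_nonneg_AE) (auto elim: eventually_mono)
  then have lam_le: "lam \<le> (\<integral>x. x \<partial>\<nu>) / \<epsilon>"
    using nu_tail[OF \<epsilon>] \<epsilon> unfolding em by (simp add: ennreal_le_iff)
  have [measurable]: "{\<epsilon><..} \<in> sets \<nu>" by (simp add: sets_nu)
  have split: "(CLINT x|\<nu>. indicator {\<epsilon><..} x *\<^sub>R (iexp (u * x) - 1))
     = (CLINT x|\<nu>. indicator {\<epsilon><..} x *\<^sub>R iexp (u * x)) - lam" for u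
  proof -
    have 1: "integrable \<nu> (\<lambda>x. indicator {\<epsilon><..} x *\<^sub>R iexp (u * x))"
      by (rule Bochner_Integration.integrable_bound[where f = "indicator {\<epsilon><..} :: real \<Rightarrow> real"])
        (use fin in \<open>auto split: split_indicator\<close>)
    have 2: "integrable \<nu> (\<lambda>x. indicator {\<epsilon><..} x *\<^sub>R (1::complex))"
      using fin by (intro integrable_scaleR_left) auto
    have "(CLINT x|\<nu>. indicator {\<epsilon><..} x *\<^sub>R (1::complex)) = lam"
      using fin by (subst integral_scaleR_left) (auto simp: lam_def scaleR_conv_of_real)
    then show ?thesis
      unfolding scaleR_diff_right by (subst Bochner_Integration.integral_diff[OF 1 2]) simp
  qed
  show ?thesis
  proof (cases "lam = 0")
    case True
    then have "emeasure \<nu> {\<epsilon><..} = 0" using em by simp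
    then have "AE x in \<nu>. x \<notin> {\<epsilon><..}" by (intro AE_not_in null_setsI) auto
    then have "(CLINT x|\<nu>. indicator {\<epsilon><..} x *\<^sub>R (iexp (u * x) - 1)) = 0" for u
      by (intro integral_eq_zero_AE) (auto elim!: eventually_mono)
    then show ?thesis using nonneg_char_shift[of 0] by simp
  next
    case False
    then have lam: "lam > 0" unfolding lam_def by (simp add: less_le)
    define P where "P = density \<nu> (\<lambda>x. ennreal (indicator {\<epsilon><..} x / lam))"
    have "emeasure P (space P) = (\<integral>\<^sup>+x. ennreal (1 / lam) * indicator {\<epsilon><..} x \<partial>\<nu>)"
      unfolding P_def by (subst emeasure_density) (auto intro!: nn_integral_cong split: split_indicator)
    also have "\<dots> = 1" using lam by (subst nn_integral_cmult_indicator) (auto simp: em ennreal_mult[symmetric])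
    finally have "prob_space P" by (rule prob_spaceI)
    then have P: "real_distribution P"
      by (intro real_distribution.intro real_distribution_axioms.intro) (auto simp: P_def sets_nu)
    have nn: "AE x in P. 0 \<le> x"
      unfolding P_def using AE_pos by (subst AE_density) (auto elim: eventually_mono)
    have ch: "char P u = (CLINT x|\<nu>. indicator {\<epsilon><..} x *\<^sub>R iexp (u * x)) / lam" for u
    proof -
      have "char P u = (CLINT x|\<nu>. (indicator {\<epsilon><..} x / lam) *\<^sub>R iexp (u * x))"
        unfolding char_def P_def using lam by (subst integral_density) auto
      also have "\<dots> = (CLINT x|\<nu>. (indicator {\<epsilon><..} x *\<^sub>R iexp (u * x)) / lam)"
        by (intro Bochner_Integration.integral_cong) (auto split: split_indicator simp: scaleR_conv_of_real)
      finally show ?thesis by simp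
    qed
    have "q * lam \<le> q * ((\<integral>x. x \<partial>\<nu>) / \<epsilon>)" using lam_le q by (intro mult_left_mono)
    also have "\<dots> \<le> 1" using q \<epsilon> by (simp add: divide_le_eq)
    finally have "nonneg_char (\<lambda>u. (1 - q * lam) + (q * lam) * char P u)"
      using nonneg_char_mix[of "char P" "q * lam"] P nn lam q by (auto simp: nonneg_char_def)
    then show ?thesis unfolding ch split using lam by (simp add: algebra_simps)
  qed
qed

lemma infdiv_nonneg:
  fixes p :: real
  assumes P: "real_distribution P" and ch: "\<And>u. char P u = exp (levy_exponent \<gamma> 0 \<nu> u * p)"
    and p: "0 \<le> p" and d: "0 \<le> drift"
  shows "AE x in P. 0 \<le> x"
proof -
  define C where "C = (\<integral>x. x \<partial>\<nu>)"
  have C: "0 \<le> C" unfolding C_def using AE_pos by (intro integral_nonneg_AE) (auto elim: eventually_mono)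
  \<comment> \<open>This threshold makes \<open>p / n\<close> times the first moment of \<nu> at
    most \<open>\<epsilon> n\<close>, as \<open>nonneg_char_compound\<close> demands; the summand 1
    keeps it positive when \<open>p * C = 0\<close>.\<close>
  define \<epsilon> where "\<epsilon> n = (p * C + 1) / real n" for n
  define z where "z n u = (CLINT x|\<nu>. indicator {\<epsilon> n<..} x *\<^sub>R (iexp (u * x) - 1))" for n u
  define \<phi> where "\<phi> n u = iexp (u * (drift * p)) * (1 + (p * z (Suc n) u) / of_nat (Suc n)) ^ Suc n" for n u
  have pC: "0 \<le> p * C" using p C by simp
  have nn: "nonneg_char (\<phi> n)" for n
  proof -
    have "nonneg_char (\<lambda>u. 1 + complex_of_real (p / real (Suc n)) * z (Suc n) u)"
      unfolding z_def
    proof (rule nonneg_char_compound)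
      show "0 < \<epsilon> (Suc n)" using pC by (simp add: \<epsilon>_def add_nonneg_pos)
      show "p / real (Suc n) * (\<integral>x. x \<partial>\<nu>) \<le> \<epsilon> (Suc n)"
        using pC by (simp add: \<epsilon>_def C_def divide_right_mono)
    qed (use p in simp)
    then have "nonneg_char (\<lambda>u. (1 + (p * z (Suc n) u) / of_nat (Suc n)) ^ Suc n)"
      by (intro nonneg_char_power) simp
    moreover have "nonneg_char (\<lambda>u. iexp (u * (drift * p)))"
      using p d by (intro nonneg_char_shift) simp
    ultimately show ?thesis unfolding \<phi>_def by (rule nonneg_char_mult[rotated])
  qed
  have lim: "(\<lambda>n. \<phi> n u) \<longlonglongrightarrow> char P u" for u
  proof -
    have "(\<lambda>n. z n u) \<longlonglongrightarrow> (CLINT x|\<nu>. iexp (u * x) - 1)"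
      unfolding z_def
    proof (rule integral_dominated_convergence[where w = "\<lambda>x. \<bar>u * x\<bar>"])
      show "integrable \<nu> (\<lambda>x. \<bar>u * x\<bar>)" by (intro integrable_abs integrable_mult_right integrable_id)
      show "AE x in \<nu>. (\<lambda>n. indicator {\<epsilon> n<..} x *\<^sub>R (iexp (u * x) - 1)) \<longlonglongrightarrow> iexp (u * x) - 1"
        using AE_pos
      proof eventually_elim
        case (elim x)
        have "\<epsilon> \<longlonglongrightarrow> 0" unfolding \<epsilon>_def by (rule lim_const_over_n)
        then have "\<forall>\<^sub>F n in sequentially. \<epsilon> n < x" using elim by (rule order_tendstoD)
        then have "\<forall>\<^sub>F n in sequentially. iexp (u * x) - 1 = indicator {\<epsilon> n<..} x *\<^sub>R (iexp (u * x) - 1)"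
          by eventually_elim simp
        then show ?case by (rule Lim_transform_eventually[OF tendsto_const])
      qed
      show "AE x in \<nu>. norm (indicator {\<epsilon> n<..} x *\<^sub>R (iexp (u * x) - 1)) \<le> \<bar>u * x\<bar>" for n
      proof (rule AE_I2)
        fix x
        show "norm (indicator {\<epsilon> n<..} x *\<^sub>R (iexp (u * x) - 1)) \<le> \<bar>u * x\<bar>"
          using norm_iexp_diff_le[of "u * x"] by (simp only: norm_scaleR split: split_indicator) simp
      qed
    qed simp_all
    then have "(\<lambda>n. p * z n u) \<longlonglongrightarrow> p * (CLINT x|\<nu>. iexp (u * x) - 1)" by (intro tendsto_intros)
    from complex_exp_limit[OF this]
    have "(\<lambda>n. (1 + p * z (Suc n) u / of_nat (Suc n)) ^ Suc n) \<longlonglongrightarrow> exp (p * (CLINT x|\<nu>. iexp (u * x) - 1))"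
      by (rule LIMSEQ_Suc)
    then have "(\<lambda>n. \<phi> n u) \<longlonglongrightarrow> iexp (u * (drift * p)) * exp (p * (CLINT x|\<nu>. iexp (u * x) - 1))"
      unfolding \<phi>_def by (intro tendsto_intros)
    moreover have "iexp (u * (drift * p)) * exp (p * (CLINT x|\<nu>. iexp (u * x) - 1)) = char P u"
      by (simp add: ch levy_exponent_eq exp_add[symmetric] algebra_simps)
    ultimately show ?thesis by simp
  qed
  show ?thesis by (rule nonneg_limit[OF nn P lim])
qed

end

section \<open>Convergence in probability and in mean square\<close>

lemma mult_le_squares: "\<bar>a * b\<bar> \<le> a\<^sup>2 + (b::real)\<^sup>2"
proof -
  have "0 \<le> (\<bar>a\<bar> - \<bar>b\<bar>)\<^sup>2" "0 \<le> a\<^sup>2" "0 \<le> b\<^sup>2" by simp_all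
  moreover have "0 \<le> \<bar>a\<bar> * \<bar>b\<bar>" by simp
  ultimately show ?thesis unfolding abs_mult power2_diff power2_abs by linarith
qed

lemma square_add_le: "(a + b)\<^sup>2 \<le> 2 * a\<^sup>2 + 2 * (b::real)\<^sup>2"
proof -
  have "0 \<le> (a - b)\<^sup>2" by simp
  then show ?thesis by (simp add: power2_diff power2_sum)
qed

lemma square_diff_le: "(a - b)\<^sup>2 \<le> 2 * a\<^sup>2 + 2 * (b::real)\<^sup>2"
  using square_add_le[of a "- b"] by simp

lemma integrable_mult_L2:
  fixes X Y :: "'a \<Rightarrow> real"
  assumes [measurable]: "X \<in> borel_measurable M" "Y \<in> borel_measurable M"
    and "integrable M (\<lambda>\<omega>. (X \<omega>)\<^sup>2)" "integrable M (\<lambda>\<omega>. (Y \<omega>)\<^sup>2)"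
  shows "integrable M (\<lambda>\<omega>. X \<omega> * Y \<omega>)"
proof (rule Bochner_Integration.integrable_bound)
  show "integrable M (\<lambda>\<omega>. (X \<omega>)\<^sup>2 + (Y \<omega>)\<^sup>2)" using assms by auto
  show "AE \<omega> in M. norm (X \<omega> * Y \<omega>) \<le> norm ((X \<omega>)\<^sup>2 + (Y \<omega>)\<^sup>2)"
    using mult_le_squares by (intro AE_I2) (auto intro: order_trans[OF _ abs_ge_self])
qed simp

lemma integrable_add_L2:
  fixes X Y :: "'a \<Rightarrow> real"
  assumes [measurable]: "X \<in> borel_measurable M" "Y \<in> borel_measurable M"
    and "integrable M (\<lambda>\<omega>. (X \<omega>)\<^sup>2)" "integrable M (\<lambda>\<omega>. (Y \<omega>)\<^sup>2)"
  shows "integrable M (\<lambda>\<omega>. (X \<omega> + Y \<omega>)\<^sup>2)" "integrable M (\<lambda>\<omega>. (X \<omega> - Y \<omega>)\<^sup>2)"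
  using assms integrable_mult_L2[OF assms] by (auto simp: power2_sum power2_diff mult.assoc)

text \<open>The integral of \<open>(a * Y \<omega> - c * X \<omega>)\<^sup>2\<close> is
  \<open>a * (a * b - c\<^sup>2)\<close>, which settles the case
  \<open>a \<noteq> 0\<close>.\<close>

lemma Cauchy_Schwarz_integral:
  fixes X Y :: "'a \<Rightarrow> real"
  assumes [measurable]: "X \<in> borel_measurable M" "Y \<in> borel_measurable M"
    and X: "integrable M (\<lambda>\<omega>. (X \<omega>)\<^sup>2)" and Y: "integrable M (\<lambda>\<omega>. (Y \<omega>)\<^sup>2)"
  shows "\<bar>\<integral>\<omega>. X \<omega> * Y \<omega> \<partial>M\<bar> \<le> sqrt (\<integral>\<omega>. (X \<omega>)\<^sup>2 \<partial>M) * sqrt (\<integral>\<omega>. (Y \<omega>)\<^sup>2 \<partial>M)"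
proof -
  define a b c where "a = (\<integral>\<omega>. (X \<omega>)\<^sup>2 \<partial>M)" and "b = (\<integral>\<omega>. (Y \<omega>)\<^sup>2 \<partial>M)" and "c = (\<integral>\<omega>. X \<omega> * Y \<omega> \<partial>M)"
  have XY: "integrable M (\<lambda>\<omega>. X \<omega> * Y \<omega>)" using integrable_mult_L2 assms by blast
  have a0: "0 \<le> a" "0 \<le> b" by (auto simp: a_def b_def)
  have "c\<^sup>2 \<le> a * b"
  proof (cases "a = 0")
    case True
    then have "AE \<omega> in M. (X \<omega>)\<^sup>2 = 0"
      unfolding a_def using integral_nonneg_eq_0_iff_AE[OF X] by simp
    then have "c = 0" unfolding c_def by (intro integral_eq_zero_AE) (auto elim: eventually_mono)
    then show ?thesis using a0 by simp
  next
    case False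
    have "0 \<le> (\<integral>\<omega>. (a * Y \<omega> - c * X \<omega>)\<^sup>2 \<partial>M)" by simp
    also have "(\<lambda>\<omega>. (a * Y \<omega> - c * X \<omega>)\<^sup>2) = (\<lambda>\<omega>. a\<^sup>2 * (Y \<omega>)\<^sup>2 + c\<^sup>2 * (X \<omega>)\<^sup>2 - 2 * a * c * (X \<omega> * Y \<omega>))"
      by (intro ext) (simp add: power2_diff power_mult_distrib)
    also have "(\<integral>\<omega>. a\<^sup>2 * (Y \<omega>)\<^sup>2 + c\<^sup>2 * (X \<omega>)\<^sup>2 - 2 * a * c * (X \<omega> * Y \<omega>) \<partial>M) = a\<^sup>2 * b + c\<^sup>2 * a - 2 * a * c * c"
      using X Y XY by (simp add: a_def b_def c_def)
    also have "\<dots> = a * (a * b - c\<^sup>2)" by (simp add: power2_eq_square algebra_simps)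
    finally show ?thesis using False a0 by (simp add: zero_le_mult_iff)
  qed
  then have "sqrt (c\<^sup>2) \<le> sqrt (a * b)" by (rule real_sqrt_le_mono)
  then show ?thesis by (simp add: real_sqrt_mult a_def b_def c_def)
qed

text \<open>The distance of \<open>X\<close> to 0 in a metric for convergence in probability. It
  replaces statements about deviation probabilities by limits of real numbers and satisfies the
  triangle inequality.\<close>

definition ky_fan :: "'a measure \<Rightarrow> ('a \<Rightarrow> real) \<Rightarrow> real" where
  "ky_fan M X = (\<integral>\<omega>. min 1 \<bar>X \<omega>\<bar> \<partial>M)"

context prob_space
begin

lemma integrable_min_abs [simp]:
  fixes X :: "'a \<Rightarrow> real"
  shows "X \<in> borel_measurable M \<Longrightarrow> integrable M (\<lambda>\<omega>. min 1 \<bar>X \<omega>\<bar>)"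
  by (rule integrable_const_bound[where B = 1]) auto

lemma ky_fan_nonneg [simp]: "0 \<le> ky_fan M X"
  by (simp add: ky_fan_def)

lemma ky_fan_cong_AE:
  assumes [measurable]: "X \<in> borel_measurable M" "Y \<in> borel_measurable M" and "AE \<omega> in M. X \<omega> = Y \<omega>"
  shows "ky_fan M X = ky_fan M Y"
  unfolding ky_fan_def using assms(3) by (intro integral_cong_AE) (auto elim: eventually_mono)

lemma ky_fan_add:
  assumes [measurable]: "X \<in> borel_measurable M" "Y \<in> borel_measurable M"
  shows "ky_fan M (\<lambda>\<omega>. X \<omega> + Y \<omega>) \<le> ky_fan M X + ky_fan M Y"
  unfolding ky_fan_def
  by (subst Bochner_Integration.integral_add[symmetric], simp, simp, rule integral_mono) auto

lemma ky_fan_diff: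
  assumes [measurable]: "X \<in> borel_measurable M" "Y \<in> borel_measurable M"
  shows "ky_fan M (\<lambda>\<omega>. X \<omega> - Y \<omega>) \<le> ky_fan M X + ky_fan M Y"
  unfolding ky_fan_def
  by (subst Bochner_Integration.integral_add[symmetric], simp, simp, rule integral_mono) auto

lemma ky_fan_commute: "ky_fan M (\<lambda>\<omega>. X \<omega> - Y \<omega>) = ky_fan M (\<lambda>\<omega>. Y \<omega> - X \<omega>)"
  unfolding ky_fan_def by (simp add: abs_minus_commute)

lemma ky_fan_triangle:
  assumes [measurable]: "X \<in> borel_measurable M" "Y \<in> borel_measurable M" "Z \<in> borel_measurable M"
  shows "ky_fan M (\<lambda>\<omega>. X \<omega> - Z \<omega>) \<le> ky_fan M (\<lambda>\<omega>. X \<omega> - Y \<omega>) + ky_fan M (\<lambda>\<omega>. Y \<omega> - Z \<omega>)"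
  using ky_fan_add[of "\<lambda>\<omega>. X \<omega> - Y \<omega>" "\<lambda>\<omega>. Y \<omega> - Z \<omega>"] by simp

lemma ky_fan_le_L2:
  assumes [measurable]: "X \<in> borel_measurable M" and "integrable M (\<lambda>\<omega>. (X \<omega>)\<^sup>2)"
  shows "ky_fan M X \<le> sqrt (expectation (\<lambda>\<omega>. (X \<omega>)\<^sup>2))"
proof -
  have 1: "integrable M (\<lambda>\<omega>. (min 1 \<bar>X \<omega>\<bar>)\<^sup>2)"
    by (rule integrable_const_bound[where B = 1]) (auto simp: power_le_one)
  have "ky_fan M X \<le> sqrt (expectation (\<lambda>\<omega>. (min 1 \<bar>X \<omega>\<bar>)\<^sup>2)) * sqrt (expectation (\<lambda>\<omega>. 1\<^sup>2))"
    using Cauchy_Schwarz_integral[of "\<lambda>\<omega>. min 1 \<bar>X \<omega>\<bar>" M "\<lambda>_. 1"] 1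
    by (simp add: ky_fan_def)
  also have "\<dots> = sqrt (expectation (\<lambda>\<omega>. (min 1 \<bar>X \<omega>\<bar>)\<^sup>2))" by (simp add: prob_space)
  also have "\<dots> \<le> sqrt (expectation (\<lambda>\<omega>. (X \<omega>)\<^sup>2))"
    by (intro real_sqrt_le_mono integral_mono 1 assms)
      (simp add: min_def abs_le_square_iff[symmetric])
  finally show ?thesis .
qed

lemma conv_in_prob_ky_fan:
  assumes "conv_in_prob M X Z"
  shows "(\<lambda>n. ky_fan M (\<lambda>\<omega>. X n \<omega> - Z \<omega>)) \<longlonglongrightarrow> 0"
proof (rule LIMSEQ_I)
  have [measurable]: "X n \<in> borel_measurable M" "Z \<in> borel_measurable M" for n
    using assms by (auto simp: conv_in_prob_def)
  fix r :: real assume r: "0 < r"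
  have "(\<lambda>n. measure M {\<omega> \<in> space M. r / 2 \<le> \<bar>X n \<omega> - Z \<omega>\<bar>}) \<longlonglongrightarrow> 0"
    using assms half_gt_zero[OF r] unfolding conv_in_prob_def by blast
  from LIMSEQ_D[OF this half_gt_zero[OF r]]
  obtain N where N: "\<And>n. n \<ge> N \<Longrightarrow> norm (measure M {\<omega> \<in> space M. r / 2 \<le> \<bar>X n \<omega> - Z \<omega>\<bar>} - 0) < r / 2"
    by blast
  have "ky_fan M (\<lambda>\<omega>. X n \<omega> - Z \<omega>) < r" if "n \<ge> N" for n
  proof -
    let ?A = "{\<omega> \<in> space M. r / 2 \<le> \<bar>X n \<omega> - Z \<omega>\<bar>}"
    have "ky_fan M (\<lambda>\<omega>. X n \<omega> - Z \<omega>) \<le> expectation (\<lambda>\<omega>. r / 2 + indicator ?A \<omega>)"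
      unfolding ky_fan_def
    proof (rule integral_mono)
      show "integrable M (\<lambda>\<omega>. r / 2 + indicator ?A \<omega>)"
        by (intro Bochner_Integration.integrable_add integrable_const integrable_real_indicator)
          (auto simp: less_top[symmetric])
      show "min 1 \<bar>X n \<omega> - Z \<omega>\<bar> \<le> r / 2 + indicator ?A \<omega>" if "\<omega> \<in> space M" for \<omega>
        using that r by (cases "\<omega> \<in> ?A") (simp_all add: min_def)
    qed simp
    also have "\<dots> = r / 2 + measure M ?A"
      by (subst Bochner_Integration.integral_add)
        (auto simp: less_top[symmetric] prob_space intro!: integrable_real_indicator)
    finally show ?thesis using N[OF that] by simp
  qed
  then show "\<exists>N. \<forall>n\<ge>N. norm (ky_fan M (\<lambda>\<omega>. X n \<omega> - Z \<omega>) - 0) < r" by auto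
qed

lemma AE_subseq_of_ky_fan:
  assumes [measurable]: "\<And>n. X n \<in> borel_measurable M" "Z \<in> borel_measurable M"
    and "(\<lambda>n. ky_fan M (\<lambda>\<omega>. X n \<omega> - Z \<omega>)) \<longlonglongrightarrow> 0"
  shows "\<exists>r. strict_mono r \<and> (AE \<omega> in M. (\<lambda>n. X (r n) \<omega>) \<longlonglongrightarrow> Z \<omega>)"
proof -
  have "\<exists>r. strict_mono r \<and> (AE \<omega> in M. (\<lambda>n. min 1 \<bar>X (r n) \<omega> - Z \<omega>\<bar>) \<longlonglongrightarrow> 0)"
    by (rule tendsto_L1_AE_subseq) (use assms(3) in \<open>simp_all add: ky_fan_def\<close>)
  then obtain r where r: "strict_mono r" "AE \<omega> in M. (\<lambda>n. min 1 \<bar>X (r n) \<omega> - Z \<omega>\<bar>) \<longlonglongrightarrow> 0" by blast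
  from r(2) have "AE \<omega> in M. (\<lambda>n. X (r n) \<omega>) \<longlonglongrightarrow> Z \<omega>"
  proof eventually_elim
    case (elim \<omega>)
    have "\<forall>\<^sub>F n in sequentially. min 1 \<bar>X (r n) \<omega> - Z \<omega>\<bar> < 1"
      using elim by (rule order_tendstoD) simp
    then have "\<forall>\<^sub>F n in sequentially. min 1 \<bar>X (r n) \<omega> - Z \<omega>\<bar> = \<bar>X (r n) \<omega> - Z \<omega>\<bar>"
      by eventually_elim auto
    from Lim_transform_eventually[OF elim this] have "(\<lambda>n. X (r n) \<omega> - Z \<omega>) \<longlonglongrightarrow> 0"
      by (simp add: tendsto_rabs_zero_iff)
    then show ?case by (simp add: LIM_zero_iff)
  qed
  with r(1) show ?thesis by blast
qed

text \<open>Fatou's lemma along an almost surely convergent subsequence. The bound is demanded only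
  for large \<open>n\<close>, so that a Cauchy estimate can be turned into an estimate of the
  distance to the limit.\<close>

lemma moment_limit_le:
  fixes p :: nat
  assumes [measurable]: "\<And>n. X n \<in> borel_measurable M" "Z \<in> borel_measurable M" "Y \<in> borel_measurable M"
    and lim: "(\<lambda>n. ky_fan M (\<lambda>\<omega>. X n \<omega> - Z \<omega>)) \<longlonglongrightarrow> 0"
    and int: "\<And>n. n \<ge> N \<Longrightarrow> integrable M (\<lambda>\<omega>. \<bar>Y \<omega> - X n \<omega>\<bar> ^ p)"
    and le: "\<And>n. n \<ge> N \<Longrightarrow> expectation (\<lambda>\<omega>. \<bar>Y \<omega> - X n \<omega>\<bar> ^ p) \<le> c"
  shows "integrable M (\<lambda>\<omega>. \<bar>Y \<omega> - Z \<omega>\<bar> ^ p)" "expectation (\<lambda>\<omega>. \<bar>Y \<omega> - Z \<omega>\<bar> ^ p) \<le> c"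
proof -
  obtain r where r: "strict_mono r" "AE \<omega> in M. (\<lambda>n. X (r n) \<omega>) \<longlonglongrightarrow> Z \<omega>"
    using AE_subseq_of_ky_fan[OF _ _ lim] by auto
  have c: "0 \<le> c" using le[of N] by (rule order_trans[rotated]) auto
  have "(\<integral>\<^sup>+\<omega>. ennreal (\<bar>Y \<omega> - Z \<omega>\<bar> ^ p) \<partial>M) = (\<integral>\<^sup>+\<omega>. liminf (\<lambda>n. ennreal (\<bar>Y \<omega> - X (r n) \<omega>\<bar> ^ p)) \<partial>M)"
  proof (rule nn_integral_cong_AE)
    show "AE \<omega> in M. ennreal (\<bar>Y \<omega> - Z \<omega>\<bar> ^ p) = liminf (\<lambda>n. ennreal (\<bar>Y \<omega> - X (r n) \<omega>\<bar> ^ p))"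
      using r(2)
    proof eventually_elim
      case (elim \<omega>)
      have "(\<lambda>n. ennreal (\<bar>Y \<omega> - X (r n) \<omega>\<bar> ^ p)) \<longlonglongrightarrow> ennreal (\<bar>Y \<omega> - Z \<omega>\<bar> ^ p)"
        by (intro tendsto_intros tendsto_ennrealI elim)
      then show ?case by (rule lim_imp_Liminf[symmetric, rotated]) simp
    qed
  qed
  also have "\<dots> \<le> liminf (\<lambda>n. \<integral>\<^sup>+\<omega>. ennreal (\<bar>Y \<omega> - X (r n) \<omega>\<bar> ^ p) \<partial>M)"
    by (rule nn_integral_liminf) simp
  also have "\<dots> \<le> liminf (\<lambda>n. ennreal c)"
  proof (rule Liminf_mono)
    show "\<forall>\<^sub>F n in sequentially. (\<integral>\<^sup>+\<omega>. ennreal (\<bar>Y \<omega> - X (r n) \<omega>\<bar> ^ p) \<partial>M) \<le> ennreal c"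
      using eventually_ge_at_top[of N]
    proof eventually_elim
      case (elim n)
      then have n: "N \<le> r n" using strict_mono_imp_increasing[OF r(1), of n] by simp
      show ?case using le[OF n] by (subst nn_integral_eq_integral[OF int[OF n]]) (auto intro: ennreal_leI)
    qed
  qed
  also have "\<dots> = ennreal c" by (rule lim_imp_Liminf) auto
  finally have le: "(\<integral>\<^sup>+\<omega>. ennreal (\<bar>Y \<omega> - Z \<omega>\<bar> ^ p) \<partial>M) \<le> ennreal c" .
  then show int: "integrable M (\<lambda>\<omega>. \<bar>Y \<omega> - Z \<omega>\<bar> ^ p)"
    by (intro integrableI_nonneg) (auto simp: order_le_less_trans)
  show "expectation (\<lambda>\<omega>. \<bar>Y \<omega> - Z \<omega>\<bar> ^ p) \<le> c"
    using le c by (subst (asm) nn_integral_eq_integral[OF int]) auto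
qed

text \<open>The product is split into \<open>(X n - X') * (Y n - Y')\<close>, two mixed terms and
  \<open>X' * Y'\<close>, and all but the last vanish by the Cauchy-Schwarz inequality. With a
  constant second factor this also gives convergence of means.\<close>

lemma L2_limit_product:
  fixes X Y :: "nat \<Rightarrow> 'a \<Rightarrow> real" and X' Y' :: "'a \<Rightarrow> real"
  assumes m[measurable]: "\<And>n. X n \<in> borel_measurable M" "\<And>n. Y n \<in> borel_measurable M"
      "X' \<in> borel_measurable M" "Y' \<in> borel_measurable M"
    and X': "integrable M (\<lambda>\<omega>. (X' \<omega>)\<^sup>2)" and Y': "integrable M (\<lambda>\<omega>. (Y' \<omega>)\<^sup>2)"
    and X: "\<And>n. integrable M (\<lambda>\<omega>. (X n \<omega> - X' \<omega>)\<^sup>2)" "(\<lambda>n. expectation (\<lambda>\<omega>. (X n \<omega> - X' \<omega>)\<^sup>2)) \<longlonglongrightarrow> 0"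
    and Y: "\<And>n. integrable M (\<lambda>\<omega>. (Y n \<omega> - Y' \<omega>)\<^sup>2)" "(\<lambda>n. expectation (\<lambda>\<omega>. (Y n \<omega> - Y' \<omega>)\<^sup>2)) \<longlonglongrightarrow> 0"
  shows "(\<lambda>n. expectation (\<lambda>\<omega>. X n \<omega> * Y n \<omega>)) \<longlonglongrightarrow> expectation (\<lambda>\<omega>. X' \<omega> * Y' \<omega>)"
proof -
  have i1: "integrable M (\<lambda>\<omega>. (X n \<omega> - X' \<omega>) * (Y n \<omega> - Y' \<omega>))" for n
    by (rule integrable_mult_L2) (use m X(1) Y(1) in simp_all)
  have i2: "integrable M (\<lambda>\<omega>. (X n \<omega> - X' \<omega>) * Y' \<omega>)" for n
    by (rule integrable_mult_L2) (use m X(1) Y' in simp_all)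
  have i3: "integrable M (\<lambda>\<omega>. X' \<omega> * (Y n \<omega> - Y' \<omega>))" for n
    by (rule integrable_mult_L2) (use m X' Y(1) in simp_all)
  have i4: "integrable M (\<lambda>\<omega>. X' \<omega> * Y' \<omega>)"
    by (rule integrable_mult_L2) (use m X' Y' in simp_all)
  note i = i1 i2 i3 i4
  have sX: "(\<lambda>n. sqrt (expectation (\<lambda>\<omega>. (X n \<omega> - X' \<omega>)\<^sup>2))) \<longlonglongrightarrow> 0"
    and sY: "(\<lambda>n. sqrt (expectation (\<lambda>\<omega>. (Y n \<omega> - Y' \<omega>)\<^sup>2))) \<longlonglongrightarrow> 0"
    using tendsto_real_sqrt[OF X(2)] tendsto_real_sqrt[OF Y(2)] by simp_all
  have l1: "(\<lambda>n. expectation (\<lambda>\<omega>. (X n \<omega> - X' \<omega>) * (Y n \<omega> - Y' \<omega>))) \<longlonglongrightarrow> 0"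
    by (rule Lim_null_comparison[OF _ tendsto_mult_zero[OF sX sY]])
      (intro always_eventually allI, simp only: real_norm_def, intro Cauchy_Schwarz_integral X(1) Y(1), measurable)
  have l2: "(\<lambda>n. expectation (\<lambda>\<omega>. (X n \<omega> - X' \<omega>) * Y' \<omega>)) \<longlonglongrightarrow> 0"
    by (rule Lim_null_comparison[OF _ tendsto_mult_left_zero[OF sX, of "sqrt (expectation (\<lambda>\<omega>. (Y' \<omega>)\<^sup>2))"]])
      (intro always_eventually allI, simp only: real_norm_def, intro Cauchy_Schwarz_integral X(1) Y', measurable)
  have l3: "(\<lambda>n. expectation (\<lambda>\<omega>. X' \<omega> * (Y n \<omega> - Y' \<omega>))) \<longlonglongrightarrow> 0"
    by (rule Lim_null_comparison[OF _ tendsto_mult_right_zero[OF sY, of "sqrt (expectation (\<lambda>\<omega>. (X' \<omega>)\<^sup>2))"]])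
      (intro always_eventually allI, simp only: real_norm_def, intro Cauchy_Schwarz_integral X' Y(1), measurable)
  have "(\<lambda>n. expectation (\<lambda>\<omega>. (X n \<omega> - X' \<omega>) * (Y n \<omega> - Y' \<omega>)) + expectation (\<lambda>\<omega>. (X n \<omega> - X' \<omega>) * Y' \<omega>)
     + expectation (\<lambda>\<omega>. X' \<omega> * (Y n \<omega> - Y' \<omega>)) + expectation (\<lambda>\<omega>. X' \<omega> * Y' \<omega>)) \<longlonglongrightarrow>
     0 + 0 + 0 + expectation (\<lambda>\<omega>. X' \<omega> * Y' \<omega>)"
    by (intro tendsto_intros l1 l2 l3)
  moreover have "expectation (\<lambda>\<omega>. (X n \<omega> - X' \<omega>) * (Y n \<omega> - Y' \<omega>)) + expectation (\<lambda>\<omega>. (X n \<omega> - X' \<omega>) * Y' \<omega>)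
     + expectation (\<lambda>\<omega>. X' \<omega> * (Y n \<omega> - Y' \<omega>)) + expectation (\<lambda>\<omega>. X' \<omega> * Y' \<omega>)
     = expectation (\<lambda>\<omega>. X n \<omega> * Y n \<omega>)" for n
  proof -
    have e: "(\<lambda>\<omega>. X n \<omega> * Y n \<omega>) = (\<lambda>\<omega>. (X n \<omega> - X' \<omega>) * (Y n \<omega> - Y' \<omega>) + (X n \<omega> - X' \<omega>) * Y' \<omega>
      + X' \<omega> * (Y n \<omega> - Y' \<omega>) + X' \<omega> * Y' \<omega>)" by (simp add: algebra_simps)
    show ?thesis unfolding e
      by (simp only: Bochner_Integration.integral_add i Bochner_Integration.integrable_add)
  qed
  ultimately show ?thesis by simp
qed

end

section \<open>Simple integrals with respect to a square integrable L\'evy basis\<close>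

definition levy_sum :: "((real \<times> real) set \<Rightarrow> 'w \<Rightarrow> real) \<Rightarrow> (real \<times> (real \<times> real) set) list \<Rightarrow> 'w \<Rightarrow> real" where
  "levy_sum \<Lambda> g \<omega> = (\<Sum>(c, C)\<leftarrow>g. c * \<Lambda> C \<omega>)"

text \<open>Restriction to \<open>D\<close> is moved into the list, so that an integral over
  \<open>D\<close> is again a plain sum over a list and every fact about sums applies to it.\<close>

definition restrict_simple :: "(real \<times> real) set \<Rightarrow> (real \<times> (real \<times> real) set) list \<Rightarrow> (real \<times> (real \<times> real) set) list" where
  "restrict_simple D g = map (\<lambda>(c, C). (c, D \<inter> C)) g"

definition scale_simple :: "real \<Rightarrow> (real \<times> (real \<times> real) set) list \<Rightarrow> (real \<times> (real \<times> real) set) list" where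
  "scale_simple a g = map (\<lambda>(c, C). (a * c, C)) g"

lemma levy_sum_simps [simp]:
  "levy_sum \<Lambda> [] \<omega> = 0"
  "levy_sum \<Lambda> ((c, C) # g) \<omega> = c * \<Lambda> C \<omega> + levy_sum \<Lambda> g \<omega>"
  "levy_sum \<Lambda> (g @ h) \<omega> = levy_sum \<Lambda> g \<omega> + levy_sum \<Lambda> h \<omega>"
  "levy_sum \<Lambda> (scale_simple a g) \<omega> = a * levy_sum \<Lambda> g \<omega>"
  by (simp_all add: levy_sum_def scale_simple_def o_def split_beta sum_list_const_mult[symmetric] mult.assoc)

lemma levy_simple_fun_simps [simp]:
  "levy_simple_fun [] z = 0"
  "levy_simple_fun ((c, C) # g) z = c * indicator C z + levy_simple_fun g z"
  "levy_simple_fun (g @ h) z = levy_simple_fun g z + levy_simple_fun h z"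
  "levy_simple_fun (scale_simple a g) z = a * levy_simple_fun g z"
  by (simp_all add: levy_simple_fun_def scale_simple_def o_def split_beta sum_list_const_mult[symmetric] mult.assoc)

lemma levy_simple_fun_restrict [simp]:
  "levy_simple_fun (restrict_simple D g) z = indicator D z * levy_simple_fun g z"
  by (simp add: levy_simple_fun_def restrict_simple_def o_def split_beta sum_list_const_mult[symmetric]
      indicator_inter_arith mult_ac)

lemma levy_simple_simps [simp]:
  "levy_simple []"
  "levy_simple ((c, C) # g) \<longleftrightarrow> C \<in> bounded_borel \<and> levy_simple g"
  "levy_simple (g @ h) \<longleftrightarrow> levy_simple g \<and> levy_simple h"
  by (auto simp: levy_simple_def)

lemma levy_simple_scale [simp]: "levy_simple g \<Longrightarrow> levy_simple (scale_simple a g)"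
  by (auto simp: levy_simple_def scale_simple_def)

lemma restrict_simple_simps [simp]:
  "restrict_simple D [] = []"
  "restrict_simple D ((c, C) # g) = (c, D \<inter> C) # restrict_simple D g"
  "restrict_simple D (g @ h) = restrict_simple D g @ restrict_simple D h"
  "restrict_simple D (scale_simple a g) = scale_simple a (restrict_simple D g)"
  by (auto simp: restrict_simple_def scale_simple_def)

lemma bounded_borel_Int: "C \<in> bounded_borel \<Longrightarrow> D \<in> sets borel \<Longrightarrow> D \<inter> C \<in> bounded_borel"
  by (auto simp: bounded_borel_def intro: bounded_subset)

lemma bounded_borel_Diff: "C \<in> bounded_borel \<Longrightarrow> D \<in> sets borel \<Longrightarrow> C - D \<in> bounded_borel"
  by (auto simp: bounded_borel_def intro: bounded_subset)

lemma bounded_borel_sets: "C \<in> bounded_borel \<Longrightarrow> C \<in> sets borel"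
  by (simp add: bounded_borel_def)

lemma levy_simple_restrict [simp]: "levy_simple g \<Longrightarrow> D \<in> sets borel \<Longrightarrow> levy_simple (restrict_simple D g)"
  by (auto simp: levy_simple_def restrict_simple_def intro: bounded_borel_Int)

lemma levy_simple_integral_eq: "levy_simple_integral \<Lambda> D g = levy_sum \<Lambda> (restrict_simple D g)"
proof
  fix \<omega>
  show "levy_simple_integral \<Lambda> D g \<omega> = levy_sum \<Lambda> (restrict_simple D g) \<omega>"
    by (induction g) (auto simp: levy_simple_integral_def levy_sum_def restrict_simple_def)
qed

lemma borel_measurable_levy_simple_fun:
  "levy_simple g \<Longrightarrow> levy_simple_fun g \<in> borel_measurable borel"
proof (induction g)
  case Nil
  have "levy_simple_fun [] = (\<lambda>z. 0)" by (simp add: fun_eq_iff)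
  then show ?case by simp
next
  case (Cons p g)
  obtain c C where p: "p = (c, C)" by (cases p)
  have [measurable]: "C \<in> sets borel" "levy_simple_fun g \<in> borel_measurable borel"
    using Cons by (auto simp: p bounded_borel_def)
  have "levy_simple_fun (p # g) = (\<lambda>z. c * indicator C z + levy_simple_fun g z)"
    by (simp add: fun_eq_iff p)
  then show ?case by simp
qed

text \<open>All that integration uses of the basis: its second order structure and finite
  additivity. \<open>P\<close> is the control measure, and \<open>m\<close> and \<open>v\<close> are
  the mean and the variance per unit of it.\<close>

locale levy_L2 = prob_space M for M :: "'w measure" +
  fixes \<Lambda> :: "(real \<times> real) set \<Rightarrow> 'w \<Rightarrow> real" and P :: "(real \<times> real) measure" and m v :: real
  assumes sets_P [measurable_cong]: "sets P = sets borel"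
    and finite_P: "\<And>C. C \<in> bounded_borel \<Longrightarrow> emeasure P C < \<infinity>"
    and P_neg: "AE z in P. z \<in> {..<0} \<times> UNIV"
    and v_nonneg: "0 \<le> v"
    and basis_measurable: "\<And>C. C \<in> bounded_borel \<Longrightarrow> \<Lambda> C \<in> borel_measurable M"
    and basis_L2: "\<And>C. C \<in> bounded_borel \<Longrightarrow> integrable M (\<lambda>\<omega>. (\<Lambda> C \<omega>)\<^sup>2)"
    and basis_mean: "\<And>C. C \<in> bounded_borel \<Longrightarrow> expectation (\<Lambda> C) = m * measure P C"
    and basis_square: "\<And>C. C \<in> bounded_borel \<Longrightarrow> expectation (\<lambda>\<omega>. (\<Lambda> C \<omega>)\<^sup>2) = v * measure P C + (m * measure P C)\<^sup>2"
    and basis_disjoint: "\<And>C D. C \<in> bounded_borel \<Longrightarrow> D \<in> bounded_borel \<Longrightarrow> C \<inter> D = {} \<Longrightarrow>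
          expectation (\<lambda>\<omega>. \<Lambda> C \<omega> * \<Lambda> D \<omega>) = expectation (\<Lambda> C) * expectation (\<Lambda> D)"
    and basis_add: "\<And>C D. C \<in> bounded_borel \<Longrightarrow> D \<in> bounded_borel \<Longrightarrow> C \<inter> D = {} \<Longrightarrow>
          AE \<omega> in M. \<Lambda> (C \<union> D) \<omega> = \<Lambda> C \<omega> + \<Lambda> D \<omega>"
begin

lemma space_P [simp]: "space P = UNIV"
  using sets_eq_imp_space_eq[OF sets_P] by simp

lemma basis_integrable: "C \<in> bounded_borel \<Longrightarrow> integrable M (\<Lambda> C)"
  by (rule square_integrable_imp_integrable) (auto simp: basis_measurable basis_L2)

lemma basis_integrable_mult:
  "C \<in> bounded_borel \<Longrightarrow> D \<in> bounded_borel \<Longrightarrow> integrable M (\<lambda>\<omega>. \<Lambda> C \<omega> * \<Lambda> D \<omega>)"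
  by (rule integrable_mult_L2) (auto simp: basis_measurable basis_L2)

text \<open>Both sets are cut along their intersection. The three pieces are disjoint, so only the
  common one contributes more than a product of means.\<close>

lemma basis_covariance:
  assumes C: "C \<in> bounded_borel" and D: "D \<in> bounded_borel"
  shows "expectation (\<lambda>\<omega>. \<Lambda> C \<omega> * \<Lambda> D \<omega>) = v * measure P (C \<inter> D) + m\<^sup>2 * measure P C * measure P D"
proof -
  define A A' A'' where "A = C \<inter> D" and "A' = C - D" and "A'' = D - C"
  have b: "A \<in> bounded_borel" "A' \<in> bounded_borel" "A'' \<in> bounded_borel"
    using bounded_borel_Int[OF D bounded_borel_sets[OF C]] bounded_borel_Diff[OF C bounded_borel_sets[OF D]]
      bounded_borel_Diff[OF D bounded_borel_sets[OF C]] by (auto simp: A_def A'_def A''_def)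
  note [measurable] = basis_measurable[OF b(1)] basis_measurable[OF b(2)] basis_measurable[OF b(3)]
    basis_measurable[OF C] basis_measurable[OF D]
  have CD: "C = A \<union> A'" "D = A \<union> A''" by (auto simp: A_def A'_def A''_def)
  have disj: "A \<inter> A' = {}" "A \<inter> A'' = {}" "A' \<inter> A = {}" "A' \<inter> A'' = {}" by (auto simp: A_def A'_def A''_def)
  have eC: "AE \<omega> in M. \<Lambda> C \<omega> = \<Lambda> A \<omega> + \<Lambda> A' \<omega>" and eD: "AE \<omega> in M. \<Lambda> D \<omega> = \<Lambda> A \<omega> + \<Lambda> A'' \<omega>"
    using basis_add[OF b(1,2) disj(1)] basis_add[OF b(1,3) disj(2)] CD by auto
  have mC: "measure P C = measure P A + measure P A'" and mD: "measure P D = measure P A + measure P A''"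
    unfolding CD by (subst measure_Union; use b disj finite_P in \<open>auto simp: sets_P bounded_borel_sets less_top[symmetric]\<close>)+
  have "expectation (\<lambda>\<omega>. \<Lambda> C \<omega> * \<Lambda> D \<omega>)
     = expectation (\<lambda>\<omega>. (\<Lambda> A \<omega>)\<^sup>2 + \<Lambda> A \<omega> * \<Lambda> A'' \<omega> + \<Lambda> A' \<omega> * \<Lambda> A \<omega> + \<Lambda> A' \<omega> * \<Lambda> A'' \<omega>)"
    using eC eD by (intro integral_cong_AE, measurable, eventually_elim)
      (simp add: algebra_simps power2_eq_square)
  also have "\<dots> = expectation (\<lambda>\<omega>. (\<Lambda> A \<omega>)\<^sup>2) + expectation (\<lambda>\<omega>. \<Lambda> A \<omega> * \<Lambda> A'' \<omega>)
      + expectation (\<lambda>\<omega>. \<Lambda> A' \<omega> * \<Lambda> A \<omega>) + expectation (\<lambda>\<omega>. \<Lambda> A' \<omega> * \<Lambda> A'' \<omega>)"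
    by (simp add: basis_L2 basis_integrable_mult b)
  also have "\<dots> = v * measure P A + m\<^sup>2 * measure P C * measure P D"
    unfolding basis_disjoint[OF b(1,3) disj(2)] basis_disjoint[OF b(2,1) disj(3)] basis_disjoint[OF b(2,3) disj(4)]
      basis_square[OF b(1)] basis_mean[OF b(1)] basis_mean[OF b(2)] basis_mean[OF b(3)] mC mD
    by (simp add: power2_eq_square algebra_simps)
  finally show ?thesis by (simp add: A_def)
qed

lemma levy_sum_measurable: "levy_simple g \<Longrightarrow> levy_sum \<Lambda> g \<in> borel_measurable M"
proof (induction g)
  case Nil
  have "levy_sum \<Lambda> [] = (\<lambda>\<omega>. 0)" by (simp add: fun_eq_iff)
  then show ?case by simp
next
  case (Cons p g)
  obtain c C where p: "p = (c, C)" by (cases p)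
  have [measurable]: "\<Lambda> C \<in> borel_measurable M" "levy_sum \<Lambda> g \<in> borel_measurable M"
    using Cons basis_measurable by (auto simp: p)
  have "levy_sum \<Lambda> (p # g) = (\<lambda>\<omega>. c * \<Lambda> C \<omega> + levy_sum \<Lambda> g \<omega>)"
    by (simp add: fun_eq_iff p)
  then show ?case by simp
qed

lemma simple_fun_measurable: "levy_simple g \<Longrightarrow> levy_simple_fun g \<in> borel_measurable P"
  using borel_measurable_levy_simple_fun[of g] sets_P by (simp cong: measurable_cong_sets)

lemma levy_sum_mean:
  assumes "levy_simple g"
  shows "integrable M (levy_sum \<Lambda> g)" "integrable P (levy_simple_fun g)"
    "expectation (levy_sum \<Lambda> g) = m * (\<integral>z. levy_simple_fun g z \<partial>P)"
proof -
  have "integrable M (levy_sum \<Lambda> g) \<and> integrable P (levy_simple_fun g) \<and>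
    expectation (levy_sum \<Lambda> g) = m * (\<integral>z. levy_simple_fun g z \<partial>P)"
    using assms
  proof (induction g)
    case Nil
    have "levy_sum \<Lambda> [] = (\<lambda>\<omega>. 0)" "levy_simple_fun [] = (\<lambda>\<omega>. 0)" by (simp_all add: fun_eq_iff)
    then show ?case by simp
  next
    case (Cons p g)
    obtain c C where p: "p = (c, C)" by (cases p)
    have C: "C \<in> bounded_borel" and g: "levy_simple g" using Cons by (auto simp: p)
    have e: "levy_sum \<Lambda> (p # g) = (\<lambda>\<omega>. c * \<Lambda> C \<omega> + levy_sum \<Lambda> g \<omega>)"
      "levy_simple_fun (p # g) = (\<lambda>z. c * indicator C z + levy_simple_fun g z)"
      by (simp_all add: fun_eq_iff p)
    have "integrable P (indicator C :: _ \<Rightarrow> real)"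
      using finite_P[OF C] bounded_borel_sets[OF C] by (intro integrable_real_indicator) (auto simp: sets_P)
    then show ?case unfolding e using Cons.IH[OF g] C basis_integrable[OF C] bounded_borel_sets[OF C]
      by (simp add: basis_mean distrib_left sets_P)
  qed
  then show "integrable M (levy_sum \<Lambda> g)" "integrable P (levy_simple_fun g)"
    "expectation (levy_sum \<Lambda> g) = m * (\<integral>z. levy_simple_fun g z \<partial>P)" by auto
qed

text \<open>The sets in a list may overlap. Induction on one list at a time, starting from
  \<open>basis_covariance\<close>, avoids bringing simple functions into a disjoint normal
  form.\<close>

lemma levy_sum_covariance_aux:
  assumes "levy_simple g" and D: "D \<in> bounded_borel"
  shows "integrable M (\<lambda>\<omega>. levy_sum \<Lambda> g \<omega> * \<Lambda> D \<omega>)" "integrable P (\<lambda>z. levy_simple_fun g z * indicator D z)"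
    "expectation (\<lambda>\<omega>. levy_sum \<Lambda> g \<omega> * \<Lambda> D \<omega>) =
       v * (\<integral>z. levy_simple_fun g z * indicator D z \<partial>P) + m\<^sup>2 * (\<integral>z. levy_simple_fun g z \<partial>P) * measure P D"
proof -
  have "integrable M (\<lambda>\<omega>. levy_sum \<Lambda> g \<omega> * \<Lambda> D \<omega>) \<and> integrable P (\<lambda>z. levy_simple_fun g z * indicator D z) \<and>
    expectation (\<lambda>\<omega>. levy_sum \<Lambda> g \<omega> * \<Lambda> D \<omega>) =
       v * (\<integral>z. levy_simple_fun g z * indicator D z \<partial>P) + m\<^sup>2 * (\<integral>z. levy_simple_fun g z \<partial>P) * measure P D"
    using assms(1)
  proof (induction g)
    case Nil
    then show ?case by simp
  next
    case (Cons p g)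
    obtain c C where p: "p = (c, C)" by (cases p)
    have C: "C \<in> bounded_borel" and g: "levy_simple g" using Cons by (auto simp: p)
    have e: "(\<lambda>\<omega>. levy_sum \<Lambda> (p # g) \<omega> * \<Lambda> D \<omega>) = (\<lambda>\<omega>. c * (\<Lambda> C \<omega> * \<Lambda> D \<omega>) + levy_sum \<Lambda> g \<omega> * \<Lambda> D \<omega>)"
      "(\<lambda>z. levy_simple_fun (p # g) z * indicator D z) = (\<lambda>z. c * indicator (C \<inter> D) z + levy_simple_fun g z * indicator D z)"
      "levy_simple_fun (p # g) = (\<lambda>z. c * indicator C z + levy_simple_fun g z)"
      by (simp_all add: fun_eq_iff p algebra_simps indicator_inter_arith)
    have CD: "C \<inter> D \<in> bounded_borel" using bounded_borel_Int[OF D bounded_borel_sets[OF C]] .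
    have i: "integrable P (indicator C :: _ \<Rightarrow> real)" "integrable P (indicator (C \<inter> D) :: _ \<Rightarrow> real)"
      using finite_P[OF C] bounded_borel_sets[OF C] finite_P[OF CD] bounded_borel_sets[OF CD]
      by (auto intro!: integrable_real_indicator simp: sets_P)
    have 1: "integrable P (\<lambda>z. c * indicator (C \<inter> D) z + levy_simple_fun g z * indicator D z)"
      "(\<integral>z. c * indicator (C \<inter> D) z + levy_simple_fun g z * indicator D z \<partial>P)
        = c * measure P (C \<inter> D) + (\<integral>z. levy_simple_fun g z * indicator D z \<partial>P)"
      using Cons.IH[OF g] integrable_mult_right[OF i(2), of c] by auto
    have 2: "(\<integral>z. c * indicator C z + levy_simple_fun g z \<partial>P) = c * measure P C + (\<integral>z. levy_simple_fun g z \<partial>P)"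
      using i(1) levy_sum_mean(2)[OF g] by simp
    have 3: "integrable M (\<lambda>\<omega>. c * (\<Lambda> C \<omega> * \<Lambda> D \<omega>) + levy_sum \<Lambda> g \<omega> * \<Lambda> D \<omega>)"
      "expectation (\<lambda>\<omega>. c * (\<Lambda> C \<omega> * \<Lambda> D \<omega>) + levy_sum \<Lambda> g \<omega> * \<Lambda> D \<omega>)
        = c * (v * measure P (C \<inter> D) + m\<^sup>2 * measure P C * measure P D) + expectation (\<lambda>\<omega>. levy_sum \<Lambda> g \<omega> * \<Lambda> D \<omega>)"
      using Cons.IH[OF g] integrable_mult_right[OF basis_integrable_mult[OF C D], of c] by (auto simp: basis_covariance[OF C D])
    show ?case unfolding e(1,2) unfolding e(3) 1(2) 2 3(2) using 1(1) 3(1) Cons.IH[OF g]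
      by (simp add: distrib_left distrib_right mult_ac)
  qed
  then show "integrable M (\<lambda>\<omega>. levy_sum \<Lambda> g \<omega> * \<Lambda> D \<omega>)" "integrable P (\<lambda>z. levy_simple_fun g z * indicator D z)"
    "expectation (\<lambda>\<omega>. levy_sum \<Lambda> g \<omega> * \<Lambda> D \<omega>) =
       v * (\<integral>z. levy_simple_fun g z * indicator D z \<partial>P) + m\<^sup>2 * (\<integral>z. levy_simple_fun g z \<partial>P) * measure P D" by auto
qed

lemma levy_sum_covariance:
  assumes g: "levy_simple g" and "levy_simple h"
  shows "integrable M (\<lambda>\<omega>. levy_sum \<Lambda> g \<omega> * levy_sum \<Lambda> h \<omega>)" "integrable P (\<lambda>z. levy_simple_fun g z * levy_simple_fun h z)"
    "expectation (\<lambda>\<omega>. levy_sum \<Lambda> g \<omega> * levy_sum \<Lambda> h \<omega>) =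
       v * (\<integral>z. levy_simple_fun g z * levy_simple_fun h z \<partial>P) + m\<^sup>2 * (\<integral>z. levy_simple_fun g z \<partial>P) * (\<integral>z. levy_simple_fun h z \<partial>P)"
proof -
  have "integrable M (\<lambda>\<omega>. levy_sum \<Lambda> g \<omega> * levy_sum \<Lambda> h \<omega>) \<and> integrable P (\<lambda>z. levy_simple_fun g z * levy_simple_fun h z) \<and>
    expectation (\<lambda>\<omega>. levy_sum \<Lambda> g \<omega> * levy_sum \<Lambda> h \<omega>) =
       v * (\<integral>z. levy_simple_fun g z * levy_simple_fun h z \<partial>P) + m\<^sup>2 * (\<integral>z. levy_simple_fun g z \<partial>P) * (\<integral>z. levy_simple_fun h z \<partial>P)"
    using assms(2)
  proof (induction h)
    case Nil
    then show ?case by simp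
  next
    case (Cons p h)
    obtain c D where p: "p = (c, D)" by (cases p)
    have D: "D \<in> bounded_borel" and h: "levy_simple h" using Cons by (auto simp: p)
    have e: "(\<lambda>\<omega>. levy_sum \<Lambda> g \<omega> * levy_sum \<Lambda> (p # h) \<omega>) = (\<lambda>\<omega>. c * (levy_sum \<Lambda> g \<omega> * \<Lambda> D \<omega>) + levy_sum \<Lambda> g \<omega> * levy_sum \<Lambda> h \<omega>)"
      "(\<lambda>z. levy_simple_fun g z * levy_simple_fun (p # h) z) = (\<lambda>z. c * (levy_simple_fun g z * indicator D z) + levy_simple_fun g z * levy_simple_fun h z)"
      "levy_simple_fun (p # h) = (\<lambda>z. c * indicator D z + levy_simple_fun h z)"
      by (simp_all add: fun_eq_iff p algebra_simps)
    have i: "integrable P (indicator D :: _ \<Rightarrow> real)"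
      using finite_P[OF D] bounded_borel_sets[OF D] by (auto intro!: integrable_real_indicator simp: sets_P)
    show ?case unfolding e using Cons.IH[OF h] i levy_sum_covariance_aux[OF g D] levy_sum_mean(2)[OF h] bounded_borel_sets[OF D]
      by (simp add: sets_P algebra_simps)
  qed
  then show "integrable M (\<lambda>\<omega>. levy_sum \<Lambda> g \<omega> * levy_sum \<Lambda> h \<omega>)" "integrable P (\<lambda>z. levy_simple_fun g z * levy_simple_fun h z)"
    "expectation (\<lambda>\<omega>. levy_sum \<Lambda> g \<omega> * levy_sum \<Lambda> h \<omega>) =
       v * (\<integral>z. levy_simple_fun g z * levy_simple_fun h z \<partial>P) + m\<^sup>2 * (\<integral>z. levy_simple_fun g z \<partial>P) * (\<integral>z. levy_simple_fun h z \<partial>P)"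
    by auto
qed

text \<open>Bounds the second moment of the integral over \<open>D\<close>. The absolute value in
  the second term makes the bound monotone in \<open>D\<close>, whereas the exact second moment need
  not be, because the integral of a function that changes sign can cancel.\<close>

definition L2_bound :: "(real \<times> (real \<times> real) set) list \<Rightarrow> (real \<times> real) set \<Rightarrow> real" where
  "L2_bound g D = v * (\<integral>z. indicator D z * (levy_simple_fun g z)\<^sup>2 \<partial>P) + (m * (\<integral>z. indicator D z * \<bar>levy_simple_fun g z\<bar> \<partial>P))\<^sup>2"

lemma simple_fun_square_integrable: "levy_simple g \<Longrightarrow> integrable P (\<lambda>z. (levy_simple_fun g z)\<^sup>2)"
  using levy_sum_covariance(2)[of g g] by (simp add: power2_eq_square)

lemma levy_sum_square_le:
  assumes g: "levy_simple g" and D: "D \<in> sets borel"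
  shows "integrable M (\<lambda>\<omega>. (levy_sum \<Lambda> (restrict_simple D g) \<omega>)\<^sup>2)"
    "expectation (\<lambda>\<omega>. (levy_sum \<Lambda> (restrict_simple D g) \<omega>)\<^sup>2) \<le> L2_bound g D"
proof -
  let ?g = "restrict_simple D g"
  have s: "levy_simple ?g" using assms by simp
  note c = levy_sum_covariance[OF s s]
  show "integrable M (\<lambda>\<omega>. (levy_sum \<Lambda> ?g \<omega>)\<^sup>2)" using c(1) by (simp add: power2_eq_square)
  have "expectation (\<lambda>\<omega>. (levy_sum \<Lambda> ?g \<omega>)\<^sup>2) =
     v * (\<integral>z. indicator D z * (levy_simple_fun g z)\<^sup>2 \<partial>P) + (m * (\<integral>z. levy_simple_fun ?g z \<partial>P))\<^sup>2"
  proof -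
    have "(\<lambda>z. levy_simple_fun ?g z * levy_simple_fun ?g z) = (\<lambda>z. indicator D z * (levy_simple_fun g z)\<^sup>2)"
      by (auto simp: fun_eq_iff power2_eq_square split: split_indicator)
    then show ?thesis using c(3) by (simp add: power2_eq_square mult_ac)
  qed
  also have "\<dots> \<le> L2_bound g D"
  proof -
    have "\<bar>\<integral>z. levy_simple_fun ?g z \<partial>P\<bar> \<le> (\<integral>z. \<bar>levy_simple_fun ?g z\<bar> \<partial>P)" by (rule integral_abs_bound)
    also have "(\<lambda>z. \<bar>levy_simple_fun ?g z\<bar>) = (\<lambda>z. indicator D z * \<bar>levy_simple_fun g z\<bar>)"
      by (auto simp: fun_eq_iff split: split_indicator)
    finally have "\<bar>m * (\<integral>z. levy_simple_fun ?g z \<partial>P)\<bar> \<le> \<bar>m * (\<integral>z. indicator D z * \<bar>levy_simple_fun g z\<bar> \<partial>P)\<bar>"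
      by (auto simp: abs_mult intro!: mult_left_mono)
    then show ?thesis unfolding L2_bound_def by (simp add: abs_le_square_iff)
  qed
  finally show "expectation (\<lambda>\<omega>. (levy_sum \<Lambda> ?g \<omega>)\<^sup>2) \<le> L2_bound g D" .
qed

lemma L2_bound_mono:
  assumes g: "levy_simple g" and D: "D \<in> sets borel" "E \<in> sets borel" "D \<subseteq> E"
  shows "L2_bound g D \<le> L2_bound g E"
proof -
  note [measurable] = simple_fun_measurable[OF g]
  have [measurable]: "D \<in> sets P" "E \<in> sets P" using D by (auto simp: sets_P)
  have i: "integrable P (\<lambda>z. indicator F z * (levy_simple_fun g z)\<^sup>2)"
    "integrable P (\<lambda>z. indicator F z * \<bar>levy_simple_fun g z\<bar>)" if "F \<in> sets P" for F
    using integrable_mult_indicator[OF that simple_fun_square_integrable[OF g]]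
      integrable_mult_indicator[OF that integrable_abs[OF levy_sum_mean(2)[OF g]]] by simp_all
  have "(\<integral>z. indicator D z * (levy_simple_fun g z)\<^sup>2 \<partial>P) \<le> (\<integral>z. indicator E z * (levy_simple_fun g z)\<^sup>2 \<partial>P)"
    "(\<integral>z. indicator D z * \<bar>levy_simple_fun g z\<bar> \<partial>P) \<le> (\<integral>z. indicator E z * \<bar>levy_simple_fun g z\<bar> \<partial>P)"
    using D(3) by (intro integral_mono i; auto split: split_indicator)+
  moreover have "0 \<le> (\<integral>z. indicator D z * \<bar>levy_simple_fun g z\<bar> \<partial>P)" by (intro integral_nonneg_AE) auto
  ultimately show ?thesis unfolding L2_bound_def using v_nonneg
    by (intro add_mono mult_left_mono) (auto simp: power_mult_distrib intro!: mult_left_mono power_mono)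
qed

lemma levy_sum_restrict_Un:
  assumes g: "levy_simple g" and D: "D \<in> sets borel" "E \<in> sets borel" "D \<inter> E = {}"
  shows "AE \<omega> in M. levy_sum \<Lambda> (restrict_simple (D \<union> E) g) \<omega> =
     levy_sum \<Lambda> (restrict_simple D g) \<omega> + levy_sum \<Lambda> (restrict_simple E g) \<omega>"
  using g
proof (induction g)
  case Nil
  then show ?case by simp
next
  case (Cons p g)
  obtain c C where p: "p = (c, C)" by (cases p)
  have C: "C \<in> bounded_borel" and g: "levy_simple g" using Cons by (auto simp: p)
  have "AE \<omega> in M. \<Lambda> ((D \<inter> C) \<union> (E \<inter> C)) \<omega> = \<Lambda> (D \<inter> C) \<omega> + \<Lambda> (E \<inter> C) \<omega>"
    by (rule basis_add) (use C D bounded_borel_Int in auto)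
  then have "AE \<omega> in M. \<Lambda> ((D \<union> E) \<inter> C) \<omega> = \<Lambda> (D \<inter> C) \<omega> + \<Lambda> (E \<inter> C) \<omega>" by (simp add: Int_Un_distrib2)
  with Cons.IH[OF g] show ?case by eventually_elim (simp add: p algebra_simps)
qed

definition restricted_size :: "(real \<times> (real \<times> real) set) list \<Rightarrow> (real \<times> real) set \<Rightarrow> real" where
  "restricted_size g D = ky_fan M (levy_sum \<Lambda> (restrict_simple D g))"

lemma restricted_size_le:
  assumes "levy_simple g" "D \<in> sets borel"
  shows "restricted_size g D \<le> sqrt (L2_bound g D)"
proof -
  have "restricted_size g D \<le> sqrt (expectation (\<lambda>\<omega>. (levy_sum \<Lambda> (restrict_simple D g) \<omega>)\<^sup>2))"
    unfolding restricted_size_def using assms by (intro ky_fan_le_L2 levy_sum_measurable levy_sum_square_le) auto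
  also have "\<dots> \<le> sqrt (L2_bound g D)" using levy_sum_square_le[OF assms] by simp
  finally show ?thesis .
qed

lemma restricted_size_Un:
  assumes g: "levy_simple g" and D: "D \<in> sets borel" "E \<in> sets borel" "D \<inter> E = {}"
  shows "restricted_size g (D \<union> E) \<le> restricted_size g D + restricted_size g E"
proof -
  note [measurable] = levy_sum_measurable
  have "restricted_size g (D \<union> E) = ky_fan M (\<lambda>\<omega>. levy_sum \<Lambda> (restrict_simple D g) \<omega> + levy_sum \<Lambda> (restrict_simple E g) \<omega>)"
    unfolding restricted_size_def using levy_sum_restrict_Un[OF assms] g D
    by (intro ky_fan_cong_AE borel_measurable_add levy_sum_measurable) auto
  also have "\<dots> \<le> restricted_size g D + restricted_size g E"
    unfolding restricted_size_def using g D by (intro ky_fan_add levy_sum_measurable) auto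
  finally show ?thesis .
qed

text \<open>The form in which \<open>gliding_hump\<close> uses the bounds: \<open>D\<close> is
  covered by two sets on each of which the integrand is small, and \<open>D \<inter> A\<close> and
  \<open>D - A\<close> are estimated separately.\<close>

lemma restricted_size_split_le:
  assumes g: "levy_simple g" and D: "D \<in> sets borel" "A \<in> sets borel" "B \<in> sets borel" "D \<subseteq> A \<union> B"
  shows "restricted_size g D \<le> sqrt (L2_bound g A) + sqrt (L2_bound g B)"
proof -
  have "restricted_size g D = restricted_size g ((D \<inter> A) \<union> (D - A))" by (simp add: Int_Diff_Un)
  also have "\<dots> \<le> restricted_size g (D \<inter> A) + restricted_size g (D - A)"
    using g D by (intro restricted_size_Un) auto
  also have "\<dots> \<le> sqrt (L2_bound g (D \<inter> A)) + sqrt (L2_bound g (D - A))"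
    using g D by (intro add_mono restricted_size_le) auto
  also have "\<dots> \<le> sqrt (L2_bound g A) + sqrt (L2_bound g B)"
    using g D by (intro add_mono real_sqrt_le_mono L2_bound_mono) auto
  finally show ?thesis .
qed

end

section \<open>Uniqueness of the integral\<close>

abbreviation neg_half :: "(real \<times> real) set" where
  "neg_half \<equiv> {..<0} \<times> UNIV"

lemma neg_half_borel [measurable, simp]: "neg_half \<in> sets borel"
  by (intro borel_open open_Times) auto

context levy_L2
begin

lemma L2_bound_tendsto_0:
  assumes "(\<lambda>n. \<integral>z. indicator (D n) z * (levy_simple_fun (g n) z)\<^sup>2 \<partial>P) \<longlonglongrightarrow> 0"
    and "(\<lambda>n. \<integral>z. indicator (D n) z * \<bar>levy_simple_fun (g n) z\<bar> \<partial>P) \<longlonglongrightarrow> 0"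
  shows "(\<lambda>n. sqrt (L2_bound (g n) (D n))) \<longlonglongrightarrow> 0"
proof -
  have "(\<lambda>n. sqrt (L2_bound (g n) (D n))) \<longlonglongrightarrow> sqrt (v * 0 + (m * 0)\<^sup>2)"
    unfolding L2_bound_def by (intro tendsto_intros assms)
  then show ?thesis by simp
qed

text \<open>
  A L\'evy integral is defined by convergence in probability over every Borel set \<open>D\<close>, without
  domination of the approximating simple functions. If the integrals over the whole space did not
  vanish in the limit, then infinitely many of them would be concentrated on disjoint sets \<open>A j\<close>,
  and the integrals over \<open>D\<close>, the union of every other \<open>A j\<close>, would not be Cauchy.
\<close>

lemma gliding_hump:
  fixes r :: "nat \<Rightarrow> (real \<times> real) set \<Rightarrow> real"
  assumes K: "incseq K" "\<And>k. K k \<subseteq> neg_half"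
    and inner: "\<And>k. (\<lambda>n. q n (K k)) \<longlonglongrightarrow> 0"
    and outer: "\<And>n. (\<lambda>k. q n (neg_half - K k)) \<longlonglongrightarrow> 0"
    and K_borel: "\<And>k. K k \<in> sets borel"
    and r_split: "\<And>n D A B. D \<in> sets borel \<Longrightarrow> A \<in> sets borel \<Longrightarrow> B \<in> sets borel \<Longrightarrow> D \<subseteq> A \<union> B \<Longrightarrow> r n D \<le> q n A + q n B"
    and r_Un: "\<And>n D E. D \<in> sets borel \<Longrightarrow> E \<in> sets borel \<Longrightarrow> D \<inter> E = {} \<Longrightarrow> r n (D \<union> E) \<le> r n D + r n E"
    and cauchy: "\<And>D. D \<in> sets borel \<Longrightarrow> D \<subseteq> neg_half \<Longrightarrow> Cauchy (\<lambda>n. r n D)"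
    and r_nonneg: "\<And>n D. 0 \<le> r n D"
  shows "(\<lambda>n. r n neg_half) \<longlonglongrightarrow> 0"
proof (rule ccontr)
  assume "\<not> (\<lambda>n. r n neg_half) \<longlonglongrightarrow> 0"
  then obtain \<delta> where \<delta>: "0 < \<delta>" "\<And>N. \<exists>n\<ge>N. \<delta> \<le> r n neg_half"
    using r_nonneg by (force simp: LIMSEQ_iff not_less)
  \<comment> \<open>Removing a piece costs at most \<open>2 * \<epsilon>\<close>. A total of
    \<open>6 * \<epsilon>\<close> thus leaves at least \<open>4 * \<epsilon>\<close> at the indices
    where \<open>D\<close> carries the mass, against at most \<open>2 * \<epsilon>\<close> at the
    others, and the gap exceeds \<open>\<epsilon>\<close>.\<close>
  define \<epsilon> where "\<epsilon> = \<delta> / 6"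
  have \<epsilon>: "0 < \<epsilon>" "\<And>N. \<exists>n\<ge>N. 6 * \<epsilon> \<le> r n neg_half" using \<delta> by (auto simp: \<epsilon>_def)
  have outer': "\<exists>l\<ge>k. q n (neg_half - K l) < \<epsilon>" for k n
  proof -
    have "\<forall>\<^sub>F l in sequentially. q n (neg_half - K l) < \<epsilon>" using outer \<epsilon>(1) by (rule order_tendstoD)
    then obtain L where "\<And>l. l \<ge> L \<Longrightarrow> q n (neg_half - K l) < \<epsilon>" by (auto simp: eventually_sequentially)
    then show ?thesis by (intro exI[of _ "max k L"]) auto
  qed
  have inner': "\<exists>N. \<forall>n\<ge>N. q n (K k) < \<epsilon>" for k
    using order_tendstoD(2)[OF inner \<epsilon>(1)] by (auto simp: eventually_sequentially)
  \<comment> \<open>A state is an index together with a level. \<open>S\<close> says that the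
    integral at this index is large although little remains outside the level set, and
    \<open>T\<close> that the next index is already negligible on the old level set.\<close>
  define S where "S x \<longleftrightarrow> 6 * \<epsilon> \<le> r (fst x) neg_half \<and> q (fst x) (neg_half - K (snd x)) < \<epsilon>" for x :: "nat \<times> nat"
  define T where "T x y \<longleftrightarrow> fst x < fst y \<and> snd x \<le> snd y \<and> q (fst y) (K (snd x)) < \<epsilon>" for x y :: "nat \<times> nat"
  have "\<exists>f::nat \<Rightarrow> nat \<times> nat. \<forall>j. S (f j) \<and> T (f j) (f (Suc j))"
  proof (rule dependent_nat_choice)
    obtain n where n: "6 * \<epsilon> \<le> r n neg_half" using \<epsilon>(2)[of 0] by auto
    obtain k where "q n (neg_half - K k) < \<epsilon>" using outer'[of 0 n] by auto
    with n show "\<exists>x. S x" by (intro exI[of _ "(n, k)"]) (simp add: S_def)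
  next
    fix x :: "nat \<times> nat" and j :: nat assume "S x"
    obtain N where N: "\<And>n. n \<ge> N \<Longrightarrow> q n (K (snd x)) < \<epsilon>" using inner' by auto
    obtain n where n: "n \<ge> max N (Suc (fst x))" "6 * \<epsilon> \<le> r n neg_half" using \<epsilon>(2) by blast
    obtain k where k: "k \<ge> snd x" "q n (neg_half - K k) < \<epsilon>" using outer' by blast
    show "\<exists>y. S y \<and> T x y" using N[of n] n k by (intro exI[of _ "(n, k)"]) (auto simp: S_def T_def)
  qed
  then obtain f where f: "\<And>j. S (f j)" "\<And>j. T (f j) (f (Suc j))" by blast
  define n k where "n j = fst (f j)" and "k j = snd (f j)" for j
  have n_mono: "strict_mono n" using f(2) by (simp add: strict_mono_Suc_iff n_def T_def)
  have k_mono: "mono k" using f(2) by (simp add: mono_iff_le_Suc k_def T_def)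
  have big: "6 * \<epsilon> \<le> r (n j) neg_half" and out: "q (n j) (neg_half - K (k j)) < \<epsilon>" for j
    using f(1) by (auto simp: S_def n_def k_def)
  have inn: "q (n (Suc j)) (K (k j)) < \<epsilon>" for j
    using f(2) by (auto simp: T_def n_def k_def)
  \<comment> \<open>The integral with index \<open>n (Suc j)\<close> is concentrated on
    \<open>A j\<close>. This shift explains why the even annuli go with the indices
    \<open>n (Suc (2 * i))\<close>.\<close>
  define A where "A j = K (k (Suc j)) - K (k j)" for j
  have A_borel [measurable]: "A j \<in> sets borel" for j using K_borel by (simp add: A_def)
  have A_disj: "A i \<inter> A j = {}" if "i < j" for i j
  proof -
    have "K (k (Suc i)) \<subseteq> K (k j)" using that k_mono K(1) by (auto simp: mono_def Suc_le_eq incseq_def)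
    then show ?thesis by (auto simp: A_def)
  qed
  define D where "D = (\<Union>i. A (2 * i))"
  have "D \<in> sets borel" unfolding D_def by measurable
  moreover have "D \<subseteq> neg_half" using K(2) by (auto simp: D_def A_def)
  ultimately have D: "D \<in> sets borel" "D \<subseteq> neg_half" by auto
  have small: "r (n (Suc j)) E \<le> 2 * \<epsilon>" if "E \<in> sets borel" "E \<subseteq> neg_half" "E \<inter> A j = {}" for E j
  proof -
    have "r (n (Suc j)) E \<le> q (n (Suc j)) (K (k j)) + q (n (Suc j)) (neg_half - K (k (Suc j)))"
      by (rule r_split) (use that K_borel in \<open>auto simp: A_def\<close>)
    then show ?thesis using inn[of j] out[of "Suc j"] by simp
  qed
  have even: "4 * \<epsilon> \<le> r (n (Suc (2 * i))) D" for i
  proof -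
    have "r (n (Suc (2 * i))) (D \<union> (neg_half - D)) \<le> r (n (Suc (2 * i))) D + r (n (Suc (2 * i))) (neg_half - D)"
      using D by (intro r_Un) auto
    moreover have "D \<union> (neg_half - D) = neg_half" using D by auto
    moreover have "r (n (Suc (2 * i))) (neg_half - D) \<le> 2 * \<epsilon>"
      by (rule small) (use D in \<open>auto simp: D_def\<close>)
    ultimately show ?thesis using big[of "Suc (2 * i)"] by simp
  qed
  have odd: "r (n (Suc (Suc (2 * i)))) D \<le> 2 * \<epsilon>" for i
  proof (rule small[OF D])
    have "A (2 * l) \<inter> A (Suc (2 * i)) = {}" for l
      using A_disj[of "2 * l" "Suc (2 * i)"] A_disj[of "Suc (2 * i)" "2 * l"] by (cases "l \<le> i") auto
    then show "D \<inter> A (Suc (2 * i)) = {}" by (auto simp: D_def)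
  qed
  obtain N where N: "\<And>a b. a \<ge> N \<Longrightarrow> b \<ge> N \<Longrightarrow> dist (r a D) (r b D) < \<epsilon>"
    using metric_CauchyD[OF cauchy[OF D] \<epsilon>(1)] by blast
  have "N \<le> n (Suc (2 * N))" "N \<le> n (Suc (Suc (2 * N)))"
    using seq_suble[OF n_mono, of "Suc (2 * N)"] seq_suble[OF n_mono, of "Suc (Suc (2 * N))"] by simp_all
  from N[OF this] even[of N] odd[of N] \<epsilon>(1) show False by (simp add: dist_real_def)
qed

text \<open>The level set \<open>K k\<close> is bounded and bounds all \<open>d n\<close> by
  \<open>k\<close> at once. On it dominated convergence applies as \<open>n\<close> grows; for fixed
  \<open>n\<close> the rest becomes negligible as \<open>k\<close> grows, because a convergent
  sequence is bounded and hence the \<open>K k\<close> exhaust the half plane up to a null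
  set.\<close>

lemma levy_sum_null:
  assumes d: "\<And>n. levy_simple (d n)"
    and lim: "AE z in P. (\<lambda>n. levy_simple_fun (d n) z) \<longlonglongrightarrow> 0"
    and cauchy: "\<And>D \<epsilon>. D \<in> sets borel \<Longrightarrow> D \<subseteq> neg_half \<Longrightarrow> 0 < \<epsilon> \<Longrightarrow> \<exists>N. \<forall>n\<ge>N. \<forall>k\<ge>N.
       ky_fan M (\<lambda>\<omega>. levy_sum \<Lambda> (restrict_simple D (d n)) \<omega> - levy_sum \<Lambda> (restrict_simple D (d k)) \<omega>) < \<epsilon>"
  shows "(\<lambda>n. restricted_size (d n) neg_half) \<longlonglongrightarrow> 0"
proof -
  define K where "K k = {z \<in> neg_half \<inter> cball 0 (real k). \<forall>n. \<bar>levy_simple_fun (d n) z\<bar> \<le> real k}" for k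
  note [measurable] = borel_measurable_levy_simple_fun[OF d]
  have K_eq: "K k = (neg_half \<inter> cball 0 (real k)) \<inter> {z \<in> space borel. \<forall>n. \<bar>levy_simple_fun (d n) z\<bar> \<le> real k}" for k
    by (auto simp: K_def)
  have K_borel: "K k \<in> sets borel" for k
  proof -
    have "{z \<in> space borel. \<forall>n. \<bar>levy_simple_fun (d n) z\<bar> \<le> real k} \<in> sets borel" by measurable
    then show ?thesis unfolding K_eq by (intro sets.Int) auto
  qed
  have K_bb: "K k \<in> bounded_borel" for k
    using K_borel by (auto simp: bounded_borel_def K_def intro: bounded_subset[OF bounded_cball[of 0 "real k"]])
  have [measurable]: "K k \<in> sets P" for k using K_borel by (simp add: sets_P)
  have [measurable]: "neg_half \<in> sets P" by (simp add: sets_P)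
  have [measurable]: "levy_simple_fun (d n) \<in> borel_measurable P" for n by (rule simple_fun_measurable[OF d])
  have intK: "integrable P (\<lambda>z. indicator (K k) z :: real)" for k
    using finite_P[OF K_bb] by (intro integrable_real_indicator) auto
  show ?thesis
  proof (rule gliding_hump[where K = K and q = "\<lambda>n D. sqrt (L2_bound (d n) D)"])
    show "incseq K"
    proof (rule incseq_SucI)
      fix k
      have le: "x \<le> real (Suc k)" if "x \<le> real k" for x using that by simp
      show "K k \<subseteq> K (Suc k)"
      proof
        fix z assume "z \<in> K k"
        then have z: "z \<in> neg_half" "norm z \<le> real k" "\<And>n. \<bar>levy_simple_fun (d n) z\<bar> \<le> real k" by (auto simp: K_def)
        show "z \<in> K (Suc k)" using z(1) le[OF z(2)] le[OF z(3)] unfolding K_def by (simp del: of_nat_Suc)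
      qed
    qed
    show "K k \<subseteq> neg_half" for k by (auto simp: K_def)
    show "K k \<in> sets borel" for k by (rule K_borel)
    show "(\<lambda>n. sqrt (L2_bound (d n) (K k))) \<longlonglongrightarrow> 0" for k
    proof (rule L2_bound_tendsto_0)
      have "(\<lambda>n. \<integral>z. indicator (K k) z * (levy_simple_fun (d n) z)\<^sup>2 \<partial>P) \<longlonglongrightarrow> (\<integral>z. 0 \<partial>P)"
      proof (rule integral_dominated_convergence[where w = "\<lambda>z. (real k)\<^sup>2 * indicator (K k) z"])
        show "AE z in P. (\<lambda>n. indicator (K k) z * (levy_simple_fun (d n) z)\<^sup>2) \<longlonglongrightarrow> 0"
          using lim by eventually_elim (auto intro!: tendsto_eq_intros)
        show "AE z in P. norm (indicator (K k) z * (levy_simple_fun (d n) z)\<^sup>2) \<le> (real k)\<^sup>2 * indicator (K k) z" for n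
          by (intro AE_I2) (auto simp: K_def abs_le_square_iff[symmetric] split: split_indicator)
      qed (use intK in auto)
      then show "(\<lambda>n. \<integral>z. indicator (K k) z * (levy_simple_fun (d n) z)\<^sup>2 \<partial>P) \<longlonglongrightarrow> 0" by simp
      have "(\<lambda>n. \<integral>z. indicator (K k) z * \<bar>levy_simple_fun (d n) z\<bar> \<partial>P) \<longlonglongrightarrow> (\<integral>z. 0 \<partial>P)"
      proof (rule integral_dominated_convergence[where w = "\<lambda>z. real k * indicator (K k) z"])
        show "AE z in P. (\<lambda>n. indicator (K k) z * \<bar>levy_simple_fun (d n) z\<bar>) \<longlonglongrightarrow> 0"
          using lim by eventually_elim (auto intro!: tendsto_eq_intros)
        show "AE z in P. norm (indicator (K k) z * \<bar>levy_simple_fun (d n) z\<bar>) \<le> real k * indicator (K k) z" for n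
          by (intro AE_I2) (auto simp: K_def split: split_indicator)
      qed (use intK in auto)
      then show "(\<lambda>n. \<integral>z. indicator (K k) z * \<bar>levy_simple_fun (d n) z\<bar> \<partial>P) \<longlonglongrightarrow> 0" by simp
    qed
    have AE_K: "AE z in P. \<forall>\<^sub>F k in sequentially. z \<in> K k"
      using lim P_neg
    proof eventually_elim
      case (elim z)
      obtain C where C: "\<And>n. norm (levy_simple_fun (d n) z) \<le> C"
        using convergent_imp_Bseq[OF convergentI[OF elim(1)]] by (auto simp: Bseq_def)
      obtain k0 where k0: "norm z \<le> real k0" "C \<le> real k0"
        using real_arch_simple[of "max (norm z) C"] by auto
      have "z \<in> K k" if "k \<ge> k0" for k
      proof -
        have "\<bar>levy_simple_fun (d n) z\<bar> \<le> real k" for n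
          using C[of n] k0(2) that by simp
        then show ?thesis using elim(2) k0(1) that by (simp add: K_def)
      qed
      then show ?case by (auto simp: eventually_sequentially)
    qed
    show "(\<lambda>k. sqrt (L2_bound (d n) (neg_half - K k))) \<longlonglongrightarrow> 0" for n
    proof (rule L2_bound_tendsto_0)
      have AE0: "AE z in P. (\<lambda>k. indicator (neg_half - K k) z * c z) \<longlonglongrightarrow> 0" for c :: "_ \<Rightarrow> real"
        using AE_K
      proof eventually_elim
        case (elim z)
        then have "\<forall>\<^sub>F k in sequentially. 0 = indicator (neg_half - K k) z * c z" by eventually_elim simp
        then show ?case by (rule Lim_transform_eventually[OF tendsto_const])
      qed
      have "(\<lambda>k. \<integral>z. indicator (neg_half - K k) z * (levy_simple_fun (d n) z)\<^sup>2 \<partial>P) \<longlonglongrightarrow> (\<integral>z. 0 \<partial>P)"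
        by (rule integral_dominated_convergence[where w = "\<lambda>z. (levy_simple_fun (d n) z)\<^sup>2"])
          (use AE0 simple_fun_square_integrable[OF d] in \<open>auto split: split_indicator\<close>)
      then show "(\<lambda>k. \<integral>z. indicator (neg_half - K k) z * (levy_simple_fun (d n) z)\<^sup>2 \<partial>P) \<longlonglongrightarrow> 0" by simp
      have "(\<lambda>k. \<integral>z. indicator (neg_half - K k) z * \<bar>levy_simple_fun (d n) z\<bar> \<partial>P) \<longlonglongrightarrow> (\<integral>z. 0 \<partial>P)"
        by (rule integral_dominated_convergence[where w = "\<lambda>z. \<bar>levy_simple_fun (d n) z\<bar>"])
          (use AE0 integrable_abs[OF levy_sum_mean(2)[OF d]] in \<open>auto split: split_indicator\<close>)
      then show "(\<lambda>k. \<integral>z. indicator (neg_half - K k) z * \<bar>levy_simple_fun (d n) z\<bar> \<partial>P) \<longlonglongrightarrow> 0" by simp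
    qed
    show "restricted_size (d n) D \<le> sqrt (L2_bound (d n) A) + sqrt (L2_bound (d n) B)"
      if "D \<in> sets borel" "A \<in> sets borel" "B \<in> sets borel" "D \<subseteq> A \<union> B" for n D A B
      using restricted_size_split_le[OF d that] .
    show "restricted_size (d n) (D \<union> E) \<le> restricted_size (d n) D + restricted_size (d n) E"
      if "D \<in> sets borel" "E \<in> sets borel" "D \<inter> E = {}" for n D E
      using restricted_size_Un[OF d that] .
    show "0 \<le> restricted_size (d n) D" for n D by (simp add: restricted_size_def)
    show "Cauchy (\<lambda>n. restricted_size (d n) D)" if D: "D \<in> sets borel" "D \<subseteq> neg_half" for D
    proof (rule metric_CauchyI)
      fix e :: real assume "0 < e"
      then obtain N where N: "\<And>n k. n \<ge> N \<Longrightarrow> k \<ge> N \<Longrightarrow>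
        ky_fan M (\<lambda>\<omega>. levy_sum \<Lambda> (restrict_simple D (d n)) \<omega> - levy_sum \<Lambda> (restrict_simple D (d k)) \<omega>) < e"
        using cauchy[OF D] by blast
      have *: "restricted_size (d n) D \<le> restricted_size (d k) D +
        ky_fan M (\<lambda>\<omega>. levy_sum \<Lambda> (restrict_simple D (d n)) \<omega> - levy_sum \<Lambda> (restrict_simple D (d k)) \<omega>)" for n k
        using ky_fan_add[of "levy_sum \<Lambda> (restrict_simple D (d k))"
            "\<lambda>\<omega>. levy_sum \<Lambda> (restrict_simple D (d n)) \<omega> - levy_sum \<Lambda> (restrict_simple D (d k)) \<omega>"]
          levy_sum_measurable[OF levy_simple_restrict[OF d D(1)]]
        by (simp add: restricted_size_def)
      have "dist (restricted_size (d n) D) (restricted_size (d k) D) < e" if "n \<ge> N" "k \<ge> N" for n k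
        using *[of n k] *[of k n] N[OF that] N[OF that(2,1)] by (simp add: dist_real_def abs_less_iff)
      then show "\<exists>N. \<forall>n\<ge>N. \<forall>k\<ge>N. dist (restricted_size (d n) D) (restricted_size (d k) D) < e" by blast
    qed
  qed
qed

end

section \<open>Moments of integrals\<close>

text \<open>Approximation from below lets \<open>f\<close> itself dominate. The sign of the
  coefficients, and not only of the function, is recorded because it decides the sign of the simple
  integrals.\<close>

definition simple_approx :: "(nat \<Rightarrow> (real \<times> (real \<times> real) set) list) \<Rightarrow> (real \<times> real \<Rightarrow> real) \<Rightarrow> bool" where
  "simple_approx h f \<longleftrightarrow> (\<forall>n. levy_simple (h n)) \<and> (\<forall>n. \<forall>(c, C)\<in>set (h n). 0 \<le> c) \<and>
     (\<forall>z\<in>neg_half. (\<lambda>n. levy_simple_fun (h n) z) \<longlonglongrightarrow> f z) \<and>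
     (\<forall>n. \<forall>z\<in>neg_half. 0 \<le> levy_simple_fun (h n) z \<and> levy_simple_fun (h n) z \<le> f z)"

text \<open>The sets are those where \<open>\<lfloor>i * f z\<rfloor>\<close> takes a given value,
  cut off by the ball of radius \<open>i\<close>. Since \<open>f\<close> is at most 1, the heights
  \<open>j / i\<close> with \<open>j \<le> i\<close> suffice; for \<open>i = 0\<close> the only
  height is \<open>0 / 0 = 0\<close>.\<close>

lemma simple_approx_exists:
  assumes f [measurable]: "f \<in> borel_measurable borel" and f01: "\<forall>z\<in>neg_half. 0 \<le> f z \<and> f z \<le> 1"
  shows "\<exists>h. simple_approx h f"
proof -
  define C where "C i j = (neg_half \<inter> cball 0 (real i)) \<inter> {z \<in> space borel. \<lfloor>real i * f z\<rfloor> = int j}" for i j :: nat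
  define h where "h i = map (\<lambda>j. (real j / real i, C i j)) [0..<Suc i]" for i
  have C_bb: "C i j \<in> bounded_borel" for i j
  proof -
    have "C i j \<in> sets borel" unfolding C_def by (intro sets.Int) auto
    then show ?thesis by (auto simp: bounded_borel_def C_def intro: bounded_subset[OF bounded_cball[of 0 "real i"]])
  qed
  have h_eq: "levy_simple_fun (h i) z = indicator (cball 0 (real i)) z * (real_of_int \<lfloor>real i * f z\<rfloor> / real i)"
    if z: "z \<in> neg_half" for i z
  proof -
    have fl: "0 \<le> \<lfloor>real i * f z\<rfloor>" "\<lfloor>real i * f z\<rfloor> \<le> int i"
      using bspec[OF f01 z] by (auto simp: floor_le_iff mult_left_le intro: order_le_less_trans[of _ "real i"])
    have "levy_simple_fun (h i) z = (\<Sum>j<Suc i. real j / real i * indicator (C i j) z)"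
      by (simp add: levy_simple_fun_def h_def o_def interv_sum_list_conv_sum_set_nat atLeast0LessThan del: upt_Suc)
    also have "\<dots> = (\<Sum>j<Suc i. if j = nat \<lfloor>real i * f z\<rfloor> then indicator (cball 0 (real i)) z * (real j / real i) else 0)"
      using z fl by (intro sum.cong) (auto simp: C_def split: split_indicator)
    also have "\<dots> = indicator (cball 0 (real i)) z * (real_of_int \<lfloor>real i * f z\<rfloor> / real i)"
      using fl by (subst sum.delta) auto
    finally show ?thesis .
  qed
  have "simple_approx h f" unfolding simple_approx_def
  proof (intro conjI allI ballI)
    show "levy_simple (h n)" for n using C_bb by (auto simp: levy_simple_def h_def)
    show "case p of (c, C) \<Rightarrow> 0 \<le> c" if "p \<in> set (h n)" for n p using that by (auto simp: h_def)
    fix z assume z: "z \<in> neg_half"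
    show "0 \<le> levy_simple_fun (h n) z" for n
      using h_eq[OF z] bspec[OF f01 z] by (auto split: split_indicator)
    show "levy_simple_fun (h n) z \<le> f z" for n
    proof (cases "n = 0")
      case True
      then show ?thesis using h_eq[OF z] bspec[OF f01 z] by simp
    next
      case False
      have "real_of_int \<lfloor>real n * f z\<rfloor> / real n \<le> f z"
        using False by (simp add: divide_le_eq mult.commute of_int_floor_le)
      then show ?thesis using h_eq[OF z] bspec[OF f01 z] by (auto split: split_indicator)
    qed
    have "(\<lambda>n. f z - 1 / real n) \<longlonglongrightarrow> f z - 0" by (intro tendsto_intros lim_const_over_n)
    then have lower: "(\<lambda>n. f z - 1 / real n) \<longlonglongrightarrow> f z" by simp
    obtain n0 where n0: "norm z \<le> real n0" using real_arch_simple by blast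
    show "(\<lambda>n. levy_simple_fun (h n) z) \<longlonglongrightarrow> f z"
    proof (rule tendsto_sandwich[OF _ _ lower tendsto_const])
      show "\<forall>\<^sub>F n in sequentially. f z - 1 / real n \<le> levy_simple_fun (h n) z"
        using eventually_ge_at_top[of "max n0 1"]
      proof eventually_elim
        case (elim n)
        have "real n * f z - 1 \<le> real_of_int \<lfloor>real n * f z\<rfloor>" by linarith
        then have "(real n * f z - 1) / real n \<le> real_of_int \<lfloor>real n * f z\<rfloor> / real n"
          by (intro divide_right_mono) auto
        moreover have "(real n * f z - 1) / real n = f z - 1 / real n" using elim by (simp add: field_simps)
        moreover have "z \<in> cball 0 (real n)" using n0 elim by simp
        ultimately show ?case using h_eq[OF z] by simp
      qed
      show "\<forall>\<^sub>F n in sequentially. levy_simple_fun (h n) z \<le> f z"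
        using \<open>\<And>n. levy_simple_fun (h n) z \<le> f z\<close> by simp
    qed
  qed
  then show ?thesis by blast
qed

context levy_L2
begin

lemma restrict_neg_half: "levy_simple g \<Longrightarrow> restrict_simple neg_half g = g"
  unfolding restrict_simple_def levy_simple_def
  by (rule map_idI) (auto simp: bounded_borel_def)

lemma levy_sum_minus: "levy_sum \<Lambda> (g @ scale_simple (-1) h) = (\<lambda>\<omega>. levy_sum \<Lambda> g \<omega> - levy_sum \<Lambda> h \<omega>)"
  by (simp add: fun_eq_iff)

lemma integrable_square_of_unit:
  fixes f :: "real \<times> real \<Rightarrow> real"
  assumes [measurable]: "f \<in> borel_measurable borel" and f01: "\<forall>z\<in>neg_half. 0 \<le> f z \<and> f z \<le> 1"
    and f: "integrable P f"
  shows "integrable P (\<lambda>z. (f z)\<^sup>2)"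
proof (rule Bochner_Integration.integrable_bound[OF f])
  show "AE z in P. norm ((f z)\<^sup>2) \<le> norm (f z)"
    using P_neg by eventually_elim (use f01 in \<open>auto simp: power2_eq_square mult_left_le\<close>)
qed simp

text \<open>A Cauchy estimate, uniform in \<open>D\<close>. In the additive form
  \<open>e n + e k\<close> it survives letting \<open>k\<close> tend to infinity and then leaves
  \<open>e n\<close> as the distance to the limit.\<close>

lemma simple_approx_L2:
  assumes f [measurable]: "f \<in> borel_measurable borel" and f01: "\<forall>z\<in>neg_half. 0 \<le> f z \<and> f z \<le> 1"
    and f1: "integrable P f" and h: "simple_approx h f"
  shows "\<exists>e. e \<longlonglongrightarrow> 0 \<and> (\<forall>n k D. D \<in> sets borel \<longrightarrow>
     L2_bound (h n @ scale_simple (-1) (h k)) D \<le> e n + e k)"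
proof -
  have hs: "levy_simple (h n)" for n using h by (simp add: simple_approx_def)
  have [measurable]: "levy_simple_fun (h n) \<in> borel_measurable P" for n by (rule simple_fun_measurable[OF hs])
  have [measurable]: "f \<in> borel_measurable P" using f sets_P by (simp cong: measurable_cong_sets)
  note f2 = integrable_square_of_unit[OF f f01 f1]
  define a where "a n = (\<integral>z. (levy_simple_fun (h n) z - f z)\<^sup>2 \<partial>P)" for n
  define b where "b n = (\<integral>z. \<bar>levy_simple_fun (h n) z - f z\<bar> \<partial>P)" for n
  have AE_le: "AE z in P. \<bar>levy_simple_fun (h n) z - f z\<bar> \<le> f z" for n
    using P_neg by eventually_elim (use h f01 in \<open>fastforce simp: simple_approx_def abs_le_iff\<close>)
  have AE_le2: "AE z in P. (levy_simple_fun (h n) z - f z)\<^sup>2 \<le> (f z)\<^sup>2" for n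
    using AE_le[of n] by eventually_elim (simp add: abs_le_square_iff[symmetric])
  have ia: "integrable P (\<lambda>z. (levy_simple_fun (h n) z - f z)\<^sup>2)" for n
    by (rule Bochner_Integration.integrable_bound[OF f2]) (use AE_le2 in auto)
  have ib: "integrable P (\<lambda>z. \<bar>levy_simple_fun (h n) z - f z\<bar>)" for n
    by (rule Bochner_Integration.integrable_bound[OF f1]) (use AE_le[of n] in \<open>auto elim: eventually_mono\<close>)
  have lim: "AE z in P. (\<lambda>n. levy_simple_fun (h n) z - f z) \<longlonglongrightarrow> 0"
    using P_neg by eventually_elim (use h in \<open>auto simp: simple_approx_def intro!: LIM_zero\<close>)
  have a0: "a \<longlonglongrightarrow> 0"
  proof -
    have "a \<longlonglongrightarrow> (\<integral>z. 0 \<partial>P)" unfolding a_def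
    proof (rule integral_dominated_convergence[where w = "\<lambda>z. (f z)\<^sup>2"])
      show "AE z in P. (\<lambda>n. (levy_simple_fun (h n) z - f z)\<^sup>2) \<longlonglongrightarrow> 0"
        using lim by eventually_elim (use tendsto_power[of _ 0 _ 2] in force)
    qed (use AE_le2 f2 in auto)
    then show ?thesis by simp
  qed
  have b0: "b \<longlonglongrightarrow> 0"
  proof -
    have "b \<longlonglongrightarrow> (\<integral>z. 0 \<partial>P)" unfolding b_def
    proof (rule integral_dominated_convergence[where w = f])
      show "AE z in P. (\<lambda>n. \<bar>levy_simple_fun (h n) z - f z\<bar>) \<longlonglongrightarrow> 0"
        using lim by eventually_elim (rule tendsto_rabs_zero)
      show "AE z in P. norm \<bar>levy_simple_fun (h n) z - f z\<bar> \<le> f z" for n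
        using AE_le by simp
    qed (use f1 in auto)
    then show ?thesis by simp
  qed
  define e where "e n = 2 * (v * a n + (m * b n)\<^sup>2)" for n
  have "e \<longlonglongrightarrow> 2 * (v * 0 + (m * 0)\<^sup>2)" unfolding e_def by (intro tendsto_intros a0 b0)
  moreover have "L2_bound (h n @ scale_simple (-1) (h k)) D \<le> e n + e k" if "D \<in> sets borel" for n k D
  proof -
    let ?d = "h n @ scale_simple (-1) (h k)"
    have d: "levy_simple ?d" using hs by simp
    have "L2_bound ?d D \<le> L2_bound ?d UNIV" by (rule L2_bound_mono[OF d]) (use that in auto)
    also have "\<dots> = v * (\<integral>z. (levy_simple_fun (h n) z - levy_simple_fun (h k) z)\<^sup>2 \<partial>P)
        + (m * (\<integral>z. \<bar>levy_simple_fun (h n) z - levy_simple_fun (h k) z\<bar> \<partial>P))\<^sup>2"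
      by (simp add: L2_bound_def)
    also have "\<dots> \<le> v * (2 * a n + 2 * a k) + (m * (b n + b k))\<^sup>2"
    proof (rule add_mono)
      have "(\<integral>z. (levy_simple_fun (h n) z - levy_simple_fun (h k) z)\<^sup>2 \<partial>P)
        \<le> (\<integral>z. 2 * (levy_simple_fun (h n) z - f z)\<^sup>2 + 2 * (levy_simple_fun (h k) z - f z)\<^sup>2 \<partial>P)"
      proof (rule integral_mono)
        show "integrable P (\<lambda>z. (levy_simple_fun (h n) z - levy_simple_fun (h k) z)\<^sup>2)"
          using simple_fun_square_integrable[OF d] by simp
        show "(levy_simple_fun (h n) z - levy_simple_fun (h k) z)\<^sup>2
          \<le> 2 * (levy_simple_fun (h n) z - f z)\<^sup>2 + 2 * (levy_simple_fun (h k) z - f z)\<^sup>2" for z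
          using square_diff_le[of "levy_simple_fun (h n) z - f z" "levy_simple_fun (h k) z - f z"] by simp
      qed (use ia in auto)
      also have "\<dots> = 2 * a n + 2 * a k" using ia by (simp add: a_def)
      finally show "v * (\<integral>z. (levy_simple_fun (h n) z - levy_simple_fun (h k) z)\<^sup>2 \<partial>P) \<le> v * (2 * a n + 2 * a k)"
        using v_nonneg by (rule mult_left_mono)
      have "(\<integral>z. \<bar>levy_simple_fun (h n) z - levy_simple_fun (h k) z\<bar> \<partial>P)
        \<le> (\<integral>z. \<bar>levy_simple_fun (h n) z - f z\<bar> + \<bar>levy_simple_fun (h k) z - f z\<bar> \<partial>P)"
      proof (rule integral_mono)
        show "integrable P (\<lambda>z. \<bar>levy_simple_fun (h n) z - levy_simple_fun (h k) z\<bar>)"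
          using integrable_abs[OF levy_sum_mean(2)[OF d]] by simp
      qed (use ib in auto)
      also have "\<dots> = b n + b k" using ib by (simp add: b_def)
      finally have "(\<integral>z. \<bar>levy_simple_fun (h n) z - levy_simple_fun (h k) z\<bar> \<partial>P) \<le> b n + b k" .
      moreover have "0 \<le> (\<integral>z. \<bar>levy_simple_fun (h n) z - levy_simple_fun (h k) z\<bar> \<partial>P)" by simp
      ultimately show "(m * (\<integral>z. \<bar>levy_simple_fun (h n) z - levy_simple_fun (h k) z\<bar> \<partial>P))\<^sup>2 \<le> (m * (b n + b k))\<^sup>2"
        unfolding power_mult_distrib by (intro mult_left_mono power_mono) auto
    qed
    also have "\<dots> \<le> e n + e k"
      using square_add_le[of "m * b n" "m * b k"] by (simp add: e_def distrib_left)
    finally show ?thesis .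
  qed
  ultimately show ?thesis by (intro exI[of _ e]) auto
qed

text \<open>The definition of \<open>Z\<close> provides some sequence \<open>g\<close>, about whose
  moments nothing is known. Its difference from the well behaved \<open>h\<close> tends to 0 almost
  everywhere and is Cauchy in probability over each \<open>D\<close>, because both sequences are. By
  \<open>levy_sum_null\<close> the integrals of \<open>h\<close> therefore converge to the same
  \<open>Z\<close>, and their mean square estimates pass on to \<open>Z\<close>.\<close>

lemma levy_integral_approx:
  assumes P: "P = \<pi> \<Otimes>\<^sub>M lborel" and Z: "has_levy_integral M \<Lambda> \<pi> f Z"
    and f [measurable]: "f \<in> borel_measurable borel" and f01: "\<forall>z\<in>neg_half. 0 \<le> f z \<and> f z \<le> 1"
    and f1: "integrable P f" and h: "simple_approx h f"
  shows "Z \<in> borel_measurable M" "integrable M (\<lambda>\<omega>. (Z \<omega>)\<^sup>2)"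
    "\<And>n. integrable M (\<lambda>\<omega>. (levy_sum \<Lambda> (h n) \<omega> - Z \<omega>)\<^sup>2)"
    "(\<lambda>n. expectation (\<lambda>\<omega>. (levy_sum \<Lambda> (h n) \<omega> - Z \<omega>)\<^sup>2)) \<longlonglongrightarrow> 0"
    "(\<lambda>n. ky_fan M (\<lambda>\<omega>. levy_sum \<Lambda> (h n) \<omega> - Z \<omega>)) \<longlonglongrightarrow> 0"
proof -
  obtain g where gs: "\<And>n. levy_simple (g n)"
    and g_lim: "AE z in P. (\<lambda>n. levy_simple_fun (g n) z) \<longlonglongrightarrow> f z"
    and g_D: "\<And>D. D \<in> sets borel \<Longrightarrow> D \<subseteq> neg_half \<Longrightarrow> \<exists>Z'. conv_in_prob M (\<lambda>n. levy_sum \<Lambda> (restrict_simple D (g n))) Z'"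
    and "conv_in_prob M (\<lambda>n. levy_sum \<Lambda> (restrict_simple neg_half (g n))) Z"
    using Z unfolding has_levy_integral_def P[symmetric] levy_simple_integral_eq by blast
  then have g_Z: "conv_in_prob M (\<lambda>n. levy_sum \<Lambda> (g n)) Z" by (simp only: restrict_neg_half[OF gs])
  show mZ [measurable]: "Z \<in> borel_measurable M" using g_Z by (simp add: conv_in_prob_def)
  have hs: "levy_simple (h n)" for n using h by (simp add: simple_approx_def)
  obtain e where e: "e \<longlonglongrightarrow> 0" "\<And>n k D. D \<in> sets borel \<Longrightarrow> L2_bound (h n @ scale_simple (-1) (h k)) D \<le> e n + e k"
    using simple_approx_L2[OF f f01 f1 h] by blast
  note [measurable] = levy_sum_measurable[OF gs] levy_sum_measurable[OF hs]
  have hD: "integrable M (\<lambda>\<omega>. (levy_sum \<Lambda> (restrict_simple D (h n)) \<omega> - levy_sum \<Lambda> (restrict_simple D (h k)) \<omega>)\<^sup>2)"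
    "expectation (\<lambda>\<omega>. (levy_sum \<Lambda> (restrict_simple D (h n)) \<omega> - levy_sum \<Lambda> (restrict_simple D (h k)) \<omega>)\<^sup>2) \<le> e n + e k"
    if D: "D \<in> sets borel" for D n k
    using levy_sum_square_le[of "h n @ scale_simple (-1) (h k)" D] hs D e(2)[OF D, of n k] by auto
  have e_small: "\<exists>N. \<forall>n\<ge>N. e n < \<epsilon>" if "0 < \<epsilon>" for \<epsilon>
    using order_tendstoD(2)[OF e(1) that] by (auto simp: eventually_sequentially)
  define d where "d n = g n @ scale_simple (-1) (h n)" for n
  have ds: "levy_simple (d n)" for n using gs hs by (simp add: d_def)
  have "(\<lambda>n. restricted_size (d n) neg_half) \<longlonglongrightarrow> 0"
  proof (rule levy_sum_null[OF ds])
    show "AE z in P. (\<lambda>n. levy_simple_fun (d n) z) \<longlonglongrightarrow> 0"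
      using g_lim P_neg
    proof eventually_elim
      case (elim z)
      then have "(\<lambda>n. levy_simple_fun (h n) z) \<longlonglongrightarrow> f z" using h by (auto simp: simple_approx_def)
      from tendsto_diff[OF elim(1) this] show ?case by (simp add: d_def)
    qed
    fix D :: "(real \<times> real) set" and \<epsilon> :: real
    assume D: "D \<in> sets borel" "D \<subseteq> neg_half" and \<epsilon>: "0 < \<epsilon>"
    obtain Z' where Z': "conv_in_prob M (\<lambda>n. levy_sum \<Lambda> (restrict_simple D (g n))) Z'" using g_D[OF D] by blast
    define G H where "G n = levy_sum \<Lambda> (restrict_simple D (g n))" and "H n = levy_sum \<Lambda> (restrict_simple D (h n))" for n
    have [measurable]: "G n \<in> borel_measurable M" "H n \<in> borel_measurable M" for n
      unfolding G_def H_def using gs hs D by (auto intro!: levy_sum_measurable)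
    have [measurable]: "Z' \<in> borel_measurable M" using Z' by (simp add: conv_in_prob_def)
    obtain N1 where N1: "\<And>n. n \<ge> N1 \<Longrightarrow> ky_fan M (\<lambda>\<omega>. G n \<omega> - Z' \<omega>) < \<epsilon> / 4"
      using order_tendstoD(2)[OF conv_in_prob_ky_fan[OF Z'], of "\<epsilon> / 4"] \<epsilon>
      by (auto simp: eventually_sequentially G_def)
    \<comment> \<open>With \<open>e n + e k < \<epsilon>\<^sup>2 / 16\<close>, the \<open>H\<close>
      part is at most \<open>\<epsilon> / 4\<close>. The two \<open>G\<close> parts add less than
      \<open>\<epsilon> / 2\<close>.\<close>
    obtain N2 where N2: "\<And>n. n \<ge> N2 \<Longrightarrow> e n < \<epsilon>\<^sup>2 / 32" using e_small[of "\<epsilon>\<^sup>2 / 32"] \<epsilon> by auto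
    have "ky_fan M (\<lambda>\<omega>. levy_sum \<Lambda> (restrict_simple D (d n)) \<omega> - levy_sum \<Lambda> (restrict_simple D (d k)) \<omega>) < \<epsilon>"
      if n: "n \<ge> max N1 N2" "k \<ge> max N1 N2" for n k
    proof -
      have "ky_fan M (\<lambda>\<omega>. levy_sum \<Lambda> (restrict_simple D (d n)) \<omega> - levy_sum \<Lambda> (restrict_simple D (d k)) \<omega>)
        = ky_fan M (\<lambda>\<omega>. (G n \<omega> - G k \<omega>) - (H n \<omega> - H k \<omega>))"
        by (simp add: d_def G_def H_def algebra_simps)
      also have "\<dots> \<le> ky_fan M (\<lambda>\<omega>. G n \<omega> - G k \<omega>) + ky_fan M (\<lambda>\<omega>. H n \<omega> - H k \<omega>)"
        by (rule ky_fan_diff) measurable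
      also have "ky_fan M (\<lambda>\<omega>. G n \<omega> - G k \<omega>) \<le> ky_fan M (\<lambda>\<omega>. G n \<omega> - Z' \<omega>) + ky_fan M (\<lambda>\<omega>. Z' \<omega> - G k \<omega>)"
        by (rule ky_fan_triangle) measurable
      also have "ky_fan M (\<lambda>\<omega>. H n \<omega> - H k \<omega>) \<le> sqrt (expectation (\<lambda>\<omega>. (H n \<omega> - H k \<omega>)\<^sup>2))"
        by (rule ky_fan_le_L2, measurable, simp only: H_def, rule hD(1)[OF D(1)])
      also have "\<dots> \<le> sqrt (e n + e k)" using hD(2)[OF D(1)] by (simp add: H_def)
      also have "\<dots> \<le> sqrt ((\<epsilon> / 4)\<^sup>2)"
        using N2[of n] N2[of k] n by (intro real_sqrt_le_mono) (simp add: power_divide)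
      also have "\<dots> = \<epsilon> / 4" using \<epsilon> by simp
      finally show ?thesis using N1[of n] N1[of k] n \<epsilon> ky_fan_commute[of Z' "G k"] by simp
    qed
    then show "\<exists>N. \<forall>n\<ge>N. \<forall>k\<ge>N.
       ky_fan M (\<lambda>\<omega>. levy_sum \<Lambda> (restrict_simple D (d n)) \<omega> - levy_sum \<Lambda> (restrict_simple D (d k)) \<omega>) < \<epsilon>"
      by blast
  qed
  then have gh: "(\<lambda>n. ky_fan M (\<lambda>\<omega>. levy_sum \<Lambda> (g n) \<omega> - levy_sum \<Lambda> (h n) \<omega>)) \<longlonglongrightarrow> 0"
    by (simp add: restricted_size_def d_def levy_sum_minus restrict_neg_half[OF gs] restrict_neg_half[OF hs])
  show kf: "(\<lambda>n. ky_fan M (\<lambda>\<omega>. levy_sum \<Lambda> (h n) \<omega> - Z \<omega>)) \<longlonglongrightarrow> 0"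
  proof (rule Lim_null_comparison[OF _ tendsto_add_zero[OF gh conv_in_prob_ky_fan[OF g_Z]]])
    show "\<forall>\<^sub>F n in sequentially. norm (ky_fan M (\<lambda>\<omega>. levy_sum \<Lambda> (h n) \<omega> - Z \<omega>))
      \<le> ky_fan M (\<lambda>\<omega>. levy_sum \<Lambda> (g n) \<omega> - levy_sum \<Lambda> (h n) \<omega>) + ky_fan M (\<lambda>\<omega>. levy_sum \<Lambda> (g n) \<omega> - Z \<omega>)"
      using ky_fan_triangle[of "levy_sum \<Lambda> (h n)" "levy_sum \<Lambda> (g n)" Z for n]
      by (intro always_eventually allI) (simp add: ky_fan_commute[of "levy_sum \<Lambda> (h _)" "levy_sum \<Lambda> (g _)"])
  qed
  have hh: "integrable M (\<lambda>\<omega>. (levy_sum \<Lambda> (h n) \<omega> - levy_sum \<Lambda> (h k) \<omega>)\<^sup>2)"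
    "expectation (\<lambda>\<omega>. (levy_sum \<Lambda> (h n) \<omega> - levy_sum \<Lambda> (h k) \<omega>)\<^sup>2) \<le> e n + e k" for n k
    using hD[OF neg_half_borel, of n k] by (simp_all add: restrict_neg_half[OF hs])
  have fatou: "integrable M (\<lambda>\<omega>. (levy_sum \<Lambda> (h n) \<omega> - Z \<omega>)\<^sup>2) \<and> expectation (\<lambda>\<omega>. (levy_sum \<Lambda> (h n) \<omega> - Z \<omega>)\<^sup>2) \<le> c"
    if "\<And>k. k \<ge> N \<Longrightarrow> e n + e k \<le> c" for n N c
    using moment_limit_le[of "\<lambda>n. levy_sum \<Lambda> (h n)" Z "levy_sum \<Lambda> (h n)" N 2 c] kf hh
      order_trans[OF hh(2) that] by simp
  obtain N1 where N1: "\<And>n. n \<ge> N1 \<Longrightarrow> e n < 1" using e_small[of 1] by auto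
  have "integrable M (\<lambda>\<omega>. (levy_sum \<Lambda> (h N1) \<omega> - Z \<omega>)\<^sup>2)"
    using fatou[of N1 N1 2] N1 by (smt (verit) order_refl)
  moreover have hsq: "integrable M (\<lambda>\<omega>. (levy_sum \<Lambda> (h n) \<omega>)\<^sup>2)" for n
    using levy_sum_covariance(1)[OF hs hs] by (simp add: power2_eq_square)
  ultimately show Z2: "integrable M (\<lambda>\<omega>. (Z \<omega>)\<^sup>2)"
    using integrable_add_L2(2)[of "levy_sum \<Lambda> (h N1)" M "\<lambda>\<omega>. levy_sum \<Lambda> (h N1) \<omega> - Z \<omega>"] by simp
  show int: "integrable M (\<lambda>\<omega>. (levy_sum \<Lambda> (h n) \<omega> - Z \<omega>)\<^sup>2)" for n
    by (intro integrable_add_L2 hsq Z2) auto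
  show "(\<lambda>n. expectation (\<lambda>\<omega>. (levy_sum \<Lambda> (h n) \<omega> - Z \<omega>)\<^sup>2)) \<longlonglongrightarrow> 0"
  proof (rule LIMSEQ_I)
    fix r :: real assume r: "0 < r"
    obtain N where N: "\<And>n. n \<ge> N \<Longrightarrow> e n < r / 4" using e_small[of "r / 4"] r by auto
    have "norm (expectation (\<lambda>\<omega>. (levy_sum \<Lambda> (h n) \<omega> - Z \<omega>)\<^sup>2) - 0) < r" if "n \<ge> N" for n
    proof -
      have "e n + e k \<le> r / 2" if "k \<ge> N" for k using N[OF that] N[OF \<open>n \<ge> N\<close>] by simp
      then have "expectation (\<lambda>\<omega>. (levy_sum \<Lambda> (h n) \<omega> - Z \<omega>)\<^sup>2) \<le> r / 2" using fatou[of N n "r / 2"] by blast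
      then show ?thesis using r by simp
    qed
    then show "\<exists>N. \<forall>n\<ge>N. norm (expectation (\<lambda>\<omega>. (levy_sum \<Lambda> (h n) \<omega> - Z \<omega>)\<^sup>2) - 0) < r" by blast
  qed
qed

lemma simple_integrals_tendsto:
  assumes f [measurable]: "f \<in> borel_measurable borel" and f01: "\<forall>z\<in>neg_half. 0 \<le> f z \<and> f z \<le> 1"
    and f1: "integrable P f" and h: "simple_approx h f"
    and g [measurable]: "g \<in> borel_measurable borel" and g01: "\<forall>z\<in>neg_half. 0 \<le> g z \<and> g z \<le> 1"
    and g1: "integrable P g" and k: "simple_approx k g"
  shows "(\<lambda>n. \<integral>z. levy_simple_fun (h n) z \<partial>P) \<longlonglongrightarrow> (\<integral>z. f z \<partial>P)"
    "(\<lambda>n. \<integral>z. levy_simple_fun (h n) z * levy_simple_fun (k n) z \<partial>P) \<longlonglongrightarrow> (\<integral>z. f z * g z \<partial>P)"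
proof -
  have [measurable]: "levy_simple_fun (h n) \<in> borel_measurable P" "levy_simple_fun (k n) \<in> borel_measurable P" for n
    using h k by (auto intro!: simple_fun_measurable simp: simple_approx_def)
  have [measurable]: "f \<in> borel_measurable P" "g \<in> borel_measurable P" using f g sets_P by (auto cong: measurable_cong_sets)
  show "(\<lambda>n. \<integral>z. levy_simple_fun (h n) z \<partial>P) \<longlonglongrightarrow> (\<integral>z. f z \<partial>P)"
  proof (rule integral_dominated_convergence[where w = f])
    show "AE z in P. (\<lambda>n. levy_simple_fun (h n) z) \<longlonglongrightarrow> f z"
      using P_neg by eventually_elim (use h in \<open>auto simp: simple_approx_def\<close>)
    show "AE z in P. norm (levy_simple_fun (h n) z) \<le> f z" for n
      using P_neg by eventually_elim (use h in \<open>auto simp: simple_approx_def\<close>)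
  qed (use f1 in auto)
  show "(\<lambda>n. \<integral>z. levy_simple_fun (h n) z * levy_simple_fun (k n) z \<partial>P) \<longlonglongrightarrow> (\<integral>z. f z * g z \<partial>P)"
  proof (rule integral_dominated_convergence[where w = f])
    show "AE z in P. (\<lambda>n. levy_simple_fun (h n) z * levy_simple_fun (k n) z) \<longlonglongrightarrow> f z * g z"
      using P_neg by eventually_elim (use h k in \<open>auto simp: simple_approx_def intro!: tendsto_mult\<close>)
    show "AE z in P. norm (levy_simple_fun (h n) z * levy_simple_fun (k n) z) \<le> f z" for n
      using P_neg
    proof eventually_elim
      case (elim z)
      have "0 \<le> levy_simple_fun (h n) z" "levy_simple_fun (h n) z \<le> f z" "0 \<le> levy_simple_fun (k n) z" "levy_simple_fun (k n) z \<le> g z"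
        using h k elim by (auto simp: simple_approx_def)
      moreover from this(4) have "levy_simple_fun (k n) z \<le> 1" using bspec[OF g01 elim] by simp
      ultimately have "0 \<le> levy_simple_fun (h n) z" "levy_simple_fun (h n) z \<le> f z" "0 \<le> levy_simple_fun (k n) z" "levy_simple_fun (k n) z \<le> 1"
        by blast+
      then have "levy_simple_fun (h n) z * levy_simple_fun (k n) z \<le> f z * 1" by (intro mult_mono) auto
      then show ?case using \<open>0 \<le> levy_simple_fun (h n) z\<close> \<open>0 \<le> levy_simple_fun (k n) z\<close> by simp
    qed
  qed (use f1 in auto)
qed

text \<open>The formulas for simple functions pass to the limit: on the side of the integrals by
  mean square convergence, on the side of the kernels by dominated convergence.\<close>

theorem levy_integral_moments:
  assumes P: "P = \<pi> \<Otimes>\<^sub>M lborel"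
    and Z: "has_levy_integral M \<Lambda> \<pi> f Z" "f \<in> borel_measurable borel" "\<forall>z\<in>neg_half. 0 \<le> f z \<and> f z \<le> 1" "integrable P f"
    and Z': "has_levy_integral M \<Lambda> \<pi> g Z'" "g \<in> borel_measurable borel" "\<forall>z\<in>neg_half. 0 \<le> g z \<and> g z \<le> 1" "integrable P g"
  shows "Z \<in> borel_measurable M" "integrable M (\<lambda>\<omega>. (Z \<omega>)\<^sup>2)" "expectation Z = m * (\<integral>z. f z \<partial>P)"
    "expectation (\<lambda>\<omega>. Z \<omega> * Z' \<omega>) = v * (\<integral>z. f z * g z \<partial>P) + m\<^sup>2 * (\<integral>z. f z \<partial>P) * (\<integral>z. g z \<partial>P)"
proof -
  obtain h where h: "simple_approx h f" using simple_approx_exists[of f] Z by blast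
  obtain k where k: "simple_approx k g" using simple_approx_exists[of g] Z' by blast
  note A = levy_integral_approx[OF P Z h] and B = levy_integral_approx[OF P Z' k]
  show "Z \<in> borel_measurable M" by (fact A(1))
  show "integrable M (\<lambda>\<omega>. (Z \<omega>)\<^sup>2)" by (fact A(2))
  have hs: "levy_simple (h n)" "levy_simple (k n)" for n using h k by (auto simp: simple_approx_def)
  note [measurable] = levy_sum_measurable[OF hs(1)] levy_sum_measurable[OF hs(2)] A(1) B(1)
  note T = simple_integrals_tendsto[OF Z(2-4) h Z'(2-4) k] simple_integrals_tendsto(1)[OF Z'(2-4) k Z(2-4) h]
  have "(\<lambda>n. expectation (\<lambda>\<omega>. levy_sum \<Lambda> (h n) \<omega> * 1)) \<longlonglongrightarrow> expectation (\<lambda>\<omega>. Z \<omega> * 1)"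
    by (rule L2_limit_product) (use A in auto)
  moreover have "(\<lambda>n. expectation (\<lambda>\<omega>. levy_sum \<Lambda> (h n) \<omega> * 1)) \<longlonglongrightarrow> m * (\<integral>z. f z \<partial>P)"
    using tendsto_mult_left[OF T(1), of m] by (simp add: levy_sum_mean(3)[OF hs(1)])
  ultimately show "expectation Z = m * (\<integral>z. f z \<partial>P)" using LIMSEQ_unique by fastforce
  have "(\<lambda>n. expectation (\<lambda>\<omega>. levy_sum \<Lambda> (h n) \<omega> * levy_sum \<Lambda> (k n) \<omega>)) \<longlonglongrightarrow> expectation (\<lambda>\<omega>. Z \<omega> * Z' \<omega>)"
    by (rule L2_limit_product) (use A B in auto)
  moreover have "(\<lambda>n. expectation (\<lambda>\<omega>. levy_sum \<Lambda> (h n) \<omega> * levy_sum \<Lambda> (k n) \<omega>)) \<longlonglongrightarrow>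
     v * (\<integral>z. f z * g z \<partial>P) + m\<^sup>2 * (\<integral>z. f z \<partial>P) * (\<integral>z. g z \<partial>P)"
    unfolding levy_sum_covariance(3)[OF hs] by (intro tendsto_intros T)
  ultimately show "expectation (\<lambda>\<omega>. Z \<omega> * Z' \<omega>) = v * (\<integral>z. f z * g z \<partial>P) + m\<^sup>2 * (\<integral>z. f z \<partial>P) * (\<integral>z. g z \<partial>P)"
    by (rule LIMSEQ_unique)
qed

lemma generated_events_subset: "generated_events M \<Lambda> bounded_borel \<subseteq> sets M"
  unfolding generated_events_def
  by (rule sets.sigma_sets_subset) (auto intro!: measurable_sets[OF basis_measurable])

text \<open>Along a subsequence the simple integrals converge almost surely. Their coefficients and
  the values of the basis are nonnegative, which gives the sign. The pointwise \<open>lim\<close> of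
  the subsequence is defined everywhere and measurable in the events of the basis, hence a version
  of the kind sought.\<close>

theorem levy_integral_nonneg_version:
  assumes P: "P = \<pi> \<Otimes>\<^sub>M lborel"
    and Z: "has_levy_integral M \<Lambda> \<pi> f Z" "f \<in> borel_measurable borel" "\<forall>z\<in>neg_half. 0 \<le> f z \<and> f z \<le> 1" "integrable P f"
    and nn: "\<And>C. C \<in> bounded_borel \<Longrightarrow> AE \<omega> in M. 0 \<le> \<Lambda> C \<omega>"
  shows "AE \<omega> in M. 0 \<le> Z \<omega>"
    "\<exists>Z'\<in>borel_measurable (sigma (space M) (generated_events M \<Lambda> bounded_borel)). AE \<omega> in M. Z \<omega> = Z' \<omega>"
proof -
  obtain h where h: "simple_approx h f" using simple_approx_exists[of f] Z by blast
  note A = levy_integral_approx[OF P Z h]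
  have hs: "levy_simple (h n)" for n using h by (auto simp: simple_approx_def)
  note [measurable] = levy_sum_measurable[OF hs] A(1)
  obtain r where r: "strict_mono r" "AE \<omega> in M. (\<lambda>n. levy_sum \<Lambda> (h (r n)) \<omega>) \<longlonglongrightarrow> Z \<omega>"
    using AE_subseq_of_ky_fan[OF _ _ A(5)] by auto
  have "AE \<omega> in M. 0 \<le> levy_sum \<Lambda> g \<omega>" if "levy_simple g" "\<forall>(c, C)\<in>set g. 0 \<le> c" for g
    using that
  proof (induction g)
    case (Cons p g)
    obtain c C where p: "p = (c, C)" by (cases p)
    have "AE \<omega> in M. 0 \<le> \<Lambda> C \<omega>" "AE \<omega> in M. 0 \<le> levy_sum \<Lambda> g \<omega>" using Cons nn by (auto simp: p)
    then show ?case by eventually_elim (use Cons in \<open>auto simp: p\<close>)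
  qed simp
  then have "AE \<omega> in M. \<forall>n. 0 \<le> levy_sum \<Lambda> (h n) \<omega>"
    using h by (subst AE_all_countable) (auto simp: simple_approx_def)
  with r(2) show "AE \<omega> in M. 0 \<le> Z \<omega>"
    by eventually_elim (rule LIMSEQ_le_const, auto)
  let ?G = "sigma (space M) (generated_events M \<Lambda> bounded_borel)"
  have sub: "generated_events M \<Lambda> bounded_borel \<subseteq> Pow (space M)"
    using generated_events_subset sets.space_closed by blast
  have mC: "\<Lambda> C \<in> borel_measurable ?G" if "C \<in> bounded_borel" for C
  proof (rule measurableI)
    fix A :: "real set" assume "A \<in> sets borel"
    then show "\<Lambda> C -` A \<inter> space ?G \<in> sets ?G"
      using that sub by (auto simp: generated_events_def space_measure_of_conv intro!: in_measure_of sigma_sets.Basic)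
  qed simp
  have mS: "levy_sum \<Lambda> g \<in> borel_measurable ?G" if "levy_simple g" for g
    using that
  proof (induction g)
    case Nil
    have "levy_sum \<Lambda> [] = (\<lambda>\<omega>. 0)" by (simp add: fun_eq_iff)
    then show ?case by simp
  next
    case (Cons p g)
    obtain c C where p: "p = (c, C)" by (cases p)
    have [measurable]: "\<Lambda> C \<in> borel_measurable ?G" "levy_sum \<Lambda> g \<in> borel_measurable ?G"
      using Cons mC by (auto simp: p)
    have "levy_sum \<Lambda> (p # g) = (\<lambda>\<omega>. c * \<Lambda> C \<omega> + levy_sum \<Lambda> g \<omega>)" by (simp add: fun_eq_iff p)
    then show ?case by simp
  qed
  show "\<exists>Z'\<in>borel_measurable ?G. AE \<omega> in M. Z \<omega> = Z' \<omega>"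
  proof (intro bexI)
    show "AE \<omega> in M. Z \<omega> = lim (\<lambda>n. levy_sum \<Lambda> (h (r n)) \<omega>)"
      using r(2) by eventually_elim (simp add: limI)
    show "(\<lambda>\<omega>. lim (\<lambda>n. levy_sum \<Lambda> (h (r n)) \<omega>)) \<in> borel_measurable ?G"
      using mS[OF hs] by (intro borel_measurable_lim_metric)
  qed
qed

end

section \<open>The supOU kernel under a Gamma mean reversion law\<close>

text \<open>Euler's integral after the substitution \<open>t = c * r\<close>.\<close>

lemma nn_integral_gamma_scaled:
  assumes z: "0 < z" and c: "0 < (c::real)"
  shows "(\<integral>\<^sup>+r. ennreal (indicator {0..} r * r powr (z - 1) * exp (- (c * r))) \<partial>lborel) = ennreal (Gamma z * c powr (- z))"
proof -
  let ?I = "\<integral>\<^sup>+r. ennreal (indicator {0..} r * r powr (z - 1) * exp (- (c * r))) \<partial>lborel"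
  have "ennreal (Gamma z) = (\<integral>\<^sup>+t. ennreal (indicator {0..} t * t powr (z - 1) / exp t) \<partial>lborel)"
    using Gamma_conv_nn_integral_real[OF z] by simp
  also have "\<dots> = \<bar>c\<bar> * (\<integral>\<^sup>+r. ennreal (indicator {0..} (0 + c * r) * (0 + c * r) powr (z - 1) / exp (0 + c * r)) \<partial>lborel)"
    by (rule nn_integral_real_affine) (use c in auto)
  also have "(\<integral>\<^sup>+r. ennreal (indicator {0..} (0 + c * r) * (0 + c * r) powr (z - 1) / exp (0 + c * r)) \<partial>lborel)
     = (\<integral>\<^sup>+r. ennreal (c powr (z - 1)) * ennreal (indicator {0..} r * r powr (z - 1) * exp (- (c * r))) \<partial>lborel)"
    using c by (intro nn_integral_cong)
      (auto simp: ennreal_mult[symmetric] powr_mult exp_minus field_simps zero_le_mult_iff split: split_indicator)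
  also have "\<dots> = ennreal (c powr (z - 1)) * ?I" by (rule nn_integral_cmult) simp
  finally have "ennreal (Gamma z) = ennreal (c * c powr (z - 1)) * ?I"
    using c by (simp add: ennreal_mult mult.assoc)
  also have "c * c powr (z - 1) = c powr z" using c by (simp add: powr_mult_base)
  finally have "ennreal (c powr (- z)) * ennreal (Gamma z) = (ennreal (c powr (- z)) * ennreal (c powr z)) * ?I"
    by (simp add: mult.assoc)
  also have "ennreal (c powr (- z)) * ennreal (c powr z) = 1"
    using c by (simp add: ennreal_mult[symmetric] powr_add[symmetric])
  finally show ?thesis using c z by (simp add: ennreal_mult[symmetric] mult.commute)
qed

text \<open>The exponential density with rate \<open>- k\<close>, reflected at \<open>u\<close>, has
  total mass 1.\<close>

lemma nn_integral_exp_decay: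
  assumes "k < (0::real)"
  shows "(\<integral>\<^sup>+s. ennreal (exp (k * (u - s)) * indicator {..u} s) \<partial>lborel) = ennreal (1 / (- k))"
proof -
  interpret prob_space "density lborel (exponential_density (- k))"
    by (rule prob_space_exponential_density) (use assms in simp)
  have "1 = (\<integral>\<^sup>+x. ennreal (exponential_density (- k) x) \<partial>lborel)"
    using emeasure_space_1 by (simp add: emeasure_density)
  also have "\<dots> = ennreal \<bar>- 1\<bar> * (\<integral>\<^sup>+s. ennreal (exponential_density (- k) (u + (- 1) * s)) \<partial>lborel)"
    by (rule nn_integral_real_affine) auto
  also have "\<dots> = (\<integral>\<^sup>+s. ennreal (- k) * ennreal (exp (k * (u - s)) * indicator {..u} s) \<partial>lborel)"
    using assms by (simp, intro nn_integral_cong)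
      (auto simp: exponential_density_def ennreal_mult[symmetric] algebra_simps split: split_indicator)
  also have "\<dots> = ennreal (- k) * (\<integral>\<^sup>+s. ennreal (exp (k * (u - s)) * indicator {..u} s) \<partial>lborel)"
    by (rule nn_integral_cmult) simp
  finally have "ennreal (1 / (- k)) * 1 = (ennreal (1 / (- k)) * ennreal (- k)) * (\<integral>\<^sup>+s. ennreal (exp (k * (u - s)) * indicator {..u} s) \<partial>lborel)"
    by (simp add: mult.assoc)
  also have "ennreal (1 / (- k)) * ennreal (- k) = 1"
    using assms by (subst ennreal_mult[symmetric]) auto
  finally show ?thesis by simp
qed

definition supOU_kernel :: "real \<Rightarrow> real \<times> real \<Rightarrow> real" where
  "supOU_kernel t = (\<lambda>(A, s). exp (A * (t - s)) * indicator {..t} s)"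

lemma supOU_kernel_measurable [measurable]: "supOU_kernel t \<in> borel_measurable borel"
proof -
  have "supOU_kernel t \<in> borel_measurable (borel \<Otimes>\<^sub>M borel)"
    unfolding supOU_kernel_def by measurable
  then show ?thesis by (simp add: borel_prod)
qed

lemma supOU_kernel_bounds: "\<forall>z\<in>{..<0} \<times> UNIV. 0 \<le> supOU_kernel t z \<and> supOU_kernel t z \<le> 1"
proof
  fix z :: "real \<times> real" assume "z \<in> {..<0} \<times> UNIV"
  then obtain A s where z: "z = (A, s)" "A < 0" by auto
  show "0 \<le> supOU_kernel t z \<and> supOU_kernel t z \<le> 1"
    using z(2) by (auto simp: z(1) supOU_kernel_def intro!: mult_nonpos_nonneg split: split_indicator)
qed

lemma AE_pair_neg_half:
  assumes sets: "sets \<pi> = sets (borel :: real measure)" and ae: "AE A in \<pi>. A < 0"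
  shows "AE z in \<pi> \<Otimes>\<^sub>M (lborel :: real measure). z \<in> {..<0} \<times> UNIV"
proof -
  have sp: "space \<pi> = UNIV" using sets_eq_imp_space_eq[OF sets] by simp
  have "emeasure \<pi> {0..} = 0"
    using ae by (subst (asm) AE_iff_measurable[of "{0..}"]) (auto simp: sets sp)
  then have "emeasure (\<pi> \<Otimes>\<^sub>M (lborel :: real measure)) ({0..} \<times> UNIV) = 0"
    by (subst lborel.emeasure_pair_measure_Times) (auto simp: sets)
  then have "AE z in \<pi> \<Otimes>\<^sub>M (lborel :: real measure). z \<notin> {0..} \<times> UNIV"
    by (intro AE_not_in null_setsI) (auto simp: sets)
  then show ?thesis by eventually_elim auto
qed

locale gamma_mean_reversion =
  fixes \<pi> :: "real measure" and \<alpha> B :: real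
  assumes pi: "\<pi> = distr (gamma_distribution \<alpha>) borel (\<lambda>r. B * r)" and B: "B < 0" and alpha: "1 < \<alpha>"
begin

lemma sets_pi [measurable_cong, simp]: "sets \<pi> = sets borel"
  by (simp add: pi)

lemma nn_integral_pi:
  assumes [measurable]: "g \<in> borel_measurable borel"
  shows "(\<integral>\<^sup>+A. g A \<partial>\<pi>) = (\<integral>\<^sup>+r. ennreal (if 0 < r then r powr (\<alpha> - 1) * exp (- r) / Gamma \<alpha> else 0) * g (B * r) \<partial>lborel)"
proof -
  have "(\<lambda>r. B * r) \<in> borel_measurable (gamma_distribution \<alpha>)" by (simp add: gamma_distribution_def)
  then have "(\<integral>\<^sup>+A. g A \<partial>\<pi>) = (\<integral>\<^sup>+r. g (B * r) \<partial>gamma_distribution \<alpha>)"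
    unfolding pi by (rule nn_integral_distr) simp
  also have "\<dots> = (\<integral>\<^sup>+r. ennreal (if 0 < r then r powr (\<alpha> - 1) * exp (- r) / Gamma \<alpha> else 0) * g (B * r) \<partial>lborel)"
    unfolding gamma_distribution_def by (rule nn_integral_density) auto
  finally show ?thesis .
qed

lemma AE_pi_neg: "AE A in \<pi>. A < 0"
proof -
  have m: "(\<lambda>r. B * r) \<in> borel_measurable (gamma_distribution \<alpha>)" by (simp add: gamma_distribution_def)
  have "AE r in gamma_distribution \<alpha>. B * r < 0"
    unfolding gamma_distribution_def using B by (subst AE_density) (auto simp: mult_less_0_iff)
  then show ?thesis unfolding pi using m by (subst AE_distr_iff) auto
qed

text \<open>The factor \<open>1 / (- A)\<close> stems from integrating the kernel over time. It
  lowers the shape of the Gamma law from \<alpha> to \<open>\<alpha> - 1\<close>, which is where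
  \<open>1 < \<alpha>\<close> enters, and the exponential changes its rate from 1 to
  \<open>1 - B * \<tau>\<close>.\<close>

lemma nn_integral_pi_exp:
  assumes \<tau>: "0 \<le> \<tau>"
  shows "(\<integral>\<^sup>+A. ennreal (exp (A * \<tau>) / (- A)) \<partial>\<pi>) = ennreal ((1 - B * \<tau>) powr (1 - \<alpha>) / (- B * (\<alpha> - 1)))"
proof -
  have G: "Gamma \<alpha> = (\<alpha> - 1) * Gamma (\<alpha> - 1)"
    using Gamma_plus1[of "\<alpha> - 1"] alpha by (simp add: nonpos_Ints_def)
  have Gp: "Gamma \<alpha> > 0" "Gamma (\<alpha> - 1) > 0" using alpha by auto
  have c: "0 < 1 - B * \<tau>" using B \<tau> mult_nonpos_nonneg[of B \<tau>] by simp
  have "(\<integral>\<^sup>+A. ennreal (exp (A * \<tau>) / (- A)) \<partial>\<pi>)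
    = (\<integral>\<^sup>+r. ennreal (if 0 < r then r powr (\<alpha> - 1) * exp (- r) / Gamma \<alpha> else 0) * ennreal (exp (B * r * \<tau>) / (- (B * r))) \<partial>lborel)"
    by (rule nn_integral_pi) simp
  also have "\<dots> = (\<integral>\<^sup>+r. ennreal (1 / (- B * Gamma \<alpha>)) *
      ennreal (indicator {0..} r * r powr ((\<alpha> - 1) - 1) * exp (- ((1 - B * \<tau>) * r))) \<partial>lborel)"
  proof (rule nn_integral_cong)
    fix r :: real
    show "ennreal (if 0 < r then r powr (\<alpha> - 1) * exp (- r) / Gamma \<alpha> else 0) * ennreal (exp (B * r * \<tau>) / (- (B * r)))
      = ennreal (1 / (- B * Gamma \<alpha>)) * ennreal (indicator {0..} r * r powr ((\<alpha> - 1) - 1) * exp (- ((1 - B * \<tau>) * r)))"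
    proof (cases "0 < r")
      case True
      have 1: "r powr (\<alpha> - 1) = r powr ((\<alpha> - 1) - 1) * r" using True powr_add[of r "(\<alpha> - 1) - 1" 1] by simp
      have 2: "exp (- ((1 - B * \<tau>) * r)) = exp (- r) * exp (B * r * \<tau>)"
        by (simp add: exp_add[symmetric] algebra_simps)
      have "r powr (\<alpha> - 1) * exp (- r) / Gamma \<alpha> * (exp (B * r * \<tau>) / (- (B * r)))
        = 1 / (- B * Gamma \<alpha>) * (indicator {0..} r * r powr ((\<alpha> - 1) - 1) * exp (- ((1 - B * \<tau>) * r)))"
        unfolding 1 2 using True B Gp by (simp add: field_simps)
      then show ?thesis using True B Gp
        by (subst (1 2) ennreal_mult[symmetric]) (auto simp: mult_neg_pos mult_nonpos_nonneg divide_nonneg_neg intro!: divide_nonneg_nonpos)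
    qed (auto split: split_indicator simp: order.order_iff_strict)
  qed
  also have "\<dots> = ennreal (1 / (- B * Gamma \<alpha>)) * ennreal (Gamma (\<alpha> - 1) * (1 - B * \<tau>) powr (- (\<alpha> - 1)))"
    using alpha c by (subst nn_integral_cmult, simp, subst nn_integral_gamma_scaled) auto
  also have "\<dots> = ennreal (1 / (- B * Gamma \<alpha>) * (Gamma (\<alpha> - 1) * (1 - B * \<tau>) powr (- (\<alpha> - 1))))"
    using B Gp by (subst ennreal_mult) (auto simp: mult_neg_pos divide_nonneg_neg less_imp_le)
  also have "1 / (- B * Gamma \<alpha>) * (Gamma (\<alpha> - 1) * (1 - B * \<tau>) powr (- (\<alpha> - 1))) = (1 - B * \<tau>) powr (1 - \<alpha>) / (- B * (\<alpha> - 1))"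
  proof -
    have "1 / (b * (c * g)) * (g * x) = x / (b * c)" if "g \<noteq> 0" for b c g x :: real
      using that by (simp add: mult_ac)
    from this[of "Gamma (\<alpha> - 1)" "- B" "\<alpha> - 1"] show ?thesis unfolding G using Gp by simp
  qed
  finally show ?thesis .
qed

lemma kernel_pair_measurable [measurable]: "supOU_kernel t \<in> borel_measurable (\<pi> \<Otimes>\<^sub>M lborel)"
proof -
  have "sets (\<pi> \<Otimes>\<^sub>M lborel) = sets (borel :: (real \<times> real) measure)"
    by (simp add: borel_prod[symmetric] cong: sets_pair_measure_cong)
  then show ?thesis using supOU_kernel_measurable[of t] by (simp cong: measurable_cong_sets)
qed

lemma AE_pair_neg: "AE z in \<pi> \<Otimes>\<^sub>M (lborel :: real measure). z \<in> {..<0} \<times> UNIV"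
  by (rule AE_pair_neg_half[OF sets_pi AE_pi_neg])

lemma kernel_integral:
  "has_bochner_integral (\<pi> \<Otimes>\<^sub>M lborel) (supOU_kernel t) (1 / (- B * (\<alpha> - 1)))"
proof (rule has_bochner_integral_nn_integral)
  show "AE z in \<pi> \<Otimes>\<^sub>M lborel. 0 \<le> supOU_kernel t z"
    using AE_pair_neg by eventually_elim (use supOU_kernel_bounds in auto)
  show "0 \<le> 1 / (- B * (\<alpha> - 1))" using B alpha by (intro divide_nonneg_nonneg mult_nonneg_nonneg) auto
  have "(\<integral>\<^sup>+z. ennreal (supOU_kernel t z) \<partial>(\<pi> \<Otimes>\<^sub>M lborel)) = (\<integral>\<^sup>+A. \<integral>\<^sup>+s. ennreal (supOU_kernel t (A, s)) \<partial>lborel \<partial>\<pi>)"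
    by (rule lborel.nn_integral_fst[symmetric]) simp
  also have "\<dots> = (\<integral>\<^sup>+A. ennreal (exp (A * 0) / (- A)) \<partial>\<pi>)"
    using AE_pi_neg by (intro nn_integral_cong_AE, eventually_elim) (simp add: supOU_kernel_def nn_integral_exp_decay)
  also have "\<dots> = ennreal (1 / (- B * (\<alpha> - 1)))" by (subst nn_integral_pi_exp) auto
  finally show "(\<integral>\<^sup>+z. ennreal (supOU_kernel t z) \<partial>(\<pi> \<Otimes>\<^sub>M lborel)) = ennreal (1 / (- B * (\<alpha> - 1)))" .
qed simp

text \<open>Up to time \<open>s\<close> the product of the kernels is
  \<open>exp (A * (t - s))\<close> times \<open>exp (2 * A * (s - w))\<close>. Integrating the
  second factor produces \<open>1 / (- 2 * A)\<close>, the origin of the 2 in the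
  denominator.\<close>

lemma kernel_product_integral_le:
  assumes "s \<le> t"
  shows "has_bochner_integral (\<pi> \<Otimes>\<^sub>M lborel) (\<lambda>z. supOU_kernel s z * supOU_kernel t z)
     ((1 - B * (t - s)) powr (1 - \<alpha>) / (- 2 * B * (\<alpha> - 1)))"
proof (rule has_bochner_integral_nn_integral)
  show "AE z in \<pi> \<Otimes>\<^sub>M lborel. 0 \<le> supOU_kernel s z * supOU_kernel t z"
    using AE_pair_neg by eventually_elim (use supOU_kernel_bounds in auto)
  have "0 \<le> (- 2 * B) * (\<alpha> - 1)" using B alpha by (intro mult_nonneg_nonneg[of "- 2 * B"]) auto
  then show "0 \<le> (1 - B * (t - s)) powr (1 - \<alpha>) / (- 2 * B * (\<alpha> - 1))"
    by (intro divide_nonneg_nonneg) auto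
  have "(\<integral>\<^sup>+z. ennreal (supOU_kernel s z * supOU_kernel t z) \<partial>(\<pi> \<Otimes>\<^sub>M lborel))
     = (\<integral>\<^sup>+A. \<integral>\<^sup>+w. ennreal (supOU_kernel s (A, w) * supOU_kernel t (A, w)) \<partial>lborel \<partial>\<pi>)"
    by (rule lborel.nn_integral_fst[symmetric]) simp
  also have "\<dots> = (\<integral>\<^sup>+A. ennreal (1 / 2) * ennreal (exp (A * (t - s)) / (- A)) \<partial>\<pi>)"
  proof (intro nn_integral_cong_AE, use AE_pi_neg in eventually_elim)
    case (elim A)
    have "(\<integral>\<^sup>+w. ennreal (supOU_kernel s (A, w) * supOU_kernel t (A, w)) \<partial>lborel)
      = (\<integral>\<^sup>+w. ennreal (exp (A * (t - s))) * ennreal (exp ((2 * A) * (s - w)) * indicator {..s} w) \<partial>lborel)"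
      using assms by (intro nn_integral_cong)
        (auto simp: supOU_kernel_def ennreal_mult[symmetric] exp_add[symmetric] algebra_simps split: split_indicator)
    also have "\<dots> = ennreal (exp (A * (t - s))) * ennreal (1 / (- (2 * A)))"
      using elim by (subst nn_integral_cmult, simp, subst nn_integral_exp_decay) auto
    also have "\<dots> = ennreal (1 / 2) * ennreal (exp (A * (t - s)) / (- A))"
      using elim by (subst (1 2) ennreal_mult[symmetric]) (auto intro!: divide_nonneg_neg)
    finally show ?case .
  qed
  also have "\<dots> = ennreal (1 / 2) * (\<integral>\<^sup>+A. ennreal (exp (A * (t - s)) / (- A)) \<partial>\<pi>)"
    by (rule nn_integral_cmult) simp
  also have "\<dots> = ennreal (1 / 2) * ennreal ((1 - B * (t - s)) powr (1 - \<alpha>) / (- B * (\<alpha> - 1)))"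
    using assms by (subst nn_integral_pi_exp) auto
  also have "\<dots> = ennreal ((1 - B * (t - s)) powr (1 - \<alpha>) / (- 2 * B * (\<alpha> - 1)))"
  proof -
    have "0 \<le> (1 - B * (t - s)) powr (1 - \<alpha>) / (- B * (\<alpha> - 1))"
      using B alpha by (intro divide_nonneg_nonneg mult_nonneg_nonneg) auto
    then show ?thesis by (subst ennreal_mult[symmetric]) (auto simp: mult.assoc)
  qed
  finally show "(\<integral>\<^sup>+z. ennreal (supOU_kernel s z * supOU_kernel t z) \<partial>(\<pi> \<Otimes>\<^sub>M lborel)) = ennreal ((1 - B * (t - s)) powr (1 - \<alpha>) / (- 2 * B * (\<alpha> - 1)))" .
qed simp

lemma kernel_product_integral:
  "has_bochner_integral (\<pi> \<Otimes>\<^sub>M lborel) (\<lambda>z. supOU_kernel s z * supOU_kernel t z)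
     ((1 - B * \<bar>t - s\<bar>) powr (1 - \<alpha>) / (- 2 * B * (\<alpha> - 1)))"
proof (cases "s \<le> t")
  case True
  then show ?thesis using kernel_product_integral_le[of s t] by simp
next
  case False
  then show ?thesis using kernel_product_integral_le[of t s] by (simp add: mult.commute abs_minus_commute)
qed

text \<open>The strip belongs to the underlying Levy process at time 1. Its unit mass is the reason
  why \<open>mean\<close> and \<open>var\<close> are the parameters \<mu> and \<sigma>2.\<close>

lemma unit_strip_integral:
  assumes "prob_space \<pi>"
  shows "has_bochner_integral (\<pi> \<Otimes>\<^sub>M lborel) (indicator ({..<0} \<times> {0<..1::real})) (1::real)"
proof -
  interpret prob_space \<pi> by fact
  have [simp]: "space \<pi> = UNIV" using sets_eq_imp_space_eq[OF sets_pi] by simp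
  have "prob {..<0} = 1" using AE_pi_neg by (subst prob_eq_1) auto
  then have "emeasure \<pi> {..<0} = 1" by (simp add: emeasure_eq_measure)
  then have e: "emeasure (\<pi> \<Otimes>\<^sub>M lborel) ({..<0} \<times> {0<..1::real}) = 1"
    by (subst lborel.emeasure_pair_measure_Times) auto
  have "has_bochner_integral (\<pi> \<Otimes>\<^sub>M lborel) (indicator ({..<0} \<times> {0<..1::real}) :: _ \<Rightarrow> real) (measure (\<pi> \<Otimes>\<^sub>M lborel) ({..<0} \<times> {0<..1::real}))"
    by (rule has_bochner_integral_real_indicator) (auto simp: e)
  then show ?thesis using e by (simp add: measure_def)
qed

end

section \<open>Simple processes on a common grid\<close>

abbreviation wiener_sum :: "(real \<Rightarrow> 'w \<Rightarrow> real) \<Rightarrow> (nat \<Rightarrow> 'w \<Rightarrow> real) \<Rightarrow> (nat \<Rightarrow> real) \<Rightarrow> nat \<Rightarrow> 'w \<Rightarrow> real" where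
  "wiener_sum W \<zeta> p n \<omega> \<equiv> (\<Sum>k<n. \<zeta> k \<omega> * (W (p (Suc k)) \<omega> - W (p k) \<omega>))"

abbreviation square_sum :: "(nat \<Rightarrow> 'w \<Rightarrow> real) \<Rightarrow> (nat \<Rightarrow> real) \<Rightarrow> nat \<Rightarrow> 'w \<Rightarrow> real" where
  "square_sum \<zeta> p n \<omega> \<equiv> (\<Sum>k<n. (\<zeta> k \<omega>)\<^sup>2 * (p (Suc k) - p k))"

text \<open>Only the truncated endpoints \<open>min r t\<close> and \<open>min s t\<close> matter
  for an integral up to \<open>t\<close>, and these are required to be grid points. Beyond the index
  \<open>N\<close> nothing is known about \<open>p\<close>; for \<open>t = 0\<close> the grid is a
  single point.\<close>

definition is_grid :: "real \<Rightarrow> (real \<times> real \<times> ('w \<Rightarrow> real)) list \<Rightarrow> (nat \<Rightarrow> real) \<Rightarrow> nat \<Rightarrow> bool" where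
  "is_grid t h p N \<longleftrightarrow> p 0 = 0 \<and> p N = t \<and> (\<forall>i j. i < j \<longrightarrow> j \<le> N \<longrightarrow> p i < p j) \<and>
     (\<forall>(r, s, \<xi>)\<in>set h. 0 \<le> r \<and> r \<le> s \<and> min r t \<in> p ` {..N} \<and> min s t \<in> p ` {..N})"

text \<open>The value of the simple process on the cell \<open>{p k<..p (Suc k)}\<close>. It is
  decided by comparison with the left end \<open>p k\<close>, so that only coefficients already
  known at time \<open>p k\<close> occur.\<close>

definition grid_coeff :: "real \<Rightarrow> (real \<times> real \<times> ('w \<Rightarrow> real)) list \<Rightarrow> (nat \<Rightarrow> real) \<Rightarrow> nat \<Rightarrow> 'w \<Rightarrow> real" where
  "grid_coeff t h p k \<omega> = (\<Sum>(r, s, \<xi>)\<leftarrow>h. if min r t \<le> p k \<and> p k < min s t then \<xi> \<omega> else 0)"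

lemma finite_set_enumeration:
  fixes S :: "real set"
  assumes "finite S" "S \<noteq> {}"
  shows "\<exists>p N. (\<forall>i j. i < j \<longrightarrow> j \<le> N \<longrightarrow> p i < p j) \<and> S = p ` {..N::nat}"
proof -
  define xs where "xs = sorted_list_of_set S"
  have xs: "set xs = S" "sorted_wrt (<) xs" "xs \<noteq> []"
    using assms by (auto simp: xs_def sorted_list_of_set.strict_sorted_key_list_of_set)
  define N where "N = length xs - 1"
  have l: "length xs = Suc N" using xs(3) by (cases xs) (auto simp: N_def)
  have "S = (\<lambda>i. xs ! i) ` {..N}"
    using xs(1) l by (auto simp: in_set_conv_nth less_Suc_eq_le image_iff)
  moreover have "\<forall>i j. i < j \<longrightarrow> j \<le> N \<longrightarrow> xs ! i < xs ! j"
    using sorted_wrt_nth_less[OF xs(2)] l by auto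
  ultimately show ?thesis by (intro exI[of _ "\<lambda>i. xs ! i"] exI[of _ N]) auto
qed

lemma grid_exists:
  assumes t: "0 \<le> t" and h: "\<forall>(r, s, \<xi>)\<in>set h. 0 \<le> r \<and> r \<le> s"
  shows "\<exists>p N. is_grid t h p N"
proof -
  define S where "S = {0, t} \<union> (\<lambda>(r, s, \<xi>). min r t) ` set h \<union> (\<lambda>(r, s, \<xi>). min s t) ` set h"
  have S: "finite S" "S \<noteq> {}" by (auto simp: S_def)
  obtain p N where p: "\<And>i j. i < j \<Longrightarrow> j \<le> N \<Longrightarrow> p i < p j" "S = p ` {..N::nat}"
    using finite_set_enumeration[OF S] by blast
  have range: "0 \<le> x \<and> x \<le> t" if "x \<in> S" for x
    using that t h by (fastforce simp: S_def)
  have le: "p i \<le> p j" if "i \<le> j" "j \<le> N" for i j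
    using p(1)[of i j] that by (cases "i = j") auto
  have "0 \<in> S" "t \<in> S" by (auto simp: S_def)
  then obtain i j where ij: "i \<le> N" "p i = 0" "j \<le> N" "p j = t" unfolding p(2) by force
  have "p 0 \<in> S" "p N \<in> S" using p(2) by auto
  then have "p 0 = 0" "p N = t" using range[of "p 0"] range[of "p N"] le[of 0 i] le[of j N] ij by auto
  moreover have "min r t \<in> S \<and> min s t \<in> S" if "(r, s, \<xi>) \<in> set h" for r s \<xi>
    unfolding S_def using that by force
  ultimately have "is_grid t h p N" unfolding is_grid_def using p h by fastforce
  then show ?thesis by blast
qed

lemma is_grid_mono:
  assumes "is_grid t h p N" "i \<le> N" "j \<le> N"
  shows "p i \<le> p j \<longleftrightarrow> i \<le> j" "p i < p j \<longleftrightarrow> i < j"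
proof -
  have *: "\<And>i j. i < j \<Longrightarrow> j \<le> N \<Longrightarrow> p i < p j" using assms(1) by (auto simp: is_grid_def)
  show "p i \<le> p j \<longleftrightarrow> i \<le> j" "p i < p j \<longleftrightarrow> i < j"
    using *[of i j] *[of j i] assms(2,3) by (cases i j rule: linorder_cases; force)+
qed

lemma is_grid_range:
  assumes "is_grid t h p N" "i \<le> N"
  shows "0 \<le> p i" "p i \<le> t"
  using is_grid_mono(1)[OF assms(1), of 0 i] is_grid_mono(1)[OF assms(1), of i N] assms by (auto simp: is_grid_def)

lemma is_grid_Cons: "is_grid t (x # h) p N \<Longrightarrow> is_grid t h p N"
  by (auto simp: is_grid_def)

text \<open>Each summand of \<open>h\<close> telescopes over the cells between its two truncated
  endpoints.\<close>

lemma simple_ito_integral_grid: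
  assumes "is_grid t h p N"
  shows "simple_ito_integral W t h \<omega> = (wiener_sum W (grid_coeff t h p) p N \<omega>)"
  using assms
proof (induction h)
  case Nil
  then show ?case by (simp add: simple_ito_integral_def grid_coeff_def)
next
  case (Cons x h)
  obtain r s \<xi> where x: "x = (r, s, \<xi>)" by (cases x)
  have "min r t \<in> p ` {..N}" "min s t \<in> p ` {..N}" "r \<le> s" using Cons.prems by (auto simp: is_grid_def x)
  then obtain i j where ij: "i \<le> N" "j \<le> N" "min r t = p i" "min s t = p j" "r \<le> s" by auto
  have "p i \<le> p j" unfolding ij(3,4)[symmetric] using ij(5) by auto
  then have le: "i \<le> j" using is_grid_mono(1)[OF Cons.prems ij(1,2)] by simp
  have "(\<Sum>k<N. (if min r t \<le> p k \<and> p k < min s t then \<xi> \<omega> else 0) * (W (p (Suc k)) \<omega> - W (p k) \<omega>))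
    = (\<Sum>k<N. if k \<in> {i..<j} then \<xi> \<omega> * (W (p (Suc k)) \<omega> - W (p k) \<omega>) else 0)"
    using ij is_grid_mono[OF Cons.prems] by (intro sum.cong) auto
  also have "\<dots> = (\<Sum>k\<in>{i..<j}. \<xi> \<omega> * (W (p (Suc k)) \<omega> - W (p k) \<omega>))"
    using ij by (subst sum.inter_restrict[symmetric]) (auto intro!: sum.cong)
  also have "\<dots> = \<xi> \<omega> * (W (p j) \<omega> - W (p i) \<omega>)"
    unfolding sum_distrib_left[symmetric] using le by (subst sum_Suc_diff') auto
  finally have "(\<Sum>k<N. (if min r t \<le> p k \<and> p k < min s t then \<xi> \<omega> else 0) * (W (p (Suc k)) \<omega> - W (p k) \<omega>))
    = \<xi> \<omega> * (W (min s t) \<omega> - W (min r t) \<omega>)" using ij by simp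
  then show ?case using Cons.IH[OF is_grid_Cons[OF Cons.prems]]
    by (simp add: x simple_ito_integral_def grid_coeff_def distrib_right sum.distrib)
qed

lemma simple_process_fun_grid:
  assumes "is_grid t h p N" and k: "k < N" and u: "p k < u" "u \<le> p (Suc k)"
  shows "simple_process_fun h u \<omega> = grid_coeff t h p k \<omega>"
  using assms(1)
proof (induction h)
  case Nil
  then show ?case by (simp add: simple_process_fun_def grid_coeff_def)
next
  case (Cons x h)
  obtain r s \<xi> where x: "x = (r, s, \<xi>)" by (cases x)
  have "min r t \<in> p ` {..N}" "min s t \<in> p ` {..N}" "r \<le> s" using Cons.prems by (auto simp: is_grid_def x)
  then obtain i j where ij: "i \<le> N" "j \<le> N" "min r t = p i" "min s t = p j" "r \<le> s" by auto
  have ut: "u \<le> t" using u is_grid_range(2)[OF Cons.prems, of "Suc k"] k by simp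
  have "r < u \<longleftrightarrow> min r t < u" "u \<le> s \<longleftrightarrow> u \<le> min s t" using ut u is_grid_range(2)[OF Cons.prems, of k] k by auto
  moreover have "min r t < u \<longleftrightarrow> min r t \<le> p k"
  proof -
    have "p i < u \<longleftrightarrow> i \<le> k"
    proof
      assume "p i < u"
      then have "p i < p (Suc k)" using u by simp
      then show "i \<le> k" using is_grid_mono(2)[OF Cons.prems ij(1), of "Suc k"] k by simp
    next
      assume "i \<le> k"
      then show "p i < u" using is_grid_mono(1)[OF Cons.prems ij(1), of k] k u by simp
    qed
    then show ?thesis using ij is_grid_mono(1)[OF Cons.prems ij(1), of k] k by simp
  qed
  moreover have "u \<le> min s t \<longleftrightarrow> p k < min s t"
  proof -
    have "u \<le> p j \<longleftrightarrow> k < j"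
    proof
      assume "u \<le> p j"
      then have "p k < p j" using u by simp
      then show "k < j" using is_grid_mono(2)[OF Cons.prems _ ij(2), of k] k by simp
    next
      assume "k < j"
      then show "u \<le> p j" using is_grid_mono(1)[OF Cons.prems _ ij(2), of "Suc k"] k u by simp
    qed
    then show ?thesis using ij is_grid_mono(2)[OF Cons.prems _ ij(2), of k] k by simp
  qed
  ultimately show ?case using Cons.IH[OF is_grid_Cons[OF Cons.prems]]
    by (auto simp: x simple_process_fun_def grid_coeff_def split: split_indicator)
qed

lemma indicator_grid:
  assumes "is_grid t h p N" "n \<le> N"
  shows "indicator {0<..p n} u = (\<Sum>k<n. indicator {p k<..p (Suc k)} u :: real)"
  using assms(2)
proof (induction n)
  case 0
  then show ?case using assms by (auto simp: is_grid_def)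
next
  case (Suc n)
  have "p n < p (Suc n)" "0 \<le> p n" using is_grid_mono(2)[OF assms(1), of n "Suc n"] is_grid_range[OF assms(1), of n] Suc by auto
  then have "indicator {0<..p (Suc n)} u = indicator {0<..p n} u + (indicator {p n<..p (Suc n)} u :: real)"
    by (auto split: split_indicator)
  then show ?case using Suc by simp
qed

lemma simple_process_fun_square_grid:
  assumes g: "is_grid t h p N" and u: "0 < u" "u \<le> t"
  shows "(simple_process_fun h u \<omega>)\<^sup>2 = (\<Sum>k<N. (grid_coeff t h p k \<omega>)\<^sup>2 * indicator {p k<..p (Suc k)} u)"
proof -
  have pN: "p N = t" using g by (simp add: is_grid_def)
  have "(simple_process_fun h u \<omega>)\<^sup>2 = (simple_process_fun h u \<omega>)\<^sup>2 * indicator {0<..p N} u" using u pN by simp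
  also have "\<dots> = (\<Sum>k<N. (simple_process_fun h u \<omega>)\<^sup>2 * indicator {p k<..p (Suc k)} u)"
    unfolding indicator_grid[OF g order_refl] by (rule sum_distrib_left)
  also have "\<dots> = (\<Sum>k<N. (grid_coeff t h p k \<omega>)\<^sup>2 * indicator {p k<..p (Suc k)} u)"
    using simple_process_fun_grid[OF g] by (intro sum.cong) (auto split: split_indicator)
  finally show ?thesis .
qed

lemma nn_integral_simple_process_grid:
  assumes g: "is_grid t h p N"
  shows "(\<integral>\<^sup>+u\<in>{0..t}. ennreal ((simple_process_fun h u \<omega>)\<^sup>2) \<partial>lborel) =
    ennreal (square_sum (grid_coeff t h p) p N \<omega>)"
proof -
  have "(\<integral>\<^sup>+u\<in>{0..t}. ennreal ((simple_process_fun h u \<omega>)\<^sup>2) \<partial>lborel)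
    = (\<integral>\<^sup>+u. (\<Sum>k<N. ennreal ((grid_coeff t h p k \<omega>)\<^sup>2) * indicator {p k<..p (Suc k)} u) \<partial>lborel)"
  proof (rule nn_integral_cong_AE)
    have "AE u in lborel. u \<noteq> (0::real)" by (rule AE_lborel_singleton)
    then show "AE u in lborel. ennreal ((simple_process_fun h u \<omega>)\<^sup>2) * indicator {0..t} u
      = (\<Sum>k<N. ennreal ((grid_coeff t h p k \<omega>)\<^sup>2) * indicator {p k<..p (Suc k)} u)"
    proof eventually_elim
      case (elim u)
      show ?case
      proof (cases "0 < u \<and> u \<le> t")
        case True
        have "(\<Sum>k<N. ennreal ((grid_coeff t h p k \<omega>)\<^sup>2) * indicator {p k<..p (Suc k)} u)
          = (\<Sum>k<N. ennreal ((grid_coeff t h p k \<omega>)\<^sup>2 * indicator {p k<..p (Suc k)} u))"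
          by (intro sum.cong) (auto split: split_indicator)
        also have "\<dots> = ennreal ((simple_process_fun h u \<omega>)\<^sup>2)"
          using True by (subst sum_ennreal) (auto simp: simple_process_fun_square_grid[OF g])
        finally show ?thesis using True by simp
      next
        case False
        then have "u \<notin> {p k<..p (Suc k)}" if "k < N" for k
          using is_grid_range[OF g, of k] is_grid_range[OF g, of "Suc k"] that by auto
        then show ?thesis using False elim by (auto split: split_indicator)
      qed
    qed
  qed
  also have "\<dots> = (\<Sum>k<N. ennreal ((grid_coeff t h p k \<omega>)\<^sup>2) * ennreal (p (Suc k) - p k))"
    using is_grid_mono(1)[OF g]
    by (subst nn_integral_sum) (auto intro!: sum.cong simp: nn_integral_cmult_indicator)
  also have "\<dots> = (\<Sum>k<N. ennreal ((grid_coeff t h p k \<omega>)\<^sup>2 * (p (Suc k) - p k)))"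
    by (intro sum.cong refl, subst ennreal_mult) (use is_grid_mono(1)[OF g] in auto)
  also have "\<dots> = ennreal (square_sum (grid_coeff t h p) p N \<omega>)"
    using is_grid_mono(1)[OF g] by (intro sum_ennreal) auto
  finally show ?thesis .
qed

lemma grid_coeff_measurable:
  assumes "\<And>r s \<xi>. (r, s, \<xi>) \<in> set h \<Longrightarrow> min r t \<le> p k \<Longrightarrow> p k < min s t \<Longrightarrow> \<xi> \<in> borel_measurable K"
  shows "grid_coeff t h p k \<in> borel_measurable K"
  using assms
proof (induction h)
  case Nil
  show ?case by (simp add: grid_coeff_def[abs_def])
next
  case (Cons x h)
  obtain r s \<xi> where x: "x = (r, s, \<xi>)" by (cases x)
  have "grid_coeff t h p k \<in> borel_measurable K" using Cons by auto
  moreover have "(\<lambda>\<omega>. if min r t \<le> p k \<and> p k < min s t then \<xi> \<omega> else 0) \<in> borel_measurable K"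
  proof (cases "min r t \<le> p k \<and> p k < min s t")
    case True
    then have "\<xi> \<in> borel_measurable K" using Cons.prems[of r s \<xi>] by (simp add: x)
    then show ?thesis using True by (simp only: if_True simp_thms)
  next
    case False
    then show ?thesis by (simp only: if_False borel_measurable_const)
  qed
  moreover have "grid_coeff t (x # h) p k = (\<lambda>\<omega>. (if min r t \<le> p k \<and> p k < min s t then \<xi> \<omega> else 0) + grid_coeff t h p k \<omega>)"
    by (simp add: fun_eq_iff grid_coeff_def x)
  ultimately show ?case by simp
qed

lemma grid_coeff_bounded:
  assumes "\<And>r s \<xi>. (r, s, \<xi>) \<in> set h \<Longrightarrow> bounded (\<xi> ` A)"
  shows "\<exists>c. \<forall>\<omega>\<in>A. \<bar>grid_coeff t h p k \<omega>\<bar> \<le> c"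
  using assms
proof (induction h)
  case Nil
  then show ?case by (auto simp: grid_coeff_def)
next
  case (Cons x h)
  obtain r s \<xi> where x: "x = (r, s, \<xi>)" by (cases x)
  obtain c where c: "\<forall>\<omega>\<in>A. \<bar>grid_coeff t h p k \<omega>\<bar> \<le> c" using Cons by auto
  obtain b where b: "\<forall>\<omega>\<in>A. \<bar>\<xi> \<omega>\<bar> \<le> b" using Cons.prems[of r s \<xi>] by (auto simp: x bounded_iff)
  have "\<bar>grid_coeff t (x # h) p k \<omega>\<bar> \<le> \<bar>b\<bar> + c" if "\<omega> \<in> A" for \<omega>
  proof -
    have "grid_coeff t (x # h) p k \<omega> = (if min r t \<le> p k \<and> p k < min s t then \<xi> \<omega> else 0) + grid_coeff t h p k \<omega>"
      by (simp add: grid_coeff_def x)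
    then show ?thesis using b[rule_format, OF that] c[rule_format, OF that] by auto
  qed
  then show ?case by blast
qed

section \<open>Operations on simple processes\<close>

definition scale_process :: "real \<Rightarrow> (real \<times> real \<times> ('w \<Rightarrow> real)) list \<Rightarrow> (real \<times> real \<times> ('w \<Rightarrow> real)) list" where
  "scale_process c h = map (\<lambda>(r, s, \<xi>). (r, s, \<lambda>\<omega>. c * \<xi> \<omega>)) h"

text \<open>Turns the increment of an integral between \<open>a\<close> and \<open>b\<close> into
  one integral up to a later time. A linear combination of two increments thereby becomes a single
  simple integral.\<close>

definition clamp_process :: "real \<Rightarrow> real \<Rightarrow> (real \<times> real \<times> ('w \<Rightarrow> real)) list \<Rightarrow> (real \<times> real \<times> ('w \<Rightarrow> real)) list" where
  "clamp_process a b h = map (\<lambda>(r, s, \<xi>). (max a (min r b), max a (min s b), \<xi>)) h"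

lemma simple_process_fun_append [simp]:
  "simple_process_fun (g @ h) u \<omega> = simple_process_fun g u \<omega> + simple_process_fun h u \<omega>"
  by (simp add: simple_process_fun_def)

lemma simple_ito_integral_append [simp]:
  "simple_ito_integral W t (g @ h) \<omega> = simple_ito_integral W t g \<omega> + simple_ito_integral W t h \<omega>"
  by (simp add: simple_ito_integral_def)

lemma simple_process_fun_scale [simp]:
  "simple_process_fun (scale_process c h) u \<omega> = c * simple_process_fun h u \<omega>"
  by (induction h) (auto simp: simple_process_fun_def scale_process_def algebra_simps)

lemma simple_ito_integral_scale [simp]:
  "simple_ito_integral W t (scale_process c h) \<omega> = c * simple_ito_integral W t h \<omega>"
  by (induction h) (auto simp: simple_ito_integral_def scale_process_def algebra_simps)

lemma simple_process_append: "simple_process F g \<Longrightarrow> simple_process F h \<Longrightarrow> simple_process F (g @ h)"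
  by (auto simp: simple_process_def)

lemma simple_process_scale: "simple_process F h \<Longrightarrow> simple_process F (scale_process c h)"
proof -
  assume h: "simple_process F h"
  have "0 \<le> r \<and> r \<le> s \<and> \<eta> \<in> borel_measurable (F r) \<and> bounded (\<eta> ` space (F r))"
    if m: "(r, s, \<eta>) \<in> set (scale_process c h)" for r s \<eta>
  proof -
    obtain \<xi> where \<xi>: "(r, s, \<xi>) \<in> set h" "\<eta> = (\<lambda>\<omega>. c * \<xi> \<omega>)"
      using m by (auto simp: scale_process_def)
    then have p: "0 \<le> r" "r \<le> s" "\<xi> \<in> borel_measurable (F r)" "bounded (\<xi> ` space (F r))"
      using h by (auto simp: simple_process_def)
    have "bounded ((\<lambda>x. c *\<^sub>R x) ` (\<xi> ` space (F r)))" by (rule bounded_scaling[OF p(4)])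
    then have "bounded (\<eta> ` space (F r))" by (simp add: \<xi>(2) image_image)
    then show ?thesis using p \<xi>(2) by simp
  qed
  then show "simple_process F (scale_process c h)" by (auto simp: simple_process_def)
qed

lemma simple_process_fun_clamp:
  assumes "\<forall>(r, s, \<xi>)\<in>set h. r \<le> s" "a \<le> b"
  shows "simple_process_fun (clamp_process a b h) u \<omega> = indicator {a<..b} u * simple_process_fun h u \<omega>"
  using assms by (induction h)
    (auto simp: simple_process_fun_def clamp_process_def algebra_simps max_def min_def split: split_indicator)

lemma simple_ito_integral_clamp:
  assumes "\<forall>(r, s, \<xi>)\<in>set h. r \<le> s" "a \<le> b" "b \<le> t"
  shows "simple_ito_integral W t (clamp_process a b h) \<omega> = simple_ito_integral W b h \<omega> - simple_ito_integral W a h \<omega>"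
  using assms(1)
proof (induction h)
  case Nil
  then show ?case by (simp add: simple_ito_integral_def clamp_process_def)
next
  case (Cons x h)
  obtain r s \<xi> where x: "x = (r, s, \<xi>)" by (cases x)
  have "r \<le> s" using Cons by (simp add: x)
  have e: "W (min (max a (min s b)) t) \<omega> - W (min (max a (min r b)) t) \<omega>
     = (W (min s b) \<omega> - W (min r b) \<omega>) - (W (min s a) \<omega> - W (min r a) \<omega>)"
    using assms(2,3) \<open>r \<le> s\<close> by (auto simp: min_def max_def)
  show ?case using Cons
    by (simp add: x simple_ito_integral_def clamp_process_def e) (simp add: algebra_simps)
qed

section \<open>Increments of Brownian motion\<close>

lemma Int_stable_vimage: "Int_stable {D -` A \<inter> S | A. A \<in> sets N}"
  unfolding Int_stable_def
proof (intro ballI)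
  fix a b assume "a \<in> {D -` A \<inter> S | A. A \<in> sets N}" "b \<in> {D -` A \<inter> S | A. A \<in> sets N}"
  then obtain A B where AB: "a = D -` A \<inter> S" "b = D -` B \<inter> S" "A \<in> sets N" "B \<in> sets N" by blast
  have "a \<inter> b = D -` (A \<inter> B) \<inter> S" using AB by auto
  then show "a \<inter> b \<in> {D -` A \<inter> S | A. A \<in> sets N}" using sets.Int[OF AB(3,4)] by blast
qed

context prob_space
begin

lemma normal_increment_moments:
  assumes D: "distributed M lborel D (normal_density 0 \<sigma>)" and \<sigma>: "0 < \<sigma>"
  shows "integrable M (\<lambda>\<omega>. D \<omega> ^ n)" "expectation D = 0" "expectation (\<lambda>\<omega>. (D \<omega>)\<^sup>2) = \<sigma>\<^sup>2"
    "expectation (\<lambda>\<omega>. D \<omega> ^ 3) = 0" "expectation (\<lambda>\<omega>. D \<omega> ^ 4) = 3 * \<sigma> ^ 4"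
proof -
  have m: "(\<lambda>x::real. x ^ n) \<in> borel_measurable lborel" for n :: nat by simp
  have nn: "0 \<le> normal_density 0 \<sigma> x" for x by simp
  have even: "has_bochner_integral lborel (\<lambda>x. normal_density 0 \<sigma> x * x ^ (2 * k)) (fact (2 * k) / ((2 / \<sigma>\<^sup>2)^k * fact k))" for k
    using normal_moment_even[OF \<sigma>, of 0 k] by simp
  have odd: "has_bochner_integral lborel (\<lambda>x. normal_density 0 \<sigma> x * x ^ (2 * k + 1)) 0" for k
    using normal_moment_odd[OF \<sigma>, of 0 k] by simp
  have "integrable lborel (\<lambda>x. normal_density 0 \<sigma> x * x ^ n)"
  proof (cases "even n")
    case True
    then obtain k where "n = 2 * k" by (auto elim: evenE)
    then show ?thesis using even[of k] by (simp add: integrable.intros)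
  next
    case False
    then obtain k where "n = 2 * k + 1" by (auto elim: oddE)
    then show ?thesis using odd[of k] by (simp add: integrable.intros)
  qed
  then show "integrable M (\<lambda>\<omega>. D \<omega> ^ n)" using distributed_integrable[OF D m nn] by blast
  have e: "expectation (\<lambda>\<omega>. D \<omega> ^ n) = (\<integral>x. normal_density 0 \<sigma> x * x ^ n \<partial>lborel)" for n
    using distributed_integral[OF D m nn] by simp
  show "expectation D = 0" using e[of 1] has_bochner_integral_integral_eq[OF odd[of 0]] by simp
  show "expectation (\<lambda>\<omega>. (D \<omega>)\<^sup>2) = \<sigma>\<^sup>2" using e[of 2] has_bochner_integral_integral_eq[OF even[of 1]] by simp
  show "expectation (\<lambda>\<omega>. D \<omega> ^ 3) = 0" using e[of 3] has_bochner_integral_integral_eq[OF odd[of 1]] by (simp add: numeral_3_eq_3)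
  have "fact 4 / ((2 / \<sigma>\<^sup>2)\<^sup>2 * fact 2) = 3 * \<sigma> ^ 4"
    using \<sigma> by (simp add: fact_numeral power_divide power_mult[symmetric])
  then show "expectation (\<lambda>\<omega>. D \<omega> ^ 4) = 3 * \<sigma> ^ 4"
    using e[of 4] has_bochner_integral_integral_eq[OF even[of 2]] by simp
qed

lemma indep_increment:
  fixes Z D :: "'a \<Rightarrow> real"
  assumes K: "subalgebra M K" and D: "D \<in> borel_measurable M"
    and ind: "indep_set (sets K) {D -` A \<inter> space M | A. A \<in> sets borel}"
    and Z: "Z \<in> borel_measurable K"
  shows "indep_var borel Z borel D"
proof -
  have Z': "Z \<in> borel_measurable M" by (rule measurable_from_subalg[OF K Z])
  have sp: "space K = space M" using K by (simp add: subalgebra_def)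
  have "indep_set (sigma_sets (space M) (sets K)) (sigma_sets (space M) {D -` A \<inter> space M | A. A \<in> sets borel})"
  proof (rule indep_set_sigma_sets[OF ind])
    show "Int_stable (sets K)" by (auto simp: Int_stable_def)
    show "Int_stable {D -` A \<inter> space M | A. A \<in> sets borel}"
      by (rule Int_stable_vimage)
  qed
  moreover have "sigma_sets (space M) {Z -` A \<inter> space M | A. A \<in> sets borel} \<subseteq> sigma_sets (space M) (sets K)"
    by (rule sigma_sets_mono') (use measurable_sets[OF Z] sp in auto)
  ultimately have "indep_set (sigma_sets (space M) {Z -` A \<inter> space M | A. A \<in> sets borel})
     (sigma_sets (space M) {D -` A \<inter> space M | A. A \<in> sets borel})"
    unfolding indep_sets2_eq by blast
  then show ?thesis unfolding indep_var_eq using Z' D by simp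
qed

lemma increment_product:
  assumes K: "subalgebra M K" and D: "distributed M lborel D (normal_density 0 \<sigma>)" "0 < \<sigma>"
    and ind: "indep_set (sets K) {D -` A \<inter> space M | A. A \<in> sets borel}"
    and Z: "Z \<in> borel_measurable K" "integrable M Z"
  shows "integrable M (\<lambda>\<omega>. Z \<omega> * D \<omega> ^ n)"
    "expectation (\<lambda>\<omega>. Z \<omega> * D \<omega> ^ n) = expectation Z * expectation (\<lambda>\<omega>. D \<omega> ^ n)"
proof -
  have mD: "D \<in> borel_measurable M" using distributed_measurable[OF D(1)] by simp
  have "indep_var borel Z borel D" by (rule indep_increment[OF K mD ind Z(1)])
  then have "indep_var borel ((\<lambda>x. x) \<circ> Z) borel ((\<lambda>x. x ^ n) \<circ> D)" by (rule indep_var_compose) auto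
  then have i: "indep_var borel Z borel (\<lambda>\<omega>. D \<omega> ^ n)" by (simp add: o_def)
  show "integrable M (\<lambda>\<omega>. Z \<omega> * D \<omega> ^ n)"
    by (rule indep_var_integrable[OF i Z(2) normal_increment_moments(1)[OF D]])
  show "expectation (\<lambda>\<omega>. Z \<omega> * D \<omega> ^ n) = expectation Z * expectation (\<lambda>\<omega>. D \<omega> ^ n)"
    by (rule indep_var_lebesgue_integral[OF i Z(2) normal_increment_moments(1)[OF D]])
qed

end

locale brownian = prob_space M for M :: "'w measure" +
  fixes F :: "real \<Rightarrow> 'w measure" and W :: "real \<Rightarrow> 'w \<Rightarrow> real"
  assumes bm: "brownian_motion M F W"
begin

lemma sub_F: "subalgebra M (F t)"
  using bm by (simp add: brownian_motion_def subfiltration_def)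

lemma sets_F_mono: "s \<le> t \<Longrightarrow> sets (F s) \<subseteq> sets (F t)"
  using bm by (auto simp: brownian_motion_def subfiltration_def dest: filtration.sets_F_mono)

lemma space_F: "space (F t) = space M"
  using sub_F by (simp add: subalgebra_def)

lemma F_measurable_mono: "f \<in> borel_measurable (F s) \<Longrightarrow> s \<le> t \<Longrightarrow> f \<in> borel_measurable (F t)"
  by (rule measurable_from_subalg[of "F t" "F s"]) (auto simp: subalgebra_def space_F sets_F_mono)

lemma F_measurable_M: "f \<in> borel_measurable (F s) \<Longrightarrow> f \<in> borel_measurable M"
  by (rule measurable_from_subalg[OF sub_F])

lemma W_measurable_F: "0 \<le> t \<Longrightarrow> W t \<in> borel_measurable (F t)"
  using bm by (simp add: brownian_motion_def)

lemma W_measurable: "0 \<le> t \<Longrightarrow> W t \<in> borel_measurable M"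
  using W_measurable_F F_measurable_M by blast

lemma increment_distributed:
  "0 \<le> s \<Longrightarrow> s < t \<Longrightarrow> distributed M lborel (\<lambda>\<omega>. W t \<omega> - W s \<omega>) (normal_density 0 (sqrt (t - s)))"
  using bm by (simp add: brownian_motion_def)

lemma increment_indep:
  "0 \<le> s \<Longrightarrow> s < t \<Longrightarrow> indep_set (sets (F s)) {(\<lambda>\<omega>. W t \<omega> - W s \<omega>) -` A \<inter> space M | A. A \<in> sets borel}"
  using bm by (simp add: brownian_motion_def)

lemma F_increment:
  assumes s: "0 \<le> s" "s < t" and Z: "Z \<in> borel_measurable (F s)" "integrable M Z"
  shows "integrable M (\<lambda>\<omega>. Z \<omega> * (W t \<omega> - W s \<omega>))" "expectation (\<lambda>\<omega>. Z \<omega> * (W t \<omega> - W s \<omega>)) = 0"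
    "integrable M (\<lambda>\<omega>. Z \<omega> * (W t \<omega> - W s \<omega>)\<^sup>2)" "expectation (\<lambda>\<omega>. Z \<omega> * (W t \<omega> - W s \<omega>)\<^sup>2) = expectation Z * (t - s)"
proof -
  have \<sigma>: "0 < sqrt (t - s)" using s by simp
  note p = increment_product[OF sub_F increment_distributed[OF s] \<sigma> increment_indep[OF s] Z]
  note q = normal_increment_moments[OF increment_distributed[OF s] \<sigma>]
  show "integrable M (\<lambda>\<omega>. Z \<omega> * (W t \<omega> - W s \<omega>))" "expectation (\<lambda>\<omega>. Z \<omega> * (W t \<omega> - W s \<omega>)) = 0"
    using p[of 1] q(2) by simp_all
  show "integrable M (\<lambda>\<omega>. Z \<omega> * (W t \<omega> - W s \<omega>)\<^sup>2)" "expectation (\<lambda>\<omega>. Z \<omega> * (W t \<omega> - W s \<omega>)\<^sup>2) = expectation Z * (t - s)"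
    using p[of 2] q(3) s by simp_all
qed

text \<open>The Ito isometry on a grid. Measurability of the partial sum at time \<open>p n\<close>
  is carried along because the mixed term with the next increment vanishes on account of it.\<close>

lemma martingale_sum:
  assumes p: "\<And>i j. i < j \<Longrightarrow> j \<le> N \<Longrightarrow> p i < p j" "0 \<le> p 0"
    and \<zeta>: "\<And>k. k < N \<Longrightarrow> \<zeta> k \<in> borel_measurable (F (p k))" "\<And>k \<omega>. k < N \<Longrightarrow> \<omega> \<in> space M \<Longrightarrow> \<bar>\<zeta> k \<omega>\<bar> \<le> c"
    and n: "n \<le> N"
  shows "(\<lambda>\<omega>. wiener_sum W \<zeta> p n \<omega>) \<in> borel_measurable (F (p n)) \<and>
    integrable M (\<lambda>\<omega>. (wiener_sum W \<zeta> p n \<omega>)\<^sup>2) \<and>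
    integrable M (\<lambda>\<omega>. square_sum \<zeta> p n \<omega>) \<and>
    expectation (\<lambda>\<omega>. (wiener_sum W \<zeta> p n \<omega>)\<^sup>2) = expectation (\<lambda>\<omega>. square_sum \<zeta> p n \<omega>)"
  using n
proof (induction n)
  case 0
  then show ?case by simp
next
  case (Suc n)
  define S where "S \<omega> = (wiener_sum W \<zeta> p n \<omega>)" for \<omega>
  define V where "V \<omega> = (square_sum \<zeta> p n \<omega>)" for \<omega>
  have IH: "S \<in> borel_measurable (F (p n))" "integrable M (\<lambda>\<omega>. (S \<omega>)\<^sup>2)" "integrable M V"
    "expectation (\<lambda>\<omega>. (S \<omega>)\<^sup>2) = expectation V"
    using Suc unfolding S_def V_def by auto
  have n: "n < N" "p n < p (Suc n)" using Suc p(1)[of n "Suc n"] by auto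
  have pn: "0 \<le> p n" using p(1)[of 0 n] p(2) n by (cases n) auto
  define z where "z = \<zeta> n"
  define D where "D \<omega> = W (p (Suc n)) \<omega> - W (p n) \<omega>" for \<omega>
  have z: "z \<in> borel_measurable (F (p n))" "\<And>\<omega>. \<omega> \<in> space M \<Longrightarrow> \<bar>z \<omega>\<bar> \<le> c" using \<zeta> n by (auto simp: z_def)
  have zM: "z \<in> borel_measurable M" "S \<in> borel_measurable M" using z(1) IH(1) F_measurable_M by auto
  have z2: "integrable M (\<lambda>\<omega>. (z \<omega>)\<^sup>2)"
    by (rule integrable_const_bound[where B = "c\<^sup>2"]) (use z(2) zM in \<open>auto intro!: AE_I2 power_mono[of "\<bar>_\<bar>" c 2, simplified]\<close>)
  have z2': "(\<lambda>\<omega>. (z \<omega>)\<^sup>2) \<in> borel_measurable (F (p n))" using z by simp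
  have Sz: "integrable M (\<lambda>\<omega>. S \<omega> * z \<omega>)" "(\<lambda>\<omega>. S \<omega> * z \<omega>) \<in> borel_measurable (F (p n))"
    using integrable_mult_L2[OF zM(2,1) IH(2) z2] z(1) IH(1) by simp_all
  note a = F_increment(1,2)[OF pn n(2) Sz(2,1)] and b = F_increment(3,4)[OF pn n(2) z2' z2]
  have sq: "(S \<omega> + z \<omega> * D \<omega>)\<^sup>2 = (S \<omega>)\<^sup>2 + 2 * ((S \<omega> * z \<omega>) * D \<omega>) + (z \<omega>)\<^sup>2 * (D \<omega>)\<^sup>2" for \<omega>
    by (simp add: power2_eq_square algebra_simps)
  have e: "(wiener_sum W \<zeta> p (Suc n) \<omega>) = S \<omega> + z \<omega> * D \<omega>"
    "(square_sum \<zeta> p (Suc n) \<omega>) = V \<omega> + (z \<omega>)\<^sup>2 * (p (Suc n) - p n)" for \<omega>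
    by (simp_all add: S_def V_def z_def D_def)
  have mS: "(\<lambda>\<omega>. S \<omega> + z \<omega> * D \<omega>) \<in> borel_measurable (F (p (Suc n)))"
  proof -
    have [measurable]: "S \<in> borel_measurable (F (p (Suc n)))" "z \<in> borel_measurable (F (p (Suc n)))"
      "W (p n) \<in> borel_measurable (F (p (Suc n)))" "W (p (Suc n)) \<in> borel_measurable (F (p (Suc n)))"
      using F_measurable_mono[OF IH(1)] F_measurable_mono[OF z(1)] F_measurable_mono[OF W_measurable_F[OF pn]] n W_measurable_F[of "p (Suc n)"] pn by auto
    show ?thesis unfolding D_def by measurable
  qed
  have 1: "integrable M (\<lambda>\<omega>. (S \<omega> + z \<omega> * D \<omega>)\<^sup>2)"
    unfolding sq unfolding D_def by (intro Bochner_Integration.integrable_add integrable_mult_right IH a b)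
  have 2: "integrable M (\<lambda>\<omega>. V \<omega> + (z \<omega>)\<^sup>2 * (p (Suc n) - p n))" using IH z2 by simp
  have "expectation (\<lambda>\<omega>. (S \<omega> + z \<omega> * D \<omega>)\<^sup>2) = expectation (\<lambda>\<omega>. (S \<omega>)\<^sup>2) + 2 * 0 + expectation (\<lambda>\<omega>. (z \<omega>)\<^sup>2) * (p (Suc n) - p n)"
    unfolding sq using IH a b by (simp add: D_def[symmetric])
  also have "\<dots> = expectation (\<lambda>\<omega>. V \<omega> + (z \<omega>)\<^sup>2 * (p (Suc n) - p n))"
    using IH z2 by simp
  finally show ?case unfolding e using mS 1 2 by blast
qed

text \<open>The coefficients are switched off once the accumulated squares \<open>V\<close> exceed
  \<delta>. The stopped sum has second moment at most \<delta> by the isometry, and it differs from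
  the original one only where \<open>V N\<close> exceeds \<delta>.\<close>

lemma lenglart:
  assumes p: "\<And>i j. i < j \<Longrightarrow> j \<le> N \<Longrightarrow> p i < p j" "0 \<le> p 0"
    and \<zeta>: "\<And>k. k < N \<Longrightarrow> \<zeta> k \<in> borel_measurable (F (p k))" "\<And>k \<omega>. k < N \<Longrightarrow> \<omega> \<in> space M \<Longrightarrow> \<bar>\<zeta> k \<omega>\<bar> \<le> c"
    and \<delta>: "0 < \<delta>"
  shows "ky_fan M (\<lambda>\<omega>. wiener_sum W \<zeta> p N \<omega>)
     \<le> sqrt \<delta> + prob {\<omega> \<in> space M. \<delta> \<le> (square_sum \<zeta> p N \<omega>)}"
proof -
  define d where "d k = p (Suc k) - p k" for k
  have d: "0 < d k" if "k < N" for k using p(1)[of k "Suc k"] that by (simp add: d_def)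
  define V where "V n \<omega> = (\<Sum>k<n. (\<zeta> k \<omega>)\<^sup>2 * d k)" for n \<omega>
  \<comment> \<open>The criterion uses \<open>V (Suc k)\<close>, which includes the contribution of
    the cell \<open>k\<close> itself. It is still known at time \<open>p k\<close>, and it prevents
    the stopped squares from overshooting \<delta>.\<close>
  define \<eta> where "\<eta> k \<omega> = (if V (Suc k) \<omega> \<le> \<delta> then \<zeta> k \<omega> else 0)" for k \<omega>
  have le: "p i \<le> p j" if "i \<le> j" "j \<le> N" for i j using p(1)[of i j] that by (cases "i = j") auto
  have V_meas: "V (Suc k) \<in> borel_measurable (F (p k))" if "k < N" for k
    unfolding V_def using that by (intro borel_measurable_sum borel_measurable_times borel_measurable_power borel_measurable_const F_measurable_mono[OF \<zeta>(1)] le) auto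
  have \<eta>_meas: "\<eta> k \<in> borel_measurable (F (p k))" if "k < N" for k
    unfolding \<eta>_def using V_meas[OF that] \<zeta>(1)[OF that] by measurable
  have \<eta>_bd: "\<bar>\<eta> k \<omega>\<bar> \<le> max c 0" if "k < N" "\<omega> \<in> space M" for k \<omega>
    using \<zeta>(2)[OF that] by (auto simp: \<eta>_def)
  define S S' where "S \<omega> = (wiener_sum W \<zeta> p N \<omega>)"
    and "S' \<omega> = (wiener_sum W \<eta> p N \<omega>)" for \<omega>
  have V_mono: "V m \<omega> \<le> V n \<omega>" if "m \<le> n" "n \<le> N" for m n \<omega>
    unfolding V_def by (rule sum_mono2) (use that in \<open>auto intro!: mult_nonneg_nonneg less_imp_le[OF d]\<close>)
  have \<eta>_le: "(\<Sum>k<n. (\<eta> k \<omega>)\<^sup>2 * d k) \<le> \<delta>" if "n \<le> N" for n \<omega>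
    using that
  proof (induction n)
    case 0
    then show ?case using \<delta> by simp
  next
    case (Suc n)
    show ?case
    proof (cases "V (Suc n) \<omega> \<le> \<delta>")
      case True
      have "(\<Sum>k<Suc n. (\<eta> k \<omega>)\<^sup>2 * d k) \<le> V (Suc n) \<omega>"
        unfolding V_def using Suc.prems d by (intro sum_mono mult_right_mono) (auto simp: \<eta>_def less_imp_le)
      then show ?thesis using True by simp
    next
      case False
      then show ?thesis using Suc by (simp add: \<eta>_def)
    qed
  qed
  have M0: "S \<in> borel_measurable (F (p N))"
    unfolding S_def
    by (rule martingale_sum[where N = N and n = N and p = p and \<zeta> = \<zeta> and c = c, THEN conjunct1]) (use p \<zeta> in auto)
  have M1: "S' \<in> borel_measurable (F (p N)) \<and> integrable M (\<lambda>\<omega>. (S' \<omega>)\<^sup>2) \<and>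
    integrable M (\<lambda>\<omega>. \<Sum>k<N. (\<eta> k \<omega>)\<^sup>2 * d k) \<and>
    expectation (\<lambda>\<omega>. (S' \<omega>)\<^sup>2) = expectation (\<lambda>\<omega>. \<Sum>k<N. (\<eta> k \<omega>)\<^sup>2 * d k)"
    unfolding S'_def d_def
    by (rule martingale_sum[where N = N and n = N and p = p and \<zeta> = \<eta> and c = "max c 0"]) (use p \<eta>_meas \<eta>_bd in auto)
  have mS [measurable]: "S \<in> borel_measurable M" "S' \<in> borel_measurable M"
    using F_measurable_M[OF M0] M1 F_measurable_M by blast+
  have VM [measurable]: "V N \<in> borel_measurable M"
    unfolding V_def using F_measurable_M[OF \<zeta>(1)] by (intro borel_measurable_sum borel_measurable_times borel_measurable_power borel_measurable_const) auto
  have "ky_fan M S' \<le> sqrt (expectation (\<lambda>\<omega>. (S' \<omega>)\<^sup>2))"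
    using M1 by (intro ky_fan_le_L2 mS) auto
  also have "\<dots> \<le> sqrt \<delta>"
  proof (rule real_sqrt_le_mono)
    have "expectation (\<lambda>\<omega>. (S' \<omega>)\<^sup>2) = expectation (\<lambda>\<omega>. \<Sum>k<N. (\<eta> k \<omega>)\<^sup>2 * d k)"
      using M1 by simp
    also have "\<dots> \<le> expectation (\<lambda>\<omega>. \<delta>)" using M1 \<eta>_le by (intro integral_mono) auto
    finally show "expectation (\<lambda>\<omega>. (S' \<omega>)\<^sup>2) \<le> \<delta>" by (simp add: prob_space)
  qed
  finally have S': "ky_fan M S' \<le> sqrt \<delta>" .
  let ?A = "{\<omega> \<in> space M. \<delta> \<le> V N \<omega>}"
  have A: "?A \<in> events" by measurable
  have eq: "S \<omega> = S' \<omega>" if "\<omega> \<in> space M" "\<omega> \<notin> ?A" for \<omega>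
  proof -
    have "V (Suc k) \<omega> \<le> \<delta>" if "k < N" for k
      using V_mono[of "Suc k" N \<omega>] that \<open>\<omega> \<notin> ?A\<close> \<open>\<omega> \<in> space M\<close> by auto
    then show ?thesis by (auto simp: S_def S'_def \<eta>_def intro!: sum.cong)
  qed
  have "ky_fan M S \<le> expectation (\<lambda>\<omega>. min 1 \<bar>S' \<omega>\<bar> + indicator ?A \<omega>)"
    unfolding ky_fan_def
  proof (rule integral_mono)
    show "integrable M (\<lambda>\<omega>. min 1 \<bar>S' \<omega>\<bar> + indicator ?A \<omega>)"
      using A by (intro Bochner_Integration.integrable_add integrable_min_abs mS integrable_real_indicator) (auto simp: less_top[symmetric])
    show "min 1 \<bar>S \<omega>\<bar> \<le> min 1 \<bar>S' \<omega>\<bar> + indicator ?A \<omega>" if "\<omega> \<in> space M" for \<omega>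
      using eq[OF that] by (cases "\<omega> \<in> ?A") auto
  qed simp
  also have "\<dots> = ky_fan M S' + prob ?A"
    using A by (subst Bochner_Integration.integral_add) (auto simp: ky_fan_def less_top[symmetric] intro!: integrable_real_indicator)
  finally show ?thesis using S' by (simp add: S_def[abs_def] V_def d_def)
qed

end

section \<open>Uniqueness of the It\^o integral\<close>

lemma simple_process_fun_measurable:
  assumes "\<And>r s \<xi>. (r, s, \<xi>) \<in> set h \<Longrightarrow> \<xi> \<in> borel_measurable M"
  shows "(\<lambda>z. simple_process_fun h (snd z) (fst z)) \<in> borel_measurable (M \<Otimes>\<^sub>M lborel)"
  using assms
proof (induction h)
  case Nil
  then show ?case by (simp add: simple_process_fun_def)
next
  case (Cons x h)
  obtain r s \<xi> where x: "x = (r, s, \<xi>)" by (cases x)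
  have [measurable]: "\<xi> \<in> borel_measurable M" using Cons.prems[of r s \<xi>] by (simp add: x)
  have [measurable]: "(\<lambda>z. simple_process_fun h (snd z) (fst z)) \<in> borel_measurable (M \<Otimes>\<^sub>M lborel)"
    using Cons by auto
  have "(\<lambda>z. simple_process_fun (x # h) (snd z) (fst z))
    = (\<lambda>z. \<xi> (fst z) * indicator {r<..s} (snd z) + simple_process_fun h (snd z) (fst z))"
    by (simp add: fun_eq_iff simple_process_fun_def x)
  then show ?case by simp
qed

context brownian
begin

lemma simple_processD:
  assumes "simple_process F h" "(r, s, \<xi>) \<in> set h"
  shows "0 \<le> r" "r \<le> s" "\<xi> \<in> borel_measurable (F r)" "bounded (\<xi> ` space M)"
  using assms unfolding simple_process_def by (auto simp: space_F dest!: bspec)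

lemma simple_process_coeff_measurable:
  "simple_process F h \<Longrightarrow> (r, s, \<xi>) \<in> set h \<Longrightarrow> \<xi> \<in> borel_measurable M"
  using F_measurable_M simple_processD(3) by blast

lemma simple_process_measurable:
  "simple_process F h \<Longrightarrow> (\<lambda>z. simple_process_fun h (snd z) (fst z)) \<in> borel_measurable (M \<Otimes>\<^sub>M lborel)"
  using simple_process_coeff_measurable by (intro simple_process_fun_measurable) blast

lemma simple_ito_integral_measurable:
  assumes "\<And>r s \<xi>. (r, s, \<xi>) \<in> set h \<Longrightarrow> \<xi> \<in> borel_measurable M \<and> 0 \<le> r \<and> 0 \<le> s" "0 \<le> t"
  shows "simple_ito_integral W t h \<in> borel_measurable M"
  using assms(1)
proof (induction h)
  case Nil
  then show ?case by (simp add: simple_ito_integral_def[abs_def])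
next
  case (Cons x h)
  obtain r s \<xi> where x: "x = (r, s, \<xi>)" by (cases x)
  have [measurable]: "\<xi> \<in> borel_measurable M" "W (min s t) \<in> borel_measurable M" "W (min r t) \<in> borel_measurable M"
    using Cons.prems[of r s \<xi>] assms(2) by (auto simp: x intro!: W_measurable)
  have [measurable]: "simple_ito_integral W t h \<in> borel_measurable M" using Cons by auto
  have "simple_ito_integral W t (x # h) = (\<lambda>\<omega>. \<xi> \<omega> * (W (min s t) \<omega> - W (min r t) \<omega>) + simple_ito_integral W t h \<omega>)"
    by (simp add: fun_eq_iff simple_ito_integral_def x)
  then show ?case by simp
qed

lemma simple_ito_integral_measurable':
  "simple_process F h \<Longrightarrow> 0 \<le> t \<Longrightarrow> simple_ito_integral W t h \<in> borel_measurable M"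
proof (rule simple_ito_integral_measurable)
  fix r s \<xi> assume h: "simple_process F h" and m: "(r, s, \<xi>) \<in> set h"
  show "\<xi> \<in> borel_measurable M \<and> 0 \<le> r \<and> 0 \<le> s"
    using simple_process_coeff_measurable[OF h m] simple_processD(1,2)[OF h m] by simp
qed

lemma lenglart_process:
  assumes h: "simple_process F h" and t: "0 \<le> t" and \<delta>: "0 < \<delta>"
  shows "ky_fan M (simple_ito_integral W t h) \<le> sqrt \<delta> +
    prob {\<omega> \<in> space M. ennreal \<delta> \<le> (\<integral>\<^sup>+u\<in>{0..t}. ennreal ((simple_process_fun h u \<omega>)\<^sup>2) \<partial>lborel)}"
proof -
  have "\<forall>(r, s, \<xi>)\<in>set h. 0 \<le> r \<and> r \<le> s" using h by (auto simp: simple_process_def)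
  then obtain p N where g: "is_grid t h p N" using grid_exists[OF t] by blast
  have \<zeta>: "grid_coeff t h p k \<in> borel_measurable (F (p k))" if "k < N" for k
  proof (rule grid_coeff_measurable)
    fix r s \<xi> assume a: "(r, s, \<xi>) \<in> set h" "min r t \<le> p k" "p k < min s t"
    then have "r \<le> p k" by (auto simp: min_def split: if_splits)
    then show "\<xi> \<in> borel_measurable (F (p k))"
      using F_measurable_mono[OF simple_processD(3)[OF h a(1)]] by blast
  qed
  have "\<exists>c. \<forall>\<omega>\<in>space M. \<bar>grid_coeff t h p k \<omega>\<bar> \<le> c" for k
    using simple_processD(4)[OF h] by (rule grid_coeff_bounded)
  then obtain c where c: "\<And>k \<omega>. \<omega> \<in> space M \<Longrightarrow> \<bar>grid_coeff t h p k \<omega>\<bar> \<le> c k" by metis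
  have c': "\<bar>grid_coeff t h p k \<omega>\<bar> \<le> (\<Sum>k<N. \<bar>c k\<bar>)" if "k < N" "\<omega> \<in> space M" for k \<omega>
    using c[OF that(2), of k] member_le_sum[of k "{..<N}" "\<lambda>k. \<bar>c k\<bar>"] that(1) by simp
  have "ky_fan M (\<lambda>\<omega>. wiener_sum W (grid_coeff t h p) p N \<omega>)
     \<le> sqrt \<delta> + prob {\<omega> \<in> space M. \<delta> \<le> (square_sum (grid_coeff t h p) p N \<omega>)}"
    by (rule lenglart[where c = "\<Sum>k<N. \<bar>c k\<bar>"]) (use g \<zeta> c' \<delta> in \<open>auto simp: is_grid_def\<close>)
  moreover have "0 \<le> (square_sum (grid_coeff t h p) p N \<omega>)" for \<omega>
    using is_grid_mono(1)[OF g] by (intro sum_nonneg mult_nonneg_nonneg) auto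
  ultimately show ?thesis
    unfolding nn_integral_simple_process_grid[OF g] simple_ito_integral_grid[OF g, abs_def] by simp
qed

text \<open>Progressive measurability speaks about a restricted time interval. Clamping the time
  gives a function that is measurable on the full product and unchanged on
  \<open>{0..t}\<close>.\<close>

lemma progressive_clamp:
  assumes H: "progressively_measurable F H" and t: "0 \<le> t"
  shows "(\<lambda>z. H (max 0 (min t (snd z))) (fst z)) \<in> borel_measurable (M \<Otimes>\<^sub>M lborel)"
proof -
  have "(\<lambda>z. (max 0 (min t (snd z)), fst z)) \<in> measurable (M \<Otimes>\<^sub>M lborel) (restrict_space borel {0..t} \<Otimes>\<^sub>M F t)"
  proof (rule measurable_Pair)
    show "(\<lambda>z. max 0 (min t (snd z))) \<in> measurable (M \<Otimes>\<^sub>M lborel) (restrict_space borel {0..t})"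
      using t by (intro measurable_restrict_space2) auto
    have "(\<lambda>\<omega>. \<omega>) \<in> measurable M (F t)"
      using sub_F[of t] by (intro measurableI) (auto simp: subalgebra_def Int_absorb2 sets.sets_into_space)
    then show "fst \<in> measurable (M \<Otimes>\<^sub>M lborel) (F t)"
      using measurable_compose[OF measurable_fst] by blast
  qed
  moreover have "(\<lambda>(s, \<omega>). H s \<omega>) \<in> borel_measurable (restrict_space borel {0..t} \<Otimes>\<^sub>M F t)"
    using H t by (simp add: progressively_measurable_def)
  ultimately have "(\<lambda>z. (\<lambda>(s, \<omega>). H s \<omega>) (max 0 (min t (snd z)), fst z)) \<in> borel_measurable (M \<Otimes>\<^sub>M lborel)"
    by (rule measurable_compose)
  then show ?thesis by simp
qed

text \<open>Extended real values are used because the square of \<open>H\<close> is integrable over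
  time only almost surely.\<close>

definition L2_distance :: "real \<Rightarrow> (real \<times> real \<times> ('w \<Rightarrow> real)) list \<Rightarrow> (real \<Rightarrow> 'w \<Rightarrow> real) \<Rightarrow> 'w \<Rightarrow> ennreal" where
  "L2_distance t h H \<omega> = (\<integral>\<^sup>+u\<in>{0..t}. ennreal ((simple_process_fun h u \<omega> - H u \<omega>)\<^sup>2) \<partial>lborel)"

lemma L2_distance_clamp:
  "L2_distance t h H \<omega> = (\<integral>\<^sup>+u. ennreal ((simple_process_fun h u \<omega> - H (max 0 (min t u)) \<omega>)\<^sup>2) * indicator {0..t} u \<partial>lborel)"
  unfolding L2_distance_def by (intro nn_integral_cong) (auto split: split_indicator)

lemma L2_distance_measurable:
  assumes h: "simple_process F h" and H: "progressively_measurable F H" and t: "0 \<le> t"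
  shows "L2_distance t h H \<in> borel_measurable M"
proof -
  note [measurable] = progressive_clamp[OF H t] simple_process_measurable[OF h]
  have "(\<lambda>z. ennreal ((simple_process_fun h (snd z) (fst z) - H (max 0 (min t (snd z))) (fst z))\<^sup>2) * indicator {0..t} (snd z)) \<in> borel_measurable (M \<Otimes>\<^sub>M lborel)"
    by measurable
  from lborel.borel_measurable_nn_integral_fst[OF this] show ?thesis
    unfolding L2_distance_clamp[abs_def] by simp
qed

lemma L2_distance_triangle:
  assumes h: "simple_process F h" and g: "simple_process F g" and H: "progressively_measurable F H" and t: "0 \<le> t"
    and \<omega>: "\<omega> \<in> space M"
  shows "(\<integral>\<^sup>+u\<in>{0..t}. ennreal ((simple_process_fun (h @ scale_process (-1) g) u \<omega>)\<^sup>2) \<partial>lborel)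
    \<le> 2 * L2_distance t h H \<omega> + 2 * L2_distance t g H \<omega>"
proof -
  have m: "(\<lambda>u. ennreal ((simple_process_fun h u \<omega> - H (max 0 (min t u)) \<omega>)\<^sup>2) * indicator {0..t} u) \<in> borel_measurable lborel"
    if "simple_process F h" for h
  proof -
    note [measurable] = progressive_clamp[OF H t] simple_process_measurable[OF that]
    have "(\<lambda>z. ennreal ((simple_process_fun h (snd z) (fst z) - H (max 0 (min t (snd z))) (fst z))\<^sup>2) * indicator {0..t} (snd z)) \<in> borel_measurable (M \<Otimes>\<^sub>M lborel)"
      by measurable
    from measurable_compose[OF measurable_Pair1'[OF \<omega>] this] show ?thesis by simp
  qed
  have "(\<integral>\<^sup>+u\<in>{0..t}. ennreal ((simple_process_fun (h @ scale_process (-1) g) u \<omega>)\<^sup>2) \<partial>lborel)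
    \<le> (\<integral>\<^sup>+u. 2 * (ennreal ((simple_process_fun h u \<omega> - H (max 0 (min t u)) \<omega>)\<^sup>2) * indicator {0..t} u)
          + 2 * (ennreal ((simple_process_fun g u \<omega> - H (max 0 (min t u)) \<omega>)\<^sup>2) * indicator {0..t} u) \<partial>lborel)"
  proof (rule nn_integral_mono)
    fix u
    have "(x - y)\<^sup>2 \<le> 2 * (x - z)\<^sup>2 + 2 * (y - z)\<^sup>2" for x y z :: real
      using square_diff_le[of "x - z" "y - z"] by simp
    then have "ennreal ((simple_process_fun h u \<omega> - simple_process_fun g u \<omega>)\<^sup>2) \<le>
      ennreal (2 * (simple_process_fun h u \<omega> - H (max 0 (min t u)) \<omega>)\<^sup>2 + 2 * (simple_process_fun g u \<omega> - H (max 0 (min t u)) \<omega>)\<^sup>2)"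
      by (intro ennreal_leI) simp
    also have "\<dots> = 2 * ennreal ((simple_process_fun h u \<omega> - H (max 0 (min t u)) \<omega>)\<^sup>2) + 2 * ennreal ((simple_process_fun g u \<omega> - H (max 0 (min t u)) \<omega>)\<^sup>2)"
      by (simp add: ennreal_mult)
    finally show "ennreal ((simple_process_fun (h @ scale_process (-1) g) u \<omega>)\<^sup>2) * indicator {0..t} u
      \<le> 2 * (ennreal ((simple_process_fun h u \<omega> - H (max 0 (min t u)) \<omega>)\<^sup>2) * indicator {0..t} u)
          + 2 * (ennreal ((simple_process_fun g u \<omega> - H (max 0 (min t u)) \<omega>)\<^sup>2) * indicator {0..t} u)"
      by (cases "u \<in> {0..t}") simp_all
  qed
  also have "\<dots> = 2 * L2_distance t h H \<omega> + 2 * L2_distance t g H \<omega>"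
    unfolding L2_distance_clamp using m[OF h] m[OF g]
    by (subst nn_integral_add) (auto simp: nn_integral_cmult)
  finally show ?thesis .
qed

text \<open>The definition offers some approximating sequence \<open>g\<close>. Any other sequence
  \<open>h\<close> with the same limit \<open>H\<close> is close to it, so
  \<open>lenglart_process\<close> makes the difference of the simple integrals small in
  probability.\<close>

lemma ito_integral_unique:
  assumes Z: "has_ito_integral M F W t H Z" and t: "0 \<le> t"
    and h: "\<And>n. simple_process F (h n)"
    and lim: "\<And>\<epsilon>. 0 < \<epsilon> \<Longrightarrow> (\<lambda>n. prob {\<omega> \<in> space M. ennreal \<epsilon> \<le> L2_distance t (h n) H \<omega>}) \<longlonglongrightarrow> 0"
  shows "Z \<in> borel_measurable M" "(\<lambda>n. ky_fan M (\<lambda>\<omega>. simple_ito_integral W t (h n) \<omega> - Z \<omega>)) \<longlonglongrightarrow> 0"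
proof -
  have H: "progressively_measurable F H" using Z by (simp add: has_ito_integral_def)
  obtain g where g: "\<And>n. simple_process F (g n)"
    and g_lim: "\<And>\<epsilon>. 0 < \<epsilon> \<Longrightarrow> (\<lambda>n. prob {\<omega> \<in> space M. ennreal \<epsilon> \<le> L2_distance t (g n) H \<omega>}) \<longlonglongrightarrow> 0"
    and g_Z: "conv_in_prob M (\<lambda>n. simple_ito_integral W t (g n)) Z"
    using Z unfolding has_ito_integral_def L2_distance_def by blast
  show mZ [measurable]: "Z \<in> borel_measurable M" using g_Z by (simp add: conv_in_prob_def)
  note [measurable] = simple_ito_integral_measurable'[OF h t] simple_ito_integral_measurable'[OF g t]
    L2_distance_measurable[OF h H t] L2_distance_measurable[OF g H t]
  let ?A = "\<lambda>h \<delta>. {\<omega> \<in> space M. ennreal \<delta> \<le> L2_distance t h H \<omega>}"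
  \<comment> \<open>If both distances to \<open>H\<close> are below \<open>\<delta> / 4\<close>, the
    squared distance between the two processes is below \<delta>, by the factors 2 in
    \<open>L2_distance_triangle\<close>.\<close>
  have bound: "ky_fan M (\<lambda>\<omega>. simple_ito_integral W t (h n) \<omega> - simple_ito_integral W t (g n) \<omega>)
     \<le> sqrt \<delta> + (prob (?A (h n) (\<delta> / 4)) + prob (?A (g n) (\<delta> / 4)))" if \<delta>: "0 < \<delta>" for n \<delta>
  proof -
    let ?d = "h n @ scale_process (-1) (g n)"
    have d: "simple_process F ?d" by (intro simple_process_append simple_process_scale h g)
    have "simple_ito_integral W t ?d = (\<lambda>\<omega>. simple_ito_integral W t (h n) \<omega> - simple_ito_integral W t (g n) \<omega>)"
      by (simp add: fun_eq_iff)
    then have "ky_fan M (\<lambda>\<omega>. simple_ito_integral W t (h n) \<omega> - simple_ito_integral W t (g n) \<omega>) \<le> sqrt \<delta> +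
      prob {\<omega> \<in> space M. ennreal \<delta> \<le> (\<integral>\<^sup>+u\<in>{0..t}. ennreal ((simple_process_fun ?d u \<omega>)\<^sup>2) \<partial>lborel)}"
      using lenglart_process[OF d t \<delta>] by simp
    also have "prob {\<omega> \<in> space M. ennreal \<delta> \<le> (\<integral>\<^sup>+u\<in>{0..t}. ennreal ((simple_process_fun ?d u \<omega>)\<^sup>2) \<partial>lborel)}
      \<le> prob (?A (h n) (\<delta> / 4) \<union> ?A (g n) (\<delta> / 4))"
    proof (rule finite_measure_mono)
      show "?A (h n) (\<delta> / 4) \<union> ?A (g n) (\<delta> / 4) \<in> events" by measurable
      show "{\<omega> \<in> space M. ennreal \<delta> \<le> (\<integral>\<^sup>+u\<in>{0..t}. ennreal ((simple_process_fun ?d u \<omega>)\<^sup>2) \<partial>lborel)}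
        \<subseteq> ?A (h n) (\<delta> / 4) \<union> ?A (g n) (\<delta> / 4)"
      proof (rule subsetI, rule ccontr)
        fix \<omega> assume a: "\<omega> \<in> {\<omega> \<in> space M. ennreal \<delta> \<le> (\<integral>\<^sup>+u\<in>{0..t}. ennreal ((simple_process_fun ?d u \<omega>)\<^sup>2) \<partial>lborel)}"
          "\<omega> \<notin> ?A (h n) (\<delta> / 4) \<union> ?A (g n) (\<delta> / 4)"
        then have \<omega>: "\<omega> \<in> space M" and lt: "L2_distance t (h n) H \<omega> < ennreal (\<delta> / 4)" "L2_distance t (g n) H \<omega> < ennreal (\<delta> / 4)"
          by (auto simp: not_le)
        obtain x where x: "L2_distance t (h n) H \<omega> = ennreal x" "0 \<le> x" using lt(1) by (cases "L2_distance t (h n) H \<omega>") auto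
        obtain y where y: "L2_distance t (g n) H \<omega> = ennreal y" "0 \<le> y" using lt(2) by (cases "L2_distance t (g n) H \<omega>") auto
        have "ennreal \<delta> \<le> 2 * ennreal x + 2 * ennreal y"
          using a(1) L2_distance_triangle[OF h g H t \<omega>, of n n] x y by auto
        also have "\<dots> = ennreal (2 * x + 2 * y)" using x y by (simp add: ennreal_mult)
        finally have "\<delta> \<le> 2 * x + 2 * y" using x y by (subst (asm) ennreal_le_iff) auto
        then show False using lt x y \<delta> by (simp add: ennreal_less_iff)
      qed
    qed
    also have "\<dots> \<le> prob (?A (h n) (\<delta> / 4)) + prob (?A (g n) (\<delta> / 4))"
      by (rule measure_Un_le) measurable
    finally show ?thesis by simp
  qed
  have hg: "(\<lambda>n. ky_fan M (\<lambda>\<omega>. simple_ito_integral W t (h n) \<omega> - simple_ito_integral W t (g n) \<omega>)) \<longlonglongrightarrow> 0"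
  proof (rule LIMSEQ_I)
    fix e :: real assume e: "0 < e"
    define \<delta> where "\<delta> = (e / 2)\<^sup>2"
    have \<delta>: "0 < \<delta>" "sqrt \<delta> = e / 2" using e by (auto simp: \<delta>_def)
    have "(\<lambda>n. prob (?A (h n) (\<delta> / 4)) + prob (?A (g n) (\<delta> / 4))) \<longlonglongrightarrow> 0 + 0"
      using \<delta> by (intro tendsto_add lim g_lim) auto
    then have "\<forall>\<^sub>F n in sequentially. prob (?A (h n) (\<delta> / 4)) + prob (?A (g n) (\<delta> / 4)) < e / 2"
      by (rule order_tendstoD) (use e in auto)
    then obtain N where N: "\<And>n. n \<ge> N \<Longrightarrow> prob (?A (h n) (\<delta> / 4)) + prob (?A (g n) (\<delta> / 4)) < e / 2"
      by (auto simp: eventually_sequentially)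
    have "norm (ky_fan M (\<lambda>\<omega>. simple_ito_integral W t (h n) \<omega> - simple_ito_integral W t (g n) \<omega>) - 0) < e" if "n \<ge> N" for n
      using bound[OF \<delta>(1), of n] N[OF that] \<delta>(2) by simp
    then show "\<exists>N. \<forall>n\<ge>N. norm (ky_fan M (\<lambda>\<omega>. simple_ito_integral W t (h n) \<omega> - simple_ito_integral W t (g n) \<omega>) - 0) < e"
      by blast
  qed
  show "(\<lambda>n. ky_fan M (\<lambda>\<omega>. simple_ito_integral W t (h n) \<omega> - Z \<omega>)) \<longlonglongrightarrow> 0"
  proof (rule Lim_null_comparison[OF _ tendsto_add_zero[OF hg conv_in_prob_ky_fan[OF g_Z]]])
    show "\<forall>\<^sub>F n in sequentially. norm (ky_fan M (\<lambda>\<omega>. simple_ito_integral W t (h n) \<omega> - Z \<omega>))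
      \<le> ky_fan M (\<lambda>\<omega>. simple_ito_integral W t (h n) \<omega> - simple_ito_integral W t (g n) \<omega>) + ky_fan M (\<lambda>\<omega>. simple_ito_integral W t (g n) \<omega> - Z \<omega>)"
      using ky_fan_triangle[of "simple_ito_integral W t (h n)" "simple_ito_integral W t (g n)" Z for n]
      by (intro always_eventually allI) simp
  qed
qed

end

section \<open>Integrals of coefficients independent of the Brownian motion\<close>

lemma sets_sigma_generated_events:
  assumes "generated_events M Z I \<subseteq> Pow (space M)"
  shows "sets (sigma (space M) (generated_events M Z I)) = generated_events M Z I"
proof -
  have "(\<Union>i\<in>I. {Z i -` A \<inter> space M |A. A \<in> sets borel}) \<subseteq> Pow (space M)" by auto
  then show ?thesis using assms
    by (simp add: generated_events_def sigma_sets_sigma_sets_eq)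
qed

lemma generated_events_Pow: "generated_events M Z I \<subseteq> Pow (space M)"
  unfolding generated_events_def by (rule subsetI, rule PowI, erule sigma_sets_into_sp[rotated]) auto

lemma generated_events_measurable:
  assumes "i \<in> I"
  shows "Z i \<in> borel_measurable (sigma (space M) (generated_events M Z I))"
proof (rule measurableI)
  fix A :: "real set" assume "A \<in> sets borel"
  then show "Z i -` A \<inter> space (sigma (space M) (generated_events M Z I)) \<in> sets (sigma (space M) (generated_events M Z I))"
    unfolding sets_sigma_generated_events[OF generated_events_Pow]
    using assms generated_events_Pow[of M Z I] by (auto simp: generated_events_def space_measure_of_conv intro!: sigma_sets.Basic)
qed simp

lemma generated_events_least:
  assumes "\<And>i. i \<in> I \<Longrightarrow> Z i \<in> borel_measurable K" "space K = space M"
  shows "generated_events M Z I \<subseteq> sets K"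
  unfolding generated_events_def
  by (rule sets.sigma_sets_subset[of _ K, unfolded assms(2)]) (use measurable_sets[OF assms(1)] assms(2) in auto)

locale brownian_indep = brownian M F W for M :: "'w measure" and F W +
  fixes G :: "'w measure"
  assumes sub_G: "subalgebra M G"
    and indep_G: "indep_set (sets G) (generated_events M W {0..})"
begin

lemma space_G: "space G = space M"
  using sub_G by (simp add: subalgebra_def)

text \<open>Closed under intersection, so that independence of the generated algebra reduces to a
  product formula for three events.\<close>

abbreviation cylinders :: "real \<Rightarrow> 'w set set" where
  "cylinders s \<equiv> {A \<inter> B | A B. A \<in> sets G \<and> B \<in> generated_events M W {0..s}}"

text \<open>
  \<open>W\<close> is still a Brownian motion for the filtration generated by itself and the whole of \<open>G\<close>, so
  that integrands which are measurable in \<open>G\<close> can be treated as adapted at all times.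
\<close>

definition enlarged :: "real \<Rightarrow> 'w measure" where
  "enlarged s = sigma (space M) (cylinders s)"

lemma generated_F: "generated_events M W {0..s} \<subseteq> sets (F s)"
  by (rule generated_events_least) (auto intro: F_measurable_mono[OF W_measurable_F] simp: space_F)

lemma generated_M: "generated_events M W {0..} \<subseteq> sets M"
  by (rule generated_events_least) (auto intro: W_measurable)

lemma generated_mono: "I \<subseteq> J \<Longrightarrow> generated_events M W I \<subseteq> generated_events M W J"
  unfolding generated_events_def by (rule sigma_sets_mono') auto

lemma enlarged_generator_subset: "cylinders s \<subseteq> sets M"
proof -
  have "A \<in> sets M" "B \<in> sets M" if "A \<in> sets G" "B \<in> generated_events M W {0..s}" for A B
    using that sub_G generated_M generated_mono[of "{0..s}" "{0..}"] by (auto simp: subalgebra_def)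
  then show ?thesis by blast
qed

lemma space_enlarged: "space (enlarged s) = space M"
  unfolding enlarged_def using enlarged_generator_subset[of s] sets.space_closed by (subst space_measure_of) blast+

lemma sets_enlarged: "sets (enlarged s) = sigma_sets (space M) (cylinders s)"
  unfolding enlarged_def using enlarged_generator_subset[of s] sets.space_closed by (subst sets_measure_of) blast+

lemma sub_enlarged: "subalgebra M (enlarged s)"
  unfolding subalgebra_def space_enlarged sets_enlarged
  using sets.sigma_sets_subset[OF enlarged_generator_subset] by simp

lemma top_generated: "space M \<in> generated_events M W I"
  unfolding generated_events_def by (rule sigma_sets_top)

lemma enlarged_G: "Z \<in> borel_measurable G \<Longrightarrow> Z \<in> borel_measurable (enlarged s)"
proof (rule measurable_from_subalg)
  have "A \<in> sets (enlarged s)" if "A \<in> sets G" for A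
  proof -
    have "A = A \<inter> space M" using sets.sets_into_space[OF that] space_G by auto
    then show ?thesis unfolding sets_enlarged using that top_generated by (intro sigma_sets.Basic) blast
  qed
  then show "subalgebra (enlarged s) G" by (auto simp: subalgebra_def space_enlarged space_G)
qed

lemma enlarged_W: "0 \<le> r \<Longrightarrow> r \<le> s \<Longrightarrow> W r \<in> borel_measurable (enlarged s)"
proof (rule measurable_from_subalg)
  assume r: "0 \<le> r" "r \<le> s"
  show "W r \<in> borel_measurable (sigma (space M) (generated_events M W {0..s}))"
    by (rule generated_events_measurable) (use r in auto)
  have "B \<in> sets (enlarged s)" if "B \<in> generated_events M W {0..s}" for B
  proof -
    have "B = space G \<inter> B" using that generated_events_Pow[of M W "{0..s}"] space_G by auto
    then show ?thesis unfolding sets_enlarged using that sets.top[of G] by (intro sigma_sets.Basic) blast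
  qed
  then show "subalgebra (enlarged s) (sigma (space M) (generated_events M W {0..s}))"
    unfolding subalgebra_def sets_sigma_generated_events[OF generated_events_Pow]
    by (auto simp: space_enlarged space_measure_of_conv)
qed

lemma enlarged_mono: "s \<le> t \<Longrightarrow> Z \<in> borel_measurable (enlarged s) \<Longrightarrow> Z \<in> borel_measurable (enlarged t)"
proof (rule measurable_from_subalg)
  assume "s \<le> t"
  then have "generated_events M W {0..s} \<subseteq> generated_events M W {0..t}" by (intro generated_mono) auto
  then show "subalgebra (enlarged t) (enlarged s)"
    unfolding subalgebra_def space_enlarged sets_enlarged by (auto intro!: sigma_sets_mono')
qed

text \<open>The event \<open>A\<close> of \<open>G\<close> is split off first, because
  \<open>B\<close> and the event of the increment both belong to the Brownian motion; then the
  increment is split off from its past \<open>B\<close>. Only the generated past, and not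
  \<open>F s\<close>, is joined with \<open>G\<close>, since independence of the increment from
  \<open>F s\<close> and \<open>G\<close> together is not given.\<close>

lemma enlarged_indep:
  assumes s: "0 \<le> s" "s < t"
  shows "indep_set (sets (enlarged s)) {(\<lambda>\<omega>. W t \<omega> - W s \<omega>) -` A \<inter> space M | A. A \<in> sets borel}"
proof -
  let ?D = "\<lambda>\<omega>. W t \<omega> - W s \<omega>"
  let ?C = "{?D -` A \<inter> space M | A. A \<in> sets borel}"
  let ?GW = "sigma (space M) (generated_events M W {0..})"
  have [measurable]: "W t \<in> borel_measurable ?GW" "W s \<in> borel_measurable ?GW"
    using s by (auto intro!: generated_events_measurable)
  have "?D \<in> borel_measurable ?GW" by measurable
  then have C_gen: "C \<in> generated_events M W {0..}" if "C \<in> ?C" for C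
    using that measurable_sets[of ?D ?GW borel]
    by (auto simp: sets_sigma_generated_events[OF generated_events_Pow] space_measure_of_conv)
  have Int_gen: "B \<inter> C \<in> generated_events M W {0..}" if "B \<in> generated_events M W {0..}" "C \<in> generated_events M W {0..}" for B C
    using sets.Int[of B ?GW C] that unfolding sets_sigma_generated_events[OF generated_events_Pow] by blast
  have "indep_set (cylinders s) ?C"
  proof (rule indep_setI)
    show "cylinders s \<subseteq> events" by (rule enlarged_generator_subset)
    show "?C \<subseteq> events" using C_gen generated_M by blast
    fix a c assume "a \<in> cylinders s" and c: "c \<in> ?C"
    then obtain A B where AB: "a = A \<inter> B" "A \<in> sets G" "B \<in> generated_events M W {0..s}" by blast
    have B': "B \<in> generated_events M W {0..}" using AB generated_mono[of "{0..s}" "{0..}"] by auto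
    have "prob (a \<inter> c) = prob (A \<inter> (B \<inter> c))" using AB by (simp add: Int_assoc)
    also have "\<dots> = prob A * prob (B \<inter> c)"
      by (rule indep_setD[OF indep_G AB(2)]) (use Int_gen[OF B' C_gen[OF c]] in simp)
    also have "prob (B \<inter> c) = prob B * prob c"
      by (rule indep_setD[OF increment_indep[OF s]]) (use AB(3) generated_F c in auto)
    also have "prob A * (prob B * prob c) = (prob A * prob B) * prob c" by simp
    also have "prob A * prob B = prob a"
      unfolding AB(1) by (rule indep_setD[OF indep_G AB(2) B', symmetric])
    finally show "prob (a \<inter> c) = prob a * prob c" .
  qed
  then have "indep_set (sigma_sets (space M) (cylinders s)) (sigma_sets (space M) ?C)"
  proof (rule indep_set_sigma_sets)
    let ?GWs = "sigma (space M) (generated_events M W {0..s})"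
    have Int_s: "B \<inter> B' \<in> generated_events M W {0..s}" if "B \<in> generated_events M W {0..s}" "B' \<in> generated_events M W {0..s}" for B B'
      using sets.Int[of B ?GWs B'] that unfolding sets_sigma_generated_events[OF generated_events_Pow] by blast
    show "Int_stable (cylinders s)"
      unfolding Int_stable_def
    proof (intro ballI)
      fix a b assume "a \<in> cylinders s"
        and "b \<in> cylinders s"
      then obtain A B A' B' where AB: "a = A \<inter> B" "b = A' \<inter> B'" "A \<in> sets G" "A' \<in> sets G"
        "B \<in> generated_events M W {0..s}" "B' \<in> generated_events M W {0..s}" by blast
      have "a \<inter> b = (A \<inter> A') \<inter> (B \<inter> B')" using AB by auto
      then show "a \<inter> b \<in> cylinders s"
        using sets.Int[OF AB(3,4)] Int_s[OF AB(5,6)] by blast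
    qed
    show "Int_stable ?C"
      by (rule Int_stable_vimage)
  qed
  then show ?thesis unfolding sets_enlarged indep_sets2_eq by blast
qed

lemma abs_power_le_fourth: "n \<le> 4 \<Longrightarrow> \<bar>x\<bar> ^ n \<le> 1 + (x::real) ^ 4"
proof -
  assume n: "n \<le> 4"
  show ?thesis
  proof (cases "\<bar>x\<bar> \<le> 1")
    case True
    then have "\<bar>x\<bar> ^ n \<le> 1" by (simp add: power_le_one)
    then show ?thesis by (simp add: add_increasing2)
  next
    case False
    then have "\<bar>x\<bar> ^ n \<le> \<bar>x\<bar> ^ 4" using n by (intro power_increasing) auto
    then show ?thesis by simp
  qed
qed

text \<open>
  The bounded weight \<open>Z\<close>, measurable in \<open>G\<close>, stands in for conditional expectations given \<open>G\<close>
  and is what the induction on \<open>n\<close> needs.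
\<close>

lemma fourth_moment_sum:
  assumes p: "\<And>i j. i < j \<Longrightarrow> j \<le> N \<Longrightarrow> p i < p j" "0 \<le> p 0"
    and \<zeta>: "\<And>k. k < N \<Longrightarrow> \<zeta> k \<in> borel_measurable G" "\<And>k \<omega>. k < N \<Longrightarrow> \<omega> \<in> space M \<Longrightarrow> \<bar>\<zeta> k \<omega>\<bar> \<le> c"
    and n: "n \<le> N"
  shows "(\<lambda>\<omega>. wiener_sum W \<zeta> p n \<omega>) \<in> borel_measurable (enlarged (p n)) \<and>
    integrable M (\<lambda>\<omega>. (wiener_sum W \<zeta> p n \<omega>) ^ 4) \<and>
    (\<forall>Z\<in>borel_measurable G. (\<exists>b. \<forall>\<omega>\<in>space M. \<bar>Z \<omega>\<bar> \<le> b) \<longrightarrow>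
      expectation (\<lambda>\<omega>. Z \<omega> * (wiener_sum W \<zeta> p n \<omega>)\<^sup>2)
        = expectation (\<lambda>\<omega>. Z \<omega> * (square_sum \<zeta> p n \<omega>)) \<and>
      expectation (\<lambda>\<omega>. Z \<omega> * (wiener_sum W \<zeta> p n \<omega>) ^ 4)
        = 3 * expectation (\<lambda>\<omega>. Z \<omega> * (square_sum \<zeta> p n \<omega>)\<^sup>2))"
  using n
proof (induction n)
  case 0
  then show ?case by simp
next
  case (Suc n)
  define S where "S \<omega> = (wiener_sum W \<zeta> p n \<omega>)" for \<omega>
  define V where "V \<omega> = (square_sum \<zeta> p n \<omega>)" for \<omega>
  have n: "n < N" "p n < p (Suc n)" using Suc p(1)[of n "Suc n"] by auto
  have IH: "S \<in> borel_measurable (enlarged (p n))" "integrable M (\<lambda>\<omega>. S \<omega> ^ 4)"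
    and IH2: "\<And>Z. Z \<in> borel_measurable G \<Longrightarrow> (\<exists>b. \<forall>\<omega>\<in>space M. \<bar>Z \<omega>\<bar> \<le> b) \<Longrightarrow>
      expectation (\<lambda>\<omega>. Z \<omega> * (S \<omega>)\<^sup>2) = expectation (\<lambda>\<omega>. Z \<omega> * V \<omega>) \<and>
      expectation (\<lambda>\<omega>. Z \<omega> * S \<omega> ^ 4) = 3 * expectation (\<lambda>\<omega>. Z \<omega> * (V \<omega>)\<^sup>2)"
    using Suc.IH n unfolding S_def V_def by auto
  have pn: "0 \<le> p n" using p(1)[of 0 n] p(2) n by (cases n) auto
  define z where "z = \<zeta> n"
  define d where "d = p (Suc n) - p n"
  have d: "0 < d" using n by (simp add: d_def)
  define D where "D \<omega> = W (p (Suc n)) \<omega> - W (p n) \<omega>" for \<omega>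
  have z: "z \<in> borel_measurable G" "\<And>\<omega>. \<omega> \<in> space M \<Longrightarrow> \<bar>z \<omega>\<bar> \<le> c" using \<zeta> n by (auto simp: z_def)
  have V: "V \<in> borel_measurable G"
    unfolding V_def using \<zeta>(1) n by (intro borel_measurable_sum borel_measurable_times borel_measurable_power borel_measurable_const) auto
  define v where "v = (\<Sum>k<n. c\<^sup>2 * (p (Suc k) - p k))"
  have Vb: "\<bar>V \<omega>\<bar> \<le> v" if "\<omega> \<in> space M" for \<omega>
  proof -
    have "\<bar>V \<omega>\<bar> \<le> (\<Sum>k<n. \<bar>(\<zeta> k \<omega>)\<^sup>2 * (p (Suc k) - p k)\<bar>)" unfolding V_def by (rule sum_abs)
    also have "\<dots> \<le> v" unfolding v_def
    proof (rule sum_mono)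
      fix k assume k: "k \<in> {..<n}"
      then have "0 < p (Suc k) - p k" using p(1)[of k "Suc k"] n by simp
      moreover have "(\<zeta> k \<omega>)\<^sup>2 \<le> c\<^sup>2" using \<zeta>(2)[of k \<omega>] k n that by (intro power2_le_iff_abs_le[THEN iffD2]) (auto intro: order_trans[OF abs_ge_zero])
      ultimately show "\<bar>(\<zeta> k \<omega>)\<^sup>2 * (p (Suc k) - p k)\<bar> \<le> c\<^sup>2 * (p (Suc k) - p k)"
        by (simp add: abs_mult mult_right_mono)
    qed
    finally show ?thesis .
  qed
  define bd where "bd Y \<longleftrightarrow> Y \<in> borel_measurable G \<and> (\<exists>b. \<forall>\<omega>\<in>space M. \<bar>Y \<omega>\<bar> \<le> b)" for Y :: "'w \<Rightarrow> real"
  have bd_mult: "bd (\<lambda>\<omega>. X \<omega> * Y \<omega>)" if bX: "bd X" and bY: "bd Y" for X Y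
  proof -
    obtain a b where ab: "\<forall>\<omega>\<in>space M. \<bar>X \<omega>\<bar> \<le> a" "\<forall>\<omega>\<in>space M. \<bar>Y \<omega>\<bar> \<le> b" using bX bY unfolding bd_def by blast
    have "\<bar>X \<omega> * Y \<omega>\<bar> \<le> \<bar>a\<bar> * \<bar>b\<bar>" if "\<omega> \<in> space M" for \<omega>
      using ab that unfolding abs_mult by (intro mult_mono) (auto intro: order_trans[OF _ abs_ge_self])
    then show ?thesis using bX bY by (auto simp: bd_def)
  qed
  have bdz: "bd z" and bdV: "bd V" using z V Vb by (auto simp: bd_def)
  have mSM: "S \<in> borel_measurable M" by (rule measurable_from_subalg[OF sub_enlarged IH(1)])
  have i1: "integrable M (\<lambda>\<omega>. Y \<omega> * S \<omega> ^ m)" and m1: "(\<lambda>\<omega>. Y \<omega> * S \<omega> ^ m) \<in> borel_measurable (enlarged (p n))"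
    if Y: "bd Y" and m: "m \<le> 4" for Y m
  proof -
    obtain b where b: "\<forall>\<omega>\<in>space M. \<bar>Y \<omega>\<bar> \<le> b" using Y by (auto simp: bd_def)
    have Ym: "Y \<in> borel_measurable G" using Y by (simp add: bd_def)
    have YM: "Y \<in> borel_measurable M" by (rule measurable_from_subalg[OF sub_G Ym])
    show "(\<lambda>\<omega>. Y \<omega> * S \<omega> ^ m) \<in> borel_measurable (enlarged (p n))"
      using enlarged_G[OF Ym] IH(1) by (intro borel_measurable_times borel_measurable_power)
    show "integrable M (\<lambda>\<omega>. Y \<omega> * S \<omega> ^ m)"
    proof (rule Bochner_Integration.integrable_bound)
      show "integrable M (\<lambda>\<omega>. \<bar>b\<bar> * (1 + S \<omega> ^ 4))" using IH(2) by simp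
      show "AE \<omega> in M. norm (Y \<omega> * S \<omega> ^ m) \<le> norm (\<bar>b\<bar> * (1 + S \<omega> ^ 4))"
      proof (rule AE_I2)
        fix \<omega> assume \<omega>: "\<omega> \<in> space M"
        have "\<bar>Y \<omega>\<bar> * \<bar>S \<omega>\<bar> ^ m \<le> \<bar>b\<bar> * (1 + S \<omega> ^ 4)"
          using b[rule_format, OF \<omega>] abs_power_le_fourth[OF m, of "S \<omega>"] by (intro mult_mono) auto
        then show "norm (Y \<omega> * S \<omega> ^ m) \<le> norm (\<bar>b\<bar> * (1 + S \<omega> ^ 4))"
          by (simp add: abs_mult power_abs)
      qed
    qed (use YM mSM in simp)
  qed
  have \<sigma>: "0 < sqrt d" using d by simp
  have dist: "distributed M lborel D (normal_density 0 (sqrt d))"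
    using increment_distributed[OF pn n(2)] by (simp add: D_def[abs_def] d_def)
  have ind: "indep_set (sets (enlarged (p n))) {D -` A \<inter> space M | A. A \<in> sets borel}"
    using enlarged_indep[OF pn n(2)] by (simp add: D_def[abs_def])
  note mom = normal_increment_moments[OF dist \<sigma>]
  have d4: "sqrt d ^ 4 = d\<^sup>2" using d by (simp add: power4_eq_xxxx power2_eq_square)
  have prod: "integrable M (\<lambda>\<omega>. (Y \<omega> * S \<omega> ^ m) * D \<omega> ^ j)"
    "expectation (\<lambda>\<omega>. (Y \<omega> * S \<omega> ^ m) * D \<omega> ^ j) = expectation (\<lambda>\<omega>. Y \<omega> * S \<omega> ^ m) * expectation (\<lambda>\<omega>. D \<omega> ^ j)"
    if "bd Y" "m \<le> 4" for Y m j
    using increment_product[OF sub_enlarged dist \<sigma> ind m1[OF that] i1[OF that]] by simp_all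
  have e: "(wiener_sum W \<zeta> p (Suc n) \<omega>) = S \<omega> + z \<omega> * D \<omega>"
    "(square_sum \<zeta> p (Suc n) \<omega>) = V \<omega> + (z \<omega>)\<^sup>2 * d" for \<omega>
    by (simp_all add: S_def V_def z_def D_def d_def)
  have mS: "(\<lambda>\<omega>. S \<omega> + z \<omega> * D \<omega>) \<in> borel_measurable (enlarged (p (Suc n)))"
  proof -
    have [measurable]: "S \<in> borel_measurable (enlarged (p (Suc n)))" "z \<in> borel_measurable (enlarged (p (Suc n)))"
      "W (p n) \<in> borel_measurable (enlarged (p (Suc n)))" "W (p (Suc n)) \<in> borel_measurable (enlarged (p (Suc n)))"
      using enlarged_mono[OF _ IH(1), of "p (Suc n)"] enlarged_G[OF z(1)] enlarged_W n pn by auto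
    show ?thesis unfolding D_def by measurable
  qed
  have pow2: "Y * (s + x * y)\<^sup>2 = (Y * s ^ 2) * y ^ 0 + 2 * ((Y * x * s ^ 1) * y ^ 1) + (Y * (x * x) * s ^ 0) * y ^ 2" for Y s x y :: real
    by (simp add: power2_eq_square algebra_simps)
  \<comment> \<open>Each summand is a weighted power of the partial sum times a power of the
    increment, the form to which \<open>prod\<close> applies. The summands with an odd power of the
    increment have expectation 0.\<close>
  have pow4: "Y * (s + x * y) ^ 4 = (Y * s ^ 4) * y ^ 0 + 4 * ((Y * x * s ^ 3) * y ^ 1) + 6 * ((Y * (x * x) * s ^ 2) * y ^ 2)
      + 4 * ((Y * (x * (x * x)) * s ^ 1) * y ^ 3) + (Y * ((x * x) * (x * x)) * s ^ 0) * y ^ 4" for Y s x y :: real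
    by (simp add: power2_eq_square power3_eq_cube power4_eq_xxxx algebra_simps)
  have bd1: "bd (\<lambda>_. 1)" by (auto simp: bd_def)
  have int4: "integrable M (\<lambda>\<omega>. Z \<omega> * (S \<omega> + z \<omega> * D \<omega>) ^ 4)"
    and exp2: "expectation (\<lambda>\<omega>. Z \<omega> * (S \<omega> + z \<omega> * D \<omega>)\<^sup>2) = expectation (\<lambda>\<omega>. Z \<omega> * (V \<omega> + (z \<omega>)\<^sup>2 * d))"
    and exp4: "expectation (\<lambda>\<omega>. Z \<omega> * (S \<omega> + z \<omega> * D \<omega>) ^ 4) = 3 * expectation (\<lambda>\<omega>. Z \<omega> * (V \<omega> + (z \<omega>)\<^sup>2 * d)\<^sup>2)"
    if Z: "bd Z" for Z
  proof -
    have bZ: "bd (\<lambda>\<omega>. Z \<omega> * z \<omega>)" "bd (\<lambda>\<omega>. Z \<omega> * (z \<omega> * z \<omega>))" "bd (\<lambda>\<omega>. Z \<omega> * (z \<omega> * (z \<omega> * z \<omega>)))"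
      "bd (\<lambda>\<omega>. Z \<omega> * ((z \<omega> * z \<omega>) * (z \<omega> * z \<omega>)))"
      by (intro bd_mult bdz Z)+
    have int_bd: "integrable M Y" if "bd Y" for Y using i1[OF that, of 0] by simp
    show "integrable M (\<lambda>\<omega>. Z \<omega> * (S \<omega> + z \<omega> * D \<omega>) ^ 4)"
      unfolding pow4 by (intro Bochner_Integration.integrable_add integrable_mult_right prod(1) bZ Z) auto
    have "expectation (\<lambda>\<omega>. Z \<omega> * (S \<omega> + z \<omega> * D \<omega>)\<^sup>2)
      = expectation (\<lambda>\<omega>. (Z \<omega> * S \<omega> ^ 2) * D \<omega> ^ 0) + 2 * expectation (\<lambda>\<omega>. (Z \<omega> * z \<omega> * S \<omega> ^ 1) * D \<omega> ^ 1)
        + expectation (\<lambda>\<omega>. (Z \<omega> * (z \<omega> * z \<omega>) * S \<omega> ^ 0) * D \<omega> ^ 2)"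
      unfolding pow2
      by (subst Bochner_Integration.integral_add Bochner_Integration.integral_mult_right |
          intro Bochner_Integration.integrable_add integrable_mult_right prod(1) bZ Z | simp)+
    also have "\<dots> = expectation (\<lambda>\<omega>. Z \<omega> * S \<omega> ^ 2) + expectation (\<lambda>\<omega>. Z \<omega> * (z \<omega> * z \<omega>)) * d"
    proof -
      have 1: "expectation (\<lambda>\<omega>. (Z \<omega> * S \<omega> ^ 2) * D \<omega> ^ 0) = expectation (\<lambda>\<omega>. Z \<omega> * S \<omega> ^ 2)" by simp
      have 2: "expectation (\<lambda>\<omega>. (Z \<omega> * z \<omega> * S \<omega> ^ 1) * D \<omega> ^ 1) = 0"
        using prod(2)[OF bZ(1), of 1 1] mom(2) by simp
      have 3: "expectation (\<lambda>\<omega>. (Z \<omega> * (z \<omega> * z \<omega>) * S \<omega> ^ 0) * D \<omega> ^ 2) = expectation (\<lambda>\<omega>. Z \<omega> * (z \<omega> * z \<omega>)) * d"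
        using prod(2)[OF bZ(2), of 0 2] mom(3) d by simp
      show ?thesis unfolding 1 2 3 by simp
    qed
    also have "\<dots> = expectation (\<lambda>\<omega>. Z \<omega> * V \<omega>) + expectation (\<lambda>\<omega>. Z \<omega> * (z \<omega> * z \<omega>)) * d"
      using IH2[of Z] Z by (simp add: bd_def)
    also have "\<dots> = expectation (\<lambda>\<omega>. Z \<omega> * V \<omega> + Z \<omega> * (z \<omega> * z \<omega>) * d)"
      using int_bd[OF bd_mult[OF Z bdV]] int_bd[OF bZ(2)] by simp
    also have "\<dots> = expectation (\<lambda>\<omega>. Z \<omega> * (V \<omega> + (z \<omega>)\<^sup>2 * d))"
      by (intro Bochner_Integration.integral_cong) (auto simp: power2_eq_square algebra_simps)
    finally show "expectation (\<lambda>\<omega>. Z \<omega> * (S \<omega> + z \<omega> * D \<omega>)\<^sup>2) = expectation (\<lambda>\<omega>. Z \<omega> * (V \<omega> + (z \<omega>)\<^sup>2 * d))" .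
    have "expectation (\<lambda>\<omega>. Z \<omega> * (S \<omega> + z \<omega> * D \<omega>) ^ 4)
      = expectation (\<lambda>\<omega>. (Z \<omega> * S \<omega> ^ 4) * D \<omega> ^ 0) + 4 * expectation (\<lambda>\<omega>. (Z \<omega> * z \<omega> * S \<omega> ^ 3) * D \<omega> ^ 1)
        + 6 * expectation (\<lambda>\<omega>. (Z \<omega> * (z \<omega> * z \<omega>) * S \<omega> ^ 2) * D \<omega> ^ 2)
        + 4 * expectation (\<lambda>\<omega>. (Z \<omega> * (z \<omega> * (z \<omega> * z \<omega>)) * S \<omega> ^ 1) * D \<omega> ^ 3)
        + expectation (\<lambda>\<omega>. (Z \<omega> * ((z \<omega> * z \<omega>) * (z \<omega> * z \<omega>)) * S \<omega> ^ 0) * D \<omega> ^ 4)"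
      unfolding pow4
      by (subst Bochner_Integration.integral_add Bochner_Integration.integral_mult_right |
          intro Bochner_Integration.integrable_add integrable_mult_right prod(1) bZ Z | simp)+
    also have "\<dots> = expectation (\<lambda>\<omega>. Z \<omega> * S \<omega> ^ 4) + 6 * (expectation (\<lambda>\<omega>. Z \<omega> * (z \<omega> * z \<omega>) * S \<omega> ^ 2) * d)
        + expectation (\<lambda>\<omega>. Z \<omega> * ((z \<omega> * z \<omega>) * (z \<omega> * z \<omega>))) * (3 * d\<^sup>2)"
    proof -
      have 1: "expectation (\<lambda>\<omega>. (Z \<omega> * S \<omega> ^ 4) * D \<omega> ^ 0) = expectation (\<lambda>\<omega>. Z \<omega> * S \<omega> ^ 4)" by simp
      have 2: "expectation (\<lambda>\<omega>. (Z \<omega> * z \<omega> * S \<omega> ^ 3) * D \<omega> ^ 1) = 0"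
        using prod(2)[OF bZ(1), of 3 1] mom(2) by simp
      have 3: "expectation (\<lambda>\<omega>. (Z \<omega> * (z \<omega> * z \<omega>) * S \<omega> ^ 2) * D \<omega> ^ 2) = expectation (\<lambda>\<omega>. Z \<omega> * (z \<omega> * z \<omega>) * S \<omega> ^ 2) * d"
        using prod(2)[OF bZ(2), of 2 2] mom(3) d by simp
      have 4: "expectation (\<lambda>\<omega>. (Z \<omega> * (z \<omega> * (z \<omega> * z \<omega>)) * S \<omega> ^ 1) * D \<omega> ^ 3) = 0"
        using prod(2)[OF bZ(3), of 1 3] mom(4) by simp
      have 5: "expectation (\<lambda>\<omega>. (Z \<omega> * ((z \<omega> * z \<omega>) * (z \<omega> * z \<omega>)) * S \<omega> ^ 0) * D \<omega> ^ 4)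
        = expectation (\<lambda>\<omega>. Z \<omega> * ((z \<omega> * z \<omega>) * (z \<omega> * z \<omega>))) * (3 * d\<^sup>2)"
        using prod(2)[OF bZ(4), of 0 4] mom(5) d4 by simp
      show ?thesis unfolding 1 2 3 4 5 by simp
    qed
    \<comment> \<open>The middle term uses the induction hypothesis with
      \<open>Z \<omega> * (z \<omega> * z \<omega>)\<close> as its weight. The result is the
      expansion of 3 times a square, the 3 being the fourth moment of the standard normal
      law.\<close>
    also have "\<dots> = 3 * expectation (\<lambda>\<omega>. Z \<omega> * (V \<omega>)\<^sup>2) + 6 * (expectation (\<lambda>\<omega>. Z \<omega> * (z \<omega> * z \<omega>) * V \<omega>) * d)
        + expectation (\<lambda>\<omega>. Z \<omega> * ((z \<omega> * z \<omega>) * (z \<omega> * z \<omega>))) * (3 * d\<^sup>2)"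
      using IH2[of Z] IH2[of "\<lambda>\<omega>. Z \<omega> * (z \<omega> * z \<omega>)"] Z bZ(2) by (simp add: bd_def)
    also have "\<dots> = expectation (\<lambda>\<omega>. 3 * (Z \<omega> * (V \<omega> * V \<omega>)) + 6 * (Z \<omega> * (z \<omega> * z \<omega>) * V \<omega> * d)
        + Z \<omega> * ((z \<omega> * z \<omega>) * (z \<omega> * z \<omega>)) * (3 * d\<^sup>2))"
      using int_bd[OF bd_mult[OF Z bd_mult[OF bdV bdV]]] int_bd[OF bd_mult[OF bZ(2) bdV]] int_bd[OF bZ(4)]
      by (simp add: power2_eq_square)
    also have "\<dots> = expectation (\<lambda>\<omega>. 3 * (Z \<omega> * (V \<omega> + (z \<omega>)\<^sup>2 * d)\<^sup>2))"
      by (intro Bochner_Integration.integral_cong) (auto simp: power2_eq_square algebra_simps)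
    also have "\<dots> = 3 * expectation (\<lambda>\<omega>. Z \<omega> * (V \<omega> + (z \<omega>)\<^sup>2 * d)\<^sup>2)" by simp
    finally show "expectation (\<lambda>\<omega>. Z \<omega> * (S \<omega> + z \<omega> * D \<omega>) ^ 4) = 3 * expectation (\<lambda>\<omega>. Z \<omega> * (V \<omega> + (z \<omega>)\<^sup>2 * d)\<^sup>2)" .
  qed
  have "integrable M (\<lambda>\<omega>. (S \<omega> + z \<omega> * D \<omega>) ^ 4)" using int4[OF bd1] by simp
  then show ?case unfolding e using mS exp2 exp4 by (auto simp: bd_def)
qed

end

text \<open>Carries the conditional Gaussian identities for the second and fourth moments over to
  the limit. The bound on \<open>(X n - X k) ^ 4\<close> upgrades convergence in probability to
  convergence in the fourth mean, which gives mean square convergence of the squares.\<close>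

lemma (in prob_space) fourth_moment_limit:
  fixes X q :: "nat \<Rightarrow> 'a \<Rightarrow> real" and Y Q :: "'a \<Rightarrow> real"
  assumes m [measurable]: "\<And>n. X n \<in> borel_measurable M" "Y \<in> borel_measurable M" "\<And>n. q n \<in> borel_measurable M" "Q \<in> borel_measurable M"
    and lim: "(\<lambda>n. ky_fan M (\<lambda>\<omega>. X n \<omega> - Y \<omega>)) \<longlonglongrightarrow> 0"
    and X4: "\<And>n. integrable M (\<lambda>\<omega>. X n \<omega> ^ 4)"
    and d4: "\<And>n k. integrable M (\<lambda>\<omega>. (X n \<omega> - X k \<omega>) ^ 4)" "\<And>n k. expectation (\<lambda>\<omega>. (X n \<omega> - X k \<omega>) ^ 4) \<le> e n + e k"
    and e: "e \<longlonglongrightarrow> 0"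
    and Q: "integrable M (\<lambda>\<omega>. (Q \<omega>)\<^sup>2)" "\<And>n. integrable M (\<lambda>\<omega>. (q n \<omega> - Q \<omega>)\<^sup>2)"
      "(\<lambda>n. expectation (\<lambda>\<omega>. (q n \<omega> - Q \<omega>)\<^sup>2)) \<longlonglongrightarrow> 0"
    and E2: "\<And>n. expectation (\<lambda>\<omega>. (X n \<omega>)\<^sup>2) = expectation (q n)"
    and E4: "\<And>n. expectation (\<lambda>\<omega>. X n \<omega> ^ 4) = 3 * expectation (\<lambda>\<omega>. (q n \<omega>)\<^sup>2)"
  shows "integrable M (\<lambda>\<omega>. Y \<omega> ^ 4)" "expectation (\<lambda>\<omega>. (Y \<omega>)\<^sup>2) = expectation Q"
    "expectation (\<lambda>\<omega>. Y \<omega> ^ 4) = 3 * expectation (\<lambda>\<omega>. (Q \<omega>)\<^sup>2)"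
proof -
  have sq4: "x\<^sup>2 * x\<^sup>2 = x ^ 4" for x :: real by (simp add: power2_eq_square power4_eq_xxxx)
  have add4: "(x + y) ^ 4 \<le> 8 * x ^ 4 + 8 * y ^ 4" for x y :: real
  proof -
    have "((x + y)\<^sup>2)\<^sup>2 \<le> (2 * x\<^sup>2 + 2 * y\<^sup>2)\<^sup>2" using square_add_le[of x y] by (intro power_mono) auto
    also have "\<dots> \<le> 2 * (2 * x\<^sup>2)\<^sup>2 + 2 * (2 * y\<^sup>2)\<^sup>2" by (rule square_add_le)
    finally show ?thesis by (simp add: power_mult_distrib)
  qed
  have int_add: "integrable M (\<lambda>\<omega>. (f \<omega> + g \<omega>) ^ 4)"
    if [measurable]: "f \<in> borel_measurable M" "g \<in> borel_measurable M" and "integrable M (\<lambda>\<omega>. f \<omega> ^ 4)" "integrable M (\<lambda>\<omega>. g \<omega> ^ 4)"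
    for f g :: "'a \<Rightarrow> real"
  proof (rule Bochner_Integration.integrable_bound)
    show "integrable M (\<lambda>\<omega>. 8 * f \<omega> ^ 4 + 8 * g \<omega> ^ 4)" using that by simp
    show "AE \<omega> in M. norm ((f \<omega> + g \<omega>) ^ 4) \<le> norm (8 * f \<omega> ^ 4 + 8 * g \<omega> ^ 4)"
      using add4 by (intro AE_I2) simp
  qed simp
  have fatou: "integrable M (\<lambda>\<omega>. (X n \<omega> - Y \<omega>) ^ 4) \<and> expectation (\<lambda>\<omega>. (X n \<omega> - Y \<omega>) ^ 4) \<le> c"
    if "\<And>k. k \<ge> N \<Longrightarrow> e n + e k \<le> c" for n N c
    using moment_limit_le[of X Y "X n" N 4 c] lim d4 order_trans[OF d4(2) that] by simp
  have e_small: "\<exists>N. \<forall>n\<ge>N. e n < \<epsilon>" if "0 < \<epsilon>" for \<epsilon>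
    using order_tendstoD(2)[OF e that] by (auto simp: eventually_sequentially)
  obtain N1 where N1: "\<And>n. n \<ge> N1 \<Longrightarrow> e n < 1" using e_small[of 1] by auto
  have "e N1 + e k \<le> 2" if "N1 \<le> k" for k using N1[of N1] N1[OF that] by simp
  then have "integrable M (\<lambda>\<omega>. (X N1 \<omega> - Y \<omega>) ^ 4)" using fatou[of N1 N1 2] by blast
  then have "integrable M (\<lambda>\<omega>. (Y \<omega> - X N1 \<omega>) ^ 4)" by (simp add: power4_eq_xxxx algebra_simps)
  from int_add[OF _ _ this X4[of N1]] show Y4: "integrable M (\<lambda>\<omega>. Y \<omega> ^ 4)" by simp
  have XY4: "integrable M (\<lambda>\<omega>. (X n \<omega> - Y \<omega>) ^ 4)" for n
    using int_add[of "X n" "\<lambda>\<omega>. - Y \<omega>"] X4 Y4 by simp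
  have XY0: "(\<lambda>n. expectation (\<lambda>\<omega>. (X n \<omega> - Y \<omega>) ^ 4)) \<longlonglongrightarrow> 0"
  proof (rule LIMSEQ_I)
    fix r :: real assume r: "0 < r"
    obtain N where N: "\<And>n. n \<ge> N \<Longrightarrow> e n < r / 4" using e_small[of "r / 4"] r by auto
    have "norm (expectation (\<lambda>\<omega>. (X n \<omega> - Y \<omega>) ^ 4) - 0) < r" if n: "n \<ge> N" for n
    proof -
      have "e n + e k \<le> r / 2" if "k \<ge> N" for k using N[OF that] N[OF n] by simp
      then have "expectation (\<lambda>\<omega>. (X n \<omega> - Y \<omega>) ^ 4) \<le> r / 2" using fatou[of N n "r / 2"] by blast
      then show ?thesis using r by simp
    qed
    then show "\<exists>N. \<forall>n\<ge>N. norm (expectation (\<lambda>\<omega>. (X n \<omega> - Y \<omega>) ^ 4) - 0) < r" by blast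
  qed
  define a where "a n = expectation (\<lambda>\<omega>. (X n \<omega> - Y \<omega>) ^ 4)" for n
  have a0: "a \<longlonglongrightarrow> 0" using XY0 by (simp add: a_def[abs_def])
  have a_nn: "0 \<le> a n" for n by (simp add: a_def)
  have sum4: "integrable M (\<lambda>\<omega>. (X n \<omega> + Y \<omega>) ^ 4)" for n by (intro int_add X4 Y4) auto
  \<comment> \<open>Here \<open>X n + Y\<close> is \<open>X n - Y\<close> plus \<open>2 * Y\<close>,
    and 128 is \<open>8 * 2 ^ 4\<close>.\<close>
  have sum_le: "expectation (\<lambda>\<omega>. (X n \<omega> + Y \<omega>) ^ 4) \<le> 8 * a n + 128 * expectation (\<lambda>\<omega>. Y \<omega> ^ 4)" for n
  proof -
    have "expectation (\<lambda>\<omega>. (X n \<omega> + Y \<omega>) ^ 4) \<le> expectation (\<lambda>\<omega>. 8 * (X n \<omega> - Y \<omega>) ^ 4 + 128 * Y \<omega> ^ 4)"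
    proof (rule integral_mono)
      show "(X n \<omega> + Y \<omega>) ^ 4 \<le> 8 * (X n \<omega> - Y \<omega>) ^ 4 + 128 * Y \<omega> ^ 4" for \<omega>
        using add4[of "X n \<omega> - Y \<omega>" "2 * Y \<omega>"] by (simp add: power_mult_distrib add.commute)
    qed (use sum4 XY4 Y4 in auto)
    then show ?thesis using XY4 Y4 by (simp add: a_def)
  qed
  have sq_diff: "((X n \<omega>)\<^sup>2 - (Y \<omega>)\<^sup>2)\<^sup>2 = (X n \<omega> - Y \<omega>)\<^sup>2 * (X n \<omega> + Y \<omega>)\<^sup>2" for n \<omega>
    by (simp add: power2_eq_square algebra_simps)
  have sq_int: "integrable M (\<lambda>\<omega>. ((X n \<omega>)\<^sup>2 - (Y \<omega>)\<^sup>2)\<^sup>2)" for n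
    unfolding sq_diff by (rule integrable_mult_L2) (use XY4[of n] sum4[of n] in \<open>simp_all\<close>)
  have sq_lim: "(\<lambda>n. expectation (\<lambda>\<omega>. ((X n \<omega>)\<^sup>2 - (Y \<omega>)\<^sup>2)\<^sup>2)) \<longlonglongrightarrow> 0"
  proof (rule Lim_null_comparison)
    show "\<forall>\<^sub>F n in sequentially. norm (expectation (\<lambda>\<omega>. ((X n \<omega>)\<^sup>2 - (Y \<omega>)\<^sup>2)\<^sup>2))
      \<le> sqrt (a n) * sqrt (8 * a n + 128 * expectation (\<lambda>\<omega>. Y \<omega> ^ 4))"
    proof (intro always_eventually allI)
      fix n
      have "\<bar>expectation (\<lambda>\<omega>. (X n \<omega> - Y \<omega>)\<^sup>2 * (X n \<omega> + Y \<omega>)\<^sup>2)\<bar>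
        \<le> sqrt (expectation (\<lambda>\<omega>. ((X n \<omega> - Y \<omega>)\<^sup>2)\<^sup>2)) * sqrt (expectation (\<lambda>\<omega>. ((X n \<omega> + Y \<omega>)\<^sup>2)\<^sup>2))"
        by (rule Cauchy_Schwarz_integral) (use XY4[of n] sum4[of n] in \<open>simp_all\<close>)
      also have "\<dots> \<le> sqrt (a n) * sqrt (8 * a n + 128 * expectation (\<lambda>\<omega>. Y \<omega> ^ 4))"
        using sum_le[of n] a_nn[of n] by (intro mult_mono real_sqrt_le_mono) (simp_all add: a_def)
      finally show "norm (expectation (\<lambda>\<omega>. ((X n \<omega>)\<^sup>2 - (Y \<omega>)\<^sup>2)\<^sup>2))
        \<le> sqrt (a n) * sqrt (8 * a n + 128 * expectation (\<lambda>\<omega>. Y \<omega> ^ 4))" unfolding sq_diff by simp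
    qed
    have "(\<lambda>n. sqrt (a n) * sqrt (8 * a n + 128 * expectation (\<lambda>\<omega>. Y \<omega> ^ 4))) \<longlonglongrightarrow> sqrt 0 * sqrt (8 * 0 + 128 * expectation (\<lambda>\<omega>. Y \<omega> ^ 4))"
      by (intro tendsto_intros a0)
    then show "(\<lambda>n. sqrt (a n) * sqrt (8 * a n + 128 * expectation (\<lambda>\<omega>. Y \<omega> ^ 4))) \<longlonglongrightarrow> 0" by simp
  qed
  have Y22: "integrable M (\<lambda>\<omega>. ((Y \<omega>)\<^sup>2)\<^sup>2)" using Y4 by simp
  have "(\<lambda>n. expectation (\<lambda>\<omega>. (X n \<omega>)\<^sup>2 * (X n \<omega>)\<^sup>2)) \<longlonglongrightarrow> expectation (\<lambda>\<omega>. (Y \<omega>)\<^sup>2 * (Y \<omega>)\<^sup>2)"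
    by (rule L2_limit_product) (use Y22 sq_int sq_lim in auto)
  moreover have "(\<lambda>n. expectation (\<lambda>\<omega>. q n \<omega> * q n \<omega>)) \<longlonglongrightarrow> expectation (\<lambda>\<omega>. Q \<omega> * Q \<omega>)"
    by (rule L2_limit_product) (use Q in auto)
  then have "(\<lambda>n. 3 * expectation (\<lambda>\<omega>. (q n \<omega>)\<^sup>2)) \<longlonglongrightarrow> 3 * expectation (\<lambda>\<omega>. (Q \<omega>)\<^sup>2)"
    unfolding power2_eq_square by (intro tendsto_intros)
  then have "(\<lambda>n. expectation (\<lambda>\<omega>. (X n \<omega>)\<^sup>2 * (X n \<omega>)\<^sup>2)) \<longlonglongrightarrow> 3 * expectation (\<lambda>\<omega>. (Q \<omega>)\<^sup>2)"
    unfolding sq4 E4 .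
  ultimately show "expectation (\<lambda>\<omega>. Y \<omega> ^ 4) = 3 * expectation (\<lambda>\<omega>. (Q \<omega>)\<^sup>2)"
    unfolding sq4 using LIMSEQ_unique by blast
  have "(\<lambda>n. expectation (\<lambda>\<omega>. (X n \<omega>)\<^sup>2 * 1)) \<longlonglongrightarrow> expectation (\<lambda>\<omega>. (Y \<omega>)\<^sup>2 * 1)"
    by (rule L2_limit_product) (use Y22 sq_int sq_lim in auto)
  moreover have "(\<lambda>n. expectation (\<lambda>\<omega>. q n \<omega> * 1)) \<longlonglongrightarrow> expectation (\<lambda>\<omega>. Q \<omega> * 1)"
    by (rule L2_limit_product) (use Q in auto)
  ultimately show "expectation (\<lambda>\<omega>. (Y \<omega>)\<^sup>2) = expectation Q"
    using E2 LIMSEQ_unique by fastforce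
qed

text \<open>
  Not normalised: the total mass is \<open>T\<close>.
\<close>

definition uniform_time :: "real \<Rightarrow> real measure" where
  "uniform_time T = density lborel (\<lambda>u. ennreal (indicator {0..T} u))"

lemma sets_uniform_time [measurable_cong, simp]: "sets (uniform_time T) = sets borel"
  by (simp add: uniform_time_def)

lemma space_uniform_time [simp]: "space (uniform_time T) = UNIV"
  by (simp add: uniform_time_def)

lemma nn_integral_uniform_time:
  "f \<in> borel_measurable borel \<Longrightarrow> (\<integral>\<^sup>+u. f u \<partial>uniform_time T) = (\<integral>\<^sup>+u\<in>{0..T}. f u \<partial>lborel)"
  unfolding uniform_time_def by (subst nn_integral_density) (auto intro!: nn_integral_cong split: split_indicator)

lemma AE_uniform_time:
  "AE u in uniform_time T. 0 < u \<and> u \<le> T"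
proof -
  have "AE u in lborel. u \<noteq> (0::real)" by (rule AE_lborel_singleton)
  then show ?thesis unfolding uniform_time_def
    by (subst AE_density) (auto elim: eventually_mono split: split_indicator)
qed

lemma finite_measure_uniform_time: "finite_measure (uniform_time T)"
proof (rule finite_measureI)
  have "emeasure (uniform_time T) (space (uniform_time T)) = (\<integral>\<^sup>+u. 1 \<partial>uniform_time T)" by simp
  also have "\<dots> = emeasure lborel {0..T}" by (subst nn_integral_uniform_time) auto
  finally show "emeasure (uniform_time T) (space (uniform_time T)) \<noteq> \<infinity>" by (simp add: emeasure_lborel_Icc_eq)
qed

lemma measure_uniform_time: "0 \<le> T \<Longrightarrow> measure (uniform_time T) UNIV = T"
proof -
  assume T: "0 \<le> T"
  have "emeasure (uniform_time T) UNIV = (\<integral>\<^sup>+u. 1 \<partial>uniform_time T)" by simp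
  also have "\<dots> = emeasure lborel {0..T}" by (subst nn_integral_uniform_time) auto
  also have "\<dots> = ennreal T" using T by simp
  finally show ?thesis using T by (simp add: measure_def)
qed

context brownian_indep
begin

text \<open>The quadratic variation at time \<open>T\<close> of the integral of \<open>h\<close>,
  which is the conditional variance of this integral when the coefficients of \<open>h\<close> are
  measurable in \<open>G\<close>.\<close>

definition quad :: "real \<Rightarrow> (real \<times> real \<times> ('w \<Rightarrow> real)) list \<Rightarrow> 'w \<Rightarrow> real" where
  "quad T h \<omega> = (\<integral>u. (simple_process_fun h u \<omega>)\<^sup>2 \<partial>uniform_time T)"

lemma quad_grid:
  assumes g: "is_grid T h p N"
  shows "quad T h \<omega> = (square_sum (grid_coeff T h p) p N \<omega>)"
proof -
  have meas: "(\<lambda>u. simple_process_fun h u \<omega>) \<in> borel_measurable borel"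
  proof (induction h)
    case Nil
    then show ?case by (simp add: simple_process_fun_def)
  next
    case (Cons x h)
    obtain r s \<xi> where x: "x = (r, s, \<xi>)" by (cases x)
    have "(\<lambda>u. simple_process_fun (x # h) u \<omega>) = (\<lambda>u. \<xi> \<omega> * indicator {r<..s} u + simple_process_fun h u \<omega>)"
      by (simp add: fun_eq_iff simple_process_fun_def x)
    then show ?case using Cons by simp
  qed
  have "(\<integral>\<^sup>+u. ennreal ((simple_process_fun h u \<omega>)\<^sup>2) \<partial>uniform_time T)
    = ennreal (square_sum (grid_coeff T h p) p N \<omega>)"
    using meas by (subst nn_integral_uniform_time) (simp_all add: nn_integral_simple_process_grid[OF g])
  moreover have "0 \<le> (square_sum (grid_coeff T h p) p N \<omega>)"
    using is_grid_mono(1)[OF g] by (intro sum_nonneg mult_nonneg_nonneg) auto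
  ultimately have "has_bochner_integral (uniform_time T) (\<lambda>u. (simple_process_fun h u \<omega>)\<^sup>2)
     (square_sum (grid_coeff T h p) p N \<omega>)"
    using meas by (intro has_bochner_integral_nn_integral) auto
  then show ?thesis unfolding quad_def by (rule has_bochner_integral_integral_eq)
qed

text \<open>The constant family \<open>\<lambda>_. G\<close> as filtration expresses that all
  coefficients are known from the start. The moments are those of \<open>fourth_moment_sum\<close>
  with weight 1.\<close>

lemma simple_ito_moments:
  assumes h: "simple_process (\<lambda>_. G) h" and T: "0 \<le> T"
  shows "integrable M (\<lambda>\<omega>. simple_ito_integral W T h \<omega> ^ 4)" "quad T h \<in> borel_measurable M"
    "expectation (\<lambda>\<omega>. (simple_ito_integral W T h \<omega>)\<^sup>2) = expectation (quad T h)"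
    "expectation (\<lambda>\<omega>. simple_ito_integral W T h \<omega> ^ 4) = 3 * expectation (\<lambda>\<omega>. (quad T h \<omega>)\<^sup>2)"
proof -
  have hD: "0 \<le> r \<and> r \<le> s \<and> \<xi> \<in> borel_measurable G \<and> bounded (\<xi> ` space M)" if "(r, s, \<xi>) \<in> set h" for r s \<xi>
    using h that unfolding simple_process_def space_G by (auto dest!: bspec)
  then have "\<forall>(r, s, \<xi>)\<in>set h. 0 \<le> r \<and> r \<le> s" by auto
  then obtain p N where g: "is_grid T h p N" using grid_exists[OF T] by blast
  have \<zeta>: "grid_coeff T h p k \<in> borel_measurable G" for k
    using hD by (intro grid_coeff_measurable) blast
  have "\<exists>c. \<forall>\<omega>\<in>space M. \<bar>grid_coeff T h p k \<omega>\<bar> \<le> c" for k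
    using hD by (intro grid_coeff_bounded) blast
  then obtain c where c: "\<And>k \<omega>. \<omega> \<in> space M \<Longrightarrow> \<bar>grid_coeff T h p k \<omega>\<bar> \<le> c k" by metis
  have c': "\<bar>grid_coeff T h p k \<omega>\<bar> \<le> (\<Sum>k<N. \<bar>c k\<bar>)" if "k < N" "\<omega> \<in> space M" for k \<omega>
    using c[OF that(2), of k] member_le_sum[of k "{..<N}" "\<lambda>k. \<bar>c k\<bar>"] that(1) by simp
  have F: "(\<lambda>\<omega>. wiener_sum W (grid_coeff T h p) p N \<omega>) \<in> borel_measurable (enlarged (p N)) \<and>
    integrable M (\<lambda>\<omega>. (wiener_sum W (grid_coeff T h p) p N \<omega>) ^ 4) \<and>
    (\<forall>Z\<in>borel_measurable G. (\<exists>b. \<forall>\<omega>\<in>space M. \<bar>Z \<omega>\<bar> \<le> b) \<longrightarrow>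
      expectation (\<lambda>\<omega>. Z \<omega> * (wiener_sum W (grid_coeff T h p) p N \<omega>)\<^sup>2)
        = expectation (\<lambda>\<omega>. Z \<omega> * (square_sum (grid_coeff T h p) p N \<omega>)) \<and>
      expectation (\<lambda>\<omega>. Z \<omega> * (wiener_sum W (grid_coeff T h p) p N \<omega>) ^ 4)
        = 3 * expectation (\<lambda>\<omega>. Z \<omega> * (square_sum (grid_coeff T h p) p N \<omega>)\<^sup>2))"
    by (rule fourth_moment_sum[where N = N and c = "\<Sum>k<N. \<bar>c k\<bar>"]) (use g \<zeta> c' in \<open>auto simp: is_grid_def\<close>)
  note I = simple_ito_integral_grid[OF g, of W] and V = quad_grid[OF g]
  show "integrable M (\<lambda>\<omega>. simple_ito_integral W T h \<omega> ^ 4)" unfolding I using F by blast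
  have "(\<lambda>\<omega>. square_sum (grid_coeff T h p) p N \<omega>) \<in> borel_measurable M"
    using measurable_from_subalg[OF sub_G \<zeta>] by (intro borel_measurable_sum borel_measurable_times borel_measurable_power borel_measurable_const)
  then show "quad T h \<in> borel_measurable M" by (simp add: V[abs_def])
  have one: "(\<lambda>_. 1::real) \<in> borel_measurable G" "\<exists>b. \<forall>\<omega>\<in>space M. \<bar>1::real\<bar> \<le> b" by auto
  have "expectation (\<lambda>\<omega>. 1 * (wiener_sum W (grid_coeff T h p) p N \<omega>)\<^sup>2)
        = expectation (\<lambda>\<omega>. 1 * (square_sum (grid_coeff T h p) p N \<omega>)) \<and>
      expectation (\<lambda>\<omega>. 1 * (wiener_sum W (grid_coeff T h p) p N \<omega>) ^ 4)
        = 3 * expectation (\<lambda>\<omega>. 1 * (square_sum (grid_coeff T h p) p N \<omega>)\<^sup>2)"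
    by (rule F[THEN conjunct2, THEN conjunct2, THEN bspec, OF one(1), THEN mp, OF one(2)])
  then show "expectation (\<lambda>\<omega>. (simple_ito_integral W T h \<omega>)\<^sup>2) = expectation (quad T h)"
    "expectation (\<lambda>\<omega>. simple_ito_integral W T h \<omega> ^ 4) = 3 * expectation (\<lambda>\<omega>. (quad T h \<omega>)\<^sup>2)"
    unfolding I V[abs_def] by simp_all
qed

end

section \<open>Fourth moments of stochastic volatility returns\<close>

text \<open>Truncation provides the boundedness that simple processes need. The cut at 0 takes care
  of the null sets on which a version of the volatility is negative.\<close>

definition trunc :: "nat \<Rightarrow> real \<Rightarrow> real" where
  "trunc n x = min (max 0 x) (real n)"

lemma trunc_bounds: "0 \<le> trunc n x" "trunc n x \<le> real n" "\<bar>trunc n x - trunc n y\<bar> \<le> \<bar>x - y\<bar>"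
  by (auto simp: trunc_def)

lemma trunc_measurable [measurable]: "trunc n \<in> borel_measurable borel"
  unfolding trunc_def[abs_def] by measurable

text \<open>The function \<open>sqrt\<close> is odd on the reals, so \<open>x\<close> can be
  recovered from its root even where it is negative. Measurability of the root is thus inherited by
  the volatility.\<close>

lemma sqrt_mult_abs_sqrt: "sqrt x * \<bar>sqrt x\<bar> = x"
proof (cases "0 \<le> x")
  case False
  then have "sqrt x = - sqrt (- x)" by (simp add: real_sqrt_minus)
  then show ?thesis using False by simp
qed simp

lemma sqrt_diff_square_le:
  assumes "0 \<le> x" "0 \<le> y"
  shows "(sqrt x - sqrt y)\<^sup>2 \<le> \<bar>x - y\<bar>"
proof -
  have "(sqrt x - sqrt y)\<^sup>2 = \<bar>sqrt x - sqrt y\<bar> * \<bar>sqrt x - sqrt y\<bar>" by (simp add: power2_eq_square)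
  also have "\<dots> \<le> \<bar>sqrt x - sqrt y\<bar> * \<bar>sqrt x + sqrt y\<bar>"
    using assms by (intro mult_left_mono) (auto simp: abs_le_iff)
  also have "\<dots> = \<bar>x - y\<bar>"
  proof -
    have "(sqrt x - sqrt y) * (sqrt x + sqrt y) = x - y" using assms by (simp add: algebra_simps)
    then show ?thesis by (simp only: abs_mult[symmetric])
  qed
  finally show ?thesis .
qed

text \<open>Values at left ends keep the process adapted. The same \<open>n\<close> governs the mesh
  and the level of truncation.\<close>

definition grid_process :: "real \<Rightarrow> (real \<Rightarrow> 'w \<Rightarrow> real) \<Rightarrow> nat \<Rightarrow> (real \<times> real \<times> ('w \<Rightarrow> real)) list" where
  "grid_process T V n = map (\<lambda>k. (T * real k / real (Suc n), T * real (Suc k) / real (Suc n),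
     \<lambda>\<omega>. sqrt (trunc n (V (T * real k / real (Suc n)) \<omega>)))) [0..<Suc n]"

text \<open>The left end of the cell that contains \<open>u\<close>. As cells are open on the left,
  a grid time belongs to the cell before it, hence the ceiling minus 1 in place of a floor.\<close>

definition grid_point :: "real \<Rightarrow> nat \<Rightarrow> real \<Rightarrow> real" where
  "grid_point T n u = T * real (nat (\<lceil>real (Suc n) * u / T\<rceil> - 1)) / real (Suc n)"

lemma grid_process_fun:
  assumes T: "0 < T" and u: "0 < u" "u \<le> T"
  shows "simple_process_fun (grid_process T V n) u \<omega> = sqrt (trunc n (V (grid_point T n u) \<omega>))"
    "0 \<le> grid_point T n u" "grid_point T n u \<le> T" "\<bar>grid_point T n u - u\<bar> \<le> T / real (Suc n)"
proof -
  define N where "N = real (Suc n)"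
  have N: "0 < N" by (simp add: N_def)
  define k where "k = nat (\<lceil>N * u / T\<rceil> - 1)"
  have x: "0 < N * u / T" "N * u / T \<le> N" using T u N by (auto simp: divide_le_eq)
  have k1: "real k < N * u / T" "N * u / T \<le> real k + 1"
    using x unfolding k_def by linarith+
  have kn: "k < Suc n" using k1 x by (simp add: N_def)
  have iff: "T * real j / N < u \<and> u \<le> T * real (Suc j) / N \<longleftrightarrow> j = k" for j
  proof -
    have "T * real j / N < u \<longleftrightarrow> real j < N * u / T" "u \<le> T * real (Suc j) / N \<longleftrightarrow> N * u / T \<le> real j + 1"
      using T N by (auto simp: field_simps)
    then show ?thesis using k1 by auto
  qed
  have gp: "grid_point T n u = T * real k / N" by (simp add: grid_point_def k_def N_def)
  have "simple_process_fun (grid_process T V n) u \<omega>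
    = (\<Sum>j<Suc n. sqrt (trunc n (V (T * real j / N) \<omega>)) * indicator {T * real j / N<..T * real (Suc j) / N} u)"
    by (simp add: simple_process_fun_def grid_process_def o_def interv_sum_list_conv_sum_set_nat atLeast0LessThan N_def del: upt_Suc)
  also have "\<dots> = (\<Sum>j<Suc n. if j = k then sqrt (trunc n (V (T * real k / N) \<omega>)) else 0)"
    using iff by (intro sum.cong) (auto split: split_indicator simp del: of_nat_Suc)
  also have "\<dots> = sqrt (trunc n (V (grid_point T n u) \<omega>))" using kn by (simp add: gp)
  finally show "simple_process_fun (grid_process T V n) u \<omega> = sqrt (trunc n (V (grid_point T n u) \<omega>))" .
  show "0 \<le> grid_point T n u" using T N by (simp add: gp)
  have b: "T * real k / N < u" "u \<le> T * real (Suc k) / N" using iff[of k] by auto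
  then show "grid_point T n u \<le> T" using u by (simp add: gp)
  have "T * real (Suc k) / N = T * real k / N + T / N" by (simp add: distrib_left add_divide_distrib)
  then show "\<bar>grid_point T n u - u\<bar> \<le> T / real (Suc n)" using b by (simp add: gp N_def[symmetric] del: of_nat_Suc)
qed

lemma grid_process_mem:
  assumes "(r, s, \<xi>) \<in> set (grid_process T V n)" "0 < T"
  shows "0 \<le> r \<and> r \<le> s \<and> r \<le> T \<and> \<xi> = (\<lambda>\<omega>. sqrt (trunc n (V r \<omega>)))"
proof -
  obtain k where k: "k < Suc n" "r = T * real k / real (Suc n)" "s = T * real (Suc k) / real (Suc n)"
    "\<xi> = (\<lambda>\<omega>. sqrt (trunc n (V r \<omega>)))"
    using assms(1) by (auto simp: grid_process_def simp del: upt_Suc)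
  have "T * real k \<le> T * real (Suc n)" using k(1) assms(2) by (intro mult_left_mono) auto
  then have "r \<le> T" unfolding k(2) by (simp add: divide_le_eq del: of_nat_Suc)
  then show ?thesis using k assms(2) by (auto intro!: divide_right_mono mult_left_mono)
qed

lemma sqrt_trunc_bounded: "bounded ((\<lambda>\<omega>. sqrt (trunc n (V \<omega>))) ` A)"
  unfolding bounded_iff using trunc_bounds by (intro exI[of _ "sqrt (real n)"]) auto

text \<open>Two versions of the volatility are needed: \<open>S\<close> is progressively measurable
  for \<open>F\<close> and is the integrand, \<open>S'\<close> is measurable in \<open>G\<close> and
  hence independent of the Brownian motion. They agree almost surely at each fixed time, therefore
  at all points of a grid at once. \<rho> bounds the mean square oscillation over a given time
  distance.\<close>

locale volatility = brownian_indep M F W G for M :: "'w measure" and F W G +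
  fixes S S' :: "real \<Rightarrow> 'w \<Rightarrow> real" and T C :: real and \<rho> :: "real \<Rightarrow> real"
  assumes T: "0 < T"
    and prog: "progressively_measurable F (\<lambda>u \<omega>. sqrt (S u \<omega>))"
    and S_nonneg: "\<And>u. AE \<omega> in M. 0 \<le> S u \<omega>"
    and S'_meas: "\<And>u. S' u \<in> borel_measurable G" and S_S': "\<And>u. AE \<omega> in M. S u \<omega> = S' u \<omega>"
    and S_meas: "\<And>u. S u \<in> borel_measurable M" and S_L2: "\<And>u. integrable M (\<lambda>\<omega>. (S u \<omega>)\<^sup>2)"
    and S_bound: "\<And>u. expectation (\<lambda>\<omega>. (S u \<omega>)\<^sup>2) \<le> C"
    and S_cont: "\<And>u w \<delta>. \<bar>u - w\<bar> \<le> \<delta> \<Longrightarrow> expectation (\<lambda>\<omega>. (S u \<omega> - S w \<omega>)\<^sup>2) \<le> \<rho> \<delta>"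
    and \<rho>: "(\<lambda>n. \<rho> (T / real (Suc n))) \<longlonglongrightarrow> 0"
begin

lemma S_F_measurable: "0 \<le> u \<Longrightarrow> S u \<in> borel_measurable (F u)"
proof -
  assume u: "0 \<le> u"
  have "(\<lambda>(s, \<omega>). sqrt (S s \<omega>)) \<in> borel_measurable (restrict_space borel {0..u} \<Otimes>\<^sub>M F u)"
    using prog u by (simp add: progressively_measurable_def)
  moreover have "Pair u \<in> measurable (F u) (restrict_space borel {0..u} \<Otimes>\<^sub>M F u)"
    using u by (intro measurable_Pair1') (simp add: space_restrict_space)
  ultimately have "(\<lambda>\<omega>. (\<lambda>(s, \<omega>). sqrt (S s \<omega>)) (u, \<omega>)) \<in> borel_measurable (F u)"
    by (rule measurable_compose[rotated])
  then have [measurable]: "(\<lambda>\<omega>. sqrt (S u \<omega>)) \<in> borel_measurable (F u)" by simp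
  have "(\<lambda>\<omega>. sqrt (S u \<omega>) * \<bar>sqrt (S u \<omega>)\<bar>) \<in> borel_measurable (F u)" by measurable
  then show ?thesis by (simp add: sqrt_mult_abs_sqrt)
qed

lemma grid_process_F: "simple_process F (grid_process T S n)"
  unfolding simple_process_def
proof (intro ballI, clarify)
  fix r s \<xi> assume "(r, s, \<xi>) \<in> set (grid_process T S n)"
  note m = grid_process_mem[OF this T]
  have [measurable]: "S r \<in> borel_measurable (F r)" using S_F_measurable m by blast
  have "(\<lambda>\<omega>. sqrt (trunc n (S r \<omega>))) \<in> borel_measurable (F r)" by measurable
  then show "0 \<le> r \<and> r \<le> s \<and> \<xi> \<in> borel_measurable (F r) \<and> bounded (\<xi> ` space (F r))"
    using m sqrt_trunc_bounded by blast
qed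

lemma grid_process_G: "simple_process (\<lambda>_. G) (grid_process T S' n)"
  unfolding simple_process_def
proof (intro ballI, clarify)
  fix r s \<xi> assume "(r, s, \<xi>) \<in> set (grid_process T S' n)"
  note m = grid_process_mem[OF this T]
  note [measurable] = S'_meas[of r]
  have "(\<lambda>\<omega>. sqrt (trunc n (S' r \<omega>))) \<in> borel_measurable G" by measurable
  then show "0 \<le> r \<and> r \<le> s \<and> \<xi> \<in> borel_measurable G \<and> bounded (\<xi> ` space G)"
    using m sqrt_trunc_bounded by blast
qed

text \<open>
  The volatility is only known to be measurable on \<open>{0..T}\<close> jointly in time and \<open>\<omega>\<close>, and to be
  nonnegative almost surely at each time; \<open>vol\<close> is a modification for which both hold everywhere.
\<close>

definition vol :: "real \<Rightarrow> 'w \<Rightarrow> real" where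
  "vol u \<omega> = max 0 (S (max 0 (min T u)) \<omega>)"

abbreviation U where "U \<equiv> uniform_time T"

definition gvol :: "nat \<Rightarrow> real \<Rightarrow> 'w \<Rightarrow> real" where
  "gvol n u \<omega> = (simple_process_fun (grid_process T S' n) u \<omega>)\<^sup>2"

sublocale U: finite_measure U by (rule finite_measure_uniform_time)

sublocale MU: pair_sigma_finite M U ..

lemma sets_MU: "sets (M \<Otimes>\<^sub>M U) = sets (M \<Otimes>\<^sub>M lborel)"
  by (rule sets_pair_measure_cong) auto

lemma gproc_measurable [measurable]: "(\<lambda>z. simple_process_fun (grid_process T S' n) (snd z) (fst z)) \<in> borel_measurable (M \<Otimes>\<^sub>M U)"
proof -
  have "(\<lambda>z. simple_process_fun (grid_process T S' n) (snd z) (fst z)) \<in> borel_measurable (M \<Otimes>\<^sub>M lborel)"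
  proof (rule simple_process_fun_measurable)
    fix r s \<xi> assume "(r, s, \<xi>) \<in> set (grid_process T S' n)"
    then have "\<xi> \<in> borel_measurable G" using grid_process_G unfolding simple_process_def by (auto dest!: bspec)
    then show "\<xi> \<in> borel_measurable M" by (rule measurable_from_subalg[OF sub_G])
  qed
  then show ?thesis using sets_MU by (simp cong: measurable_cong_sets)
qed

lemma gvol_measurable [measurable]: "(\<lambda>z. gvol n (snd z) (fst z)) \<in> borel_measurable (M \<Otimes>\<^sub>M U)"
  unfolding gvol_def by measurable

lemma vol_measurable [measurable]: "(\<lambda>z. vol (snd z) (fst z)) \<in> borel_measurable (M \<Otimes>\<^sub>M U)"
proof -
  have "(\<lambda>z. sqrt (S (max 0 (min T (snd z))) (fst z))) \<in> borel_measurable (M \<Otimes>\<^sub>M lborel)"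
    by (rule progressive_clamp[OF prog]) (use T in simp)
  then have [measurable]: "(\<lambda>z. sqrt (S (max 0 (min T (snd z))) (fst z))) \<in> borel_measurable (M \<Otimes>\<^sub>M U)"
    using sets_MU by (simp cong: measurable_cong_sets)
  have "(\<lambda>z. max 0 (sqrt (S (max 0 (min T (snd z))) (fst z)) * \<bar>sqrt (S (max 0 (min T (snd z))) (fst z))\<bar>)) \<in> borel_measurable (M \<Otimes>\<^sub>M U)"
    by measurable
  then show ?thesis by (simp add: vol_def sqrt_mult_abs_sqrt)
qed

lemma vol_nonneg: "0 \<le> vol u \<omega>"
  by (simp add: vol_def)

lemma vol_section [measurable]: "vol u \<in> borel_measurable M"
  unfolding vol_def[abs_def] using S_meas by measurable

lemma AE_vol: "0 \<le> u \<Longrightarrow> u \<le> T \<Longrightarrow> AE \<omega> in M. vol u \<omega> = S u \<omega>"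
  using S_nonneg[of u] by eventually_elim (simp add: vol_def)

lemma gvol_eq: "0 < u \<Longrightarrow> u \<le> T \<Longrightarrow> gvol n u \<omega> = trunc n (S' (grid_point T n u) \<omega>)"
  using T by (simp add: gvol_def grid_process_fun trunc_bounds)

lemma gvol_nonneg: "0 \<le> gvol n u \<omega>" by (simp add: gvol_def)

lemma vol_L2_time: "integrable M (\<lambda>\<omega>. (vol u \<omega>)\<^sup>2)" "expectation (\<lambda>\<omega>. (vol u \<omega>)\<^sup>2) \<le> C"
proof -
  have le: "(vol u \<omega>)\<^sup>2 \<le> (S (max 0 (min T u)) \<omega>)\<^sup>2" for \<omega> by (auto simp: vol_def max_def)
  show i: "integrable M (\<lambda>\<omega>. (vol u \<omega>)\<^sup>2)"
    by (rule Bochner_Integration.integrable_bound[OF S_L2]) (use le in auto)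
  have "expectation (\<lambda>\<omega>. (vol u \<omega>)\<^sup>2) \<le> expectation (\<lambda>\<omega>. (S (max 0 (min T u)) \<omega>)\<^sup>2)"
    by (intro integral_mono i S_L2 le)
  then show "expectation (\<lambda>\<omega>. (vol u \<omega>)\<^sup>2) \<le> C" using S_bound order_trans by blast
qed

lemma vol_L2: "integrable (M \<Otimes>\<^sub>M U) (\<lambda>z. (vol (snd z) (fst z))\<^sup>2)"
proof (rule integrableI_bounded)
  have "(\<integral>\<^sup>+z. ennreal (norm ((vol (snd z) (fst z))\<^sup>2)) \<partial>(M \<Otimes>\<^sub>M U)) = (\<integral>\<^sup>+u. \<integral>\<^sup>+\<omega>. ennreal ((vol u \<omega>)\<^sup>2) \<partial>M \<partial>U)"
    by (subst MU.nn_integral_snd[symmetric]) auto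
  also have "\<dots> \<le> (\<integral>\<^sup>+u. ennreal C \<partial>U)"
    using vol_L2_time by (intro nn_integral_mono) (simp add: nn_integral_eq_integral ennreal_leI)
  also have "\<dots> < \<infinity>" using U.emeasure_finite[of UNIV] by (simp add: ennreal_mult_eq_top_iff less_top[symmetric])
  finally show "(\<integral>\<^sup>+z. ennreal (norm ((vol (snd z) (fst z))\<^sup>2)) \<partial>(M \<Otimes>\<^sub>M U)) < \<infinity>" .
qed simp

lemma finite_MU: "finite_measure (M \<Otimes>\<^sub>M U)"
proof (rule finite_measureI)
  have "emeasure (M \<Otimes>\<^sub>M U) (space M \<times> UNIV) = emeasure M (space M) * emeasure U UNIV"
    by (rule U.emeasure_pair_measure_Times) auto
  then show "emeasure (M \<Otimes>\<^sub>M U) (space (M \<Otimes>\<^sub>M U)) \<noteq> \<infinity>"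
    using U.emeasure_finite[of UNIV] by (simp add: space_pair_measure emeasure_space_1)
qed

lemma measure_MU: "measure (M \<Otimes>\<^sub>M U) (space (M \<Otimes>\<^sub>M U)) = T"
proof -
  have "emeasure (M \<Otimes>\<^sub>M U) (space M \<times> UNIV) = emeasure M (space M) * emeasure U UNIV"
    by (rule U.emeasure_pair_measure_Times) auto
  then have "measure (M \<Otimes>\<^sub>M U) (space M \<times> UNIV) = measure U UNIV"
    by (simp add: measure_def emeasure_space_1)
  then show ?thesis using measure_uniform_time[of T] T by (simp add: space_pair_measure)
qed

lemma gvol_section [measurable]: "gvol n u \<in> borel_measurable M"
  using measurable_compose[OF measurable_Pair2'[of u U M] gvol_measurable[of n]] by simp

lemma gvol_le: "AE z in M \<Otimes>\<^sub>M U. gvol n (snd z) (fst z) \<le> real n"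
proof (rule MU.AE_pair_measure)
  show "{z \<in> space (M \<Otimes>\<^sub>M U). gvol n (snd z) (fst z) \<le> real n} \<in> sets (M \<Otimes>\<^sub>M U)" by measurable
  show "AE x in M. AE y in U. gvol n (snd (x, y)) (fst (x, y)) \<le> real n"
  proof (rule AE_I2)
    fix x
    show "AE y in U. gvol n (snd (x, y)) (fst (x, y)) \<le> real n"
      using AE_uniform_time[of T] by (rule eventually_mono) (simp add: gvol_eq trunc_bounds)
  qed
qed

lemma gvol_L2: "integrable (M \<Otimes>\<^sub>M U) (\<lambda>z. (gvol n (snd z) (fst z))\<^sup>2)"
proof (rule finite_measure.integrable_const_bound[OF finite_MU, where B = "(real n)\<^sup>2"])
  show "AE z in M \<Otimes>\<^sub>M U. norm ((gvol n (snd z) (fst z))\<^sup>2) \<le> (real n)\<^sup>2"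
    using gvol_le[of n] by eventually_elim (simp add: gvol_nonneg power_mono)
qed simp

definition gerr :: "nat \<Rightarrow> real" where
  "gerr n = (\<integral>z. (gvol n (snd z) (fst z) - vol (snd z) (fst z))\<^sup>2 \<partial>(M \<Otimes>\<^sub>M U))"

lemma gerr_integrable: "integrable (M \<Otimes>\<^sub>M U) (\<lambda>z. (gvol n (snd z) (fst z) - vol (snd z) (fst z))\<^sup>2)"
  by (intro integrable_add_L2 gvol_L2 vol_L2) measurable

lemma gerr_pair: "integrable (M \<Otimes>\<^sub>M U) (case_prod (\<lambda>\<omega> u. (gvol n u \<omega> - vol u \<omega>)\<^sup>2))"
  using gerr_integrable[of n] by (simp add: case_prod_beta')

text \<open>The error of discretisation in time, controlled by \<rho>, and the error of truncation
  are separated by passing through the truncated volatility at time \<open>u\<close>; truncation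
  does not increase distances.\<close>

lemma gvol_error_at:
  assumes u: "0 < u" "u \<le> T"
  shows "expectation (\<lambda>\<omega>. (gvol n u \<omega> - vol u \<omega>)\<^sup>2)
    \<le> 2 * \<rho> (T / real (Suc n)) + 2 * expectation (\<lambda>\<omega>. (trunc n (vol u \<omega>) - vol u \<omega>)\<^sup>2)"
proof -
  let ?v = "grid_point T n u"
  note v = grid_process_fun(2-4)[OF T u, of n]
  note [measurable] = S_meas
  have i1: "integrable M (\<lambda>\<omega>. (S ?v \<omega> - S u \<omega>)\<^sup>2)" by (intro integrable_add_L2 S_L2) measurable
  have tr: "(trunc n x - x)\<^sup>2 \<le> x\<^sup>2" if "0 \<le> x" for x
    using that by (intro power2_le_iff_abs_le[THEN iffD2]) (auto simp: trunc_def)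
  have i2: "integrable M (\<lambda>\<omega>. (trunc n (vol u \<omega>) - vol u \<omega>)\<^sup>2)"
    by (rule Bochner_Integration.integrable_bound[OF vol_L2_time(1)[of u]]) (use tr vol_nonneg in auto)
  have "expectation (\<lambda>\<omega>. (gvol n u \<omega> - vol u \<omega>)\<^sup>2)
    \<le> expectation (\<lambda>\<omega>. 2 * (S ?v \<omega> - S u \<omega>)\<^sup>2 + 2 * (trunc n (vol u \<omega>) - vol u \<omega>)\<^sup>2)"
  proof (rule integral_mono_AE)
    have AE1: "AE \<omega> in M. (gvol n u \<omega> - vol u \<omega>)\<^sup>2 \<le> 2 * (S ?v \<omega> - S u \<omega>)\<^sup>2 + 2 * (trunc n (vol u \<omega>) - vol u \<omega>)\<^sup>2"
      using S_S'[of ?v] AE_vol[OF less_imp_le[OF u(1)] u(2)]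
    proof eventually_elim
      case (elim \<omega>)
      have "(gvol n u \<omega> - vol u \<omega>)\<^sup>2 = ((trunc n (S ?v \<omega>) - trunc n (S u \<omega>)) + (trunc n (vol u \<omega>) - vol u \<omega>))\<^sup>2"
        using elim by (simp add: gvol_eq[OF u])
      also have "\<dots> \<le> 2 * (trunc n (S ?v \<omega>) - trunc n (S u \<omega>))\<^sup>2 + 2 * (trunc n (vol u \<omega>) - vol u \<omega>)\<^sup>2"
        by (rule square_add_le)
      also have "(trunc n (S ?v \<omega>) - trunc n (S u \<omega>))\<^sup>2 \<le> (S ?v \<omega> - S u \<omega>)\<^sup>2"
        using trunc_bounds(3) by (simp add: abs_le_square_iff[symmetric])
      finally show ?case by simp
    qed
    show "AE \<omega> in M. (gvol n u \<omega> - vol u \<omega>)\<^sup>2 \<le> 2 * (S ?v \<omega> - S u \<omega>)\<^sup>2 + 2 * (trunc n (vol u \<omega>) - vol u \<omega>)\<^sup>2"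
      by (fact AE1)
    show "integrable M (\<lambda>\<omega>. 2 * (S ?v \<omega> - S u \<omega>)\<^sup>2 + 2 * (trunc n (vol u \<omega>) - vol u \<omega>)\<^sup>2)" using i1 i2 by simp
    then show "integrable M (\<lambda>\<omega>. (gvol n u \<omega> - vol u \<omega>)\<^sup>2)"
      by (rule Bochner_Integration.integrable_bound) (use AE1 in \<open>auto elim: eventually_mono\<close>)
  qed
  also have "\<dots> = 2 * expectation (\<lambda>\<omega>. (S ?v \<omega> - S u \<omega>)\<^sup>2) + 2 * expectation (\<lambda>\<omega>. (trunc n (vol u \<omega>) - vol u \<omega>)\<^sup>2)"
    using i1 i2 by simp
  finally show ?thesis using S_cont[OF v(3)] by simp
qed

text \<open>The estimate at a fixed time is integrated over time by Fubini's theorem. The truncation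
  error vanishes by dominated convergence, since each value of \<open>vol\<close> is eventually not
  truncated.\<close>

lemma gerr_tendsto: "gerr \<longlonglongrightarrow> 0"
proof -
  have tr: "(trunc n x - x)\<^sup>2 \<le> x\<^sup>2" if "0 \<le> x" for x n
    using that by (intro power2_le_iff_abs_le[THEN iffD2]) (auto simp: trunc_def)
  define d where "d n = (\<integral>z. (trunc n (vol (snd z) (fst z)) - vol (snd z) (fst z))\<^sup>2 \<partial>(M \<Otimes>\<^sub>M U))" for n
  have d_int: "integrable (M \<Otimes>\<^sub>M U) (case_prod (\<lambda>\<omega> u. (trunc n (vol u \<omega>) - vol u \<omega>)\<^sup>2))" for n
    unfolding case_prod_beta' by (rule Bochner_Integration.integrable_bound[OF vol_L2]) (use tr vol_nonneg in auto)
  have "d \<longlonglongrightarrow> (\<integral>z. 0 \<partial>(M \<Otimes>\<^sub>M U))" unfolding d_def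
  proof (rule integral_dominated_convergence[where w = "\<lambda>z. (vol (snd z) (fst z))\<^sup>2"])
    show "AE z in M \<Otimes>\<^sub>M U. (\<lambda>n. (trunc n (vol (snd z) (fst z)) - vol (snd z) (fst z))\<^sup>2) \<longlonglongrightarrow> 0"
    proof (rule AE_I2)
      fix z
      obtain n0 where n0: "vol (snd z) (fst z) \<le> real n0" using real_arch_simple by blast
      have "\<forall>\<^sub>F n in sequentially. 0 = (trunc n (vol (snd z) (fst z)) - vol (snd z) (fst z))\<^sup>2"
        using eventually_ge_at_top[of n0]
        by eventually_elim (use n0 vol_nonneg[of "snd z" "fst z"] in \<open>auto simp: trunc_def min_def max_def\<close>)
      then show "(\<lambda>n. (trunc n (vol (snd z) (fst z)) - vol (snd z) (fst z))\<^sup>2) \<longlonglongrightarrow> 0"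
        by (rule Lim_transform_eventually[OF tendsto_const])
    qed
    show "AE z in M \<Otimes>\<^sub>M U. norm ((trunc n (vol (snd z) (fst z)) - vol (snd z) (fst z))\<^sup>2) \<le> (vol (snd z) (fst z))\<^sup>2" for n
      using tr vol_nonneg by (intro AE_I2) simp
  qed (use vol_L2 in auto)
  then have d0: "d \<longlonglongrightarrow> 0" by simp
  have le: "gerr n \<le> 2 * \<rho> (T / real (Suc n)) * T + 2 * d n" for n
  proof -
    have "gerr n = (\<integral>u. expectation (\<lambda>\<omega>. (gvol n u \<omega> - vol u \<omega>)\<^sup>2) \<partial>U)"
      using MU.integral_snd[OF gerr_pair[of n]] by (simp add: gerr_def case_prod_beta')
    also have "\<dots> \<le> (\<integral>u. 2 * \<rho> (T / real (Suc n)) + 2 * expectation (\<lambda>\<omega>. (trunc n (vol u \<omega>) - vol u \<omega>)\<^sup>2) \<partial>U)"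
    proof (rule integral_mono_AE)
      show "integrable U (\<lambda>u. expectation (\<lambda>\<omega>. (gvol n u \<omega> - vol u \<omega>)\<^sup>2))" by (rule MU.integrable_snd[OF gerr_pair])
      show "integrable U (\<lambda>u. 2 * \<rho> (T / real (Suc n)) + 2 * expectation (\<lambda>\<omega>. (trunc n (vol u \<omega>) - vol u \<omega>)\<^sup>2))"
        using MU.integrable_snd[OF d_int] by simp
      show "AE u in U. expectation (\<lambda>\<omega>. (gvol n u \<omega> - vol u \<omega>)\<^sup>2) \<le> 2 * \<rho> (T / real (Suc n)) + 2 * expectation (\<lambda>\<omega>. (trunc n (vol u \<omega>) - vol u \<omega>)\<^sup>2)"
        using AE_uniform_time[of T] by eventually_elim (use gvol_error_at in auto)
    qed
    also have "\<dots> = 2 * \<rho> (T / real (Suc n)) * T + 2 * (\<integral>u. expectation (\<lambda>\<omega>. (trunc n (vol u \<omega>) - vol u \<omega>)\<^sup>2) \<partial>U)"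
      using MU.integrable_snd[OF d_int] measure_uniform_time[of T] T by simp
    also have "(\<integral>u. expectation (\<lambda>\<omega>. (trunc n (vol u \<omega>) - vol u \<omega>)\<^sup>2) \<partial>U) = d n"
      using MU.integral_snd[OF d_int[of n]] by (simp add: d_def case_prod_beta')
    finally show ?thesis .
  qed
  have "(\<lambda>n. 2 * \<rho> (T / real (Suc n)) * T + 2 * d n) \<longlonglongrightarrow> 2 * 0 * T + 2 * 0"
    by (intro tendsto_intros \<rho> d0)
  then have "(\<lambda>n. 2 * \<rho> (T / real (Suc n)) * T + 2 * d n) \<longlonglongrightarrow> 0" by simp
  then show ?thesis
    by (rule Lim_null_comparison[rotated]) (use le in \<open>auto simp: gerr_def intro!: always_eventually\<close>)
qed

end

lemma (in finite_measure) square_integral_le: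
  fixes f :: "'a \<Rightarrow> real"
  assumes [measurable]: "f \<in> borel_measurable M" and f: "integrable M (\<lambda>x. (f x)\<^sup>2)"
  shows "integrable M f" "(\<integral>x. f x \<partial>M)\<^sup>2 \<le> measure M (space M) * (\<integral>x. (f x)\<^sup>2 \<partial>M)"
proof -
  show "integrable M f" by (rule square_integrable_imp_integrable[OF _ f]) simp
  have "\<bar>\<integral>x. f x * 1 \<partial>M\<bar> \<le> sqrt (\<integral>x. (f x)\<^sup>2 \<partial>M) * sqrt (\<integral>x. 1\<^sup>2 \<partial>M)"
    by (rule Cauchy_Schwarz_integral) (use f in auto)
  then have "\<bar>\<integral>x. f x \<partial>M\<bar>\<^sup>2 \<le> (sqrt (\<integral>x. (f x)\<^sup>2 \<partial>M) * sqrt (measure M (space M)))\<^sup>2"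
    by (intro power_mono) auto
  then show "(\<integral>x. f x \<partial>M)\<^sup>2 \<le> measure M (space M) * (\<integral>x. (f x)\<^sup>2 \<partial>M)"
    by (simp add: power_mult_distrib mult.commute)
qed

context volatility
begin

section \<open>Approximation of the integrand of the Ito integral\<close>

lemma grid_process_S_section:
  assumes u: "0 < u" "u \<le> T"
  shows "AE \<omega> in M. (simple_process_fun (grid_process T S n) u \<omega> - sqrt (S (max 0 (min T u)) \<omega>))\<^sup>2 \<le> \<bar>gvol n u \<omega> - vol u \<omega>\<bar>"
  using S_S'[of "grid_point T n u"] AE_vol[OF less_imp_le[OF u(1)] u(2)]
proof eventually_elim
  case (elim \<omega>)
  have "simple_process_fun (grid_process T S n) u \<omega> = sqrt (gvol n u \<omega>)"
    using elim by (simp add: grid_process_fun(1)[OF T u] gvol_eq[OF u])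
  moreover have "S (max 0 (min T u)) \<omega> = vol u \<omega>" using elim u by simp
  ultimately show ?case using sqrt_diff_square_le[OF gvol_nonneg vol_nonneg] by simp
qed

text \<open>The inequality \<open>(sqrt x - sqrt y)\<^sup>2 \<le> \<bar>x - y\<bar>\<close> replaces
  roots by volatilities, and the Cauchy-Schwarz inequality on a space of total mass \<open>T\<close>
  passes from the first to the second mean.\<close>

lemma expected_L2_distance:
  assumes t: "0 \<le> t" "t \<le> T"
  shows "(\<integral>\<^sup>+\<omega>. L2_distance t (grid_process T S n) (\<lambda>u \<omega>. sqrt (S u \<omega>)) \<omega> \<partial>M) \<le> ennreal (sqrt (gerr n) * sqrt T)"
proof -
  define f where "f z = ennreal ((simple_process_fun (grid_process T S n) (snd z) (fst z) - sqrt (S (max 0 (min T (snd z))) (fst z)))\<^sup>2)" for z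
  have m1: "(\<lambda>z. simple_process_fun (grid_process T S n) (snd z) (fst z)) \<in> borel_measurable (M \<Otimes>\<^sub>M U)"
    using simple_process_measurable[OF grid_process_F[of n]] sets_MU by (simp cong: measurable_cong_sets)
  have m2: "(\<lambda>z. sqrt (S (max 0 (min T (snd z))) (fst z))) \<in> borel_measurable (M \<Otimes>\<^sub>M U)"
    using progressive_clamp[OF prog, of T] T sets_MU by (simp cong: measurable_cong_sets)
  have f [measurable]: "f \<in> borel_measurable (M \<Otimes>\<^sub>M U)"
    unfolding f_def using m1 m2 by measurable
  have "(\<integral>\<^sup>+\<omega>. L2_distance t (grid_process T S n) (\<lambda>u \<omega>. sqrt (S u \<omega>)) \<omega> \<partial>M) \<le> (\<integral>\<^sup>+\<omega>. \<integral>\<^sup>+u. f (\<omega>, u) \<partial>U \<partial>M)"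
  proof (rule nn_integral_mono)
    fix \<omega> assume \<omega>: "\<omega> \<in> space M"
    have "(\<lambda>u. f (\<omega>, u)) \<in> borel_measurable U" using measurable_compose[OF measurable_Pair1'[OF \<omega>] f] .
    then have fm: "(\<lambda>u. f (\<omega>, u)) \<in> borel_measurable borel" by (simp cong: measurable_cong_sets)
    have "L2_distance t (grid_process T S n) (\<lambda>u \<omega>. sqrt (S u \<omega>)) \<omega> \<le> (\<integral>\<^sup>+u\<in>{0..T}. f (\<omega>, u) \<partial>lborel)"
      unfolding L2_distance_def f_def by (rule nn_integral_mono) (use t in \<open>auto split: split_indicator\<close>)
    then show "L2_distance t (grid_process T S n) (\<lambda>u \<omega>. sqrt (S u \<omega>)) \<omega> \<le> (\<integral>\<^sup>+u. f (\<omega>, u) \<partial>U)"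
      using nn_integral_uniform_time[OF fm] by simp
  qed
  also have "\<dots> = (\<integral>\<^sup>+u. \<integral>\<^sup>+\<omega>. f (\<omega>, u) \<partial>M \<partial>U)"
    by (rule MU.Fubini'[symmetric]) (simp add: case_prod_beta')
  also have "\<dots> \<le> (\<integral>\<^sup>+u. \<integral>\<^sup>+\<omega>. ennreal \<bar>gvol n u \<omega> - vol u \<omega>\<bar> \<partial>M \<partial>U)"
  proof (rule nn_integral_mono_AE)
    show "AE u in U. (\<integral>\<^sup>+\<omega>. f (\<omega>, u) \<partial>M) \<le> (\<integral>\<^sup>+\<omega>. ennreal \<bar>gvol n u \<omega> - vol u \<omega>\<bar> \<partial>M)"
      using AE_uniform_time[of T]
    proof eventually_elim
      case (elim u)
      show ?case using grid_process_S_section[of u n] elim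
        by (intro nn_integral_mono_AE) (auto elim!: eventually_mono simp: f_def intro: ennreal_leI)
    qed
  qed
  also have "\<dots> = (\<integral>\<^sup>+z. ennreal \<bar>gvol n (snd z) (fst z) - vol (snd z) (fst z)\<bar> \<partial>(M \<Otimes>\<^sub>M U))"
    by (subst MU.nn_integral_snd[symmetric]) simp_all
  also have "\<dots> = ennreal (\<integral>z. \<bar>gvol n (snd z) (fst z) - vol (snd z) (fst z)\<bar> \<partial>(M \<Otimes>\<^sub>M U))"
    by (rule nn_integral_eq_integral)
      (use finite_measure.square_integral_le(1)[OF finite_MU _ gerr_integrable[of n]] in auto)
  also have "\<dots> \<le> ennreal (sqrt (gerr n) * sqrt T)"
  proof (rule ennreal_leI)
    have "(\<integral>z. \<bar>gvol n (snd z) (fst z) - vol (snd z) (fst z)\<bar> \<partial>(M \<Otimes>\<^sub>M U))\<^sup>2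
      \<le> measure (M \<Otimes>\<^sub>M U) (space (M \<Otimes>\<^sub>M U)) * (\<integral>z. \<bar>gvol n (snd z) (fst z) - vol (snd z) (fst z)\<bar>\<^sup>2 \<partial>(M \<Otimes>\<^sub>M U))"
      by (rule finite_measure.square_integral_le(2)[OF finite_MU]) (use gerr_integrable in auto)
    also have "\<dots> = T * gerr n" by (simp add: measure_MU gerr_def)
    finally have "(\<integral>z. \<bar>gvol n (snd z) (fst z) - vol (snd z) (fst z)\<bar> \<partial>(M \<Otimes>\<^sub>M U)) \<le> sqrt (T * gerr n)"
      by (rule real_le_rsqrt)
    then show "(\<integral>z. \<bar>gvol n (snd z) (fst z) - vol (snd z) (fst z)\<bar> \<partial>(M \<Otimes>\<^sub>M U)) \<le> sqrt (gerr n) * sqrt T"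
      by (simp add: real_sqrt_mult mult.commute)
  qed
  finally show ?thesis .
qed

lemma L2_distance_tendsto:
  assumes t: "0 \<le> t" "t \<le> T" and \<epsilon>: "0 < \<epsilon>"
  shows "(\<lambda>n. prob {\<omega> \<in> space M. ennreal \<epsilon> \<le> L2_distance t (grid_process T S n) (\<lambda>u \<omega>. sqrt (S u \<omega>)) \<omega>}) \<longlonglongrightarrow> 0"
proof (rule Lim_null_comparison)
  let ?L = "\<lambda>n. L2_distance t (grid_process T S n) (\<lambda>u \<omega>. sqrt (S u \<omega>))"
  have g0: "0 \<le> gerr n" for n by (simp add: gerr_def)
  show "\<forall>\<^sub>F n in sequentially. norm (prob {\<omega> \<in> space M. ennreal \<epsilon> \<le> ?L n \<omega>}) \<le> sqrt (gerr n) * sqrt T / \<epsilon>"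
  proof (intro always_eventually allI)
    fix n
    have [measurable]: "?L n \<in> borel_measurable M" by (rule L2_distance_measurable[OF grid_process_F prog t(1)])
    have "ennreal \<epsilon> * emeasure M {\<omega> \<in> space M. ennreal \<epsilon> \<le> ?L n \<omega>} = (\<integral>\<^sup>+\<omega>. ennreal \<epsilon> * indicator {\<omega> \<in> space M. ennreal \<epsilon> \<le> ?L n \<omega>} \<omega> \<partial>M)"
      by (subst nn_integral_cmult_indicator) auto
    also have "\<dots> \<le> (\<integral>\<^sup>+\<omega>. ?L n \<omega> \<partial>M)" by (intro nn_integral_mono) (auto split: split_indicator)
    also have "\<dots> \<le> ennreal (sqrt (gerr n) * sqrt T)" by (rule expected_L2_distance[OF t])
    finally have "ennreal (\<epsilon> * prob {\<omega> \<in> space M. ennreal \<epsilon> \<le> ?L n \<omega>}) \<le> ennreal (sqrt (gerr n) * sqrt T)"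
      using \<epsilon> by (simp add: emeasure_eq_measure ennreal_mult)
    then have "\<epsilon> * prob {\<omega> \<in> space M. ennreal \<epsilon> \<le> ?L n \<omega>} \<le> sqrt (gerr n) * sqrt T"
      using g0[of n] T by (subst (asm) ennreal_le_iff) auto
    then show "norm (prob {\<omega> \<in> space M. ennreal \<epsilon> \<le> ?L n \<omega>}) \<le> sqrt (gerr n) * sqrt T / \<epsilon>"
      using \<epsilon> by (simp add: le_divide_eq mult.commute)
  qed
  have "(\<lambda>n. sqrt (gerr n) * sqrt T / \<epsilon>) \<longlonglongrightarrow> sqrt 0 * sqrt T / \<epsilon>"
    by (intro tendsto_intros gerr_tendsto) (use \<epsilon> in auto)
  then show "(\<lambda>n. sqrt (gerr n) * sqrt T / \<epsilon>) \<longlonglongrightarrow> 0" by simp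
qed

lemma simple_ito_integral_AE:
  "AE \<omega> in M. simple_ito_integral W t (grid_process T S n) \<omega> = simple_ito_integral W t (grid_process T S' n) \<omega>"
proof -
  have "AE \<omega> in M. \<forall>k. S (T * real k / real (Suc n)) \<omega> = S' (T * real k / real (Suc n)) \<omega>"
    using S_S' by (subst AE_all_countable) blast
  then show ?thesis
    by eventually_elim (simp add: simple_ito_integral_def grid_process_def o_def)
qed

section \<open>Linear combinations of two returns\<close>

definition weight :: "real \<Rightarrow> real \<Rightarrow> real \<Rightarrow> real \<Rightarrow> real \<Rightarrow> real \<Rightarrow> real" where
  "weight a b a' b' \<epsilon> u = indicator {a<..b} u + \<epsilon> * indicator {a'<..b'} u"

lemma weight_measurable [measurable]: "weight a b a' b' \<epsilon> \<in> borel_measurable borel"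
  unfolding weight_def[abs_def] by measurable

lemma weight_square_le:
  assumes "b \<le> a'" "\<bar>\<epsilon>\<bar> \<le> 1"
  shows "(weight a b a' b' \<epsilon> u)\<^sup>2 \<le> 1"
  using assms by (auto simp: weight_def abs_square_le_1 split: split_indicator)

text \<open>Discretises the integrand of \<open>(X b - X a) + \<epsilon> * (X b' - X a')\<close>. It
  is built from \<open>S'\<close>, so that the moment formulas for coefficients in \<open>G\<close>
  apply, while its integral agrees almost surely with the one built from \<open>S\<close>.\<close>

definition weighted_process :: "real \<Rightarrow> real \<Rightarrow> real \<Rightarrow> real \<Rightarrow> real \<Rightarrow> nat \<Rightarrow> (real \<times> real \<times> ('w \<Rightarrow> real)) list" where
  "weighted_process a b a' b' \<epsilon> n =
     clamp_process a b (grid_process T S' n) @ scale_process \<epsilon> (clamp_process a' b' (grid_process T S' n))"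

lemma grid_process_le: "\<forall>(r, s, \<xi>)\<in>set (grid_process T V n). r \<le> s"
  using grid_process_mem[OF _ T] by blast

lemma simple_process_clamp:
  assumes h: "simple_process (\<lambda>_. G) h" and "0 \<le> a"
  shows "simple_process (\<lambda>_. G) (clamp_process a b h)"
  unfolding simple_process_def
proof (intro ballI, clarify)
  fix r s \<xi> assume "(r, s, \<xi>) \<in> set (clamp_process a b h)"
  then obtain r' s' where m: "(r', s', \<xi>) \<in> set h" "r = max a (min r' b)" "s = max a (min s' b)"
    by (auto simp: clamp_process_def)
  then have "r' \<le> s'" "\<xi> \<in> borel_measurable G" "bounded (\<xi> ` space G)"
    using h unfolding simple_process_def by (auto dest!: bspec)
  then show "0 \<le> r \<and> r \<le> s \<and> \<xi> \<in> borel_measurable G \<and> bounded (\<xi> ` space G)"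
    using m assms(2) by (auto simp: max_def min_def)
qed

lemma weighted_process_G: "0 \<le> a \<Longrightarrow> 0 \<le> a' \<Longrightarrow> simple_process (\<lambda>_. G) (weighted_process a b a' b' \<epsilon> n)"
  unfolding weighted_process_def
  by (intro simple_process_append simple_process_scale simple_process_clamp grid_process_G)

lemma weighted_process_fun:
  "a \<le> b \<Longrightarrow> a' \<le> b' \<Longrightarrow> simple_process_fun (weighted_process a b a' b' \<epsilon> n) u \<omega>
    = weight a b a' b' \<epsilon> u * simple_process_fun (grid_process T S' n) u \<omega>"
  by (simp add: weighted_process_def simple_process_fun_clamp[OF grid_process_le] weight_def algebra_simps)

lemma weighted_process_integral:
  assumes "a \<le> b" "b \<le> T" "a' \<le> b'" "b' \<le> T"
  shows "AE \<omega> in M. simple_ito_integral W T (weighted_process a b a' b' \<epsilon> n) \<omega> =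
    (simple_ito_integral W b (grid_process T S n) \<omega> - simple_ito_integral W a (grid_process T S n) \<omega>)
    + \<epsilon> * (simple_ito_integral W b' (grid_process T S n) \<omega> - simple_ito_integral W a' (grid_process T S n) \<omega>)"
  using simple_ito_integral_AE[of a n] simple_ito_integral_AE[of b n] simple_ito_integral_AE[of a' n] simple_ito_integral_AE[of b' n]
  by eventually_elim (simp add: weighted_process_def simple_ito_integral_clamp[OF grid_process_le] assms)

definition weighted_vol :: "real \<Rightarrow> real \<Rightarrow> real \<Rightarrow> real \<Rightarrow> real \<Rightarrow> 'w \<Rightarrow> real" where
  "weighted_vol a b a' b' \<epsilon> \<omega> = (\<integral>u. (weight a b a' b' \<epsilon> u)\<^sup>2 * vol u \<omega> \<partial>U)"

lemma section_measurable:
  assumes "f \<in> borel_measurable (M \<Otimes>\<^sub>M U)" "\<omega> \<in> space M"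
  shows "(\<lambda>u. f (\<omega>, u)) \<in> borel_measurable U"
  using measurable_compose[OF measurable_Pair1'[OF assms(2)] assms(1)] .

definition time_integral :: "(real \<Rightarrow> real) \<Rightarrow> 'w \<Rightarrow> real" where
  "time_integral w \<omega> = (\<integral>u. w u * vol u \<omega> \<partial>U)"

lemma vol_pair: "integrable (M \<Otimes>\<^sub>M U) (case_prod (\<lambda>\<omega> u. (vol u \<omega>)\<^sup>2))"
  using vol_L2 by (simp add: case_prod_beta')

lemma weighted_section:
  assumes [measurable]: "w \<in> borel_measurable borel" and w1: "\<And>u. \<bar>w u\<bar> \<le> 1"
    and \<omega>: "\<omega> \<in> space M" and i: "integrable U (\<lambda>u. (vol u \<omega>)\<^sup>2)"
  shows "integrable U (\<lambda>u. w u * vol u \<omega>)" "(time_integral w \<omega>)\<^sup>2 \<le> T * (\<integral>u. (vol u \<omega>)\<^sup>2 \<partial>U)"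
proof -
  have [measurable]: "(\<lambda>u. vol u \<omega>) \<in> borel_measurable U"
    using section_measurable[OF vol_measurable \<omega>] by simp
  have [measurable]: "w \<in> borel_measurable U" by (simp cong: measurable_cong_sets)
  have le: "(w u * vol u \<omega>)\<^sup>2 \<le> (vol u \<omega>)\<^sup>2" for u
    using w1[of u] by (simp add: abs_le_square_iff[symmetric] abs_mult mult_left_le_one_le)
  have i': "integrable U (\<lambda>u. (w u * vol u \<omega>)\<^sup>2)"
    by (rule Bochner_Integration.integrable_bound[OF i]) (use le in auto)
  show "integrable U (\<lambda>u. w u * vol u \<omega>)" by (rule U.square_integral_le(1)[OF _ i']) measurable
  have "(time_integral w \<omega>)\<^sup>2 \<le> measure U (space U) * (\<integral>u. (w u * vol u \<omega>)\<^sup>2 \<partial>U)"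
    unfolding time_integral_def by (rule U.square_integral_le(2)[OF _ i']) measurable
  also have "\<dots> \<le> T * (\<integral>u. (vol u \<omega>)\<^sup>2 \<partial>U)"
    using measure_uniform_time[of T] T le by (simp, intro integral_mono i' i) auto
  finally show "(time_integral w \<omega>)\<^sup>2 \<le> T * (\<integral>u. (vol u \<omega>)\<^sup>2 \<partial>U)" .
qed

lemma time_integral_L2:
  assumes w [measurable]: "w \<in> borel_measurable borel" and w1: "\<And>u. \<bar>w u\<bar> \<le> 1"
  shows "time_integral w \<in> borel_measurable M" "integrable M (\<lambda>\<omega>. (time_integral w \<omega>)\<^sup>2)"
proof -
  have "(\<lambda>z. w (snd z) * vol (snd z) (fst z)) \<in> borel_measurable (M \<Otimes>\<^sub>M U)" by measurable
  then have "(\<lambda>\<omega>. \<integral>u. w u * vol u \<omega> \<partial>U) \<in> borel_measurable M"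
    by (intro U.borel_measurable_lebesgue_integral) (simp add: case_prod_beta')
  then show m: "time_integral w \<in> borel_measurable M" by (simp add: time_integral_def[abs_def])
  show "integrable M (\<lambda>\<omega>. (time_integral w \<omega>)\<^sup>2)"
  proof (rule Bochner_Integration.integrable_bound)
    show "integrable M (\<lambda>\<omega>. T * (\<integral>u. (vol u \<omega>)\<^sup>2 \<partial>U))" using MU.integrable_fst[OF vol_pair] by simp
    show "AE \<omega> in M. norm ((time_integral w \<omega>)\<^sup>2) \<le> norm (T * (\<integral>u. (vol u \<omega>)\<^sup>2 \<partial>U))"
      using MU.AE_integrable_fst[OF vol_pair] AE_space
      by eventually_elim (use weighted_section(2)[OF w w1] in \<open>auto intro: order_trans[OF _ abs_ge_self]\<close>)
  qed (use m in simp)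
qed

text \<open>
  The parameter \<open>\<epsilon>\<close> yields the mixed moment of the squares of two returns by polarisation.
\<close>

theorem return_moments:
  assumes X: "\<And>t. 0 \<le> t \<Longrightarrow> t \<le> T \<Longrightarrow> has_ito_integral M F W t (\<lambda>u \<omega>. sqrt (S u \<omega>)) (X t)"
    and ab: "0 \<le> a" "a \<le> b" "b \<le> a'" "a' \<le> b'" "b' \<le> T" and \<epsilon>: "\<bar>\<epsilon>\<bar> \<le> 1"
  shows "integrable M (\<lambda>\<omega>. ((X b \<omega> - X a \<omega>) + \<epsilon> * (X b' \<omega> - X a' \<omega>)) ^ 4)"
    "expectation (\<lambda>\<omega>. ((X b \<omega> - X a \<omega>) + \<epsilon> * (X b' \<omega> - X a' \<omega>))\<^sup>2) = expectation (weighted_vol a b a' b' \<epsilon>)"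
    "expectation (\<lambda>\<omega>. ((X b \<omega> - X a \<omega>) + \<epsilon> * (X b' \<omega> - X a' \<omega>)) ^ 4) = 3 * expectation (\<lambda>\<omega>. (weighted_vol a b a' b' \<epsilon> \<omega>)\<^sup>2)"
proof -
  let ?w = "weight a b a' b' \<epsilon>" and ?h = "\<lambda>n. grid_process T S' n"
  define L where "L n = weighted_process a b a' b' \<epsilon> n" for n
  define x where "x n = simple_ito_integral W T (L n)" for n
  have LG: "simple_process (\<lambda>_. G) (L n)" for n unfolding L_def using ab by (intro weighted_process_G) auto
  have T0: "0 \<le> T" using T by simp
  have dG: "simple_process (\<lambda>_. G) (L n @ scale_process (-1) (L k))" for n k
    by (intro simple_process_append simple_process_scale LG)
  have L_fun: "simple_process_fun (L n) u \<omega> = ?w u * simple_process_fun (?h n) u \<omega>" for n u \<omega>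
    unfolding L_def using ab by (intro weighted_process_fun) auto
  note m1 = simple_ito_moments[OF LG T0] and m2 = simple_ito_moments[OF dG T0]
  note w1 = weight_square_le[OF ab(3) \<epsilon>, of a b']
  have mU [measurable]: "(\<lambda>u. gvol n u \<omega>) \<in> borel_measurable U" "(\<lambda>u. vol u \<omega>) \<in> borel_measurable U"
    "(\<lambda>u. simple_process_fun (?h n) u \<omega>) \<in> borel_measurable U" if "\<omega> \<in> space M" for n \<omega>
    using section_measurable[OF gvol_measurable[of n] that] section_measurable[OF vol_measurable that]
      section_measurable[OF gproc_measurable[of n] that] by simp_all
  have wU [measurable]: "?w \<in> borel_measurable U" by (simp cong: measurable_cong_sets)
  define D where "D n \<omega> = (\<integral>u. (gvol n u \<omega> - vol u \<omega>)\<^sup>2 \<partial>U)" for n \<omega>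
  have D: "integrable M (D n)" "expectation (D n) = gerr n" for n
    using MU.integrable_fst[OF gerr_pair[of n]] MU.integral_fst[OF gerr_pair[of n]]
    by (simp_all add: D_def[abs_def] gerr_def case_prod_beta')
  have D_AE: "AE \<omega> in M. integrable U (\<lambda>u. (gvol n u \<omega> - vol u \<omega>)\<^sup>2)" for n
    using MU.AE_integrable_fst[OF gerr_pair[of n]] .
  have gvol_pair: "integrable (M \<Otimes>\<^sub>M U) (case_prod (\<lambda>\<omega> u. (gvol n u \<omega>)\<^sup>2))" for n
    using gvol_L2[of n] by (simp add: case_prod_beta')
  note vol_AE = MU.AE_integrable_fst[OF vol_pair] and gvol_AE = MU.AE_integrable_fst[OF gvol_pair]
  have wint: "integrable U (\<lambda>u. (?w u)\<^sup>2 * f u)" if "integrable U f" for f :: "real \<Rightarrow> real"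
  proof (rule Bochner_Integration.integrable_bound[OF that])
    have [measurable]: "f \<in> borel_measurable U" using that by simp
    show "(\<lambda>u. (?w u)\<^sup>2 * f u) \<in> borel_measurable U" by measurable
    show "AE u in U. norm ((?w u)\<^sup>2 * f u) \<le> norm (f u)"
      using w1 by (intro AE_I2) (simp add: abs_mult mult_left_le_one_le)
  qed
  have mu: "measure U (space U) = T" using measure_uniform_time[of T] T by simp
  have q_eq: "quad T (L n) \<omega> = (\<integral>u. (?w u)\<^sup>2 * gvol n u \<omega> \<partial>U)" for n \<omega>
    by (simp add: quad_def L_fun gvol_def power_mult_distrib)
  have Q_meas [measurable]: "weighted_vol a b a' b' \<epsilon> \<in> borel_measurable M"
    and Q2: "integrable M (\<lambda>\<omega>. (weighted_vol a b a' b' \<epsilon> \<omega>)\<^sup>2)"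
    using time_integral_L2[of "\<lambda>u. (?w u)\<^sup>2"] w1 by (simp_all add: weighted_vol_def[abs_def] time_integral_def[abs_def])
  \<comment> \<open>Pathwise Cauchy-Schwarz inequality in time, with weights bounded by 1. It
    reduces the error in the quadratic variation to the error \<open>D n\<close> of the
    volatility.\<close>
  have qQ: "AE \<omega> in M. (quad T (L n) \<omega> - weighted_vol a b a' b' \<epsilon> \<omega>)\<^sup>2 \<le> T * D n \<omega>" for n
    using D_AE[of n] vol_AE gvol_AE[of n] AE_space
  proof eventually_elim
    case (elim \<omega>)
    note mU[OF elim(4), measurable]
    have iv: "integrable U (\<lambda>u. vol u \<omega>)" "integrable U (\<lambda>u. gvol n u \<omega>)"
      using U.square_integral_le(1)[OF _ elim(2)] U.square_integral_le(1)[OF _ elim(3)] by simp_all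
    have "quad T (L n) \<omega> - weighted_vol a b a' b' \<epsilon> \<omega> = (\<integral>u. (?w u)\<^sup>2 * gvol n u \<omega> - (?w u)\<^sup>2 * vol u \<omega> \<partial>U)"
      unfolding q_eq weighted_vol_def by (rule Bochner_Integration.integral_diff[symmetric]) (intro wint iv)+
    also have "\<dots> = (\<integral>u. (?w u)\<^sup>2 * (gvol n u \<omega> - vol u \<omega>) \<partial>U)" by (simp add: right_diff_distrib)
    finally have e: "quad T (L n) \<omega> - weighted_vol a b a' b' \<epsilon> \<omega> = (\<integral>u. (?w u)\<^sup>2 * (gvol n u \<omega> - vol u \<omega>) \<partial>U)" .
    have le: "((?w u)\<^sup>2 * (gvol n u \<omega> - vol u \<omega>))\<^sup>2 \<le> (gvol n u \<omega> - vol u \<omega>)\<^sup>2" for u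
      using w1[of u] by (simp add: abs_le_square_iff[symmetric] abs_mult mult_left_le_one_le)
    have i: "integrable U (\<lambda>u. ((?w u)\<^sup>2 * (gvol n u \<omega> - vol u \<omega>))\<^sup>2)"
      by (rule Bochner_Integration.integrable_bound[OF elim(1)]) (use le in auto)
    have "(\<integral>u. (?w u)\<^sup>2 * (gvol n u \<omega> - vol u \<omega>) \<partial>U)\<^sup>2 \<le> measure U (space U) * (\<integral>u. ((?w u)\<^sup>2 * (gvol n u \<omega> - vol u \<omega>))\<^sup>2 \<partial>U)"
      by (rule U.square_integral_le(2)[OF _ i]) measurable
    also have "\<dots> \<le> T * D n \<omega>"
      unfolding mu D_def using T le by (intro mult_left_mono integral_mono i elim(1)) auto
    finally show ?case unfolding e .
  qed
  \<comment> \<open>The quadratic variation of a difference involves squared differences of roots,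
    which are at most differences of volatilities. A fourth moment of integrals is thereby
    controlled by a second moment of volatilities.\<close>
  have qd: "AE \<omega> in M. (quad T (L n @ scale_process (-1) (L k)) \<omega>)\<^sup>2 \<le> 2 * T * D n \<omega> + 2 * T * D k \<omega>" for n k
    using D_AE[of n] D_AE[of k] AE_space
  proof eventually_elim
    case (elim \<omega>)
    note mU[OF elim(3), measurable]
    let ?f = "\<lambda>u. (?w u * (simple_process_fun (?h n) u \<omega> - simple_process_fun (?h k) u \<omega>))\<^sup>2"
    let ?g = "\<lambda>u. \<bar>gvol n u \<omega> - vol u \<omega>\<bar> + \<bar>gvol k u \<omega> - vol u \<omega>\<bar>"
    have q: "quad T (L n @ scale_process (-1) (L k)) \<omega> = (\<integral>u. ?f u \<partial>U)"
      by (simp add: quad_def L_fun right_diff_distrib)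
    have ia: "integrable U (\<lambda>u. \<bar>gvol n u \<omega> - vol u \<omega>\<bar>\<^sup>2)" "integrable U (\<lambda>u. \<bar>gvol k u \<omega> - vol u \<omega>\<bar>\<^sup>2)" using elim by simp_all
    have ig: "integrable U (\<lambda>u. (?g u)\<^sup>2)"
      by (intro integrable_add_L2 ia) measurable
    note ig1 = U.square_integral_le(1)[OF _ ig]
    have "0 \<le> (\<integral>u. ?f u \<partial>U)" by simp
    moreover have "(\<integral>u. ?f u \<partial>U) \<le> (\<integral>u. ?g u \<partial>U)"
    proof -
      have AEle: "AE u in U. ?f u \<le> ?g u"
        using AE_uniform_time[of T]
      proof eventually_elim
        case (elim u)
        have s: "simple_process_fun (?h j) u \<omega> = sqrt (gvol j u \<omega>)" for j
          using elim T by (simp add: gvol_def grid_process_fun(1) trunc_bounds)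
        have "?f u \<le> (sqrt (gvol n u \<omega>) - sqrt (gvol k u \<omega>))\<^sup>2"
          unfolding power_mult_distrib s using w1[of u] by (intro mult_left_le_one_le) auto
        also have "\<dots> \<le> \<bar>gvol n u \<omega> - gvol k u \<omega>\<bar>" by (rule sqrt_diff_square_le[OF gvol_nonneg gvol_nonneg])
        finally show ?case by linarith
      qed
      have ig': "integrable U ?g" by (rule ig1) measurable
      have "integrable U ?f"
        by (rule Bochner_Integration.integrable_bound[OF ig']) (use AEle in \<open>auto elim!: eventually_mono\<close>)
      then show ?thesis using ig' AEle by (rule integral_mono_AE)
    qed
    ultimately have "(\<integral>u. ?f u \<partial>U)\<^sup>2 \<le> (\<integral>u. ?g u \<partial>U)\<^sup>2" by (intro power_mono)
    also have "\<dots> \<le> T * (\<integral>u. (?g u)\<^sup>2 \<partial>U)"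
      using U.square_integral_le(2)[OF _ ig] mu by simp
    also have "(\<integral>u. (?g u)\<^sup>2 \<partial>U) \<le> (\<integral>u. 2 * (gvol n u \<omega> - vol u \<omega>)\<^sup>2 + 2 * (gvol k u \<omega> - vol u \<omega>)\<^sup>2 \<partial>U)"
    proof (rule integral_mono[OF ig])
      show "(?g u)\<^sup>2 \<le> 2 * (gvol n u \<omega> - vol u \<omega>)\<^sup>2 + 2 * (gvol k u \<omega> - vol u \<omega>)\<^sup>2" for u
        using square_add_le[of "\<bar>gvol n u \<omega> - vol u \<omega>\<bar>" "\<bar>gvol k u \<omega> - vol u \<omega>\<bar>"] by simp
    qed (use elim in auto)
    also have "\<dots> = 2 * D n \<omega> + 2 * D k \<omega>" using elim by (simp add: D_def)
    finally show ?case unfolding q using T by (simp add: algebra_simps)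
  qed
  have xd: "(\<lambda>\<omega>. x n \<omega> - x k \<omega>) = simple_ito_integral W T (L n @ scale_process (-1) (L k))" for n k
    by (simp add: fun_eq_iff x_def)
  have x_meas [measurable]: "x n \<in> borel_measurable M" for n
    unfolding x_def
  proof (rule simple_ito_integral_measurable[OF _ T0])
    fix r s \<xi> assume "(r, s, \<xi>) \<in> set (L n)"
    then have "0 \<le> r" "r \<le> s" "\<xi> \<in> borel_measurable G" using LG[of n] unfolding simple_process_def by (auto dest!: bspec)
    then show "\<xi> \<in> borel_measurable M \<and> 0 \<le> r \<and> 0 \<le> s" using measurable_from_subalg[OF sub_G] by auto
  qed
  have X_meas: "X t \<in> borel_measurable M"
    and X_lim: "(\<lambda>n. ky_fan M (\<lambda>\<omega>. simple_ito_integral W t (grid_process T S n) \<omega> - X t \<omega>)) \<longlonglongrightarrow> 0"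
    if "0 \<le> t" "t \<le> T" for t
    using ito_integral_unique[OF X[OF that] that(1) grid_process_F L2_distance_tendsto[OF that]] by auto
  have abT: "0 \<le> b" "b \<le> T" "0 \<le> a" "a \<le> T" "0 \<le> b'" "b' \<le> T" "0 \<le> a'" "a' \<le> T" using ab by auto
  note [measurable] = X_meas[OF abT(1,2)] X_meas[OF abT(3,4)] X_meas[OF abT(5,6)] X_meas[OF abT(7,8)]
  define Y where "Y \<omega> = (X b \<omega> - X a \<omega>) + \<epsilon> * (X b' \<omega> - X a' \<omega>)" for \<omega>
  have Y_meas [measurable]: "Y \<in> borel_measurable M" unfolding Y_def by measurable
  have lim: "(\<lambda>n. ky_fan M (\<lambda>\<omega>. x n \<omega> - Y \<omega>)) \<longlonglongrightarrow> 0"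
  proof (rule Lim_null_comparison)
    let ?I = "\<lambda>t n \<omega>. simple_ito_integral W t (grid_process T S n) \<omega> - X t \<omega>"
    show "\<forall>\<^sub>F n in sequentially. norm (ky_fan M (\<lambda>\<omega>. x n \<omega> - Y \<omega>))
      \<le> (ky_fan M (?I b n) + ky_fan M (?I a n)) + (ky_fan M (?I b' n) + ky_fan M (?I a' n))"
    proof (intro always_eventually allI)
      fix n
      note [measurable] = simple_ito_integral_measurable'[OF grid_process_F[of n] abT(1)] simple_ito_integral_measurable'[OF grid_process_F[of n] abT(3)]
        simple_ito_integral_measurable'[OF grid_process_F[of n] abT(5)] simple_ito_integral_measurable'[OF grid_process_F[of n] abT(7)]
      have "ky_fan M (\<lambda>\<omega>. x n \<omega> - Y \<omega>) = ky_fan M (\<lambda>\<omega>. (?I b n \<omega> - ?I a n \<omega>) + \<epsilon> * (?I b' n \<omega> - ?I a' n \<omega>))"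
        unfolding x_def L_def Y_def
        using weighted_process_integral[OF ab(2) abT(2) ab(4,5), of \<epsilon> n] x_meas[of n]
        by (intro ky_fan_cong_AE) (auto simp: x_def L_def elim!: eventually_mono simp: algebra_simps)
      also have "\<dots> \<le> ky_fan M (\<lambda>\<omega>. ?I b n \<omega> - ?I a n \<omega>) + ky_fan M (\<lambda>\<omega>. \<epsilon> * (?I b' n \<omega> - ?I a' n \<omega>))"
        by (rule ky_fan_add) measurable
      also have "ky_fan M (\<lambda>\<omega>. ?I b n \<omega> - ?I a n \<omega>) \<le> ky_fan M (?I b n) + ky_fan M (?I a n)"
        by (rule ky_fan_diff) measurable
      also have "ky_fan M (\<lambda>\<omega>. \<epsilon> * (?I b' n \<omega> - ?I a' n \<omega>)) \<le> ky_fan M (\<lambda>\<omega>. ?I b' n \<omega> - ?I a' n \<omega>)"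
        unfolding ky_fan_def
      proof (rule integral_mono)
        show "min 1 \<bar>\<epsilon> * (?I b' n \<omega> - ?I a' n \<omega>)\<bar> \<le> min 1 \<bar>?I b' n \<omega> - ?I a' n \<omega>\<bar>" for \<omega>
          using mult_left_le_one_le[of "\<bar>?I b' n \<omega> - ?I a' n \<omega>\<bar>" "\<bar>\<epsilon>\<bar>"] \<epsilon> by (simp add: abs_mult min_def)
      qed (intro integrable_min_abs, measurable)+
      also have "ky_fan M (\<lambda>\<omega>. ?I b' n \<omega> - ?I a' n \<omega>) \<le> ky_fan M (?I b' n) + ky_fan M (?I a' n)"
        by (rule ky_fan_diff) measurable
      finally show "norm (ky_fan M (\<lambda>\<omega>. x n \<omega> - Y \<omega>))
      \<le> (ky_fan M (?I b n) + ky_fan M (?I a n)) + (ky_fan M (?I b' n) + ky_fan M (?I a' n))" by simp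
    qed
    show "(\<lambda>n. (ky_fan M (?I b n) + ky_fan M (?I a n)) + (ky_fan M (?I b' n) + ky_fan M (?I a' n))) \<longlonglongrightarrow> 0"
      by (intro tendsto_add_zero X_lim abT)
  qed
  have qQ_int: "integrable M (\<lambda>\<omega>. (quad T (L n) \<omega> - weighted_vol a b a' b' \<epsilon> \<omega>)\<^sup>2)" for n
    by (rule Bochner_Integration.integrable_bound[where f = "\<lambda>\<omega>. T * D n \<omega>"])
      (use D qQ[of n] m1(2)[of n] in \<open>auto elim!: eventually_mono intro: order_trans[OF _ abs_ge_self]\<close>)
  \<comment> \<open>The constant 6 is the Gaussian factor 3 times the 2 from
    \<open>qd\<close>.\<close>
  have d4: "integrable M (\<lambda>\<omega>. (x n \<omega> - x k \<omega>) ^ 4)"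
    "expectation (\<lambda>\<omega>. (x n \<omega> - x k \<omega>) ^ 4) \<le> 6 * T * gerr n + 6 * T * gerr k" for n k
  proof -
      note [measurable] = m2(2)[of n k]
      show "integrable M (\<lambda>\<omega>. (x n \<omega> - x k \<omega>) ^ 4)" using m2(1)[of n k] by (simp only: xd[symmetric])
      have "integrable M (\<lambda>\<omega>. 2 * T * D n \<omega> + 2 * T * D k \<omega>)" using D by simp
      then have i: "integrable M (\<lambda>\<omega>. (quad T (L n @ scale_process (-1) (L k)) \<omega>)\<^sup>2)"
        by (rule Bochner_Integration.integrable_bound) (use qd[of n k] in \<open>auto elim!: eventually_mono\<close>)
      have "expectation (\<lambda>\<omega>. (x n \<omega> - x k \<omega>) ^ 4) = 3 * expectation (\<lambda>\<omega>. (quad T (L n @ scale_process (-1) (L k)) \<omega>)\<^sup>2)"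
        using m2(4)[of n k] by (simp only: xd[symmetric])
      also have "expectation (\<lambda>\<omega>. (quad T (L n @ scale_process (-1) (L k)) \<omega>)\<^sup>2) \<le> expectation (\<lambda>\<omega>. 2 * T * D n \<omega> + 2 * T * D k \<omega>)"
        by (rule integral_mono_AE[OF i _ qd]) (use D in simp)
      also have "\<dots> = 2 * T * gerr n + 2 * T * gerr k" using D by simp
      finally show "expectation (\<lambda>\<omega>. (x n \<omega> - x k \<omega>) ^ 4) \<le> 6 * T * gerr n + 6 * T * gerr k" by simp
    qed
  have q_lim: "(\<lambda>n. expectation (\<lambda>\<omega>. (quad T (L n) \<omega> - weighted_vol a b a' b' \<epsilon> \<omega>)\<^sup>2)) \<longlonglongrightarrow> 0"
    proof (rule Lim_null_comparison)
      show "\<forall>\<^sub>F n in sequentially. norm (expectation (\<lambda>\<omega>. (quad T (L n) \<omega> - weighted_vol a b a' b' \<epsilon> \<omega>)\<^sup>2)) \<le> T * gerr n"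
      proof (intro always_eventually allI)
        fix n
        have "expectation (\<lambda>\<omega>. (quad T (L n) \<omega> - weighted_vol a b a' b' \<epsilon> \<omega>)\<^sup>2) \<le> expectation (\<lambda>\<omega>. T * D n \<omega>)"
          by (rule integral_mono_AE[OF qQ_int _ qQ]) (use D in simp)
        then show "norm (expectation (\<lambda>\<omega>. (quad T (L n) \<omega> - weighted_vol a b a' b' \<epsilon> \<omega>)\<^sup>2)) \<le> T * gerr n"
          using D by simp
      qed
      show "(\<lambda>n. T * gerr n) \<longlonglongrightarrow> 0" using tendsto_mult_right_zero[OF gerr_tendsto] .
    qed
  have e0: "(\<lambda>n. 6 * T * gerr n) \<longlonglongrightarrow> 0" using tendsto_mult_right_zero[OF gerr_tendsto] .
  note m1' = m1[folded x_def]
  note res = fourth_moment_limit[where e = "\<lambda>n. 6 * T * gerr n",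
    OF x_meas Y_meas m1'(2) Q_meas lim m1'(1) d4 e0 Q2 qQ_int q_lim m1'(3,4)]
  then show "integrable M (\<lambda>\<omega>. ((X b \<omega> - X a \<omega>) + \<epsilon> * (X b' \<omega> - X a' \<omega>)) ^ 4)"
    "expectation (\<lambda>\<omega>. ((X b \<omega> - X a \<omega>) + \<epsilon> * (X b' \<omega> - X a' \<omega>))\<^sup>2) = expectation (weighted_vol a b a' b' \<epsilon>)"
    "expectation (\<lambda>\<omega>. ((X b \<omega> - X a \<omega>) + \<epsilon> * (X b' \<omega> - X a' \<omega>)) ^ 4) = 3 * expectation (\<lambda>\<omega>. (weighted_vol a b a' b' \<epsilon> \<omega>)\<^sup>2)"
    by (simp_all add: Y_def)
qed

end

context volatility
begin

section \<open>Moments of integrated volatilities and of pairs of returns\<close>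

lemma expectation_time_integral:
  assumes w [measurable]: "w \<in> borel_measurable borel" and w1: "\<And>u. \<bar>w u\<bar> \<le> 1"
    and Z [measurable]: "Z \<in> borel_measurable M" and Z2: "integrable M (\<lambda>\<omega>. (Z \<omega>)\<^sup>2)"
  shows "expectation (\<lambda>\<omega>. Z \<omega> * time_integral w \<omega>) = (\<integral>u. w u * expectation (\<lambda>\<omega>. Z \<omega> * vol u \<omega>) \<partial>U)"
proof -
  have ZU: "integrable (M \<Otimes>\<^sub>M U) (\<lambda>z. (Z (fst z))\<^sup>2)"
  proof (rule MU.Fubini_integrable)
    show "(\<lambda>z. (Z (fst z))\<^sup>2) \<in> borel_measurable (M \<Otimes>\<^sub>M U)" by measurable
    show "integrable M (\<lambda>\<omega>. \<integral>u. norm ((Z (fst (\<omega>, u)))\<^sup>2) \<partial>U)" using Z2 by simp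
    show "AE \<omega> in M. integrable U (\<lambda>u. (Z (fst (\<omega>, u)))\<^sup>2)" by simp
  qed
  have wv: "integrable (M \<Otimes>\<^sub>M U) (\<lambda>z. (w (snd z) * vol (snd z) (fst z))\<^sup>2)"
    by (rule Bochner_Integration.integrable_bound[OF vol_L2])
      (use w1 in \<open>auto simp: abs_le_square_iff[symmetric] abs_mult mult_left_le_one_le\<close>)
  have "integrable (M \<Otimes>\<^sub>M U) (\<lambda>z. Z (fst z) * (w (snd z) * vol (snd z) (fst z)))"
    by (intro integrable_mult_L2 ZU wv) measurable
  then have i: "integrable (M \<Otimes>\<^sub>M U) (case_prod (\<lambda>\<omega> u. Z \<omega> * (w u * vol u \<omega>)))"
    by (simp add: case_prod_beta')
  have "expectation (\<lambda>\<omega>. Z \<omega> * time_integral w \<omega>) = expectation (\<lambda>\<omega>. \<integral>u. Z \<omega> * (w u * vol u \<omega>) \<partial>U)"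
    by (simp add: time_integral_def)
  also have "\<dots> = (\<integral>u. expectation (\<lambda>\<omega>. Z \<omega> * (w u * vol u \<omega>)) \<partial>U)"
    by (rule MU.Fubini_integral[OF i, symmetric])
  also have "\<dots> = (\<integral>u. w u * expectation (\<lambda>\<omega>. Z \<omega> * vol u \<omega>) \<partial>U)"
    by (intro Bochner_Integration.integral_cong refl) (simp only: mult.left_commute[of "Z _"] integral_mult_right_zero)
  finally show ?thesis .
qed

abbreviation int_vol :: "real \<Rightarrow> real \<Rightarrow> 'w \<Rightarrow> real" where
  "int_vol a b \<equiv> time_integral (indicator {a<..b})"

lemmas int_vol_L2 = time_integral_L2[of "indicator {a<..b}" for a b, simplified]

lemma expectation_int_vol:
  "expectation (int_vol a b) = (\<integral>u. indicator {a<..b} u * expectation (vol u) \<partial>U)"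
  using expectation_time_integral[of "indicator {a<..b}" "\<lambda>_. 1"] by simp

lemma expectation_int_vol_mult:
  "expectation (\<lambda>\<omega>. int_vol a b \<omega> * int_vol a' b' \<omega>)
    = (\<integral>u. indicator {a<..b} u * (\<integral>w. indicator {a'<..b'} w * expectation (\<lambda>\<omega>. vol u \<omega> * vol w \<omega>) \<partial>U) \<partial>U)"
proof -
  have "expectation (\<lambda>\<omega>. int_vol a b \<omega> * int_vol a' b' \<omega>) = expectation (\<lambda>\<omega>. int_vol a' b' \<omega> * int_vol a b \<omega>)"
    by (simp add: mult.commute)
  also have "\<dots> = (\<integral>u. indicator {a<..b} u * expectation (\<lambda>\<omega>. int_vol a' b' \<omega> * vol u \<omega>) \<partial>U)"
    by (rule expectation_time_integral) (use int_vol_L2[of a' b'] in auto)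
  also have "\<dots> = (\<integral>u. indicator {a<..b} u * expectation (\<lambda>\<omega>. vol u \<omega> * int_vol a' b' \<omega>) \<partial>U)"
    by (simp add: mult.commute)
  also have "\<dots> = (\<integral>u. indicator {a<..b} u * (\<integral>w. indicator {a'<..b'} w * expectation (\<lambda>\<omega>. vol u \<omega> * vol w \<omega>) \<partial>U) \<partial>U)"
    by (subst expectation_time_integral) (use vol_L2_time in auto)
  finally show ?thesis .
qed

lemma weighted_vol_eq:
  assumes "b \<le> a'"
  shows "AE \<omega> in M. weighted_vol a b a' b' \<epsilon> \<omega> = int_vol a b \<omega> + \<epsilon>\<^sup>2 * int_vol a' b' \<omega>"
  using MU.AE_integrable_fst[OF vol_pair] AE_space
proof eventually_elim
  case (elim \<omega>)
  have i: "integrable U (\<lambda>u. indicator {c<..d} u * vol u \<omega>)" for c d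
    by (rule weighted_section(1)[OF _ _ elim(2,1)]) auto
  have "weighted_vol a b a' b' \<epsilon> \<omega> = (\<integral>u. indicator {a<..b} u * vol u \<omega> + \<epsilon>\<^sup>2 * (indicator {a'<..b'} u * vol u \<omega>) \<partial>U)"
    unfolding weighted_vol_def using assms
    by (intro Bochner_Integration.integral_cong) (auto simp: weight_def split: split_indicator)
  also have "\<dots> = int_vol a b \<omega> + \<epsilon>\<^sup>2 * int_vol a' b' \<omega>"
    using i[of a b] i[of a' b'] by (simp add: time_integral_def)
  finally show ?case .
qed

text \<open>Conditionally on the volatility the returns are independent, and polarisation expresses
  this through fourth moments: adding the identities for \<epsilon> equal to 1 and to -1 cancels the
  odd terms, and what remains compares
  \<open>12 * (Y \<omega>)\<^sup>2 * (Y' \<omega>)\<^sup>2\<close> with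
  \<open>12 * I \<omega> * J \<omega>\<close> in expectation.\<close>

theorem mixed_return_moments:
  assumes X: "\<And>t. 0 \<le> t \<Longrightarrow> t \<le> T \<Longrightarrow> has_ito_integral M F W t (\<lambda>u \<omega>. sqrt (S u \<omega>)) (X t)"
  shows "0 \<le> a \<Longrightarrow> a \<le> b \<Longrightarrow> b \<le> T \<Longrightarrow> integrable M (\<lambda>\<omega>. (X b \<omega> - X a \<omega>) ^ 4)"
    "0 \<le> a \<Longrightarrow> a \<le> b \<Longrightarrow> b \<le> T \<Longrightarrow> X b \<in> borel_measurable M \<and> X a \<in> borel_measurable M"
    "0 \<le> a \<Longrightarrow> a \<le> b \<Longrightarrow> b \<le> T \<Longrightarrow> expectation (\<lambda>\<omega>. (X b \<omega> - X a \<omega>)\<^sup>2) = expectation (int_vol a b)"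
    "0 \<le> a \<Longrightarrow> a \<le> b \<Longrightarrow> b \<le> T \<Longrightarrow> expectation (\<lambda>\<omega>. (X b \<omega> - X a \<omega>) ^ 4) = 3 * expectation (\<lambda>\<omega>. (int_vol a b \<omega>)\<^sup>2)"
    "0 \<le> a \<Longrightarrow> a \<le> b \<Longrightarrow> b \<le> a' \<Longrightarrow> a' \<le> b' \<Longrightarrow> b' \<le> T \<Longrightarrow>
      expectation (\<lambda>\<omega>. (X b \<omega> - X a \<omega>)\<^sup>2 * (X b' \<omega> - X a' \<omega>)\<^sup>2) = expectation (\<lambda>\<omega>. int_vol a b \<omega> * int_vol a' b' \<omega>)"
proof -
  have meas: "X t \<in> borel_measurable M" if "0 \<le> t" "t \<le> T" for t
    using X[OF that] unfolding has_ito_integral_def conv_in_prob_def by blast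
  note [measurable] = int_vol_L2(1)
  have wm [measurable]: "weighted_vol a b a' b' \<epsilon> \<in> borel_measurable M" if "b \<le> a'" "\<bar>\<epsilon>\<bar> \<le> 1" for a b a' b' \<epsilon>
    using time_integral_L2(1)[of "\<lambda>u. (weight a b a' b' \<epsilon> u)\<^sup>2"] weight_square_le[OF that]
    by (simp add: weighted_vol_def[abs_def] time_integral_def[abs_def])
  have single: "integrable M (\<lambda>\<omega>. (X b \<omega> - X a \<omega>) ^ 4) \<and> expectation (\<lambda>\<omega>. (X b \<omega> - X a \<omega>)\<^sup>2) = expectation (int_vol a b)
    \<and> expectation (\<lambda>\<omega>. (X b \<omega> - X a \<omega>) ^ 4) = 3 * expectation (\<lambda>\<omega>. (int_vol a b \<omega>)\<^sup>2)"
    if ab: "0 \<le> a" "a \<le> b" "b \<le> T" for a b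
  proof -
    \<comment> \<open>A single return is the case of weight 0 on a second interval that is
      degenerate at \<open>b\<close>.\<close>
    note r = return_moments[OF X ab(1,2) order_refl order_refl ab(3), of 0]
    have ae: "AE \<omega> in M. weighted_vol a b b b 0 \<omega> = int_vol a b \<omega>"
      using weighted_vol_eq[of b b a b 0] by simp
    have "expectation (weighted_vol a b b b 0) = expectation (int_vol a b)"
      using ae by (intro integral_cong_AE) (auto intro!: wm)
    moreover have "expectation (\<lambda>\<omega>. (weighted_vol a b b b 0 \<omega>)\<^sup>2) = expectation (\<lambda>\<omega>. (int_vol a b \<omega>)\<^sup>2)"
      using ae by (intro integral_cong_AE borel_measurable_power wm int_vol_L2(1)) (auto elim: eventually_mono)
    ultimately show ?thesis using r by simp
  qed
  show "integrable M (\<lambda>\<omega>. (X b \<omega> - X a \<omega>) ^ 4)" "expectation (\<lambda>\<omega>. (X b \<omega> - X a \<omega>)\<^sup>2) = expectation (int_vol a b)"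
    "expectation (\<lambda>\<omega>. (X b \<omega> - X a \<omega>) ^ 4) = 3 * expectation (\<lambda>\<omega>. (int_vol a b \<omega>)\<^sup>2)"
    if "0 \<le> a" "a \<le> b" "b \<le> T" using single[OF that] by blast+
  show "X b \<in> borel_measurable M \<and> X a \<in> borel_measurable M" if "0 \<le> a" "a \<le> b" "b \<le> T"
    using meas that by auto
  assume ab: "0 \<le> a" "a \<le> b" "b \<le> a'" "a' \<le> b'" "b' \<le> T"
  define Y Y' where "Y \<omega> = X b \<omega> - X a \<omega>" and "Y' \<omega> = X b' \<omega> - X a' \<omega>" for \<omega>
  define I J where "I = int_vol a b" and "J = int_vol a' b'"
  have [measurable]: "Y \<in> borel_measurable M" "Y' \<in> borel_measurable M"
    unfolding Y_def[abs_def] Y'_def[abs_def] using ab by (auto intro!: borel_measurable_diff meas)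
  have [measurable]: "I \<in> borel_measurable M" "J \<in> borel_measurable M"
    and IJ2: "integrable M (\<lambda>\<omega>. (I \<omega>)\<^sup>2)" "integrable M (\<lambda>\<omega>. (J \<omega>)\<^sup>2)"
    unfolding I_def J_def by (rule int_vol_L2)+
  have IJ: "integrable M (\<lambda>\<omega>. I \<omega> * J \<omega>)" by (intro integrable_mult_L2 IJ2) measurable
  have Y4: "integrable M (\<lambda>\<omega>. Y \<omega> ^ 4)" "expectation (\<lambda>\<omega>. Y \<omega> ^ 4) = 3 * expectation (\<lambda>\<omega>. (I \<omega>)\<^sup>2)"
    and Y4': "integrable M (\<lambda>\<omega>. Y' \<omega> ^ 4)" "expectation (\<lambda>\<omega>. Y' \<omega> ^ 4) = 3 * expectation (\<lambda>\<omega>. (J \<omega>)\<^sup>2)"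
    using single[of a b] single[of a' b'] ab unfolding Y_def Y'_def I_def J_def by auto
  have pm: "integrable M (\<lambda>\<omega>. (Y \<omega> + \<epsilon> * Y' \<omega>) ^ 4) \<and>
    expectation (\<lambda>\<omega>. (Y \<omega> + \<epsilon> * Y' \<omega>) ^ 4) = 3 * (expectation (\<lambda>\<omega>. (I \<omega>)\<^sup>2) + 2 * expectation (\<lambda>\<omega>. I \<omega> * J \<omega>) + expectation (\<lambda>\<omega>. (J \<omega>)\<^sup>2))"
    if \<epsilon>: "\<epsilon>\<^sup>2 = 1" for \<epsilon>
  proof -
    have \<epsilon>1: "\<bar>\<epsilon>\<bar> \<le> 1" using \<epsilon> by (simp add: abs_square_le_1[symmetric])
    note r = return_moments[OF X ab \<epsilon>1]
    have "expectation (\<lambda>\<omega>. (weighted_vol a b a' b' \<epsilon> \<omega>)\<^sup>2) = expectation (\<lambda>\<omega>. (I \<omega> + J \<omega>)\<^sup>2)"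
      using weighted_vol_eq[OF ab(3), of a b' \<epsilon>] wm[OF ab(3) \<epsilon>1] \<epsilon>
      by (intro integral_cong_AE) (auto elim: eventually_mono simp: I_def[symmetric] J_def[symmetric])
    also have "\<dots> = expectation (\<lambda>\<omega>. (I \<omega>)\<^sup>2 + 2 * (I \<omega> * J \<omega>) + (J \<omega>)\<^sup>2)"
      by (intro Bochner_Integration.integral_cong) (auto simp: power2_sum)
    also have "\<dots> = expectation (\<lambda>\<omega>. (I \<omega>)\<^sup>2) + 2 * expectation (\<lambda>\<omega>. I \<omega> * J \<omega>) + expectation (\<lambda>\<omega>. (J \<omega>)\<^sup>2)"
      using IJ IJ2 by simp
    finally show ?thesis using r by (simp add: Y_def Y'_def)
  qed
  have YY: "integrable M (\<lambda>\<omega>. (Y \<omega>)\<^sup>2 * (Y' \<omega>)\<^sup>2)"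
    by (rule integrable_mult_L2) (use Y4 Y4' in simp_all)
  have eq: "(Y \<omega> + 1 * Y' \<omega>) ^ 4 + (Y \<omega> + (-1) * Y' \<omega>) ^ 4 = 2 * Y \<omega> ^ 4 + 12 * ((Y \<omega>)\<^sup>2 * (Y' \<omega>)\<^sup>2) + 2 * Y' \<omega> ^ 4" for \<omega>
    by (simp add: power2_eq_square power4_eq_xxxx algebra_simps)
  have "expectation (\<lambda>\<omega>. (Y \<omega> + 1 * Y' \<omega>) ^ 4) + expectation (\<lambda>\<omega>. (Y \<omega> + (-1) * Y' \<omega>) ^ 4)
    = expectation (\<lambda>\<omega>. (Y \<omega> + 1 * Y' \<omega>) ^ 4 + (Y \<omega> + (-1) * Y' \<omega>) ^ 4)"
    using pm[of 1] pm[of "-1"] by simp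
  also have "\<dots> = 2 * expectation (\<lambda>\<omega>. Y \<omega> ^ 4) + 12 * expectation (\<lambda>\<omega>. (Y \<omega>)\<^sup>2 * (Y' \<omega>)\<^sup>2) + 2 * expectation (\<lambda>\<omega>. Y' \<omega> ^ 4)"
    unfolding eq using Y4 Y4' YY by simp
  finally have "expectation (\<lambda>\<omega>. (Y \<omega>)\<^sup>2 * (Y' \<omega>)\<^sup>2) = expectation (\<lambda>\<omega>. I \<omega> * J \<omega>)"
    using pm[of 1] pm[of "-1"] Y4 Y4' by simp
  then show "expectation (\<lambda>\<omega>. (X b \<omega> - X a \<omega>)\<^sup>2 * (X b' \<omega> - X a' \<omega>)\<^sup>2) = expectation (\<lambda>\<omega>. int_vol a b \<omega> * int_vol a' b' \<omega>)"
    by (simp add: Y_def Y'_def I_def J_def)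
qed

lemma expectation_vol:
  assumes "0 \<le> u" "u \<le> T" shows "expectation (vol u) = expectation (S u)"
  using AE_vol[OF assms] S_meas[of u] by (intro integral_cong_AE) auto

lemma expectation_vol_mult:
  assumes "0 \<le> u" "u \<le> T" "0 \<le> w" "w \<le> T"
  shows "expectation (\<lambda>\<omega>. vol u \<omega> * vol w \<omega>) = expectation (\<lambda>\<omega>. S u \<omega> * S w \<omega>)"
proof (rule integral_cong_AE)
  show "AE \<omega> in M. vol u \<omega> * vol w \<omega> = S u \<omega> * S w \<omega>"
    using AE_vol[OF assms(1,2)] AE_vol[OF assms(3,4)] by eventually_elim simp
qed (use S_meas in auto)

end

section \<open>Second order structure of L\'evy bases and supOU processes\<close>

text \<open>The axioms speak of sequences of disjoint sets. The two given sets are continued by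
  empty ones, whose values vanish almost surely by assumption, so that the series has two
  terms.\<close>

lemma levy_basis_disjoint:
  assumes L: "levy_basis M \<Lambda>" and C: "C \<in> bounded_borel" "D \<in> bounded_borel" "C \<inter> D = {}"
    and int: "integrable M (\<Lambda> C)" "integrable M (\<Lambda> D)"
    and null: "AE \<omega> in M. \<Lambda> {} \<omega> = 0"
  shows "(\<integral>\<omega>. \<Lambda> C \<omega> * \<Lambda> D \<omega> \<partial>M) = (\<integral>\<omega>. \<Lambda> C \<omega> \<partial>M) * (\<integral>\<omega>. \<Lambda> D \<omega> \<partial>M)"
    "AE \<omega> in M. \<Lambda> (C \<union> D) \<omega> = \<Lambda> C \<omega> + \<Lambda> D \<omega>"
proof -
  interpret prob_space M using L by (simp add: levy_basis_def)
  define E :: "nat \<Rightarrow> (real \<times> real) set" where "E n = (if n = 0 then C else if n = 1 then D else {})" for n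
  have "{} \<in> bounded_borel" by (simp add: bounded_borel_def)
  then have E: "range E \<subseteq> bounded_borel" "disjoint_family E" "(\<Union>n. E n) = C \<union> D"
    using C by (auto simp: E_def disjoint_family_on_def split: if_splits)
  have "bounded (C \<union> D)" using C by (auto simp: bounded_borel_def)
  then have s: "AE \<omega> in M. (\<lambda>n. \<Lambda> (E n) \<omega>) sums \<Lambda> (C \<union> D) \<omega>" and i: "indep_vars (\<lambda>_. borel) (\<lambda>n. \<Lambda> (E n)) UNIV"
    using L E(1,2) unfolding levy_basis_def E(3)[symmetric] by blast+
  have "indep_vars (\<lambda>_. borel) (\<lambda>n. \<Lambda> (E n)) {0, 1}" by (rule indep_vars_subset[OF i]) auto
  then have "(\<integral>\<omega>. (\<Prod>n\<in>{0, 1}. \<Lambda> (E n) \<omega>) \<partial>M) = (\<Prod>n\<in>{0, 1}. \<integral>\<omega>. \<Lambda> (E n) \<omega> \<partial>M)"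
    by (rule indep_vars_lebesgue_integral[rotated]) (use int in \<open>auto simp: E_def\<close>)
  then show "(\<integral>\<omega>. \<Lambda> C \<omega> * \<Lambda> D \<omega> \<partial>M) = (\<integral>\<omega>. \<Lambda> C \<omega> \<partial>M) * (\<integral>\<omega>. \<Lambda> D \<omega> \<partial>M)"
    by (simp add: E_def)
  show "AE \<omega> in M. \<Lambda> (C \<union> D) \<omega> = \<Lambda> C \<omega> + \<Lambda> D \<omega>"
    using s null
  proof eventually_elim
    case (elim \<omega>)
    have "(\<lambda>n. \<Lambda> (E n) \<omega>) sums (\<Sum>n\<in>{0, 1}. \<Lambda> (E n) \<omega>)"
      by (rule sums_finite) (use elim in \<open>auto simp: E_def\<close>)
    then show ?case using elim sums_unique2 by (fastforce simp: E_def)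
  qed
qed

lemma (in subordinator_triplet) levy_basis_moments:
  assumes L: "levy_basis M \<Lambda>" and Q: "generating_quadruple M \<Lambda> \<gamma> 0 \<nu> \<pi>" and C: "C \<in> bounded_borel"
  shows "\<Lambda> C \<in> borel_measurable M" "integrable M (\<lambda>\<omega>. (\<Lambda> C \<omega>)\<^sup>2)"
    "(\<integral>\<omega>. \<Lambda> C \<omega> \<partial>M) = mean * measure (\<pi> \<Otimes>\<^sub>M lborel) C"
    "(\<integral>\<omega>. (\<Lambda> C \<omega>)\<^sup>2 \<partial>M) = var * measure (\<pi> \<Otimes>\<^sub>M lborel) C + (mean * measure (\<pi> \<Otimes>\<^sub>M lborel) C)\<^sup>2"
    "0 \<le> drift \<Longrightarrow> AE \<omega> in M. 0 \<le> \<Lambda> C \<omega>"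
proof -
  interpret prob_space M using L by (simp add: levy_basis_def)
  show m [measurable]: "\<Lambda> C \<in> borel_measurable M" using L C by (simp add: levy_basis_def)
  have R: "real_distribution (distr M borel (\<Lambda> C))" by (rule real_distribution_distr) simp
  have ch: "char (distr M borel (\<Lambda> C)) u = exp (levy_exponent \<gamma> 0 \<nu> u * measure (\<pi> \<Otimes>\<^sub>M lborel) C)" for u
    using Q C by (simp add: generating_quadruple_def)
  note mo = moments_infdiv[OF R ch]
  show "integrable M (\<lambda>\<omega>. (\<Lambda> C \<omega>)\<^sup>2)" using mo(1) by (subst (asm) integrable_distr_eq) auto
  show "(\<integral>\<omega>. (\<Lambda> C \<omega>)\<^sup>2 \<partial>M) = var * measure (\<pi> \<Otimes>\<^sub>M lborel) C + (mean * measure (\<pi> \<Otimes>\<^sub>M lborel) C)\<^sup>2"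
    using mo(2) by (subst (asm) integral_distr) auto
  show "(\<integral>\<omega>. \<Lambda> C \<omega> \<partial>M) = mean * measure (\<pi> \<Otimes>\<^sub>M lborel) C"
    using mo(3) by (subst (asm) integral_distr) auto
  assume "0 \<le> drift"
  then have "AE x in distr M borel (\<Lambda> C). 0 \<le> x" by (intro infdiv_nonneg[OF R ch]) auto
  then show "AE \<omega> in M. 0 \<le> \<Lambda> C \<omega>" by (subst (asm) AE_distr_iff) auto
qed

lemma (in subordinator_triplet) levy_basis_L2:
  assumes L: "levy_basis M \<Lambda>" and Q: "generating_quadruple M \<Lambda> \<gamma> 0 \<nu> \<pi>"
  shows "levy_L2 M \<Lambda> (\<pi> \<Otimes>\<^sub>M lborel) mean var"
proof -
  interpret prob_space M using L by (simp add: levy_basis_def)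
  interpret \<pi>: prob_space \<pi> using Q by (simp add: generating_quadruple_def)
  have sets: "sets \<pi> = sets borel" and ae: "AE A in \<pi>. A < 0" using Q by (simp_all add: generating_quadruple_def)
  note mo = levy_basis_moments[OF L Q]
  have E: "{} \<in> bounded_borel" by (simp add: bounded_borel_def)
  \<comment> \<open>The empty set has measure 0, so the second moment formula makes its value vanish
    almost surely.\<close>
  have null: "AE \<omega> in M. \<Lambda> {} \<omega> = 0"
  proof -
    have "(\<integral>\<omega>. (\<Lambda> {} \<omega>)\<^sup>2 \<partial>M) = 0" using mo(4)[OF E] by simp
    then have "AE \<omega> in M. (\<Lambda> {} \<omega>)\<^sup>2 = 0" using integral_nonneg_eq_0_iff_AE[OF mo(2)[OF E]] by simp
    then show ?thesis by simp
  qed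
  have int: "integrable M (\<Lambda> C)" if "C \<in> bounded_borel" for C
    by (rule square_integrable_imp_integrable) (use mo[OF that] in auto)
  show ?thesis
  proof (unfold_locales)
    show "sets (\<pi> \<Otimes>\<^sub>M lborel) = sets (borel :: (real \<times> real) measure)"
      by (simp add: borel_prod[symmetric] sets cong: sets_pair_measure_cong)
    show "AE z in \<pi> \<Otimes>\<^sub>M lborel. z \<in> neg_half" by (rule AE_pair_neg_half[OF sets ae])
    show "0 \<le> var" by (rule var_nonneg)
    fix C assume C: "C \<in> bounded_borel"
    show "emeasure (\<pi> \<Otimes>\<^sub>M lborel) C < \<infinity>"
    proof -
      obtain r where r: "\<And>z. z \<in> C \<Longrightarrow> norm z \<le> r" using C by (auto simp: bounded_borel_def bounded_iff)
      have "C \<subseteq> UNIV \<times> {- r..r}"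
      proof
        fix z assume "z \<in> C"
        then have "\<bar>snd z\<bar> \<le> r" using r[of z] norm_snd_le[of "snd z" "fst z"] by simp
        then show "z \<in> UNIV \<times> {- r..r}" by (cases z) auto
      qed
      then have "emeasure (\<pi> \<Otimes>\<^sub>M lborel) C \<le> emeasure (\<pi> \<Otimes>\<^sub>M lborel) (UNIV \<times> {- r..r})"
        by (rule emeasure_mono) (auto simp: sets)
      also have "\<dots> = emeasure \<pi> UNIV * emeasure lborel {- r..r}"
        by (rule lborel.emeasure_pair_measure_Times) (auto simp: sets)
      also have "\<dots> < \<infinity>"
        using \<pi>.emeasure_finite[of UNIV] by (simp add: ennreal_mult_eq_top_iff less_top[symmetric] emeasure_lborel_Icc_eq)
      finally show ?thesis .
    qed
    show "\<Lambda> C \<in> borel_measurable M" "integrable M (\<lambda>\<omega>. (\<Lambda> C \<omega>)\<^sup>2)"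
      "expectation (\<Lambda> C) = mean * measure (\<pi> \<Otimes>\<^sub>M lborel) C"
      "expectation (\<lambda>\<omega>. (\<Lambda> C \<omega>)\<^sup>2) = var * measure (\<pi> \<Otimes>\<^sub>M lborel) C + (mean * measure (\<pi> \<Otimes>\<^sub>M lborel) C)\<^sup>2"
      using mo(1-4)[OF C] by auto
    fix D assume D: "D \<in> bounded_borel" "C \<inter> D = {}"
    show "expectation (\<lambda>\<omega>. \<Lambda> C \<omega> * \<Lambda> D \<omega>) = expectation (\<Lambda> C) * expectation (\<Lambda> D)"
      "AE \<omega> in M. \<Lambda> (C \<union> D) \<omega> = \<Lambda> C \<omega> + \<Lambda> D \<omega>"
      using levy_basis_disjoint[OF L C D int[OF C] int[OF D(1)] null] by auto
  qed
qed

section \<open>Integrated autocovariances\<close>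

text \<open>The integrand \<open>g\<close> has to agree with \<open>f\<close> only on
  \<open>{a<..b}\<close>. This allows \<open>g\<close> to be an iterated integral or to contain an
  absolute value that is resolved on this interval alone.\<close>

lemma integral_uniform_time_FTC:
  assumes ab: "0 \<le> a" "a \<le> b" "b \<le> T"
    and F: "\<And>x. a \<le> x \<Longrightarrow> x \<le> b \<Longrightarrow> (F has_real_derivative f x) (at x)"
    and f: "\<And>x. a \<le> x \<Longrightarrow> x \<le> b \<Longrightarrow> isCont f x"
    and g: "\<And>x. a < x \<Longrightarrow> x \<le> b \<Longrightarrow> g x = f x"
  shows "(\<integral>u. indicator {a<..b} u * g u \<partial>uniform_time T) = F b - F a"
    "integrable (uniform_time T) (\<lambda>u. indicator {a<..b} u * g u)"
proof -
  have b: "has_bochner_integral lborel (\<lambda>x. f x * indicator {a..b} x) (F b - F a)"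
    by (rule has_bochner_integral_FTC_Icc_real) (use ab F f in auto)
  have "AE u in lborel. u \<noteq> a" by (rule AE_lborel_singleton)
  then have "AE u in lborel. f u * indicator {a..b} u = indicator {a<..b} u * g u"
    by eventually_elim (use g in \<open>auto split: split_indicator\<close>)
  moreover have m: "(\<lambda>u. indicator {a<..b} u * g u) \<in> borel_measurable lborel"
  proof -
    have "(\<lambda>u. f u * indicator {a..b} u) \<in> borel_measurable lborel" using b by (auto dest: borel_measurable_has_bochner_integral)
    then have "(\<lambda>u. indicator {a<..b} u * (f u * indicator {a..b} u)) \<in> borel_measurable lborel" by measurable
    moreover have "(\<lambda>u. indicator {a<..b} u * (f u * indicator {a..b} u)) = (\<lambda>u. indicator {a<..b} u * g u)"
      using g by (auto simp: fun_eq_iff split: split_indicator)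
    ultimately show ?thesis by simp
  qed
  ultimately have h: "has_bochner_integral lborel (\<lambda>u. indicator {a<..b} u * g u) (F b - F a)"
    using b by (subst has_bochner_integral_cong_AE[symmetric]) (auto dest: borel_measurable_has_bochner_integral)
  have e: "indicator {0..T} u *\<^sub>R (indicator {a<..b} u * g u) = indicator {a<..b} u * g u" for u
    using ab by (auto split: split_indicator)
  show "(\<integral>u. indicator {a<..b} u * g u \<partial>uniform_time T) = F b - F a"
    unfolding uniform_time_def
    by (subst integral_density) (use m in \<open>simp_all only: e has_bochner_integral_integral_eq[OF h], auto\<close>)
  show "integrable (uniform_time T) (\<lambda>u. indicator {a<..b} u * g u)"
    unfolding uniform_time_def
    by (subst integrable_density) (use m integrable.intros[OF h] in \<open>simp_all only: e, auto\<close>)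
qed

lemma acv_prim'_0: "acv_prim' a B 0 = 0"
  by (simp add: acv_prim'_def)

lemma acv_prim_0: "acv_prim a B 0 = 0"
  by (simp add: acv_prim_def)

context
  fixes a B c\<^sub>0 c\<^sub>1 T :: real
  assumes B: "B < 0"
begin

text \<open>The second mixed moment of the volatility at times \<open>u\<close> and
  \<open>w\<close>, with \<open>c\<^sub>0\<close> the squared mean and \<open>c\<^sub>1\<close> the
  variance.\<close>

abbreviation acv :: "real \<Rightarrow> real \<Rightarrow> real" where
  "acv u w \<equiv> c\<^sub>0 + c\<^sub>1 * (1 - B * \<bar>u - w\<bar>) powr (1 - a)"

lemma acv_below_1: "0 \<le> x \<Longrightarrow> B * x < 1"
  using B mult_nonpos_nonneg[of B x] by simp

lemma acv_prim'_isCont: "0 \<le> x \<Longrightarrow> isCont (acv_prim' a B) x"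
  using acv_prim'_deriv[of B x a] acv_below_1[of x] B by (intro DERIV_isCont) auto

lemma acv_inner_later:
  assumes u: "u \<le> l" and l: "0 \<le> l" "l \<le> r" "r \<le> T"
  shows "(\<integral>w. indicator {l<..r} w * acv u w \<partial>uniform_time T)
    = c\<^sub>0 * (r - l) + c\<^sub>1 * (acv_prim' a B (r - u) - acv_prim' a B (l - u))"
    "integrable (uniform_time T) (\<lambda>w. indicator {l<..r} w * acv u w)"
proof -
  have D: "((\<lambda>w. c\<^sub>0 * w + c\<^sub>1 * acv_prim' a B (w - u)) has_real_derivative c\<^sub>0 + c\<^sub>1 * (1 - B * (w - u)) powr (1 - a)) (at w)"
    if "l \<le> w" "w \<le> r" for w
  proof -
    have "(acv_prim' a B has_real_derivative (1 - B * (w - u)) powr (1 - a)) (at (w - u))"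
      by (rule acv_prim'_deriv) (use B u that acv_below_1[of "w - u"] in auto)
    then have "((\<lambda>w. acv_prim' a B (w - u)) has_real_derivative (1 - B * (w - u)) powr (1 - a) * (1 - 0)) (at w)"
      by (rule DERIV_chain2) (auto intro!: derivative_eq_intros)
    from DERIV_add[OF DERIV_cmult[OF DERIV_ident] DERIV_cmult[OF this], of c\<^sub>0 c\<^sub>1] show ?thesis by simp
  qed
  have cont: "isCont (\<lambda>w. c\<^sub>0 + c\<^sub>1 * (1 - B * (w - u)) powr (1 - a)) w" if "l \<le> w" "w \<le> r" for w
  proof -
    have "isCont (\<lambda>w. (1 - B * (w - u)) powr (1 - a)) w"
      using acv_below_1[of "w - u"] u that by (intro continuous_intros) auto
    then show ?thesis by (intro isCont_add isCont_mult continuous_const)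
  qed
  have "(\<integral>w. indicator {l<..r} w * acv u w \<partial>uniform_time T)
    = (c\<^sub>0 * r + c\<^sub>1 * acv_prim' a B (r - u)) - (c\<^sub>0 * l + c\<^sub>1 * acv_prim' a B (l - u))"
    by (rule integral_uniform_time_FTC(1)[OF l D cont]) (use u in auto)
  then show "(\<integral>w. indicator {l<..r} w * acv u w \<partial>uniform_time T)
    = c\<^sub>0 * (r - l) + c\<^sub>1 * (acv_prim' a B (r - u) - acv_prim' a B (l - u))" by (simp add: algebra_simps)
  show "integrable (uniform_time T) (\<lambda>w. indicator {l<..r} w * acv u w)"
    by (rule integral_uniform_time_FTC(2)[OF l D cont]) (use u in auto)
qed

lemma acv_inner_earlier:
  assumes u: "r \<le> u" and l: "0 \<le> l" "l \<le> r" "r \<le> T"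
  shows "(\<integral>w. indicator {l<..r} w * acv u w \<partial>uniform_time T)
    = c\<^sub>0 * (r - l) + c\<^sub>1 * (acv_prim' a B (u - l) - acv_prim' a B (u - r))"
    "integrable (uniform_time T) (\<lambda>w. indicator {l<..r} w * acv u w)"
proof -
  have D: "((\<lambda>w. c\<^sub>0 * w + (- c\<^sub>1) * acv_prim' a B (u - w)) has_real_derivative c\<^sub>0 + c\<^sub>1 * (1 - B * (u - w)) powr (1 - a)) (at w)"
    if "l \<le> w" "w \<le> r" for w
  proof -
    have "(acv_prim' a B has_real_derivative (1 - B * (u - w)) powr (1 - a)) (at (u - w))"
      by (rule acv_prim'_deriv) (use B u that acv_below_1[of "u - w"] in auto)
    then have "((\<lambda>w. acv_prim' a B (u - w)) has_real_derivative (1 - B * (u - w)) powr (1 - a) * (0 - 1)) (at w)"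
      by (rule DERIV_chain2) (auto intro!: derivative_eq_intros)
    from DERIV_add[OF DERIV_cmult[OF DERIV_ident] DERIV_cmult[OF this], of c\<^sub>0 "- c\<^sub>1"] show ?thesis by simp
  qed
  have cont: "isCont (\<lambda>w. c\<^sub>0 + c\<^sub>1 * (1 - B * (u - w)) powr (1 - a)) w" if "l \<le> w" "w \<le> r" for w
  proof -
    have "isCont (\<lambda>w. (1 - B * (u - w)) powr (1 - a)) w"
      using acv_below_1[of "u - w"] u that by (intro continuous_intros) auto
    then show ?thesis by (intro isCont_add isCont_mult continuous_const)
  qed
  have "(\<integral>w. indicator {l<..r} w * acv u w \<partial>uniform_time T)
    = (c\<^sub>0 * r + (- c\<^sub>1) * acv_prim' a B (u - r)) - (c\<^sub>0 * l + (- c\<^sub>1) * acv_prim' a B (u - l))"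
    by (rule integral_uniform_time_FTC(1)[OF l D cont]) (use u in auto)
  then show "(\<integral>w. indicator {l<..r} w * acv u w \<partial>uniform_time T)
    = c\<^sub>0 * (r - l) + c\<^sub>1 * (acv_prim' a B (u - l) - acv_prim' a B (u - r))" by (simp add: algebra_simps)
  show "integrable (uniform_time T) (\<lambda>w. indicator {l<..r} w * acv u w)"
    by (rule integral_uniform_time_FTC(2)[OF l D cont]) (use u in auto)
qed

lemma acv_inner_same:
  assumes u: "0 \<le> u" "u \<le> d" "d \<le> T"
  shows "(\<integral>w. indicator {0<..d} w * acv u w \<partial>uniform_time T)
    = c\<^sub>0 * d + c\<^sub>1 * (acv_prim' a B u + acv_prim' a B (d - u))"
proof -
  note e = acv_inner_earlier[of u u 0] and l = acv_inner_later[of u u d]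
  have "(\<integral>w. indicator {0<..d} w * acv u w \<partial>uniform_time T) = (\<integral>w. indicator {0<..u} w * acv u w + indicator {u<..d} w * acv u w \<partial>uniform_time T)"
    using u by (intro Bochner_Integration.integral_cong) (auto split: split_indicator)
  also have "\<dots> = (\<integral>w. indicator {0<..u} w * acv u w \<partial>uniform_time T) + (\<integral>w. indicator {u<..d} w * acv u w \<partial>uniform_time T)"
    using e(2) l(2) u by (intro Bochner_Integration.integral_add) auto
  also have "\<dots> = c\<^sub>0 * d + c\<^sub>1 * (acv_prim' a B u + acv_prim' a B (d - u))"
    using e(1) l(1) u by (simp add: acv_prim'_0 algebra_simps)
  finally show ?thesis .
qed

text \<open>Splitting the inner interval at \<open>u\<close> resolves the absolute value. The two
  halves contribute equally to the outer integral, hence the factor 2.\<close>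

lemma acv_double_same:
  assumes d: "0 \<le> d" "d \<le> T"
  shows "(\<integral>u. indicator {0<..d} u * (\<integral>w. indicator {0<..d} w * acv u w \<partial>uniform_time T) \<partial>uniform_time T)
    = c\<^sub>0 * d\<^sup>2 + 2 * c\<^sub>1 * acv_prim a B d"
proof -
  have D: "((\<lambda>u. c\<^sub>0 * d * u + c\<^sub>1 * (acv_prim a B u - acv_prim a B (d - u))) has_real_derivative
      c\<^sub>0 * d + c\<^sub>1 * (acv_prim' a B u + acv_prim' a B (d - u))) (at u)" if "0 \<le> u" "u \<le> d" for u
  proof -
    have 1: "(acv_prim a B has_real_derivative acv_prim' a B u) (at u)"
      by (rule acv_prim_deriv) (use B that acv_below_1[of u] in auto)
    have "(acv_prim a B has_real_derivative acv_prim' a B (d - u)) (at (d - u))"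
      by (rule acv_prim_deriv) (use B that acv_below_1[of "d - u"] in auto)
    then have 2: "((\<lambda>u. acv_prim a B (d - u)) has_real_derivative acv_prim' a B (d - u) * (0 - 1)) (at u)"
      by (rule DERIV_chain2) (auto intro!: derivative_eq_intros)
    from DERIV_add[OF DERIV_cmult[OF DERIV_ident] DERIV_cmult[OF DERIV_diff[OF 1 2]], of "c\<^sub>0 * d" c\<^sub>1] show ?thesis by simp
  qed
  have cont: "isCont (\<lambda>u. c\<^sub>0 * d + c\<^sub>1 * (acv_prim' a B u + acv_prim' a B (d - u))) u" if "0 \<le> u" "u \<le> d" for u
  proof -
    have "isCont (\<lambda>u. acv_prim' a B (d - u)) u"
      by (rule isCont_o2[where g = "acv_prim' a B"]) (use that in \<open>auto intro!: acv_prim'_isCont\<close>)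
    then show ?thesis using acv_prim'_isCont[of u] that by (intro continuous_intros) auto
  qed
  have "(\<integral>u. indicator {0<..d} u * (\<integral>w. indicator {0<..d} w * acv u w \<partial>uniform_time T) \<partial>uniform_time T)
    = (c\<^sub>0 * d * d + c\<^sub>1 * (acv_prim a B d - acv_prim a B (d - d))) - (c\<^sub>0 * d * 0 + c\<^sub>1 * (acv_prim a B 0 - acv_prim a B (d - 0)))"
    by (rule integral_uniform_time_FTC(1)[OF order_refl d D cont]) (use acv_inner_same d in auto)
  then show ?thesis by (simp add: acv_prim_0 power2_eq_square algebra_simps)
qed

text \<open>As \<open>d \<le> l\<close>, the second interval lies entirely after the first and
  \<open>\<bar>u - w\<bar>\<close> has one sign. Integrating twice leaves a second difference with
  step \<open>d\<close>.\<close>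

lemma acv_double_later:
  assumes d: "0 \<le> d" "d \<le> l" "l + d \<le> T"
  shows "(\<integral>u. indicator {0<..d} u * (\<integral>w. indicator {l<..l + d} w * acv u w \<partial>uniform_time T) \<partial>uniform_time T)
    = c\<^sub>0 * d\<^sup>2 + c\<^sub>1 * (acv_prim a B (l + d) - 2 * acv_prim a B l + acv_prim a B (l - d))"
proof -
  have D1: "((\<lambda>u. acv_prim a B (r - u)) has_real_derivative acv_prim' a B (r - u) * (0 - 1)) (at u)" if "u \<le> r" for u r
  proof -
    have "(acv_prim a B has_real_derivative acv_prim' a B (r - u)) (at (r - u))"
      by (rule acv_prim_deriv) (use B that acv_below_1[of "r - u"] in auto)
    then show ?thesis by (rule DERIV_chain2) (auto intro!: derivative_eq_intros)
  qed
  have D: "((\<lambda>u. c\<^sub>0 * d * u + c\<^sub>1 * (acv_prim a B (l - u) - acv_prim a B (l + d - u))) has_real_derivative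
      c\<^sub>0 * d + c\<^sub>1 * (acv_prim' a B (l + d - u) - acv_prim' a B (l - u))) (at u)" if "0 \<le> u" "u \<le> d" for u
    using DERIV_add[OF DERIV_cmult[OF DERIV_ident] DERIV_cmult[OF DERIV_diff[OF D1 D1]], of u l "l + d" "c\<^sub>0 * d" c\<^sub>1] that d
    by (simp add: algebra_simps)
  have c1: "isCont (\<lambda>u. acv_prim' a B (r - u)) u" if "u \<le> r" for r u
    by (rule isCont_o2[where g = "acv_prim' a B"]) (use that in \<open>auto intro!: acv_prim'_isCont\<close>)
  have cont: "isCont (\<lambda>u. c\<^sub>0 * d + c\<^sub>1 * (acv_prim' a B (l + d - u) - acv_prim' a B (l - u))) u" if "0 \<le> u" "u \<le> d" for u
    using c1[of u "l + d"] c1[of u l] that d by (intro continuous_intros) auto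
  have dT: "d \<le> T" using d by simp
  have "(\<integral>u. indicator {0<..d} u * (\<integral>w. indicator {l<..l + d} w * acv u w \<partial>uniform_time T) \<partial>uniform_time T)
    = (c\<^sub>0 * d * d + c\<^sub>1 * (acv_prim a B (l - d) - acv_prim a B (l + d - d))) - (c\<^sub>0 * d * 0 + c\<^sub>1 * (acv_prim a B (l - 0) - acv_prim a B (l + d - 0)))"
    by (rule integral_uniform_time_FTC(1)[OF order_refl d(1) dT D cont]) (use acv_inner_later(1)[of _ l "l + d"] d in auto)
  then show ?thesis by (simp add: power2_eq_square algebra_simps)
qed

end

section \<open>Moments of the log-returns\<close>

lemma mult_indicator_cong:
  "(x \<in> A \<Longrightarrow> f = g) \<Longrightarrow> indicator A x * f = indicator A x * (g :: real)"
  by (simp split: split_indicator)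

locale supOU_SV = gamma_mean_reversion \<pi> \<alpha> B for \<pi> :: "real measure" and \<alpha> B :: real +
  fixes M :: "'w measure" and F :: "real \<Rightarrow> 'w measure" and \<Lambda> :: "(real \<times> real) set \<Rightarrow> 'w \<Rightarrow> real"
    and \<gamma> :: real and \<nu> :: "real measure" and \<Sigma> W X :: "real \<Rightarrow> 'w \<Rightarrow> real"
  assumes model: "supOU_SV_model M F \<Lambda> \<gamma> \<nu> \<pi> \<Sigma> W X"
    and second_moments: "set_integrable \<nu> {1<..} (\<lambda>x. x^2)"
begin

lemma levy_basis: "levy_basis M \<Lambda>" and quadruple: "generating_quadruple M \<Lambda> \<gamma> 0 \<nu> \<pi>"
  using model by (simp_all add: supOU_SV_model_def)

sublocale subordinator_triplet \<gamma> \<nu>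
  using model second_moments by unfold_locales (simp_all add: supOU_SV_model_def generating_quadruple_def)

sublocale brownian M F W
proof -
  interpret prob_space M using levy_basis by (simp add: levy_basis_def)
  show "brownian M F W" using model by unfold_locales (simp add: supOU_SV_model_def)
qed

sublocale levy_L2 M \<Lambda> "\<pi> \<Otimes>\<^sub>M lborel" mean var
  by (rule levy_basis_L2[OF levy_basis quadruple])

lemma vol_integral: "has_levy_integral M \<Lambda> \<pi> (supOU_kernel t) (\<Sigma> t)"
  using model by (simp add: supOU_SV_model_def supOU_process_def supOU_kernel_def)

definition vol_mean :: real where "vol_mean = mean / (- B * (\<alpha> - 1))"

definition vol_var :: real where "vol_var = var / (- 2 * B * (\<alpha> - 1))"

lemma vol_var_nonneg: "0 \<le> vol_var"
proof -
  have "0 \<le> 2 * (- B * (\<alpha> - 1))" using B alpha by (intro mult_nonneg_nonneg) auto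
  then show ?thesis unfolding vol_var_def using var_nonneg by (intro divide_nonneg_nonneg) auto
qed

lemma vol_moments:
  "\<Sigma> t \<in> borel_measurable M" "integrable M (\<lambda>\<omega>. (\<Sigma> t \<omega>)\<^sup>2)" "expectation (\<Sigma> t) = vol_mean"
  "expectation (\<lambda>\<omega>. \<Sigma> s \<omega> * \<Sigma> t \<omega>) = vol_mean\<^sup>2 + vol_var * (1 - B * \<bar>s - t\<bar>) powr (1 - \<alpha>)"
proof -
  note k = kernel_integral[THEN has_bochner_integral_integral_eq] and ki = integrable.intros[OF kernel_integral]
  note m = levy_integral_moments[OF refl vol_integral supOU_kernel_measurable supOU_kernel_bounds ki
      vol_integral supOU_kernel_measurable supOU_kernel_bounds ki]
  show "\<Sigma> t \<in> borel_measurable M" "integrable M (\<lambda>\<omega>. (\<Sigma> t \<omega>)\<^sup>2)" by (rule m)+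
  show "expectation (\<Sigma> t) = vol_mean" using m(3)[of t] by (simp add: k vol_mean_def)
  show "expectation (\<lambda>\<omega>. \<Sigma> s \<omega> * \<Sigma> t \<omega>) = vol_mean\<^sup>2 + vol_var * (1 - B * \<bar>s - t\<bar>) powr (1 - \<alpha>)"
    unfolding m(4)[of s t] k has_bochner_integral_integral_eq[OF kernel_product_integral]
    by (simp add: vol_mean_def vol_var_def abs_minus_commute power2_eq_square)
qed

lemma vol_second_moment: "expectation (\<lambda>\<omega>. (\<Sigma> t \<omega>)\<^sup>2) = vol_mean\<^sup>2 + vol_var"
  using vol_moments(4)[of t t] by (simp add: power2_eq_square)

lemma vol_increment:
  "expectation (\<lambda>\<omega>. (\<Sigma> s \<omega> - \<Sigma> t \<omega>)\<^sup>2) = 2 * vol_var * (1 - (1 - B * \<bar>s - t\<bar>) powr (1 - \<alpha>))"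
proof -
  have "integrable M (\<lambda>\<omega>. \<Sigma> s \<omega> * \<Sigma> t \<omega>)" by (rule integrable_mult_L2) (use vol_moments in auto)
  then have "expectation (\<lambda>\<omega>. (\<Sigma> s \<omega>)\<^sup>2 + (\<Sigma> t \<omega>)\<^sup>2 - 2 * (\<Sigma> s \<omega> * \<Sigma> t \<omega>))
    = expectation (\<lambda>\<omega>. (\<Sigma> s \<omega>)\<^sup>2) + expectation (\<lambda>\<omega>. (\<Sigma> t \<omega>)\<^sup>2) - 2 * expectation (\<lambda>\<omega>. \<Sigma> s \<omega> * \<Sigma> t \<omega>)"
    using vol_moments(2) by simp
  then show ?thesis unfolding vol_second_moment vol_moments(4) by (simp add: power2_diff algebra_simps)
qed

lemma levy_process_moments:
  assumes L: "has_levy_integral M \<Lambda> \<pi> (indicator ({..<0} \<times> {0<..1})) Z"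
  shows "expectation Z = mean" "variance Z = var"
proof -
  let ?f = "indicator ({..<0} \<times> {0<..1}) :: real \<times> real \<Rightarrow> real"
  have "prob_space \<pi>" using quadruple by (simp add: generating_quadruple_def)
  note i = unit_strip_integral[OF this]
  have f: "?f \<in> borel_measurable borel" "\<forall>z\<in>neg_half. 0 \<le> ?f z \<and> ?f z \<le> 1"
    by (auto intro!: borel_measurable_indicator borel_Times split: split_indicator)
  have ff: "?f z * ?f z = ?f z" for z by (simp split: split_indicator)
  note m = levy_integral_moments[OF refl L f integrable.intros[OF i] L f integrable.intros[OF i],
      unfolded has_bochner_integral_integral_eq[OF i] ff]
  show E: "expectation Z = mean" using m(3) by simp
  have "integrable M Z" by (rule square_integrable_imp_integrable) (use m in auto)
  then show "variance Z = var" using m(2,4) by (subst variance_eq) (auto simp: E power2_eq_square)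
qed

text \<open>The algebra generated by the basis serves as \<open>G\<close>. The modulus \<rho> is the
  mean square increment of the volatility; it is a function of the time distance alone, increasing
  because \<open>1 - \<alpha>\<close> is negative, and continuous at 0.\<close>

lemma volatility:
  assumes "0 < T"
  shows "\<exists>S' \<rho>. volatility M F W (sigma (space M) (generated_events M \<Lambda> bounded_borel)) \<Sigma> S' T (vol_mean\<^sup>2 + vol_var) \<rho>"
proof -
  let ?G = "sigma (space M) (generated_events M \<Lambda> bounded_borel)"
  have sets_G: "sets ?G = generated_events M \<Lambda> bounded_borel" by (rule sets_sigma_generated_events[OF generated_events_Pow])
  have "0 \<le> drift" using model by (simp add: supOU_SV_model_def drift_def)
  then have nn: "AE \<omega> in M. 0 \<le> \<Lambda> C \<omega>" if "C \<in> bounded_borel" for C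
    by (rule levy_basis_moments(5)[OF levy_basis quadruple that])
  note v = levy_integral_nonneg_version[OF refl vol_integral supOU_kernel_measurable supOU_kernel_bounds
      integrable.intros[OF kernel_integral] nn]
  have "\<forall>t. \<exists>Z. Z \<in> borel_measurable ?G \<and> (AE \<omega> in M. \<Sigma> t \<omega> = Z \<omega>)" using v(2) by blast
  then obtain S' where S': "\<And>t. S' t \<in> borel_measurable ?G" "\<And>t. AE \<omega> in M. \<Sigma> t \<omega> = S' t \<omega>" by metis
  define \<rho> where "\<rho> = (\<lambda>\<delta>. 2 * vol_var * (1 - (1 - B * \<delta>) powr (1 - \<alpha>)))"
  have lim: "isCont \<rho> 0" unfolding \<rho>_def by (intro continuous_intros) auto
  have "(\<lambda>n. \<rho> (T / real (Suc n))) \<longlonglongrightarrow> \<rho> 0"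
    by (rule isCont_tendsto_compose[OF lim]) real_asymp
  then have \<rho>0: "(\<lambda>n. \<rho> (T / real (Suc n))) \<longlonglongrightarrow> 0" by (simp add: \<rho>_def)
  have "volatility M F W ?G \<Sigma> S' T (vol_mean\<^sup>2 + vol_var) \<rho>"
  proof unfold_locales
    show "subalgebra M ?G" unfolding subalgebra_def sets_G using generated_events_subset by (simp add: space_measure_of_conv)
    show "indep_set (sets ?G) (generated_events M W {0..})"
      unfolding sets_G using model by (simp add: supOU_SV_model_def)
    show "progressively_measurable F (\<lambda>u \<omega>. sqrt (\<Sigma> u \<omega>))"
      using model by (auto simp: supOU_SV_model_def has_ito_integral_def)
    show "expectation (\<lambda>\<omega>. (\<Sigma> u \<omega> - \<Sigma> w \<omega>)\<^sup>2) \<le> \<rho> \<delta>" if "\<bar>u - w\<bar> \<le> \<delta>" for u w \<delta>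
    proof -
      have "B * \<delta> \<le> B * \<bar>u - w\<bar>" "B * \<bar>u - w\<bar> \<le> 0"
        using that B by (auto intro: mult_left_mono_neg mult_nonpos_nonneg)
      then have "(1 - B * \<delta>) powr (1 - \<alpha>) \<le> (1 - B * \<bar>u - w\<bar>) powr (1 - \<alpha>)"
        using alpha by (intro powr_mono2') auto
      then show ?thesis unfolding vol_increment \<rho>_def using vol_var_nonneg by (intro mult_left_mono) auto
    qed
  qed (use assms v(1) S' vol_moments(1,2) vol_second_moment \<rho>0 in auto)
  then show ?thesis by blast
qed

lemma log_return_moments:
  assumes \<Delta>: "0 < \<Delta>"
  defines "Y \<equiv> log_returns X \<Delta>"
  shows "1 \<le> n \<Longrightarrow> Y n \<in> borel_measurable M" "1 \<le> n \<Longrightarrow> integrable M (\<lambda>\<omega>. (Y n \<omega>) ^ 4)"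
    "expectation (\<lambda>\<omega>. (Y 1 \<omega>)\<^sup>2) = \<Delta> * vol_mean"
    "expectation (\<lambda>\<omega>. (Y 1 \<omega>) ^ 4) = 3 * ((\<Delta> * vol_mean)\<^sup>2 + 2 * vol_var * acv_prim \<alpha> B \<Delta>)"
    "1 \<le> h \<Longrightarrow> expectation (\<lambda>\<omega>. (Y 1 \<omega>)\<^sup>2 * (Y (1 + h) \<omega>)\<^sup>2) = (\<Delta> * vol_mean)\<^sup>2 + vol_var * acv_diff \<Delta> \<alpha> B h"
proof -
  have X: "has_ito_integral M F W t (\<lambda>u \<omega>. sqrt (\<Sigma> u \<omega>)) (X t)" if "0 \<le> t" for t
    using model that by (simp add: supOU_SV_model_def)
  have Y: "Y (1 + h) = (\<lambda>\<omega>. X (real h * \<Delta> + \<Delta>) \<omega> - X (real h * \<Delta>) \<omega>)" for h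
    by (simp add: fun_eq_iff Y_def log_returns_def algebra_simps)
  \<comment> \<open>All claims for one \<open>h\<close> are proved together, because the horizon
    \<open>T\<close> and with it the interpretation of the locale depend on
    \<open>h\<close>.\<close>
  have *: "Y (1 + h) \<in> borel_measurable M \<and> integrable M (\<lambda>\<omega>. (Y (1 + h) \<omega>) ^ 4) \<and>
    expectation (\<lambda>\<omega>. (Y 1 \<omega>)\<^sup>2) = \<Delta> * vol_mean \<and>
    expectation (\<lambda>\<omega>. (Y 1 \<omega>) ^ 4) = 3 * ((\<Delta> * vol_mean)\<^sup>2 + 2 * vol_var * acv_prim \<alpha> B \<Delta>) \<and>
    (1 \<le> h \<longrightarrow> expectation (\<lambda>\<omega>. (Y 1 \<omega>)\<^sup>2 * (Y (1 + h) \<omega>)\<^sup>2) = (\<Delta> * vol_mean)\<^sup>2 + vol_var * acv_diff \<Delta> \<alpha> B h)" for h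
  proof -
    define T where "T = real h * \<Delta> + \<Delta>"
    have T: "0 < T" "\<Delta> \<le> T" "0 \<le> real h * \<Delta>" using \<Delta> by (simp_all add: T_def add_nonneg_pos)
    obtain S' \<rho> where "volatility M F W (sigma (space M) (generated_events M \<Lambda> bounded_borel)) \<Sigma> S' T (vol_mean\<^sup>2 + vol_var) \<rho>"
      using volatility[OF T(1)] by blast
    then interpret V: volatility M F W "sigma (space M) (generated_events M \<Lambda> bounded_borel)" \<Sigma> S' T "vol_mean\<^sup>2 + vol_var" \<rho> .
    note R = V.mixed_return_moments[of X, OF X]
    have m1: "expectation (V.int_vol a b) = (\<integral>u. indicator {a<..b} u * vol_mean \<partial>uniform_time T)" if "0 \<le> a" "b \<le> T" for a b
      unfolding V.expectation_int_vol
      by (rule Bochner_Integration.integral_cong) (use that in \<open>auto simp: V.expectation_vol vol_moments(3) split: split_indicator\<close>)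
    have "expectation (V.int_vol 0 \<Delta>) = vol_mean * \<Delta> - vol_mean * 0"
      using T \<Delta> unfolding m1[OF order_refl T(2)]
      by (intro integral_uniform_time_FTC(1)[where f = "\<lambda>_. vol_mean"]) (auto intro!: derivative_eq_intros)
    then have 1: "expectation (\<lambda>\<omega>. (Y 1 \<omega>)\<^sup>2) = \<Delta> * vol_mean"
      using R(3)[of 0 \<Delta>] \<Delta> T Y[of 0] by (simp add: mult.commute)
    have m2: "expectation (\<lambda>\<omega>. V.int_vol a b \<omega> * V.int_vol a' b' \<omega>)
        = (\<integral>u. indicator {a<..b} u * (\<integral>w. indicator {a'<..b'} w *
            (vol_mean\<^sup>2 + vol_var * (1 - B * \<bar>u - w\<bar>) powr (1 - \<alpha>)) \<partial>uniform_time T) \<partial>uniform_time T)"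
      if "0 \<le> a" "b \<le> T" "0 \<le> a'" "b' \<le> T" for a b a' b'
    proof -
      have "indicator {a<..b} u * (\<integral>w. indicator {a'<..b'} w * expectation (\<lambda>\<omega>. V.vol u \<omega> * V.vol w \<omega>) \<partial>uniform_time T)
        = indicator {a<..b} u * (\<integral>w. indicator {a'<..b'} w *
            (vol_mean\<^sup>2 + vol_var * (1 - B * \<bar>u - w\<bar>) powr (1 - \<alpha>)) \<partial>uniform_time T)" for u
      proof (cases "u \<in> {a<..b}")
        case True
        then show ?thesis using that
          by (intro arg_cong2[of _ _ _ _ "(*)"] refl Bochner_Integration.integral_cong mult_indicator_cong)
            (simp add: V.expectation_vol_mult vol_moments(4))
      qed simp
      then show ?thesis unfolding V.expectation_int_vol_mult by presburger
    qed
    have "expectation (\<lambda>\<omega>. (V.int_vol 0 \<Delta> \<omega>)\<^sup>2) = (\<Delta> * vol_mean)\<^sup>2 + 2 * vol_var * acv_prim \<alpha> B \<Delta>"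
      using m2[of 0 \<Delta> 0 \<Delta>] acv_double_same[OF B, of \<Delta> T "vol_mean\<^sup>2" vol_var \<alpha>] \<Delta> T
      by (simp add: power2_eq_square mult_ac)
    then have 2: "expectation (\<lambda>\<omega>. (Y 1 \<omega>) ^ 4) = 3 * ((\<Delta> * vol_mean)\<^sup>2 + 2 * vol_var * acv_prim \<alpha> B \<Delta>)"
      using R(4)[of 0 \<Delta>] \<Delta> T Y[of 0] by simp
    have 3: "expectation (\<lambda>\<omega>. (Y 1 \<omega>)\<^sup>2 * (Y (1 + h) \<omega>)\<^sup>2) = (\<Delta> * vol_mean)\<^sup>2 + vol_var * acv_diff \<Delta> \<alpha> B h" if h: "1 \<le> h"
    proof -
      have l: "\<Delta> \<le> real h * \<Delta>" using h \<Delta> by simp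
      have d: "real (h + 1) * \<Delta> = real h * \<Delta> + \<Delta>" "real (h - 1) * \<Delta> = real h * \<Delta> - \<Delta>" using h by (simp_all add: algebra_simps of_nat_diff)
      have "expectation (\<lambda>\<omega>. V.int_vol 0 \<Delta> \<omega> * V.int_vol (real h * \<Delta>) (real h * \<Delta> + \<Delta>) \<omega>)
        = vol_mean\<^sup>2 * \<Delta>\<^sup>2 + vol_var * acv_diff \<Delta> \<alpha> B h"
        using m2[of 0 \<Delta> "real h * \<Delta>" "real h * \<Delta> + \<Delta>"]
          acv_double_later[OF B, of \<Delta> "real h * \<Delta>" T "vol_mean\<^sup>2" vol_var \<alpha>] \<Delta> T l
        unfolding acv_diff_def d by (simp add: T_def)
      then show ?thesis
        using R(5)[of 0 \<Delta> "real h * \<Delta>" "real h * \<Delta> + \<Delta>"] \<Delta> T l Y[of 0] Y[of h] by (simp add: T_def power_mult_distrib mult.commute)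
    qed
    have "X T \<in> borel_measurable M" "X (real h * \<Delta>) \<in> borel_measurable M"
      using R(2)[of "real h * \<Delta>" T] T \<Delta> by (auto simp: T_def)
    moreover have "integrable M (\<lambda>\<omega>. (X T \<omega> - X (real h * \<Delta>) \<omega>) ^ 4)"
      using R(1)[of "real h * \<Delta>" T] T \<Delta> by (simp add: T_def)
    ultimately show ?thesis using 1 2 3 unfolding Y[of h] T_def[symmetric] by simp
  qed
  show "Y n \<in> borel_measurable M" "integrable M (\<lambda>\<omega>. (Y n \<omega>) ^ 4)" if "1 \<le> n" for n
    using *[of "n - 1"] that by simp_all
  show "expectation (\<lambda>\<omega>. (Y 1 \<omega>)\<^sup>2) = \<Delta> * vol_mean"
    "expectation (\<lambda>\<omega>. (Y 1 \<omega>) ^ 4) = 3 * ((\<Delta> * vol_mean)\<^sup>2 + 2 * vol_var * acv_prim \<alpha> B \<Delta>)"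
    using *[of 0] by blast+
  show "expectation (\<lambda>\<omega>. (Y 1 \<omega>)\<^sup>2 * (Y (1 + h) \<omega>)\<^sup>2) = (\<Delta> * vol_mean)\<^sup>2 + vol_var * acv_diff \<Delta> \<alpha> B h" if "1 \<le> h"
    using *[of h] that by blast
qed

lemma moment_function_integrable:
  assumes \<Delta>: "0 < \<Delta>"
  shows "integrable M (\<lambda>\<omega>. f_SV \<Delta> (\<lambda>n. log_returns X \<Delta> n \<omega>) \<beta> k)"
proof -
  let ?Y = "log_returns X \<Delta>"
  note m = log_return_moments[OF \<Delta>]
  have sq: "integrable M (\<lambda>\<omega>. ((?Y n \<omega>)\<^sup>2)\<^sup>2)" if "1 \<le> n" for n using m(2)[OF that] by simp
  have [measurable]: "?Y n \<in> borel_measurable M" if "1 \<le> n" for n by (rule m(1)[OF that])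
  have mult: "integrable M (\<lambda>\<omega>. (?Y 1 \<omega>)\<^sup>2 * (?Y h \<omega>)\<^sup>2)" if "1 \<le> h" for h
    by (rule integrable_mult_L2) (use sq m(1) that in auto)
  have "integrable M (\<lambda>\<omega>. (?Y 1 \<omega>)\<^sup>2)"
    by (rule square_integrable_imp_integrable) (use sq m(1) in auto)
  then show ?thesis using m(2)[of 1] mult[of k]
    by (cases \<beta>; cases "k = 0"; cases "k = 1") (simp_all add: f_SV_def f_var_def f_var2_def f_lag_def)
qed

text \<open>Each expectation is written as an expression in the candidate parameters compared with
  the same expression in the true ones, so that vanishing at the true parameter is immediate and
  zeros become equations between like terms.\<close>

lemma expectation_moment_function:
  assumes \<Delta>: "0 < \<Delta>" and b: "b < 0"
  shows "expectation (\<lambda>\<omega>. f_var \<Delta> (\<lambda>n. log_returns X \<Delta> n \<omega>) (\<mu>, s, a, b)) = \<Delta> * \<mu> / (b * (a - 1)) - \<Delta> * mean / (B * (\<alpha> - 1))"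
    "expectation (\<lambda>\<omega>. f_var2 \<Delta> (\<lambda>n. log_returns X \<Delta> n \<omega>) (\<mu>, s, a, b))
      = 3 * ((\<Delta> * mean / (B * (\<alpha> - 1)))\<^sup>2 - (\<Delta> * \<mu> / (b * (a - 1)))\<^sup>2)
        + 3 * (s * acv_prim a b \<Delta> / (b * (a - 1)) - var * acv_prim \<alpha> B \<Delta> / (B * (\<alpha> - 1)))"
    "1 \<le> h \<Longrightarrow> expectation (\<lambda>\<omega>. f_lag \<Delta> h (\<lambda>n. log_returns X \<Delta> n \<omega>) (\<mu>, s, a, b))
      = (\<Delta> * mean / (B * (\<alpha> - 1)))\<^sup>2 - (\<Delta> * \<mu> / (b * (a - 1)))\<^sup>2
        + (s * acv_diff \<Delta> a b h / (2 * b * (a - 1)) - var * acv_diff \<Delta> \<alpha> B h / (2 * B * (\<alpha> - 1)))"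
proof -
  let ?Y = "log_returns X \<Delta>"
  note m = log_return_moments[OF \<Delta>]
  have sq: "integrable M (\<lambda>\<omega>. ((?Y n \<omega>)\<^sup>2)\<^sup>2)" if "1 \<le> n" for n using m(2)[OF that] by simp
  have i1: "integrable M (\<lambda>\<omega>. (?Y 1 \<omega>)\<^sup>2)"
    by (rule square_integrable_imp_integrable) (use sq m(1) in auto)
  have i2: "integrable M (\<lambda>\<omega>. (?Y 1 \<omega>)\<^sup>2 * (?Y (1 + h) \<omega>)\<^sup>2)" for h
    by (rule integrable_mult_L2) (use sq m(1) in auto)
  have i4: "integrable M (\<lambda>\<omega>. (?Y 1 \<omega>) ^ 4)" by (rule m(2)) simp
  have vm: "\<Delta> * vol_mean = - (\<Delta> * mean / (B * (\<alpha> - 1)))" by (simp add: vol_mean_def)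
  have vv: "vol_var * x = - (var * x / (2 * B * (\<alpha> - 1)))" for x by (simp add: vol_var_def)
  show "expectation (\<lambda>\<omega>. f_var \<Delta> (\<lambda>n. ?Y n \<omega>) (\<mu>, s, a, b)) = \<Delta> * \<mu> / (b * (a - 1)) - \<Delta> * mean / (B * (\<alpha> - 1))"
  proof -
    have "expectation (\<lambda>\<omega>. (?Y 1 \<omega>)\<^sup>2 + c) = expectation (\<lambda>\<omega>. (?Y 1 \<omega>)\<^sup>2) + c" for c
      using i1 by (simp add: prob_space)
    then show ?thesis unfolding f_var_def prod.case using m(3) vm by simp
  qed
  show "expectation (\<lambda>\<omega>. f_var2 \<Delta> (\<lambda>n. ?Y n \<omega>) (\<mu>, s, a, b))
      = 3 * ((\<Delta> * mean / (B * (\<alpha> - 1)))\<^sup>2 - (\<Delta> * \<mu> / (b * (a - 1)))\<^sup>2)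
        + 3 * (s * acv_prim a b \<Delta> / (b * (a - 1)) - var * acv_prim \<alpha> B \<Delta> / (B * (\<alpha> - 1)))"
  proof -
    have "expectation (\<lambda>\<omega>. (?Y 1 \<omega>) ^ 4 + c - d) = expectation (\<lambda>\<omega>. (?Y 1 \<omega>) ^ 4) + c - d" for c d
      using i4 by (simp add: prob_space)
    moreover have "2 * vol_var * acv_prim \<alpha> B \<Delta> = - (var * acv_prim \<alpha> B \<Delta> / (B * (\<alpha> - 1)))"
      by (simp add: vol_var_def)
    moreover have "3 * ((- p)\<^sup>2 + - w) + 3 * s * (x / y) - 3 * q\<^sup>2 = 3 * (p\<^sup>2 - q\<^sup>2) + 3 * (s * x / y - w)" for p q w x y :: real
      by (simp add: algebra_simps)
    ultimately show ?thesis unfolding f_var2_def prod.case cont_ext_var2[OF b \<Delta>] m(4) vm by simp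
  qed
  show "expectation (\<lambda>\<omega>. f_lag \<Delta> h (\<lambda>n. ?Y n \<omega>) (\<mu>, s, a, b))
      = (\<Delta> * mean / (B * (\<alpha> - 1)))\<^sup>2 - (\<Delta> * \<mu> / (b * (a - 1)))\<^sup>2
        + (s * acv_diff \<Delta> a b h / (2 * b * (a - 1)) - var * acv_diff \<Delta> \<alpha> B h / (2 * B * (\<alpha> - 1)))" if h: "1 \<le> h"
  proof -
    have "expectation (\<lambda>\<omega>. (?Y 1 \<omega>)\<^sup>2 * (?Y (1 + h) \<omega>)\<^sup>2 - c + d) = expectation (\<lambda>\<omega>. (?Y 1 \<omega>)\<^sup>2 * (?Y (1 + h) \<omega>)\<^sup>2) - c + d" for c d
      using i2[of h] by (simp add: prob_space)
    then show ?thesis unfolding f_lag_def prod.case cont_ext_lag[OF b \<Delta> h] using m(5)[OF h] unfolding vm vv by simp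
  qed
qed

lemma moment_function_zero_iff:
  assumes \<Delta>: "0 < \<Delta>" and b: "b < 0" and a: "1 < a" and var: "0 < var"
  shows "(\<forall>k. expectation (\<lambda>\<omega>. f_SV \<Delta> (\<lambda>n. log_returns X \<Delta> n \<omega>) (\<mu>, s, a, b) k) = 0) \<longleftrightarrow>
    (\<mu>, s, a, b) = (mean, var, \<alpha>, B)"
proof
  note E = expectation_moment_function[OF \<Delta> b]
  assume z: "\<forall>k. expectation (\<lambda>\<omega>. f_SV \<Delta> (\<lambda>n. log_returns X \<Delta> n \<omega>) (\<mu>, s, a, b) k) = 0"
  have e1: "\<Delta> * \<mu> / (b * (a - 1)) = \<Delta> * mean / (B * (\<alpha> - 1))"
    using z[rule_format, of 0] E(1)[of \<mu> s a] by (simp add: f_SV_def)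
  have e2: "s * acv_diff \<Delta> a b h / (2 * b * (a - 1)) = var * acv_diff \<Delta> \<alpha> B h / (2 * B * (\<alpha> - 1))" if "1 \<le> h" for h
    using z[rule_format, of "h + 1"] E(3)[OF that, of \<mu> s a] that unfolding f_SV_def e1 by simp
  have i: "a = \<alpha> \<and> b = B \<and> s = var"
    by (rule acv_identification[OF b B a alpha \<Delta> var e2])
  then have "\<mu> = mean" using e1 \<Delta> B alpha by simp
  with i show "(\<mu>, s, a, b) = (mean, var, \<alpha>, B)" by simp
next
  assume eq: "(\<mu>, s, a, b) = (mean, var, \<alpha>, B)"
  show "\<forall>k. expectation (\<lambda>\<omega>. f_SV \<Delta> (\<lambda>n. log_returns X \<Delta> n \<omega>) (\<mu>, s, a, b) k) = 0"
  proof
    fix k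
    show "expectation (\<lambda>\<omega>. f_SV \<Delta> (\<lambda>n. log_returns X \<Delta> n \<omega>) (\<mu>, s, a, b) k) = 0"
      unfolding eq using expectation_moment_function[OF \<Delta> B, where \<mu> = mean and s = var and a = \<alpha>]
      by (cases "k = 0"; cases "k = 1") (simp_all add: f_SV_def)
  qed
qed

end

theorem corollary3p5:
  fixes M :: "'w measure"
    and F :: "real \<Rightarrow> 'w measure"
    and \<Lambda> :: "(real \<times> real) set \<Rightarrow> 'w \<Rightarrow> real"
    and \<gamma> :: real
    and \<nu> \<pi> :: "real measure"
    and \<Sigma> W_BM X L :: "real \<Rightarrow> 'w \<Rightarrow> real"
    and W :: "(real \<times> real \<times> real \<times> real) set"
    and \<mu>\<^sub>0 \<sigma>2\<^sub>0 \<alpha>\<^sub>0 B\<^sub>0 \<Delta> :: real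
  assumes model: "supOU_SV_model M F \<Lambda> \<gamma> \<nu> \<pi> \<Sigma> W_BM X"
    and pi: "\<pi> = distr (gamma_distribution \<alpha>\<^sub>0) borel (\<lambda>r. B\<^sub>0 * r)" "B\<^sub>0 < 0" "1 < \<alpha>\<^sub>0"
    and second_moments: "set_integrable \<nu> {1<..} (\<lambda>x. x^2)"
    and levy: "underlying_levy_process M \<Lambda> \<pi> L"
    and mu: "\<mu>\<^sub>0 = prob_space.expectation M (L 1)"
    and sigma2: "\<sigma>2\<^sub>0 = prob_space.variance M (L 1)" "0 < \<sigma>2\<^sub>0"
    and W: "compact W" "W \<subseteq> {(\<mu>, \<sigma>2, \<alpha>, B). 1 < \<alpha> \<and> B < 0}"
    and true_parameter: "(\<mu>\<^sub>0, \<sigma>2\<^sub>0, \<alpha>\<^sub>0, B\<^sub>0) \<in> W"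
    and grid: "0 < \<Delta>"
  shows "asymptotically_identifiable M (log_returns X \<Delta>) (f_SV \<Delta>) W (\<mu>\<^sub>0, \<sigma>2\<^sub>0, \<alpha>\<^sub>0, B\<^sub>0)"
proof -
  interpret supOU_SV \<pi> \<alpha>\<^sub>0 B\<^sub>0 M F \<Lambda> \<gamma> \<nu> \<Sigma> W_BM X
    by unfold_locales (fact pi model second_moments)+
  have "has_levy_integral M \<Lambda> \<pi> (indicator ({..<0} \<times> {0<..1})) (L 1)"
    using levy by (simp add: underlying_levy_process_def)
  from levy_process_moments[OF this] have par: "\<mu>\<^sub>0 = mean" "\<sigma>2\<^sub>0 = var" using mu sigma2(1) by simp_all
  have "{\<beta> \<in> W. \<forall>k. expectation (\<lambda>\<omega>. f_SV \<Delta> (\<lambda>n. log_returns X \<Delta> n \<omega>) \<beta> k) = 0} = {(\<mu>\<^sub>0, \<sigma>2\<^sub>0, \<alpha>\<^sub>0, B\<^sub>0)}"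
  proof (intro set_eqI)
    fix \<beta> :: "real \<times> real \<times> real \<times> real"
    obtain \<mu> s a b where \<beta>: "\<beta> = (\<mu>, s, a, b)" by (cases \<beta>) auto
    show "\<beta> \<in> {\<beta> \<in> W. \<forall>k. expectation (\<lambda>\<omega>. f_SV \<Delta> (\<lambda>n. log_returns X \<Delta> n \<omega>) \<beta> k) = 0} \<longleftrightarrow>
      \<beta> \<in> {(\<mu>\<^sub>0, \<sigma>2\<^sub>0, \<alpha>\<^sub>0, B\<^sub>0)}"
      using moment_function_zero_iff[OF grid, of b a \<mu> s] W(2) sigma2(2) true_parameter
      unfolding \<beta> par by blast
  qed
  then show ?thesis
    unfolding asymptotically_identifiable_def using moment_function_integrable[OF grid] by blast
qed

end
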